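(* Consider the Jacobi hypergroup with parameters $\alpha\ge\beta\ge-\tfrac12$, $\alpha\ne-\tfrac12$. Let $\gamma>0$, $1\le p\le 2$ with conjugate exponent $p'$, and $f\in\mathcal{B}^{p,\infty}_{\gamma,\alpha}$. Write $L^s_c=L^s(\mathbb{R}_+,|c(\lambda)|^{-2}d\lambda)$. (i) If $1<p\le 2$ and $0<\gamma\le\frac{2(\alpha+1)}{p}$, then $\mathcal{F}(f)\in L^s_c$ for every $s$ with $\frac{2(\alpha+1)p}{\gamma p+2(\alpha+1)(p-1)}<s\le p'$. (ii) If $1<p\le 2$ and $\gamma>\frac{2(\alpha+1)}{p}$, then $\mathcal{F}(f)\in L^1_c$. (iii) If $p=1$ and $\gamma>\max\{3,2(\alpha+1)\}$, then $\mathcal{F}(f)\in L^1_c$.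
   Context: Jacobi hypergroup: $A(x)=2^{2\rho}(\sinh x)^{2\alpha+1}(\cosh x)^{2\beta+1}$ on $\mathbb{R}_+$ with $\alpha\ge\beta\ge-\tfrac12$, $\alpha\neq-\tfrac12$, $\rho=\alpha+\beta+1>0$. For $\lambda\in\mathbb{C}$, $\varphi_\lambda(x)={}_2F_1\big(\tfrac12(\rho-i\lambda),\tfrac12(\rho+i\lambda);\alpha+1;-\sinh^2 x\big)$ (Jacobi function). $L^p_A(\mathbb{R}_+)=L^p(\mathbb{R}_+,A(x)dx)$ with norm $\|\cdot\|_{A,p}$. For $f\in L^1_A$, $\mathcal{F}(f)(\lambda)=\int_0^\infty f(x)\varphi_\lambda(x)A(x)dx$; $|c(\lambda)|^{-2}$ is the (even, continuous) Plancherel density, so that $\mathcal F$ extends to an isometry of $L^2_A$ onto $L^2(\mathbb{R}_+,|c(\lambda)|^{-2}d\lambda)$, and by interpolation $\mathcal F$ is defined on $L^p_A$ for $1\le p\le2$. The hypergroup convolution $\delta_x*\delta_y$ is the probability measure on $[|x-y|,x+y]$ with $\int\varphi_\lambda\,d(\delta_x*\delta_y)=\varphi_\lambda(x)\varphi_\lambda(y)$; the generalized translation is $\tau_xf(y)=\int f\,d(\delta_x*\delta_y)$, a contraction on each $L^p_A$. The modulus of continuity is $\omega_{A,p}(f)(x)=\|\tau_xf-f\|_{A,p}$. Besov-type space: for $\gamma>0$, $1\le p\le\infty$, $1\le q\le\infty$, $\mathcal{B}^{p,q}_{\gamma,\alpha}$ is the set of $f\in L^p_A(\mathbb{R}_+)$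 with $\int_0^\infty\big(\omega_{A,p}(f)(x)/x^\gamma\big)^q\frac{dx}{x}<\infty$ if $q<\infty$, and $\sup_{x>0}\omega_{A,p}(f)(x)/x^\gamma<\infty$ if $q=\infty$. *)

theory Defs
  imports "HOL-Analysis.Analysis"
begin

definition jac_rho :: "real \<Rightarrow> real \<Rightarrow> real" where
  "jac_rho \<alpha> \<beta> = \<alpha> + \<beta> + 1"

definition jac_A :: "real \<Rightarrow> real \<Rightarrow> real \<Rightarrow> real" where
  "jac_A \<alpha> \<beta> x = 2 powr (2 * jac_rho \<alpha> \<beta>) * sinh x powr (2*\<alpha>+1) * cosh x powr (2*\<beta>+1)"

definition hyp2F1_series :: "complex \<Rightarrow> complex \<Rightarrow> complex \<Rightarrow> complex \<Rightarrow> complex" where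
  "hyp2F1_series a b c z =
     (\<Sum>n. pochhammer a n * pochhammer b n / (pochhammer c n * of_nat (fact n)) * z ^ n)"

text \<open>Analytic continuation of 2F1(a,b;c;z) to real z < 1 via Pfaff's transformation
  2F1(a,b;c;z) = (1-z)^(-a) 2F1(a,c-b;c;z/(z-1)); for |z|<1 it agrees with the series.\<close>
definition hyp2F1 :: "complex \<Rightarrow> complex \<Rightarrow> complex \<Rightarrow> real \<Rightarrow> complex" where
  "hyp2F1 a b c z =
     (complex_of_real (1 - z)) powr (- a) * hyp2F1_series a (c - b) c (complex_of_real (z / (z - 1)))"

definition jacobi_phi :: "real \<Rightarrow> real \<Rightarrow> complex \<Rightarrow> real \<Rightarrow> complex" where
  "jacobi_phi \<alpha> \<beta> l x =
     hyp2F1 ((of_real (jac_rho \<alpha> \<beta>) - \<i> * l) / 2) ((of_real (jac_rho \<alpha> \<beta>) + \<i> * l) / 2)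
            (of_real (\<alpha> + 1)) (- (sinh x)\<^sup>2)"

text \<open>Harish-Chandra c-function (Koornwinder's normalisation for this weight).\<close>
definition jac_c :: "real \<Rightarrow> real \<Rightarrow> real \<Rightarrow> complex" where
  "jac_c \<alpha> \<beta> l =
     (2::complex) powr (of_real (jac_rho \<alpha> \<beta>) - \<i> * of_real l) * Gamma (of_real (\<alpha> + 1)) * Gamma (\<i> * of_real l)
     / (Gamma ((\<i> * of_real l + of_real (jac_rho \<alpha> \<beta>)) / 2) * Gamma ((\<i> * of_real l + of_real (\<alpha> - \<beta> + 1)) / 2))"

definition jac_measure :: "real \<Rightarrow> real \<Rightarrow> real measure" where
  "jac_measure \<alpha> \<beta> = density (restrict_space lborel {0<..}) (\<lambda>x. ennreal (jac_A \<alpha> \<beta> x))"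

definition plancherel_measure :: "real \<Rightarrow> real \<Rightarrow> real measure" where
  "plancherel_measure \<alpha> \<beta> =
     density (restrict_space lborel {0<..}) (\<lambda>l. ennreal (1 / (cmod (jac_c \<alpha> \<beta> l))\<^sup>2))"

definition in_Lp :: "real measure \<Rightarrow> real \<Rightarrow> (real \<Rightarrow> complex) \<Rightarrow> bool" where
  "in_Lp M p f \<longleftrightarrow> f \<in> borel_measurable M \<and> (\<integral>\<^sup>+ x. ennreal (norm (f x) powr p) \<partial>M) < \<infinity>"

definition hyp_conv :: "real \<Rightarrow> real \<Rightarrow> real \<Rightarrow> real \<Rightarrow> real measure" where
  "hyp_conv \<alpha> \<beta> x y =
     (THE \<mu>. sets \<mu> = sets borel \<and> emeasure \<mu> UNIV = 1 \<and> emeasure \<mu> {\<bar>x - y\<bar>..x + y} = 1 \<and>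
        (\<forall>l::complex. integrable \<mu> (jacobi_phi \<alpha> \<beta> l) \<and>
           (\<integral>t. jacobi_phi \<alpha> \<beta> l t \<partial>\<mu>) = jacobi_phi \<alpha> \<beta> l x * jacobi_phi \<alpha> \<beta> l y))"

definition gen_transl :: "real \<Rightarrow> real \<Rightarrow> real \<Rightarrow> (real \<Rightarrow> complex) \<Rightarrow> real \<Rightarrow> complex" where
  "gen_transl \<alpha> \<beta> x f y = (\<integral>t. f t \<partial>hyp_conv \<alpha> \<beta> x y)"

definition mod_cont_pow :: "real \<Rightarrow> real \<Rightarrow> real \<Rightarrow> (real \<Rightarrow> complex) \<Rightarrow> real \<Rightarrow> ennreal" where
  "mod_cont_pow \<alpha> \<beta> p f x =
     (\<integral>\<^sup>+ y. ennreal (norm (gen_transl \<alpha> \<beta> x f y - f y) powr p) \<partial>jac_measure \<alpha> \<beta>)"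

text \<open>Besov space B^{p,\<infinity>}_{gamma,alpha}: f in L^p_A and sup_{x>0} omega(x)/x^gamma < \<infinity>,
  i.e. omega(x)^p \<le> C^p x^(gamma p) for some C.\<close>
definition besov_inf :: "real \<Rightarrow> real \<Rightarrow> real \<Rightarrow> real \<Rightarrow> (real \<Rightarrow> complex) set" where
  "besov_inf \<alpha> \<beta> p \<gamma> = {f. in_Lp (jac_measure \<alpha> \<beta>) p f \<and>
      (\<exists>C\<ge>0. \<forall>x>0. mod_cont_pow \<alpha> \<beta> p f x \<le> ennreal ((C * x powr \<gamma>) powr p))}"

definition jacobi_FT1 :: "real \<Rightarrow> real \<Rightarrow> (real \<Rightarrow> complex) \<Rightarrow> real \<Rightarrow> complex" where
  "jacobi_FT1 \<alpha> \<beta> f l = (\<integral>x. f x * jacobi_phi \<alpha> \<beta> (of_real l) x \<partial>jac_measure \<alpha> \<beta>)"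

text \<open>Jacobi transform on L^p_A, 1 < p \<le> 2: the (Hausdorff--Young) continuous extension from
  L^1_A \<inter> L^p_A, i.e. the L^{p'}_c-limit of the transforms of L^1 \<inter> L^p approximants.\<close>
definition jacobi_FT :: "real \<Rightarrow> real \<Rightarrow> real \<Rightarrow> (real \<Rightarrow> complex) \<Rightarrow> real \<Rightarrow> complex" where
  "jacobi_FT \<alpha> \<beta> p f =
     (if p = 1 then jacobi_FT1 \<alpha> \<beta> f
      else (SOME g. g \<in> borel_measurable (plancherel_measure \<alpha> \<beta>) \<and>
              (\<exists>fn. (\<forall>n. in_Lp (jac_measure \<alpha> \<beta>) 1 (fn n) \<and> in_Lp (jac_measure \<alpha> \<beta>) p (fn n)) \<and>
                 (\<lambda>n. \<integral>\<^sup>+ x. ennreal (norm (fn n x - f x) powr p) \<partial>jac_measure \<alpha> \<beta>) \<longlonglongrightarrow> 0 \<and>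
                 (\<lambda>n. \<integral>\<^sup>+ l. ennreal (norm (jacobi_FT1 \<alpha> \<beta> (fn n) l - g l) powr (p / (p - 1)))
                        \<partial>plancherel_measure \<alpha> \<beta>) \<longlonglongrightarrow> 0)))"

end

theory Submission
  imports Defs "HOL-Probability.Probability"
begin

text \<open>The transform of \<open>f - \<tau>\<^sub>x f\<close> is \<open>(1 - \<phi>\<^sub>l(x)) F f(l)\<close>, so the Hausdorff-Young inequality bounds the
  norm of the latter in the power class of the conjugate exponent \<open>p'\<close> by a multiple of \<open>x\<^sup>\<gamma>\<close>. For \<open>l\<close> in
  the block \<open>[2\<^sup>k, 2\<^sup>k\<^sup>+\<^sup>1)\<close> and \<open>x\<close> a small multiple of \<open>2\<^sup>-\<^sup>k\<close> the factor \<open>1 - \<phi>\<^sub>l(x)\<close> is bounded below,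
  hence the norm of \<open>F f\<close> on the block decays like \<open>2\<^sup>-\<^sup>k\<^sup>\<gamma>\<close>. The Plancherel measure of the block is at
  most a multiple of the power \<open>2(\<alpha>+1)k\<close> of 2, and comparing \<open>|F f|\<^sup>s\<close> with \<open>|F f|\<close> to the power \<open>p'\<close>
  above, and with a constant below, a suitable threshold makes the sum over the blocks a convergent
  geometric series. For \<open>p = 1\<close> the estimate holds pointwise, and since \<open>1 - \<phi>\<^sub>l(x)\<close> is of order \<open>x\<^sup>2\<close>
  it forces \<open>F f = 0\<close> as soon as \<open>\<gamma> > 2\<close>.

  Three facts about Jacobi functions carry the argument. The product formula is proved by realising
  the translation as an expectation over two Beta variables: integration by parts shows that the
  expectation of \<open>\<phi>\<^sub>l\<close> satisfies the differential equation of \<open>\<phi>\<^sub>l\<close>, whose solution regular at 0 is unique. A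
  change of variables in the same representation makes the translation symmetric for \<open>A(x) dx\<close>, hence
  contractive. Of the Plancherel theorem only an inequality is needed; it is Bessel's inequality for the
  eigenfunctions on \<open>[0, R]\<close> vanishing at \<open>R\<close>, as \<open>R\<close> grows, and the Hausdorff-Young inequality follows
  by splitting the function at a level.\<close>

text \<open>The translation and the extended transform are given only by specification, through a
  \<open>THE\<close> and a \<open>SOME\<close>. For the \<open>THE\<close>, uniqueness has to be
  proved: at the parameters -i(\<rho> + 2n) the Jacobi functions are polynomials in sinh^2 with
  positive coefficients, and these determine all moments of a measure. For the \<open>SOME\<close>,
  every estimate is proved for an arbitrary function that comes with an approximating sequence. The
  origin is the analytic obstacle: the first-order coefficient of the Jacobi equation is singular
  there. Derivatives are therefore taken in T = sinh^2 x, in which the functions are smooth across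
  0, and initial value problems are treated in divergence form. At \<beta> = -1/2 and at \<alpha> =
  \<beta> one of the two Beta laws degenerates to a point mass. Admitting point masses as Beta laws
  gives the product formula a single proof; the symmetry still needs separate kernels. With q = p',
  the exponent condition of (i) reads 2(\<alpha>+1)(q - s) < \<gamma> q s: on dyadic blocks the
  decay of the transform outweighs the growth of the volume. Norms enter through their p-th powers
  in \<open>ennreal\<close>, so finiteness and inequalities need no roots.\<close>

abbreviation Lpow :: "'a measure => real => ('a => 'b::real_normed_vector) => ennreal" where
  "Lpow M q f \<equiv> (\<integral>\<^sup>+x. ennreal (norm (f x) powr q) \<partial>M)"

section \<open>Hypergeometric functions on the half-line\<close>

definition hg_coeff :: "complex => complex => complex => nat => complex" where
  "hg_coeff a b c n = pochhammer a n * pochhammer b n / (pochhammer c n * of_nat (fact n))"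

lemma hg_coeff_0 [simp]: "hg_coeff a b c 0 = 1"
  by (simp add: hg_coeff_def)

lemma hg_coeff_rec:
  assumes "\<And>n. c + of_nat n \<noteq> 0"
  shows "(c + of_nat n) * (of_nat n + 1) * hg_coeff a b c (Suc n)
       = (a + of_nat n) * (b + of_nat n) * hg_coeff a b c n"
proof -
  have "c \<noteq> - of_nat k" for k using assms[of k] by auto
  then have "pochhammer c n \<noteq> 0" by (auto simp: pochhammer_eq_0_iff)
  moreover have "(1 + of_nat n :: complex) \<noteq> 0" by (metis of_nat_Suc of_nat_neq_0)
  moreover have "C * N * (pa * A * (pb * B) / (pc * C * (N * f))) = A * B * (pa * pb / (pc * f))"
    if "pc \<noteq> 0" "N \<noteq> 0" "C \<noteq> 0" "f \<noteq> 0" for C N pa A pb B pc f :: complex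
    using that by (simp add: field_simps)
  moreover have "(of_nat (fact (Suc n)) :: complex) = (of_nat n + 1) * of_nat (fact n)"
    by (simp add: algebra_simps)
  moreover have "(of_nat (fact n) :: complex) \<noteq> 0" by simp
  ultimately show ?thesis using assms[of n]
    unfolding hg_coeff_def pochhammer_Suc by (metis add.commute)
qed

lemma tendsto_add_nat_ratio: "(\<lambda>n. (a + of_nat n) / (of_nat n + 1 :: complex)) \<longlonglongrightarrow> 1"
proof -
  have "(\<lambda>n. 1 + (a - 1) * (1 / of_nat (Suc n))) \<longlonglongrightarrow> 1 + (a - 1) * 0"
    by (intro tendsto_intros LIMSEQ_Suc[OF lim_1_over_n])
  moreover have "1 + (a - 1) * (1 / of_nat (Suc n)) = (a + of_nat n) / (of_nat n + 1)" for n
  proof -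
    have "(1 + of_nat n :: complex) \<noteq> 0" by (metis of_nat_Suc of_nat_neq_0)
    then show ?thesis by (simp add: field_simps)
  qed
  ultimately show ?thesis by simp
qed

lemma hg_summable:
  assumes c: "\<And>n. c + of_nat n \<noteq> 0" and z: "norm z < 1"
  shows "summable (\<lambda>n. hg_coeff a b c n * z ^ n)"
proof -
  \<comment> \<open>The ratio of consecutive coefficients, every factor divided by n + 1, so that
    each quotient tends to 1 and the ratio test sees only the norm of z.\<close>
  let ?r = "\<lambda>n. (a + of_nat n) / (of_nat n + 1) * ((b + of_nat n) / (of_nat n + 1) / ((c + of_nat n) / (of_nat n + 1)))"
  have "(\<lambda>n. norm (?r n * z)) \<longlonglongrightarrow> norm (1 * (1 / 1) * z)"
    by (intro tendsto_intros tendsto_add_nat_ratio) auto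
  moreover have "norm (1 * (1 / 1) * z) < (1 + norm z) / 2" using z by simp
  ultimately have "eventually (\<lambda>n. norm (?r n * z) < (1 + norm z) / 2) sequentially"
    by (rule order_tendstoD)
  then obtain N where N: "\<And>n. n >= N ==> norm (?r n * z) < (1 + norm z) / 2"
    by (auto simp: eventually_sequentially)
  have rec: "hg_coeff a b c (Suc n) = ?r n * hg_coeff a b c n" for n
  proof -
    have "(1 + of_nat n :: complex) \<noteq> 0" by (metis of_nat_Suc of_nat_neq_0)
    moreover have "h' = A / N * ((B / N) / (C / N)) * h" if "C * N * h' = A * B * h" "C \<noteq> 0" "N \<noteq> 0"
      for A B C N h h' :: complex
      using that by (simp add: field_simps)
    ultimately show ?thesis using hg_coeff_rec[OF c, of n a b] c[of n] by (metis add.commute)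
  qed
  show ?thesis
  proof (rule summable_ratio_test[where c="(1 + norm z) / 2" and N=N])
    fix n assume "N <= n"
    have "norm (hg_coeff a b c (Suc n) * z ^ Suc n) = norm (?r n * z) * norm (hg_coeff a b c n * z ^ n)"
      by (simp only: rec norm_mult power_Suc mult_ac)
    also have "... <= (1 + norm z) / 2 * norm (hg_coeff a b c n * z ^ n)"
      by (rule mult_right_mono[OF less_imp_le[OF N[OF \<open>N <= n\<close>]] norm_ge_zero])
    finally show "norm (hg_coeff a b c (Suc n) * z ^ Suc n) <= (1 + norm z) / 2 * norm (hg_coeff a b c n * z ^ n)" .
  qed (use z in auto)
qed

text \<open>Termwise differentiation on the open unit disc. The third claim is the Euler operator z
  d/dz on coefficients; in this form the terms of the hypergeometric equation can be added index by
  index.\<close>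

lemma powser_deriv:
  fixes c :: "nat => complex"
  assumes s: "\<And>z. norm z < 1 ==> summable (\<lambda>n. c n * z ^ n)" and z: "norm z < 1"
  shows "((\<lambda>z. \<Sum>n. c n * z ^ n) has_field_derivative (\<Sum>n. diffs c n * z ^ n)) (at z)"
    and "summable (\<lambda>n. diffs c n * z ^ n)"
    and "(\<lambda>n. of_nat n * c n * z ^ n) sums (z * (\<Sum>n. diffs c n * z ^ n))"
proof -
  let ?K = "complex_of_real ((1 + norm z) / 2)"
  have "norm ?K = (1 + norm z) / 2" by (subst norm_of_real) simp
  then have K: "norm ?K < 1" "norm z < norm ?K" using z by auto
  show "((\<lambda>z. \<Sum>n. c n * z ^ n) has_field_derivative (\<Sum>n. diffs c n * z ^ n)) (at z)"
    by (rule termdiffs_strong[OF s K(2)]) (rule K)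
  show sm: "summable (\<lambda>n. diffs c n * z ^ n)"
    by (rule termdiff_converges[OF z s])
  have "(\<lambda>n. z * (diffs c n * z ^ n)) sums (z * (\<Sum>n. diffs c n * z ^ n))"
    by (intro sums_mult summable_sums sm)
  then have "(\<lambda>n. of_nat (Suc n) * c (Suc n) * z ^ Suc n) sums (z * (\<Sum>n. diffs c n * z ^ n))"
    by (simp add: diffs_def mult_ac)
  from sums_Suc[of "\<lambda>n. of_nat n * c n * z ^ n", OF this]
  show "(\<lambda>n. of_nat n * c n * z ^ n) sums (z * (\<Sum>n. diffs c n * z ^ n))" by simp
qed

text \<open>Multiplying the coefficient recursion by z^n and summing gives the equation; the z^2 S''
  term is the Euler operator applied twice, with weight n(n-1).\<close>

lemma hg_series_ode:
  fixes a b c :: complex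
  assumes c: "\<And>n. c + of_nat n \<noteq> 0" and z: "norm z < 1"
  defines "k \<equiv> hg_coeff a b c"
  defines "S0 \<equiv> \<Sum>n. k n * z ^ n" and "S1 \<equiv> \<Sum>n. diffs k n * z ^ n"
    and "S2 \<equiv> \<Sum>n. diffs (diffs k) n * z ^ n"
  shows "z * (1 - z) * S2 + (c - (a + b + 1) * z) * S1 - a * b * S0 = 0"
proof -
  have s0: "norm z < 1 ==> summable (\<lambda>n. k n * z ^ n)" for z
    unfolding k_def by (rule hg_summable[OF c])
  have s1: "norm z < 1 ==> summable (\<lambda>n. diffs k n * z ^ n)" for z
    by (rule powser_deriv(2)[OF s0])
  have A0: "(\<lambda>n. k n * z ^ n) sums S0" unfolding S0_def by (intro summable_sums s0 z)
  have A1: "(\<lambda>n. diffs k n * z ^ n) sums S1" unfolding S1_def by (intro summable_sums s1 z)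
  have A2: "(\<lambda>n. of_nat n * k n * z ^ n) sums (z * S1)" unfolding S1_def by (rule powser_deriv(3)[OF s0 z])
  have A3: "(\<lambda>n. of_nat n * diffs k n * z ^ n) sums (z * S2)" unfolding S2_def by (rule powser_deriv(3)[OF s1 z])
  have "(\<lambda>n. of_nat (Suc n) * (of_nat (Suc n) - 1) * k (Suc n) * z ^ Suc n) sums (z * (z * S2))"
    using sums_mult[OF A3, of z] by (simp add: diffs_def mult_ac)
  from sums_Suc[of "\<lambda>n. of_nat n * (of_nat n - 1) * k n * z ^ n", OF this]
  have A4: "(\<lambda>n. of_nat n * (of_nat n - 1) * k n * z ^ n) sums (z * (z * S2))" by simp
  have "(\<lambda>n. of_nat n * diffs k n * z ^ n - of_nat n * (of_nat n - 1) * k n * z ^ n + c * (diffs k n * z ^ n)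
        - (a + b + 1) * (of_nat n * k n * z ^ n) - a * b * (k n * z ^ n))
      sums (z * S2 - z * (z * S2) + c * S1 - (a + b + 1) * (z * S1) - a * b * S0)"
    by (intro sums_add sums_diff sums_mult A0 A1 A2 A3 A4)
  moreover have "of_nat n * diffs k n * z ^ n - of_nat n * (of_nat n - 1) * k n * z ^ n + c * (diffs k n * z ^ n)
        - (a + b + 1) * (of_nat n * k n * z ^ n) - a * b * (k n * z ^ n) = 0" for n
  proof -
    have "(c + of_nat n) * (of_nat n + 1) * k (Suc n) = (a + of_nat n) * (b + of_nat n) * k n"
      unfolding k_def by (rule hg_coeff_rec[OF c])
    then have "((c + of_nat n) * (of_nat n + 1) * k (Suc n) - (a + of_nat n) * (b + of_nat n) * k n) * z ^ n = 0"
      by simp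
    then show ?thesis by (simp add: diffs_def algebra_simps)
  qed
  ultimately have "(\<lambda>n::nat. 0::complex) sums (z * S2 - z * (z * S2) + c * S1 - (a + b + 1) * (z * S1) - a * b * S0)"
    by simp
  then have "z * S2 - z * (z * S2) + c * S1 - (a + b + 1) * (z * S1) - a * b * S0 = 0"
    using sums_unique2 sums_zero by blast
  then show ?thesis by (simp add: algebra_simps)
qed

text \<open>Functions (1+T)^(-a) G(T/(1+T)) are closed under differentiation: a becomes a + 1 and G
  becomes -a G + (1-z) G', with z = T/(1+T). Applied repeatedly, it yields all derivatives of the
  continued hypergeometric function.\<close>

lemma pfaff_deriv:
  fixes G :: "complex => complex"
  assumes T: "T > (-1/2::real)"
    and G: "(G has_field_derivative d) (at (of_real (T / (1 + T))))"
  shows "((\<lambda>T. of_real (1 + T) powr (- a) * G (of_real (T / (1 + T)))) has_vector_derivative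
      of_real (1 + T) powr (- (a + 1)) *
        (- a * G (of_real (T / (1 + T))) + (1 - of_real (T / (1 + T))) * d)) (at T)"
proof -
  let ?t = "complex_of_real T"
  have "1 + T \<noteq> 0" using T by auto
  then have ne: "1 + ?t \<noteq> 0" by (metis of_real_1 of_real_add of_real_eq_0_iff)
  have nn: "1 + ?t \<notin> \<real>\<^sub>\<le>\<^sub>0" using T by (auto simp: complex_nonpos_Reals_iff)
  have [simp]: "of_real (T / (1 + T)) = ?t / (1 + ?t)" by simp
  have 1: "((\<lambda>w. w / (1 + w)) has_field_derivative 1 / (1 + ?t)^2) (at ?t)"
    by (rule derivative_eq_intros refl | use ne in \<open>simp add: field_simps power2_eq_square\<close>)+
  have 2: "((\<lambda>w. G (w / (1 + w))) has_field_derivative d * (1 / (1 + ?t)^2)) (at ?t)"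
    by (rule DERIV_chain2[where f=G and g="\<lambda>w. w / (1 + w)"]) (use G 1 in simp_all)
  have 3: "((\<lambda>w. (1 + w) powr (- a)) has_field_derivative - a * (1 + ?t) powr (- a - 1)) (at ?t)"
    using nn by (auto intro!: derivative_eq_intros)
  have "((\<lambda>w. (1 + w) powr (- a) * G (w / (1 + w))) has_field_derivative
      (- a * (1 + ?t) powr (- a - 1)) * G (?t / (1 + ?t)) + (1 + ?t) powr (- a) * (d * (1 / (1 + ?t)^2))) (at ?t)"
    using DERIV_mult[OF 3 2] by (simp add: algebra_simps)
  moreover have "(- a * (1 + ?t) powr (- a - 1)) * G (?t / (1 + ?t)) + (1 + ?t) powr (- a) * (d * (1 / (1 + ?t)^2))
     = (1 + ?t) powr (- (a + 1)) * (- a * G (?t / (1 + ?t)) + (1 - ?t / (1 + ?t)) * d)"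
  proof -
    have 1: "(1 + ?t) powr (- a) = (1 + ?t) powr (- (a + 1)) * (1 + ?t)"
      using ne by (metis (no_types, lifting) add.commute minus_add_cancel minus_add_distrib powr_add powr_to_1 add.right_neutral uminus_add_conv_diff)
    have 2: "1 - ?t / (1 + ?t) = 1 / (1 + ?t)" using ne by (simp add: field_simps)
    have 3: "- a - 1 = - (a + 1)" by simp
    have "- a * E * g + E * w * (d * (1 / w^2)) = E * (- a * g + 1 / w * d)" if "w \<noteq> 0" for E g w
      using that by (simp add: field_simps power2_eq_square)
    then show ?thesis unfolding 1 2 3 using ne by blast
  qed
  ultimately have "((\<lambda>w. (1 + w) powr (- a) * G (w / (1 + w))) has_field_derivative
     (1 + ?t) powr (- (a + 1)) * (- a * G (?t / (1 + ?t)) + (1 - ?t / (1 + ?t)) * d)) (at ?t)" by simp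
  from has_vector_derivative_real_field[OF this] show ?thesis by simp
qed

text \<open>For real T > -1 the condition T > -1/2 is exactly the condition |T/(1+T)| < 1. The
  half-line contains 0 in its interior, so derivatives at T = 0 are two-sided.\<close>

lemma pfaff_arg:
  assumes "T > (-1/2::real)" shows "norm (complex_of_real (T / (1 + T))) < 1"
proof -
  have "\<bar>T / (1 + T)\<bar> < 1" using assms by (auto simp: abs_if field_simps)
  then show ?thesis by (metis norm_of_real)
qed

text \<open>Two applications of \<open>pfaff_deriv\<close> produce \<open>F1\<close> and
  \<open>F2\<close>; substituting them turns the equation for the parameters (a, b, c) into the
  power series equation for (a, c - b, c) at z = T/(1+T). The argument is -T, whence the
  signs.\<close>

lemma hyp2F1_ode:
  fixes a b c :: complex
  assumes c: "\<And>n. c + of_nat n \<noteq> 0"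
  obtains F1 F2 where
    "\<And>T. T > -1/2 ==> ((\<lambda>T. hyp2F1 a b c (- T)) has_vector_derivative F1 T) (at T)"
    "\<And>T. T > -1/2 ==> (F1 has_vector_derivative F2 T) (at T)"
    "continuous_on {-1/2<..} F2"
    "\<And>T. T > -1/2 ==> of_real (T * (1 + T)) * F2 T + (c + (a + b + 1) * of_real T) * F1 T
        + a * b * hyp2F1 a b c (- T) = 0"
proof -
  define k where "k = hg_coeff a (c - b) c"
  define S0 where "S0 = (\<lambda>z. \<Sum>n. k n * z ^ n)"
  define S1 where "S1 = (\<lambda>z. \<Sum>n. diffs k n * z ^ n)"
  define S2 where "S2 = (\<lambda>z. \<Sum>n. diffs (diffs k) n * z ^ n)"
  define S3 where "S3 = (\<lambda>z. \<Sum>n. diffs (diffs (diffs k)) n * z ^ n)"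
  have s0: "norm z < 1 ==> summable (\<lambda>n. k n * z ^ n)" for z
    unfolding k_def by (rule hg_summable[OF c])
  have s1: "norm z < 1 ==> summable (\<lambda>n. diffs k n * z ^ n)" for z
    by (rule powser_deriv(2)[OF s0])
  have s2: "norm z < 1 ==> summable (\<lambda>n. diffs (diffs k) n * z ^ n)" for z
    by (rule powser_deriv(2)[OF s1])
  have d0: "norm z < 1 ==> (S0 has_field_derivative S1 z) (at z)" for z
    unfolding S0_def S1_def by (rule powser_deriv(1)[OF s0])
  have d1: "norm z < 1 ==> (S1 has_field_derivative S2 z) (at z)" for z
    unfolding S1_def S2_def by (rule powser_deriv(1)[OF s1])
  have d2: "norm z < 1 ==> (S2 has_field_derivative S3 z) (at z)" for z
    unfolding S2_def S3_def by (rule powser_deriv(1)[OF s2])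
  define Q where "Q = (\<lambda>z. - a * S0 z + (1 - z) * S1 z)"
  define Q1 where "Q1 = (\<lambda>z. - a * S1 z - S1 z + (1 - z) * S2 z)"
  define P where "P = (\<lambda>z. - (a + 1) * Q z + (1 - z) * Q1 z)"
  have dQ: "norm z < 1 ==> (Q has_field_derivative Q1 z) (at z)" for z
    unfolding Q_def Q1_def by (rule derivative_eq_intros d0 d1 refl | simp)+
  have dQ1: "norm z < 1 ==> (Q1 has_field_derivative (- a * S2 z - S2 z - S2 z + (1 - z) * S3 z)) (at z)" for z
    unfolding Q1_def by (rule derivative_eq_intros d1 d2 refl | simp)+
  have dP: "norm z < 1 ==> \<exists>d. (P has_field_derivative d) (at z)" for z
    unfolding P_def by (rule exI) (rule derivative_intros dQ dQ1 | assumption)+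
  define z where "z = (\<lambda>T. complex_of_real (T / (1 + T)))"
  define F1 where "F1 = (\<lambda>T. of_real (1 + T) powr (- (a + 1)) * Q (z T))"
  define F2 where "F2 = (\<lambda>T. of_real (1 + T) powr (- (a + 1 + 1)) * P (z T))"
  have F0: "hyp2F1 a b c (- T) = of_real (1 + T) powr (- a) * S0 (z T)" if "T > -1/2" for T
  proof -
    have "- T / (- T - 1) = T / (1 + T)" using that by (simp add: field_simps)
    then show ?thesis
      by (simp add: hyp2F1_def hyp2F1_series_def S0_def k_def hg_coeff_def z_def)
  qed
  have zn: "norm (z T) < 1" if "T > -1/2" for T
    unfolding z_def by (rule pfaff_arg[OF that])
  show thesis
  proof (rule that[of F1 F2])
    fix T :: real assume T: "T > -1/2"
    have "((\<lambda>T. of_real (1 + T) powr (- a) * S0 (z T)) has_vector_derivative F1 T) (at T)"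
      unfolding F1_def Q_def z_def using pfaff_deriv[OF T d0[OF zn[OF T], unfolded z_def]] by simp
    then show "((\<lambda>T. hyp2F1 a b c (- T)) has_vector_derivative F1 T) (at T)"
      by (rule has_vector_derivative_transform_within_open[where S="{-1/2<..}"]) (use T F0 in auto)
    show "(F1 has_vector_derivative F2 T) (at T)"
      unfolding F1_def F2_def P_def z_def
      by (rule pfaff_deriv[OF T dQ[OF zn[OF T], unfolded z_def]])
    let ?z = "z T" and ?t = "complex_of_real T"
    have nr: "1 + T \<noteq> 0" using T by auto
    then have ne: "1 + ?t \<noteq> 0" by (metis of_real_1 of_real_add of_real_eq_0_iff)
    have zt: "?t = ?z * (1 + ?t)" "(1 - ?z) * (1 + ?t) = 1" using ne by (auto simp: z_def field_simps)
    have p2: "of_real (1 + T) powr (- (a + 1)) = of_real (1 + T) powr (- (a + 1 + 1)) * (1 + ?t)"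
      and p1: "of_real (1 + T) powr (- a) = of_real (1 + T) powr (- (a + 1 + 1)) * (1 + ?t)^2"
    proof -
      have *: "(1 + ?t) powr w = (1 + ?t) powr (w - 1) * (1 + ?t)" for w
        using ne powr_add[of "1 + ?t" "w - 1" 1] by simp
      have e: "- (a + 1) = - a - 1" "- (a + 1 + 1) = - a - 1 - 1" by simp_all
      have o: "complex_of_real (1 + T) = 1 + ?t" by simp
      show "of_real (1 + T) powr (- (a + 1)) = of_real (1 + T) powr (- (a + 1 + 1)) * (1 + ?t)"
        unfolding e o by (rule *)
      show "of_real (1 + T) powr (- a) = of_real (1 + T) powr (- (a + 1 + 1)) * (1 + ?t)^2"
        unfolding e o power2_eq_square mult.assoc[symmetric] *[of "- a - 1", symmetric] by (rule *)
    qed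
    have ode: "?z * (1 - ?z) * S2 ?z + (c - (a + (c - b) + 1) * ?z) * S1 ?z - a * (c - b) * S0 ?z = 0"
      unfolding S0_def S1_def S2_def k_def by (rule hg_series_ode[OF c zn[OF T]])
    define E where "E = complex_of_real (1 + T) powr (- (a + 1 + 1))"
    define s0 s1 s2 where "s0 = S0 ?z" and "s1 = S1 ?z" and "s2 = S2 ?z"
    have "of_real (T * (1 + T)) * F2 T + (c + (a + b + 1) * ?t) * F1 T + a * b * hyp2F1 a b c (- T)
      = E * (?t * (1 + ?t) * P ?z + (c + (a + b + 1) * ?t) * (1 + ?t) * Q ?z + a * b * (1 + ?t)^2 * S0 ?z)"
      unfolding F0[OF T] p1 unfolding F1_def F2_def p2 E_def[symmetric] by (simp add: algebra_simps)
    \<comment> \<open>A polynomial identity modulo the two relations in \<open>zt\<close>, which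
      encode z = T/(1+T) without division.\<close>
    also have "?t * (1 + ?t) * P ?z + (c + (a + b + 1) * ?t) * (1 + ?t) * Q ?z + a * b * (1 + ?t)^2 * S0 ?z
       = (1 + ?t)^2 * (1 - ?z) * (?z * (1 - ?z) * s2 + (c - (a + (c - b) + 1) * ?z) * s1 - a * (c - b) * s0)"
      unfolding P_def Q_def Q1_def s0_def[symmetric] s1_def[symmetric] s2_def[symmetric]
      using zt by algebra
    also have "... = 0" unfolding s0_def s1_def s2_def ode by simp
    finally show "of_real (T * (1 + T)) * F2 T + (c + (a + b + 1) * ?t) * F1 T + a * b * hyp2F1 a b c (- T) = 0"
      by simp
  next
    show "continuous_on {-1/2<..} F2"
    proof (intro continuous_at_imp_continuous_on ballI)
      fix T :: real assume "T \<in> {-1/2<..}"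
      then have T: "T > -1/2" by simp
      obtain d where "(P has_field_derivative d) (at (z T))" using dP[OF zn[OF T]] by blast
      from pfaff_deriv[OF T this[unfolded z_def], of "a + 1 + 1"]
      show "isCont F2 T" unfolding F2_def z_def by (rule has_vector_derivative_continuous)
    qed
  qed
qed

section \<open>Jacobi functions\<close>

text \<open>The mean value inequality on [e, L] with e tending to 0: the derivative is available
  only away from the origin, and only the limit of g at 0 enters.\<close>

lemma bound_from_zero:
  fixes g :: "real => 'a::real_normed_vector"
  assumes L: "L > 0" and g: "\<And>x. 0 < x ==> x <= L ==> (g has_vector_derivative g' x) (at x)"
    and f: "\<And>x. 0 < x ==> x <= L ==> (f has_real_derivative f' x) (at x)"
    and bnd: "\<And>x. 0 < x ==> x <= L ==> norm (g' x) <= f' x"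
    and g0: "(g \<longlongrightarrow> 0) (at_right 0)" and f0: "\<And>x. 0 < x ==> x <= L ==> f x >= 0"
  shows "norm (g L) <= f L"
proof (rule tendsto_upperbound)
  show "((\<lambda>e. norm (g L - g e)) \<longlongrightarrow> norm (g L)) (at_right 0)"
    using tendsto_norm[OF tendsto_diff[OF tendsto_const g0], of "g L"] by simp
  show "\<forall>\<^sub>F e in at_right 0. norm (g L - g e) <= f L"
    unfolding eventually_at_right_field
  proof (intro exI[of _ L] conjI allI impI L)
    fix e assume e: "0 < e" "e < L"
    have "norm (g L - g e) <= f L - f e"
    proof (rule differentiable_bound_general[OF e(2), where f'=g' and \<phi>'=f'])
      show "continuous_on {e..L} g"
        by (intro continuous_at_imp_continuous_on ballI has_vector_derivative_continuous[OF g]) (use e in auto)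
      show "continuous_on {e..L} f"
        by (intro continuous_at_imp_continuous_on ballI DERIV_isCont[OF f]) (use e in auto)
    qed (use e g f bnd in \<open>auto simp: has_real_derivative_iff_has_vector_derivative[symmetric]\<close>)
    also have "... <= f L" using f0[of e] e by simp
    finally show "norm (g L - g e) <= f L" .
  qed
qed simp

locale jacobi =
  fixes \<alpha> \<beta> :: real
  assumes \<alpha>\<beta>: "\<beta> <= \<alpha>" and \<beta>_ge: "-1/2 <= \<beta>" and \<alpha>_ne: "\<alpha> \<noteq> -1/2"
begin

abbreviation A :: "real => real" where "A \<equiv> jac_A \<alpha> \<beta>"
abbreviation \<rho> :: real where "\<rho> \<equiv> jac_rho \<alpha> \<beta>"
abbreviation \<phi> :: "complex => real => complex" where "\<phi> \<equiv> jacobi_phi \<alpha> \<beta>"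

section \<open>The weight and its logarithmic derivative\<close>

lemma \<alpha>_gt: "\<alpha> > -1/2" using \<alpha>\<beta> \<beta>_ge \<alpha>_ne by linarith

lemma \<rho>_pos: "\<rho> > 0" using \<alpha>_gt \<beta>_ge by (simp add: jac_rho_def)

text \<open>Half the logarithmic derivative of \<open>A\<close>, that is, the logarithmic derivative
  of \<open>sqrt A\<close>; the halving suits the passage to Liouville normal form.\<close>

definition hA :: "real => real" where
  "hA x = (\<alpha> + 1/2) * cosh x / sinh x + (\<beta> + 1/2) * sinh x / cosh x"

lemma hA_nonneg: "x > 0 ==> hA x >= 0"
  using \<alpha>_gt \<beta>_ge by (auto simp: hA_def intro!: add_nonneg_nonneg divide_nonneg_nonneg mult_nonneg_nonneg)

lemma A_pos: "x > 0 ==> A x > 0"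
  by (simp add: jac_A_def)

lemma A_0 [simp]: "A 0 = 0"
  by (simp add: jac_A_def)

lemma A_nonneg: "A x >= 0"
  by (simp add: jac_A_def)

lemma A_mono: "0 <= x ==> x <= y ==> A x <= A y"
  unfolding jac_A_def using \<alpha>_gt \<beta>_ge
  by (intro mult_mono powr_mono2 mult_nonneg_nonneg) (use \<rho>_pos in \<open>auto simp: cosh_real_nonneg_le_iff\<close>)

lemma A_deriv: "x > 0 ==> (A has_real_derivative 2 * hA x * A x) (at x)"
proof -
  assume x: "x > 0"
  have s: "sinh x > 0" and c: "cosh x > 0" using x by auto
  have 1: "((\<lambda>x. sinh x powr (2*\<alpha>+1)) has_real_derivative (2*\<alpha>+1) * sinh x powr (2*\<alpha>+1-1) * cosh x) (at x)"
    by (rule DERIV_chain2[where g=sinh and f="\<lambda>z. z powr (2*\<alpha>+1)"])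
       (use s x in \<open>auto intro!: has_real_derivative_powr derivative_eq_intros\<close>)
  have 2: "((\<lambda>x. cosh x powr (2*\<beta>+1)) has_real_derivative (2*\<beta>+1) * cosh x powr (2*\<beta>+1-1) * sinh x) (at x)"
    by (rule DERIV_chain2[where g=cosh and f="\<lambda>z. z powr (2*\<beta>+1)"])
       (use c x in \<open>auto intro!: has_real_derivative_powr derivative_eq_intros\<close>)
  have p: "sinh x powr (2*\<alpha>+1-1) = sinh x powr (2*\<alpha>+1) / sinh x"
    "cosh x powr (2*\<beta>+1-1) = cosh x powr (2*\<beta>+1) / cosh x"
    using s c by (simp_all add: powr_diff powr_add)
  have "(A has_real_derivative 2 powr (2*\<rho>) * ((2*\<alpha>+1) * sinh x powr (2*\<alpha>+1-1) * cosh x * cosh x powr (2*\<beta>+1)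
      + (2*\<beta>+1) * cosh x powr (2*\<beta>+1-1) * sinh x * sinh x powr (2*\<alpha>+1))) (at x)"
    using DERIV_cmult[OF DERIV_mult[OF 1 2], of "2 powr (2*\<rho>)"]
    unfolding jac_A_def[abs_def] by (simp add: mult.assoc)
  also have "2 powr (2*\<rho>) * ((2*\<alpha>+1) * sinh x powr (2*\<alpha>+1-1) * cosh x * cosh x powr (2*\<beta>+1)
      + (2*\<beta>+1) * cosh x powr (2*\<beta>+1-1) * sinh x * sinh x powr (2*\<alpha>+1)) = 2 * hA x * A x"
    unfolding p hA_def jac_A_def using s c by (simp add: field_simps)
  finally show ?thesis .
qed

lemma A_cont: "continuous_on {0..} A"
  unfolding jac_A_def[abs_def] using \<alpha>_gt
  by (intro continuous_intros continuous_on_powr') auto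

lemma A_tendsto_0: "(A \<longlongrightarrow> 0) (at_right 0)"
proof -
  have "(A \<longlongrightarrow> A 0) (at 0 within {0..})" using A_cont[unfolded continuous_on_def, THEN bspec, of 0] by simp
  then have "(A \<longlongrightarrow> A 0) (at_right 0)" by (rule tendsto_within_subset) auto
  then show ?thesis by simp
qed

text \<open>Of the weight only \<open>A(0) = 0\<close> and its monotonicity enter.\<close>

lemma gronwall:
  fixes d d' e' :: "real => 'a::real_normed_vector"
  assumes L: "L > 0" and K: "K >= 0" and \<eta>: "\<eta> >= 0"
    and d: "\<And>x. 0 < x ==> x <= L ==> (d has_vector_derivative d' x) (at x)"
    and e: "\<And>x. 0 < x ==> x <= L ==> ((\<lambda>x. A x *\<^sub>R d' x) has_vector_derivative e' x) (at x)"
    and bnd: "\<And>x. 0 < x ==> x <= L ==> norm (e' x) <= A x * (K * norm (d x) + \<eta>)"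
    and d0: "(d \<longlongrightarrow> 0) (at_right 0)" and e0: "((\<lambda>x. A x *\<^sub>R d' x) \<longlongrightarrow> 0) (at_right 0)"
  defines "C \<equiv> 2 * L^2 * exp ((2 * K * L + 1) * L)"
  assumes x: "0 < x" "x <= L"
  shows "norm (d x) <= C * \<eta>" and "norm (d' x) <= L * (K * C + 1) * \<eta>"
proof -
  \<comment> \<open>At this exponential rate, integrating the bound for \<open>d'\<close> produces
    the factor L K / c, which is at most 1/2; so the weighted maximum can be absorbed into the
    left-hand side.\<close>
  define c where "c = 2 * K * L + 1"
  have c: "c > 0" using K L by (simp add: c_def add_nonneg_pos)
  \<comment> \<open>Nothing is assumed about \<open>d\<close> at 0 itself; setting the value to its
    limit 0 gives a continuous function on a compact interval.\<close>
  define D where "D = (\<lambda>x. if x = 0 then 0 else d x)"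
  have contD: "continuous_on {0..L} D"
  proof (rule continuous_on_eq_continuous_within[THEN iffD2], rule ballI)
    fix y assume y: "y \<in> {0..L}"
    show "continuous (at y within {0..L}) D"
    proof (cases "y = 0")
      case True
      have "(D \<longlongrightarrow> 0) (at_right 0)"
        by (rule Lim_transform_eventually[OF d0]) (auto simp: D_def eventually_at_filter)
      then have "(D \<longlongrightarrow> 0) (at 0 within {0..L})"
        by (rule filterlim_mono[OF _ order_refl]) (use L in \<open>auto simp: at_within_Icc_at_right\<close>)
      then show ?thesis by (simp add: True continuous_within D_def)
    next
      case False
      with y have y': "0 < y" "y <= L" by auto
      have "(d \<longlongrightarrow> d y) (at y)" using has_vector_derivative_continuous[OF d[OF y']] by (simp add: isCont_def)
      moreover have "eventually (\<lambda>x. d x = D x) (at y)"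
      proof -
        have "eventually (\<lambda>x. x \<in> {0<..}) (nhds y)" using y' by (intro eventually_nhds_in_open) auto
        then show ?thesis unfolding eventually_at_filter by eventually_elim (auto simp: D_def)
      qed
      ultimately have "(D \<longlongrightarrow> D y) (at y)" 
        using Lim_transform_eventually[of d "d y" "at y" D] y' by (simp add: D_def)
      then show ?thesis unfolding continuous_within by (rule tendsto_mono[OF at_le[OF subset_UNIV]])
    qed
  qed
  \<comment> \<open>An exponentially weighted maximum takes the place of iterated integration:
    everything below is bounded by the maximum N, and finally N by N/2 plus a multiple of
    \<open>\<eta>\<close>.\<close>
  have "\<exists>z\<in>{0..L}. \<forall>y\<in>{0..L}. exp (- c * y) * norm (D y) <= exp (- c * z) * norm (D z)"
    by (rule continuous_attains_sup) (use L in \<open>auto intro!: continuous_intros contD\<close>)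
  then obtain z where z: "z \<in> {0..L}"
    and zmax: "\<And>y. y \<in> {0..L} ==> exp (- c * y) * norm (D y) <= exp (- c * z) * norm (D z)" by blast
  define N where "N = exp (- c * z) * norm (D z)"
  have N0: "N >= 0" by (simp add: N_def)
  have dN: "norm (d y) <= N * exp (c * y)" if "0 < y" "y <= L" for y
  proof -
    have "exp (- c * y) * norm (d y) <= N" using zmax[of y] that unfolding N_def by (simp add: D_def)
    then have "exp (c * y) * (exp (- c * y) * norm (d y)) <= exp (c * y) * N" by (intro mult_left_mono) auto
    moreover have "exp (c * y) * (exp (- c * y) * norm (d y)) = norm (d y)" by (simp add: exp_minus field_simps)
    ultimately show ?thesis by (metis mult.commute)
  qed
  have d'N: "norm (d' y) <= L * (K * N * exp (c * y) + \<eta>)" if y: "0 < y" "y <= L" for y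
  proof -
    define M where "M = A y * (K * N * exp (c * y) + \<eta>)"
    have M0: "M >= 0" unfolding M_def using N0 K \<eta> A_nonneg by (intro mult_nonneg_nonneg add_nonneg_nonneg) auto
    have "norm (A y *\<^sub>R d' y) <= M * y"
    proof (rule bound_from_zero[OF y(1) e, of "\<lambda>x. M * x" "\<lambda>x. M"])
      fix w assume w: "0 < w" "w <= y"
      have "norm (e' w) <= A w * (K * norm (d w) + \<eta>)" using w y by (intro bnd) auto
      also have "... <= A y * (K * (N * exp (c * y)) + \<eta>)"
      proof (intro mult_mono add_mono order_refl A_mono)
        have "norm (d w) <= N * exp (c * w)" using w y by (intro dN) auto
        also have "... <= N * exp (c * y)" using w c N0 by (intro mult_left_mono) auto
        finally show "norm (d w) <= N * exp (c * y)" .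
      qed (use w K \<eta> A_nonneg in auto)
      finally show "norm (e' w) <= M" by (simp add: M_def mult.assoc)
    qed (use y M0 e0 in \<open>auto intro!: derivative_eq_intros\<close>)
    then have "A y * norm (d' y) <= A y * ((K * N * exp (c * y) + \<eta>) * y)"
      using A_nonneg[of y] by (simp add: M_def mult.assoc)
    then have "norm (d' y) <= (K * N * exp (c * y) + \<eta>) * y" using A_pos[OF y(1)] by simp
    also have "... <= (K * N * exp (c * y) + \<eta>) * L"
      using y K N0 \<eta> by (intro mult_left_mono add_nonneg_nonneg) auto
    finally show ?thesis by (simp add: mult.commute)
  qed
  have dd: "norm (d y) <= N / 2 * exp (c * y) + L^2 * \<eta>" if y: "0 < y" "y <= L" for y
  proof -
    have "norm (d y) <= L * K * N / c * exp (c * y) + L * \<eta> * y"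
    proof (rule bound_from_zero[OF y(1) d, where f'="\<lambda>y. L * (K * N * exp (c * y) + \<eta>)"])
      fix w assume w: "0 < w" "w <= y"
      show "((\<lambda>y. L * K * N / c * exp (c * y) + L * \<eta> * y) has_real_derivative L * (K * N * exp (c * w) + \<eta>)) (at w)"
        using c by (auto intro!: derivative_eq_intros simp: field_simps)
      show "0 <= L * K * N / c * exp (c * w) + L * \<eta> * w" using w L K N0 \<eta> c by auto
    qed (use y d'N d0 in auto)
    also have "... <= N / 2 * exp (c * y) + L^2 * \<eta>"
    proof (intro add_mono mult_right_mono)
      have "2 * (L * K * N) <= N * c" using N0 by (simp add: c_def algebra_simps)
      then show "L * K * N / c <= N / 2" using c by (simp add: field_simps)
      have "L * \<eta> * y <= L * \<eta> * L" using y L \<eta> by (intro mult_left_mono) auto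
      then show "L * \<eta> * y <= L^2 * \<eta>" by (simp add: power2_eq_square mult_ac)
    qed auto
    finally show ?thesis .
  qed
  have Nle: "N <= 2 * L^2 * \<eta>"
  proof (cases "z = 0")
    case False
    with z have z': "0 < z" "z <= L" by auto
    have "N <= exp (- c * z) * (N / 2 * exp (c * z) + L^2 * \<eta>)"
      unfolding N_def[symmetric] using dd[OF z'] z' by (subst N_def) (auto simp: D_def)
    also have "... = N / 2 + exp (- c * z) * (L^2 * \<eta>)" by (simp add: algebra_simps exp_minus)
    also have "... <= N / 2 + 1 * (L^2 * \<eta>)" using c z' \<eta> by (intro add_left_mono mult_right_mono) auto
    finally show ?thesis by simp
  qed (use \<eta> in \<open>simp add: N_def D_def\<close>)
  have NC: "N * exp (c * y) <= C * \<eta>" if "y <= L" for y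
  proof -
    have "N * exp (c * y) <= (2 * L^2 * \<eta>) * exp (c * L)" using Nle that c N0 \<eta> by (intro mult_mono) auto
    then show ?thesis by (simp add: C_def c_def mult_ac)
  qed
  show "norm (d x) <= C * \<eta>" using dN[OF x] NC[OF x(2)] by simp
  have "norm (d' x) <= L * (K * (N * exp (c * x)) + \<eta>)" using d'N[OF x] by (simp add: mult.assoc)
  also have "... <= L * (K * (C * \<eta>) + \<eta>)" using NC[OF x(2)] L K by (intro mult_left_mono add_mono) auto
  finally show "norm (d' x) <= L * (K * C + 1) * \<eta>" by (simp add: algebra_simps)
qed

text \<open>The substitution T = sinh^2 x. The factor 4 is the one in (dT/dx)^2 = 4 T (1 + T), so
  that the last term carries the full l^2 + \<rho>^2.\<close>

lemma phi_F:
  obtains F F1 F2 :: "real => complex" where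
    "\<And>x. \<phi> l x = F ((sinh x)\<^sup>2)" "F 0 = 1"
    "\<And>T. T > -1/2 ==> (F has_vector_derivative F1 T) (at T)"
    "\<And>T. T > -1/2 ==> (F1 has_vector_derivative F2 T) (at T)"
    "continuous_on {-1/2<..} F2"
    "\<And>T. T > -1/2 ==> of_real (4 * (T * (1 + T))) * F2 T + of_real (4 * ((\<alpha> + 1) + (\<alpha> + \<beta> + 2) * T)) * F1 T
        + (l\<^sup>2 + of_real (\<rho>\<^sup>2)) * F T = 0"
proof -
  define a b c where "a = (of_real \<rho> - \<i> * l) / 2" and "b = (of_real \<rho> + \<i> * l) / 2"
    and "c = complex_of_real (\<alpha> + 1)"
  have cn: "c + of_nat n \<noteq> 0" for n
  proof -
    have "\<alpha> + 1 + real n \<noteq> 0" using \<alpha>_gt by linarith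
    then show ?thesis unfolding c_def by (metis of_real_add of_real_eq_0_iff of_real_of_nat_eq)
  qed
  obtain F1 F2 where F:
    "\<And>T. T > -1/2 ==> ((\<lambda>T. hyp2F1 a b c (- T)) has_vector_derivative F1 T) (at T)"
    "\<And>T. T > -1/2 ==> (F1 has_vector_derivative F2 T) (at T)"
    "continuous_on {-1/2<..} F2"
    "\<And>T. T > -1/2 ==> of_real (T * (1 + T)) * F2 T + (c + (a + b + 1) * of_real T) * F1 T
        + a * b * hyp2F1 a b c (- T) = 0" by (rule hyp2F1_ode[OF cn, of a b]) (rule that)
  have ab: "4 * (a * b) = l\<^sup>2 + of_real (\<rho>\<^sup>2)" "a + b + 1 = of_real (\<alpha> + \<beta> + 2)"
    by (simp_all add: a_def b_def field_simps power2_eq_square jac_rho_def)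
  show thesis
  proof (rule that[of "\<lambda>T. hyp2F1 a b c (- T)" F1 F2])
    show "hyp2F1 a b c (- 0) = 1"
      unfolding hyp2F1_def hyp2F1_series_def hg_coeff_def[symmetric] by (simp add: powser_zero)
    fix T :: real assume T: "T > -1/2"
    have "of_real (4 * (T * (1 + T))) * F2 T + of_real (4 * ((\<alpha> + 1) + (\<alpha> + \<beta> + 2) * T)) * F1 T
        + (l\<^sup>2 + of_real (\<rho>\<^sup>2)) * hyp2F1 a b c (- T)
      = 4 * (of_real (T * (1 + T)) * F2 T + (c + (a + b + 1) * of_real T) * F1 T
        + a * b * hyp2F1 a b c (- T))"
      unfolding ab(1)[symmetric] ab(2) c_def by (simp add: algebra_simps)
    also have "... = 0" by (simp only: F(4)[OF T] mult_zero_right)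
    finally show "of_real (4 * (T * (1 + T))) * F2 T + of_real (4 * ((\<alpha> + 1) + (\<alpha> + \<beta> + 2) * T)) * F1 T
        + (l\<^sup>2 + of_real (\<rho>\<^sup>2)) * hyp2F1 a b c (- T) = 0" .
  qed (use F in \<open>auto simp: jacobi_phi_def a_def b_def c_def\<close>)
qed

definition dphi :: "complex => real => complex" where
  "dphi l x = vector_derivative (\<phi> l) (at x)"

text \<open>The chain rule through T = sinh^2 x, whose derivative 2 sinh x cosh x vanishes at 0.
  Differentiability on the whole line, including 0, comes from the smoothness of F on T >
  -1/2.\<close>

lemma phi_deriv: "(\<phi> l has_vector_derivative dphi l x) (at x)"
  and dphi_deriv: "x > 0 ==> (dphi l has_vector_derivative
        (- of_real (2 * hA x) * dphi l x - (l\<^sup>2 + of_real (\<rho>\<^sup>2)) * \<phi> l x)) (at x)"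
  and dphi_0 [simp]: "dphi l 0 = 0"
  and phi_0 [simp]: "\<phi> l 0 = 1"
  and dphi_cont: "continuous_on UNIV (dphi l)"
proof -
  obtain F F1 F2 where F: "\<And>x. \<phi> l x = F ((sinh x)\<^sup>2)" "F 0 = 1"
    "\<And>T. T > -1/2 ==> (F has_vector_derivative F1 T) (at T)"
    "\<And>T. T > -1/2 ==> (F1 has_vector_derivative F2 T) (at T)"
    "continuous_on {-1/2<..} F2"
    "\<And>T. T > -1/2 ==> of_real (4 * (T * (1 + T))) * F2 T + of_real (4 * ((\<alpha> + 1) + (\<alpha> + \<beta> + 2) * T)) * F1 T
        + (l\<^sup>2 + of_real (\<rho>\<^sup>2)) * F T = 0" by (rule phi_F[of l]) (rule that)
  have T: "(sinh x)\<^sup>2 > (-1/2::real)" for x :: real using zero_le_power2[of "sinh x"] by linarith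
  have dT: "((\<lambda>x. (sinh x)\<^sup>2) has_real_derivative 2 * sinh x * cosh x) (at x)" for x :: real
    by (auto intro!: derivative_eq_intros)
  have d1: "(\<phi> l has_vector_derivative (2 * sinh x * cosh x) *\<^sub>R F1 ((sinh x)\<^sup>2)) (at x)" for x
    using vector_diff_chain_at[OF dT[unfolded has_real_derivative_iff_has_vector_derivative] F(3)[OF T]]
    unfolding o_def F(1)[symmetric] by (simp add: F(1)[abs_def])
  have dphi: "dphi l x = (2 * sinh x * cosh x) *\<^sub>R F1 ((sinh x)\<^sup>2)" for x
    unfolding dphi_def by (rule vector_derivative_at[OF d1])
  show "(\<phi> l has_vector_derivative dphi l x) (at x)" unfolding dphi by (rule d1)
  show "dphi l 0 = 0" "\<phi> l 0 = 1" by (simp_all add: dphi F)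
  have dF1: "((\<lambda>x. F1 ((sinh x)\<^sup>2)) has_vector_derivative (2 * sinh x * cosh x) *\<^sub>R F2 ((sinh x)\<^sup>2)) (at x)" for x
    using vector_diff_chain_at[OF dT[unfolded has_real_derivative_iff_has_vector_derivative] F(4)[OF T]]
    unfolding o_def .
  have ds: "((\<lambda>x. 2 * sinh x * cosh x) has_real_derivative 2 * ((cosh x)\<^sup>2 + (sinh x)\<^sup>2)) (at x)" for x :: real
    by (auto intro!: derivative_eq_intros simp: power2_eq_square)
  have d2: "(dphi l has_vector_derivative
      (2 * sinh x * cosh x) *\<^sub>R ((2 * sinh x * cosh x) *\<^sub>R F2 ((sinh x)\<^sup>2)) + (2 * ((cosh x)\<^sup>2 + (sinh x)\<^sup>2)) *\<^sub>R F1 ((sinh x)\<^sup>2)) (at x)" for x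
    unfolding dphi[abs_def] by (rule has_vector_derivative_scaleR[OF ds dF1])
  show "continuous_on UNIV (dphi l)"
    by (intro continuous_at_imp_continuous_on ballI has_vector_derivative_continuous[OF d2])
  assume x: "x > 0"
  define s c where "s = sinh x" and "c = cosh x"
  have s: "s > 0" and c: "c > 0" and cs: "c\<^sup>2 = 1 + s\<^sup>2"
    using x by (auto simp: s_def c_def cosh_square_eq)
  have sc: "2 * hA x * (2 * s * c) = 2 * (2*\<alpha>+1) * c\<^sup>2 + 2 * (2*\<beta>+1) * s\<^sup>2"
    unfolding hA_def s_def[symmetric] c_def[symmetric] using s c by (simp add: field_simps power2_eq_square)
  have "(2 * s * c) *\<^sub>R ((2 * s * c) *\<^sub>R F2 (s\<^sup>2)) + (2 * (c\<^sup>2 + s\<^sup>2)) *\<^sub>R F1 (s\<^sup>2)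
     = of_real (4 * (s\<^sup>2 * (1 + s\<^sup>2))) * F2 (s\<^sup>2) + of_real (2 * (c\<^sup>2 + s\<^sup>2)) * F1 (s\<^sup>2)"
    unfolding cs[symmetric] by (simp add: scaleR_conv_of_real power2_eq_square)
  also have "... = of_real (2 * (c\<^sup>2 + s\<^sup>2)) * F1 (s\<^sup>2) - of_real (4 * ((\<alpha> + 1) + (\<alpha> + \<beta> + 2) * s\<^sup>2)) * F1 (s\<^sup>2)
        - (l\<^sup>2 + of_real (\<rho>\<^sup>2)) * F (s\<^sup>2)"
    using F(6)[OF T[of x]] unfolding s_def[symmetric] by (simp add: algebra_simps add_eq_0_iff2)
  also have "... = - of_real (2 * hA x * (2 * s * c)) * F1 (s\<^sup>2) - (l\<^sup>2 + of_real (\<rho>\<^sup>2)) * F (s\<^sup>2)"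
    unfolding sc cs by (simp add: algebra_simps)
  also have "... = - of_real (2 * hA x) * ((2 * s * c) *\<^sub>R F1 (s\<^sup>2)) - (l\<^sup>2 + of_real (\<rho>\<^sup>2)) * F (s\<^sup>2)"
    by (simp add: scaleR_conv_of_real)
  finally show "(dphi l has_vector_derivative
        (- of_real (2 * hA x) * dphi l x - (l\<^sup>2 + of_real (\<rho>\<^sup>2)) * \<phi> l x)) (at x)"
    unfolding s_def c_def dphi F(1) by (rule has_vector_derivative_eq_rhs[OF d2[unfolded dphi[abs_def]]])
qed

text \<open>The weight is the integrating factor of the first-order term, so the equation takes the
  divergence form (A \<phi>')' = -(l^2 + \<rho>^2) A \<phi>, without singular coefficients.\<close>

lemma A_dphi_deriv:
  "x > 0 ==> ((\<lambda>x. A x *\<^sub>R dphi l x) has_vector_derivative (- (l\<^sup>2 + of_real (\<rho>\<^sup>2)) * of_real (A x) * \<phi> l x)) (at x)"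
proof -
  assume x: "x > 0"
  have "A x *\<^sub>R (- of_real (2 * hA x) * dphi l x - (l\<^sup>2 + of_real (\<rho>\<^sup>2)) * \<phi> l x) + (2 * hA x * A x) *\<^sub>R dphi l x
     = - (l\<^sup>2 + of_real (\<rho>\<^sup>2)) * of_real (A x) * \<phi> l x"
    by (simp add: scaleR_conv_of_real algebra_simps)
  then show ?thesis
    using has_vector_derivative_scaleR[OF A_deriv[OF x] dphi_deriv[OF x, of l]] by (simp only:)
qed

lemma A_dphi_tendsto: "((\<lambda>x. A x *\<^sub>R dphi l x) \<longlongrightarrow> 0) (at_right 0)"
proof -
  have "isCont (dphi l) 0" using dphi_cont[of l] by (simp add: continuous_on_eq_continuous_at)
  then have "(dphi l \<longlongrightarrow> dphi l 0) (at_right 0)"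
    unfolding isCont_def by (rule tendsto_mono[OF at_le[OF subset_UNIV]])
  from tendsto_scaleR[OF A_tendsto_0 this] show ?thesis by simp
qed

end

lemma sinh_real_ge_self: "0 <= x ==> x <= sinh (x::real)"
  using real_le_x_sinh[of x] by (simp add: sinh_field_def exp_minus)

section \<open>Real spectral parameter: bounds for the Jacobi functions and continuity in the
  parameter\<close>

context jacobi begin

text \<open>The eigenvalue of -(1/A) d/dx (A d/dx) at the Jacobi function with parameter l.\<close>

definition \<kappa> :: "real => real" where "\<kappa> l = l\<^sup>2 + \<rho>\<^sup>2"
definition rphi :: "real => real => real" where "rphi l x = Re (\<phi> (of_real l) x)"
definition rdphi :: "real => real => real" where "rdphi l x = Re (dphi (of_real l) x)"

lemma \<kappa>_pos: "\<kappa> l > 0" using \<rho>_pos by (simp add: \<kappa>_def add_nonneg_pos)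

lemma \<kappa>_complex: "(of_real l)\<^sup>2 + of_real (\<rho>\<^sup>2) = complex_of_real (\<kappa> l)" by (simp add: \<kappa>_def)

lemma rphi_0 [simp]: "rphi l 0 = 1" and rdphi_0 [simp]: "rdphi l 0 = 0"
  by (simp_all add: rphi_def rdphi_def)

lemma phi_tendsto_1: "(\<phi> l \<longlongrightarrow> 1) (at_right 0)"
proof -
  have "isCont (\<phi> l) 0" using has_vector_derivative_continuous[OF phi_deriv] .
  then have "(\<phi> l \<longlongrightarrow> \<phi> l 0) (at_right 0)" unfolding isCont_def by (rule tendsto_mono[OF at_le[OF subset_UNIV]])
  then show ?thesis by simp
qed

text \<open>For real l the eigenvalue is real, so the imaginary part solves the same equation with
  initial value 0; \<open>gronwall\<close> with zero forcing annihilates it.\<close>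

lemma phi_real: assumes "x >= 0" shows "\<phi> (of_real l) x = of_real (rphi l x)"
proof -
  have "norm (Im (\<phi> (of_real l) x)) <= 2 * x^2 * exp ((2 * \<kappa> l * x + 1) * x) * 0" if x: "x > 0"
  proof (rule gronwall(1)[of x "\<kappa> l" 0 "\<lambda>x. Im (\<phi> (of_real l) x)" "\<lambda>x. Im (dphi (of_real l) x)"
        "\<lambda>x. - \<kappa> l * A x * Im (\<phi> (of_real l) x)"])
    fix y :: real assume y: "0 < y"
    show "((\<lambda>x. Im (\<phi> (of_real l) x)) has_vector_derivative Im (dphi (of_real l) y)) (at y)"
      by (rule bounded_linear.has_vector_derivative[OF bounded_linear_Im phi_deriv])
    have "((\<lambda>x. Im (A x *\<^sub>R dphi (of_real l) x)) has_vector_derivative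
        Im (- ((of_real l)\<^sup>2 + of_real (\<rho>\<^sup>2)) * of_real (A y) * \<phi> (of_real l) y)) (at y)"
      by (rule bounded_linear.has_vector_derivative[OF bounded_linear_Im A_dphi_deriv[OF y]])
    then show "((\<lambda>x. A x *\<^sub>R Im (dphi (of_real l) x)) has_vector_derivative - \<kappa> l * A y * Im (\<phi> (of_real l) y)) (at y)"
      unfolding \<kappa>_complex by simp
    show "norm (- \<kappa> l * A y * Im (\<phi> (of_real l) y)) <= A y * (\<kappa> l * norm (Im (\<phi> (of_real l) y)) + 0)"
      using \<kappa>_pos[of l] A_nonneg[of y] by (simp add: abs_mult)
  next
    show "((\<lambda>x. Im (\<phi> (of_real l) x)) \<longlongrightarrow> 0) (at_right 0)"
      using tendsto_Im[OF phi_tendsto_1, of "of_real l"] by simp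
    show "((\<lambda>x. A x *\<^sub>R Im (dphi (of_real l) x)) \<longlongrightarrow> 0) (at_right 0)"
      using tendsto_Im[OF A_dphi_tendsto, of "of_real l"] by simp
  qed (use x \<kappa>_pos[of l] in auto)
  then show ?thesis using assms by (cases "x = 0") (auto simp: rphi_def complex_eq_iff)
qed

lemma rphi_deriv: "(rphi l has_real_derivative rdphi l x) (at x)"
  unfolding rphi_def[abs_def] rdphi_def has_real_derivative_iff_has_vector_derivative
  by (rule bounded_linear.has_vector_derivative[OF bounded_linear_Re phi_deriv])

lemma rdphi_deriv: assumes "x > 0"
  shows "(rdphi l has_real_derivative - 2 * hA x * rdphi l x - \<kappa> l * rphi l x) (at x)"
proof -
  have "((\<lambda>x. Re (dphi (of_real l) x)) has_vector_derivative
      Re (- of_real (2 * hA x) * dphi (of_real l) x - ((of_real l)\<^sup>2 + of_real (\<rho>\<^sup>2)) * \<phi> (of_real l) x)) (at x)"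
    by (rule bounded_linear.has_vector_derivative[OF bounded_linear_Re dphi_deriv[OF assms]])
  then show ?thesis unfolding \<kappa>_complex
    by (simp add: rphi_def rdphi_def[abs_def] has_real_derivative_iff_has_vector_derivative)
qed

lemma A_rdphi_deriv: assumes "x > 0"
  shows "((\<lambda>x. A x * rdphi l x) has_real_derivative - \<kappa> l * A x * rphi l x) (at x)"
  by (rule DERIV_cong[OF DERIV_mult[OF A_deriv[OF assms] rdphi_deriv[OF assms]]]) (simp add: algebra_simps)

lemma rphi_cont: "continuous_on S (rphi l)"
  by (intro continuous_at_imp_continuous_on ballI DERIV_isCont[OF rphi_deriv])

lemma rdphi_cont: "continuous_on S (rdphi l)"
  unfolding rdphi_def[abs_def] by (intro continuous_intros continuous_on_subset[OF dphi_cont]) auto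

text \<open>The first-order term acts as friction: the derivative of the energy is -4
  \<open>hA\<close> times the square of the derivative, hence at most 0, and the energy at 0 is
  \<open>\<kappa> l\<close>.\<close>

lemma energy: assumes "x >= 0" shows "(rdphi l x)\<^sup>2 + \<kappa> l * (rphi l x)\<^sup>2 <= \<kappa> l"
proof (cases "x = 0")
  case False
  with assms have x: "0 < x" by simp
  let ?E = "\<lambda>x. (rdphi l x)\<^sup>2 + \<kappa> l * (rphi l x)\<^sup>2"
  have "?E x <= ?E 0"
  proof (rule DERIV_nonpos_imp_decreasing_open[OF less_imp_le[OF x]])
    fix y assume y: "0 < y" "y < x"
    have "(?E has_real_derivative 2 * rdphi l y * (- 2 * hA y * rdphi l y - \<kappa> l * rphi l y)
        + \<kappa> l * (2 * rphi l y * rdphi l y)) (at y)"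
      by (auto intro!: derivative_eq_intros rphi_deriv rdphi_deriv y)
    moreover have "2 * rdphi l y * (- 2 * hA y * rdphi l y - \<kappa> l * rphi l y) + \<kappa> l * (2 * rphi l y * rdphi l y)
      = - 4 * hA y * (rdphi l y)\<^sup>2" by (simp add: power2_eq_square algebra_simps)
    moreover have "- 4 * hA y * (rdphi l y)\<^sup>2 <= 0" using hA_nonneg[OF y(1)] by simp
    ultimately show "\<exists>z. (?E has_real_derivative z) (at y) \<and> z <= 0" by metis
  qed (intro continuous_intros rphi_cont rdphi_cont)
  then show ?thesis by simp
qed simp

lemma rphi_le_1: assumes "x >= 0" shows "\<bar>rphi l x\<bar> <= 1"
proof -
  have "\<kappa> l * (rphi l x)\<^sup>2 <= \<kappa> l * 1" using energy[OF assms, of l] zero_le_power2[of "rdphi l x"] by linarith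
  then have "(rphi l x)\<^sup>2 <= 1" using \<kappa>_pos[of l] by simp
  then show ?thesis by (simp add: abs_square_le_1)
qed

lemma rdphi_sq_le: "x >= 0 ==> (rdphi l x)\<^sup>2 <= \<kappa> l"
  using energy[of x l] \<kappa>_pos[of l] by (smt (verit) mult_nonneg_nonneg zero_le_power2)

lemma A_rdphi_tendsto: "((\<lambda>x. A x * rdphi l x) \<longlongrightarrow> 0) (at_right 0)"
  using tendsto_Re[OF A_dphi_tendsto, of "of_real l"] by (simp add: rdphi_def)

text \<open>In divergence form the flux A \<phi>' is an integral of \<open>\<kappa> l\<close> A
  \<phi> with |\<phi>| at most 1 and A increasing; so it is at most \<open>\<kappa> l\<close> x
  A(x), and the weight cancels.\<close>

lemma rdphi_le: assumes x: "x >= 0" shows "\<bar>rdphi l x\<bar> <= \<kappa> l * x"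
proof (cases "x = 0")
  case False
  then have x: "x > 0" using x by simp
  have "norm (A x * rdphi l x) <= \<kappa> l * A x * x"
  proof (rule bound_from_zero[OF x, where f'="\<lambda>_. \<kappa> l * A x" and f="\<lambda>y. \<kappa> l * A x * y"])
    fix y assume y: "0 < y" "y <= x"
    show "((\<lambda>x. A x * rdphi l x) has_vector_derivative - \<kappa> l * A y * rphi l y) (at y)"
      using A_rdphi_deriv[OF y(1)] by (simp add: has_real_derivative_iff_has_vector_derivative)
    have "A y * \<bar>rphi l y\<bar> <= A x * 1" using y A_nonneg by (intro mult_mono A_mono rphi_le_1) auto
    then show "norm (- \<kappa> l * A y * rphi l y) <= \<kappa> l * A x"
      using \<kappa>_pos[of l] A_nonneg[of y] by (simp add: abs_mult)
  qed (use x \<kappa>_pos[of l] A_nonneg[of x] in \<open>auto intro!: derivative_eq_intros A_rdphi_tendsto mult_nonneg_nonneg\<close>)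
  then show ?thesis using A_pos[OF x] by (simp add: abs_mult field_simps)
qed simp

lemma rphi_ge: assumes x: "x >= 0" shows "rphi l x >= 1 - \<kappa> l * x\<^sup>2 / 2"
proof (cases "x = 0")
  case False
  then have x: "x > 0" using x by simp
  have "rphi l 0 + \<kappa> l * 0\<^sup>2 / 2 <= rphi l x + \<kappa> l * x\<^sup>2 / 2"
  proof (rule DERIV_nonneg_imp_increasing_open[OF less_imp_le[OF x]])
    fix y assume y: "0 < y" "y < x"
    have "((\<lambda>x. rphi l x + \<kappa> l * x\<^sup>2 / 2) has_real_derivative rdphi l y + \<kappa> l * y) (at y)"
      by (auto intro!: derivative_eq_intros rphi_deriv)
    then show "\<exists>z. ((\<lambda>x. rphi l x + \<kappa> l * x\<^sup>2 / 2) has_real_derivative z) (at y) \<and> 0 <= z"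
      using rdphi_le[of y l] y by (intro exI[of _ "rdphi l y + \<kappa> l * y"]) auto
  qed (use x in \<open>auto intro!: continuous_intros rphi_cont\<close>)
  then show ?thesis by simp
qed simp

text \<open>A bound for \<open>x * hA x\<close> on the interval (0, 1]; through it the logarithmic
  derivative of the weight enters the lower bound for 1 - \<phi>.\<close>

definition Hc :: real where "Hc = (\<alpha> + 1/2) * cosh 1 + (\<beta> + 1/2)"

lemma Hc_nonneg: "Hc >= 0" using \<alpha>_gt \<beta>_ge by (simp add: Hc_def)

lemma x_hA_le: assumes "0 < x" "x <= 1" shows "x * hA x <= Hc"
proof -
  have "x * cosh x / sinh x <= sinh x * cosh x / sinh x" using assms sinh_real_ge_self[of x] by (intro divide_right_mono mult_right_mono) auto
  also have "... = cosh x" using assms by simp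
  also have "... <= cosh 1" using assms by (simp add: cosh_real_nonneg_le_iff)
  finally have 1: "x * cosh x / sinh x <= cosh 1" .
  have "x * sinh x <= 1 * cosh x" using assms sinh_less_cosh_real[of x] by (intro mult_mono) auto
  then have 2: "x * sinh x / cosh x <= 1" by simp
  have "x * hA x = (\<alpha> + 1/2) * (x * cosh x / sinh x) + (\<beta> + 1/2) * (x * sinh x / cosh x)"
    by (simp add: hA_def algebra_simps)
  also have "... <= (\<alpha> + 1/2) * cosh 1 + (\<beta> + 1/2) * 1"
    using 1 2 \<alpha>_gt \<beta>_ge by (intro add_mono mult_left_mono) auto
  finally show ?thesis by (simp add: Hc_def)
qed

text \<open>As long as \<open>\<kappa> l\<close> x^2 is at most 1, \<phi> stays above 1/2, so the
  flux A \<phi>' decreases at least at the rate \<open>\<kappa> l\<close> A / 2. The derivative of y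
  A(y) is at most (1 + 2 \<open>Hc\<close>) A; comparing the two bounds \<phi>' above by a negative
  multiple of y, and one more integration gives the quadratic gap.\<close>

lemma one_minus_rphi_ge:
  assumes x: "0 <= x" "x <= 1" and k: "\<kappa> l * x\<^sup>2 <= 1"
  shows "1 - rphi l x >= \<kappa> l * x\<^sup>2 / (4 * (1 + 2 * Hc))"
proof (cases "x = 0")
  case False
  then have x0: "x > 0" using x by simp
  define H where "H = 1 + 2 * Hc"
  have H: "H >= 1" using Hc_nonneg by (simp add: H_def)
  have half: "rphi l y >= 1/2" if "0 <= y" "y <= x" for y
  proof -
    have "\<kappa> l * y\<^sup>2 <= \<kappa> l * x\<^sup>2" using that \<kappa>_pos[of l] by (intro mult_left_mono power_mono) auto
    then show ?thesis using rphi_ge[OF that(1), of l] k by simp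
  qed
  have d: "rdphi l y <= - (\<kappa> l / (2 * H)) * y" if y: "0 < y" "y <= x" for y
  proof -
    let ?g = "\<lambda>y. A y * rdphi l y + \<kappa> l / (2 * H) * (y * A y)"
    have "?g y <= ?g 0"
    proof (rule DERIV_nonpos_imp_decreasing_open[OF less_imp_le[OF y(1)]])
      fix z assume z: "0 < z" "z < y"
      let ?d = "- \<kappa> l * A z * rphi l z + \<kappa> l / (2 * H) * (1 * A z + 2 * hA z * A z * z)"
      have "(?g has_real_derivative ?d) (at z)"
        by (intro DERIV_add DERIV_cmult DERIV_mult A_rdphi_deriv A_deriv DERIV_ident z)
      moreover have "?d <= 0"
      proof -
        have "1 * A z + 2 * hA z * A z * z = A z * (1 + 2 * (z * hA z))" by (simp add: algebra_simps)
        also have "... <= A z * H" unfolding H_def using x_hA_le[of z] z y x A_nonneg[of z]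
          by (intro mult_left_mono add_mono) auto
        finally have "\<kappa> l / (2 * H) * (1 * A z + 2 * hA z * A z * z) <= \<kappa> l / (2 * H) * (A z * H)"
          using \<kappa>_pos[of l] H by (intro mult_left_mono) auto
        also have "... = \<kappa> l * A z * (1/2)" using H by simp
        also have "... <= \<kappa> l * A z * rphi l z" using half[of z] z y \<kappa>_pos[of l] A_nonneg[of z]
          by (intro mult_left_mono) auto
        finally show ?thesis by simp
      qed
      ultimately show "\<exists>d. (?g has_real_derivative d) (at z) \<and> d <= 0" by blast
    qed (use H in \<open>auto intro!: continuous_intros rdphi_cont continuous_on_subset[OF A_cont]\<close>)
    then have "A y * (rdphi l y + \<kappa> l / (2 * H) * y) <= 0" by (simp add: algebra_simps)
    then show ?thesis using A_pos[OF y(1)] by (simp add: mult_le_0_iff)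
  qed
  have "rphi l x + \<kappa> l / (4 * H) * x\<^sup>2 <= rphi l 0 + \<kappa> l / (4 * H) * 0\<^sup>2"
  proof (rule DERIV_nonpos_imp_decreasing_open[OF less_imp_le[OF x0]])
    fix y assume y: "0 < y" "y < x"
    have "((\<lambda>x. rphi l x + \<kappa> l / (4 * H) * x\<^sup>2) has_real_derivative rdphi l y + \<kappa> l / (4 * H) * (2 * y)) (at y)"
      using H by (auto intro!: derivative_eq_intros rphi_deriv)
    then show "\<exists>z. ((\<lambda>x. rphi l x + \<kappa> l / (4 * H) * x\<^sup>2) has_real_derivative z) (at y) \<and> z <= 0"
    proof (intro exI conjI)
      have "\<kappa> l / (4 * H) * (2 * y) = \<kappa> l / (2 * H) * y" using H by (simp add: field_simps)
      then show "rdphi l y + \<kappa> l / (4 * H) * (2 * y) <= 0" using d[of y] y by (simp add: mult.commute)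
    qed
  qed (use H in \<open>auto intro!: continuous_intros rphi_cont\<close>)
  then show ?thesis by (simp add: H_def)
qed simp

text \<open>The difference of two Jacobi functions solves the equation for l with forcing
  (\<open>\<kappa> l - \<kappa> m\<close>) \<phi>_m, which is bounded because |\<phi>_m| is at most
  1. \<open>gronwall\<close> converts this into a Lipschitz bound in the eigenvalue, and hence into
  continuity in the parameter.\<close>

lemma rphi_param_diff:
  fixes l m :: real
  assumes L: "L > 0" and x: "0 < x" "x <= L"
  defines "C \<equiv> 2 * L^2 * exp ((2 * \<kappa> l * L + 1) * L)"
  shows "\<bar>rphi l x - rphi m x\<bar> <= C * \<bar>\<kappa> l - \<kappa> m\<bar>"
    and "\<bar>rdphi l x - rdphi m x\<bar> <= L * (\<kappa> l * C + 1) * \<bar>\<kappa> l - \<kappa> m\<bar>"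
proof -
  have d: "((\<lambda>x. rphi l x - rphi m x) has_vector_derivative (rdphi l y - rdphi m y)) (at y)" for y
    using DERIV_diff[OF rphi_deriv rphi_deriv] by (simp add: has_real_derivative_iff_has_vector_derivative)
  have e: "((\<lambda>x. A x *\<^sub>R (rdphi l x - rdphi m x)) has_vector_derivative
      (- \<kappa> l * A y * rphi l y - - \<kappa> m * A y * rphi m y)) (at y)" if "0 < y" for y
    using DERIV_diff[OF A_rdphi_deriv[OF that] A_rdphi_deriv[OF that], of l m]
    by (simp add: has_real_derivative_iff_has_vector_derivative algebra_simps)
  have b: "norm (- \<kappa> l * A y * rphi l y - - \<kappa> m * A y * rphi m y)
      <= A y * (\<kappa> l * norm (rphi l y - rphi m y) + \<bar>\<kappa> l - \<kappa> m\<bar>)" if y: "0 < y" for y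
  proof -
    have "- \<kappa> l * A y * rphi l y - - \<kappa> m * A y * rphi m y
      = A y * (- \<kappa> l * (rphi l y - rphi m y) - (\<kappa> l - \<kappa> m) * rphi m y)" by (simp add: algebra_simps)
    then have "norm (- \<kappa> l * A y * rphi l y - - \<kappa> m * A y * rphi m y)
      = A y * \<bar>- \<kappa> l * (rphi l y - rphi m y) - (\<kappa> l - \<kappa> m) * rphi m y\<bar>"
      using A_nonneg[of y] by (simp add: abs_mult)
    also have "... <= A y * (\<kappa> l * \<bar>rphi l y - rphi m y\<bar> + \<bar>\<kappa> l - \<kappa> m\<bar> * 1)"
    proof (rule mult_left_mono[OF _ A_nonneg])
      have "\<bar>- \<kappa> l * (rphi l y - rphi m y) - (\<kappa> l - \<kappa> m) * rphi m y\<bar>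
         <= \<bar>- \<kappa> l * (rphi l y - rphi m y)\<bar> + \<bar>(\<kappa> l - \<kappa> m) * rphi m y\<bar>" by (rule abs_triangle_ineq4)
      also have "... = \<kappa> l * \<bar>rphi l y - rphi m y\<bar> + \<bar>\<kappa> l - \<kappa> m\<bar> * \<bar>rphi m y\<bar>"
        using \<kappa>_pos[of l] by (simp add: abs_mult)
      also have "... <= \<kappa> l * \<bar>rphi l y - rphi m y\<bar> + \<bar>\<kappa> l - \<kappa> m\<bar> * 1"
        using rphi_le_1[of y m] y by (intro add_left_mono mult_left_mono) auto
      finally show "\<bar>- \<kappa> l * (rphi l y - rphi m y) - (\<kappa> l - \<kappa> m) * rphi m y\<bar>
        <= \<kappa> l * \<bar>rphi l y - rphi m y\<bar> + \<bar>\<kappa> l - \<kappa> m\<bar> * 1" .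
    qed
    finally show ?thesis by simp
  qed
  have t1: "((\<lambda>x. rphi l x - rphi m x) \<longlongrightarrow> 0) (at_right 0)"
    using tendsto_diff[OF tendsto_Re[OF phi_tendsto_1[of "of_real l"]] tendsto_Re[OF phi_tendsto_1[of "of_real m"]]]
    by (simp add: rphi_def)
  have t2: "((\<lambda>x. A x *\<^sub>R (rdphi l x - rdphi m x)) \<longlongrightarrow> 0) (at_right 0)"
    using tendsto_diff[OF A_rdphi_tendsto A_rdphi_tendsto, of l m] by (simp add: algebra_simps)
  show "\<bar>rphi l x - rphi m x\<bar> <= C * \<bar>\<kappa> l - \<kappa> m\<bar>"
    unfolding C_def real_norm_def[symmetric]
    by (rule gronwall(1)[OF L _ _ d e _ t1 t2 x]) (use b \<kappa>_pos[of l] in auto)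
  show "\<bar>rdphi l x - rdphi m x\<bar> <= L * (\<kappa> l * C + 1) * \<bar>\<kappa> l - \<kappa> m\<bar>"
    unfolding C_def real_norm_def[symmetric]
    by (rule gronwall(2)[OF L _ _ d e _ t1 t2 x]) (use b \<kappa>_pos[of l] in auto)
qed

lemma rphi_param_cont:
  assumes x: "x > 0" shows "isCont (\<lambda>l. rphi l x) l" "isCont (\<lambda>l. rdphi l x) l"
proof -
  have k: "(\<lambda>m. \<bar>\<kappa> l - \<kappa> m\<bar>) \<midarrow>l\<rightarrow> 0"
  proof -
    have "isCont (\<lambda>m. \<bar>\<kappa> l - \<kappa> m\<bar>) l" unfolding \<kappa>_def by (intro continuous_intros)
    then show ?thesis by (simp add: isCont_def)
  qed
  obtain C where C: "\<And>m. \<bar>rphi l x - rphi m x\<bar> <= C * \<bar>\<kappa> l - \<kappa> m\<bar>"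
    using rphi_param_diff(1)[OF x x order_refl] by blast
  have "(\<lambda>m. rphi l x - rphi m x) \<midarrow>l\<rightarrow> 0"
    by (rule Lim_null_comparison[where g="\<lambda>m. C * \<bar>\<kappa> l - \<kappa> m\<bar>"])
       (use C k in \<open>auto intro: tendsto_mult_right_zero\<close>)
  from tendsto_diff[OF tendsto_const[of "rphi l x"] this] show "isCont (\<lambda>l. rphi l x) l" by (simp add: isCont_def)
  obtain C' where C': "\<And>m. \<bar>rdphi l x - rdphi m x\<bar> <= C' * \<bar>\<kappa> l - \<kappa> m\<bar>"
    using rphi_param_diff(2)[OF x x order_refl] by blast
  have "(\<lambda>m. rdphi l x - rdphi m x) \<midarrow>l\<rightarrow> 0"
    by (rule Lim_null_comparison[where g="\<lambda>m. C' * \<bar>\<kappa> l - \<kappa> m\<bar>"])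
       (use C' k in \<open>auto intro: tendsto_mult_right_zero\<close>)
  from tendsto_diff[OF tendsto_const[of "rdphi l x"] this] show "isCont (\<lambda>l. rdphi l x) l" by (simp add: isCont_def)
qed

end

section \<open>Beta distributions\<close>

text \<open>A vanishing first parameter gives the point mass at 0, a vanishing second one the point
  mass at 1, which are the weak limits of the Beta laws. The parameters \<beta> + 1/2 and \<alpha> -
  \<beta> used below may vanish.\<close>

definition beta_measure :: "real => real => real measure" where
  "beta_measure a b = (if a = 0 then return borel 0 else if b = 0 then return borel 1
     else density lborel (\<lambda>t. ennreal (indicator {0<..<1} t * (t powr (a - 1) * (1 - t) powr (b - 1) / Beta a b))))"

lemma Beta_real_pos: "a > 0 ==> b > 0 ==> Beta a (b::real) > 0"
  by (auto simp: Beta_def intro!: divide_pos_pos mult_pos_pos Gamma_real_pos)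

lemma sets_beta_measure [measurable_cong, simp]: "sets (beta_measure a b) = sets borel"
  by (simp add: beta_measure_def)

lemma prob_space_beta_measure:
  assumes "a >= 0" "b >= 0"
  shows "prob_space (beta_measure a b)"
proof (cases "a = 0 \<or> b = 0")
  case True
  then show ?thesis by (auto simp: beta_measure_def intro!: prob_space_return)
next
  case False
  then have ab: "a > 0" "b > 0" using assms by auto
  let ?f = "\<lambda>t. indicator {0<..<1} t * (t powr (a - 1) * (1 - t) powr (b - 1) / Beta a b) :: real"
  have "((\<lambda>t. (t powr (a - 1) * (1 - t) powr (b - 1)) / Beta a b) has_integral (Beta a b / Beta a b)) {0<..<1}"
    using has_integral_divide[OF has_integral_Beta_real[OF ab], of "Beta a b"] by (simp add: has_integral_Icc_iff_Ioo)
  then have "((\<lambda>t. if t \<in> {0<..<1} then (t powr (a - 1) * (1 - t) powr (b - 1)) / Beta a b else 0) has_integral 1) UNIV"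
    using Beta_real_pos[OF ab] by (subst has_integral_restrict_UNIV) auto
  also have "(\<lambda>t. if t \<in> {0<..<1} then (t powr (a - 1) * (1 - t) powr (b - 1)) / Beta a b else 0) = ?f"
    by (auto simp: indicator_def)
  finally have "(?f has_integral 1) UNIV" .
  moreover have "?f t >= 0" for t using Beta_real_pos[OF ab] by (auto simp: indicator_def)
  ultimately have "(\<integral>\<^sup>+t. ennreal (?f t) \<partial>lborel) = ennreal 1"
    by (intro nn_integral_has_integral_lborel) auto
  then show ?thesis using ab by (auto simp: beta_measure_def emeasure_density intro!: prob_spaceI)
qed

lemma beta_AE: "AE t in beta_measure a b. 0 <= t \<and> t <= 1"
proof (cases "a = 0 \<or> b = 0")
  case True
  have "AE t in return borel c. 0 <= t \<and> t <= (1::real)" if "c = 0 \<or> c = 1" for c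
    by (subst AE_return) (use that in auto)
  moreover have "beta_measure a b = return borel 0 \<or> beta_measure a b = return borel 1"
    using True by (auto simp: beta_measure_def)
  ultimately show ?thesis by metis
next
  case False
  then have bm: "beta_measure a b = density lborel (\<lambda>t. ennreal (indicator {0<..<1} t * (t powr (a - 1) * (1 - t) powr (b - 1) / Beta a b)))"
    by (simp add: beta_measure_def)
  show ?thesis unfolding bm by (subst AE_density) (auto simp: indicator_def)
qed

lemma beta_integrable:
  fixes f :: "real => 'a::{banach, second_countable_topology}"
  assumes "a >= 0" "b >= 0" and f: "continuous_on UNIV f"
  shows "integrable (beta_measure a b) f"
proof -
  interpret prob_space "beta_measure a b" using assms by (intro prob_space_beta_measure)
  have "compact (f ` {0..1})" by (rule compact_continuous_image[OF continuous_on_subset[OF f]]) auto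
  then obtain B where B: "\<And>t. t \<in> {0..1} ==> norm (f t) <= B"
    by (meson bounded_iff compact_imp_bounded image_eqI)
  show ?thesis
  proof (rule integrable_const_bound[of _ B])
    show "AE t in beta_measure a b. norm (f t) <= B" using beta_AE[of a b] by eventually_elim (use B in auto)
    show "f \<in> borel_measurable (beta_measure a b)"
      using borel_measurable_continuous_onI[OF f] by simp
  qed
qed

text \<open>Integration by parts against the Beta density; it also holds for the two point masses.\<close>

lemma beta_stein:
  fixes h h' :: "real => complex"
  assumes ab: "a >= 0" "b >= 0" and hc: "continuous_on UNIV h" "continuous_on UNIV h'"
    and d: "\<And>t. 0 < t ==> t < 1 ==> (h has_vector_derivative h' t) (at t)"
  shows "(\<integral>t. of_real (t * (1 - t)) * h' t + of_real (a - (a + b) * t) * h t \<partial>beta_measure a b) = 0"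
proof -
  let ?g = "\<lambda>t. of_real (t * (1 - t)) * h' t + of_real (a - (a + b) * t) * h t"
  have gc: "continuous_on UNIV ?g" by (intro continuous_intros hc)
  have gm: "?g \<in> borel_measurable borel" by (rule borel_measurable_continuous_onI[OF gc])
  show ?thesis
  proof (cases "a = 0 \<or> b = 0")
    case True
    \<comment> \<open>For a point mass the integrand itself vanishes: at t = 0 when a = 0, and at t
      = 1 when b = 0.\<close>
    have r: "(\<integral>t. ?g t \<partial>return borel c) = ?g c" for c by (rule integral_return) (use gm in auto)
    show ?thesis
    proof (cases "a = 0")
      case True
      then have "beta_measure a b = return borel 0" by (simp add: beta_measure_def)
      then show ?thesis unfolding r[of 0, symmetric] using True r[of 0] by simp
    next
      case False
      then have "beta_measure a b = return borel 1" "b = 0" using \<open>a = 0 \<or> b = 0\<close> by (auto simp: beta_measure_def)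
      then show ?thesis using r[of 1] by simp
    qed
  next
    case False
    then have a: "a > 0" and b: "b > 0" using ab by auto
    let ?w = "\<lambda>t. t powr (a - 1) * (1 - t) powr (b - 1) :: real"
    let ?W = "\<lambda>t. indicator {0<..<1} t * (?w t / Beta a b) :: real"
    have B: "Beta a b > 0" by (rule Beta_real_pos[OF a b])
    have W0: "?W t >= 0" for t using B by (auto simp: indicator_def)
    have Wm: "?W \<in> borel_measurable borel" by measurable
    have bm: "beta_measure a b = density lborel (\<lambda>t. ennreal (?W t))"
      using False by (simp add: beta_measure_def)
    have int: "integrable lborel (\<lambda>t. ?W t *\<^sub>R ?g t)"
      using beta_integrable[OF ab gc] unfolding bm
      by (subst (asm) integrable_density) (use gm Wm W0 in auto)
    have "(\<integral>t. ?g t \<partial>beta_measure a b) = (\<integral>t. ?W t *\<^sub>R ?g t \<partial>lborel)"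
      unfolding bm by (rule integral_density) (use gm Wm W0 in auto)
    also have "... = (LINT t:{0<..<1}|lborel. (?w t / Beta a b) *\<^sub>R ?g t)"
      unfolding set_lebesgue_integral_def by (simp only: scaleR_scaleR)
    also have "... = integral {0<..<1} (\<lambda>t. (?w t / Beta a b) *\<^sub>R ?g t)"
      by (rule set_borel_integral_eq_integral) (use int in \<open>simp only: set_integrable_def scaleR_scaleR\<close>)
    also have "... = 0"
    proof -
      \<comment> \<open>The antiderivative: the density raised by one power at each end. For a, b >
        0 it is continuous on [0, 1] and vanishes at both endpoints, so there are no boundary
        terms.\<close>
      let ?G = "\<lambda>t. (t powr a * (1 - t) powr b / Beta a b) *\<^sub>R h t"
      have "((\<lambda>t. (?w t / Beta a b) *\<^sub>R ?g t) has_integral ?G 1 - ?G 0) {0..1}"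
      proof (rule fundamental_theorem_of_calculus_interior)
        show "continuous_on {0..1} ?G"
        proof -
          have "continuous_on {0..1} (\<lambda>t. t powr a)" "continuous_on {0..1} (\<lambda>t::real. (1 - t) powr b)"
            by (rule continuous_on_powr', use a b in \<open>auto intro!: continuous_on_diff continuous_on_const continuous_on_id\<close>)+
          then show ?thesis using B by (auto intro!: continuous_intros continuous_on_subset[OF hc(1)])
        qed
        fix t :: real assume t: "t \<in> {0<..<1}"
        have pa: "t powr a = t powr (a - 1) * t" using t powr_add[of t "a - 1" 1] by simp
        have pb: "(1 - t) powr b = (1 - t) powr (b - 1) * (1 - t)" using t powr_add[of "1 - t" "b - 1" 1] by simp
        have 1: "((\<lambda>t. t powr a) has_real_derivative a * t powr (a - 1)) (at t)"
          using t by (intro has_real_derivative_powr) auto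
        have 2: "((\<lambda>t. (1 - t) powr b) has_real_derivative b * (1 - t) powr (b - 1) * (-1)) (at t)"
          by (rule DERIV_chain2[where f="\<lambda>t. t powr b" and g="\<lambda>t. 1 - t"])
             (use t in \<open>auto intro!: has_real_derivative_powr derivative_eq_intros\<close>)
        have 3: "((\<lambda>t. t powr a * (1 - t) powr b / Beta a b) has_real_derivative
            (?w t / Beta a b) * (a * (1 - t) - b * t)) (at t)"
          by (rule DERIV_cong[OF DERIV_cdivide[OF DERIV_mult[OF 1 2], of "Beta a b"]])
             (use B in \<open>simp add: pa pb field_simps\<close>)
        have "(?G has_vector_derivative (t powr a * (1 - t) powr b / Beta a b) *\<^sub>R h' t
             + ((?w t / Beta a b) * (a * (1 - t) - b * t)) *\<^sub>R h t) (at t)"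
          by (rule has_vector_derivative_scaleR[OF 3 d]) (use t in auto)
        moreover have "(t powr a * (1 - t) powr b / Beta a b) *\<^sub>R h' t
             + ((?w t / Beta a b) * (a * (1 - t) - b * t)) *\<^sub>R h t = (?w t / Beta a b) *\<^sub>R ?g t"
        proof -
          have "(E * (t * (1 - t))) *\<^sub>R h' t + (E * (a * (1 - t) - b * t)) *\<^sub>R h t = E *\<^sub>R ?g t" for E :: real
            by (simp add: scaleR_conv_of_real algebra_simps)
          moreover have "t powr a * (1 - t) powr b / Beta a b = ?w t / Beta a b * (t * (1 - t))"
            by (simp add: pa pb)
          ultimately show ?thesis by (simp only:)
        qed
        ultimately show "(?G has_vector_derivative (?w t / Beta a b) *\<^sub>R ?g t) (at t)" by simp
      qed simp
      then have "((\<lambda>t. (?w t / Beta a b) *\<^sub>R ?g t) has_integral 0) {0<..<1}"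
        using a b by (simp add: has_integral_Icc_iff_Ioo)
      then show ?thesis by (rule integral_unique)
    qed
    finally show ?thesis .
  qed
qed

text \<open>Dominated convergence for the difference quotients along sequences; the dominating
  constant is the uniform bound for the derivative, through the mean value inequality.\<close>

lemma has_vector_derivative_integral:
  fixes f f' :: "real => 'a => complex"
  assumes M: "finite_measure M" and x: "x \<in> {a<..<b}"
    and d: "\<And>y w. y \<in> {a<..<b} ==> w \<in> space M ==> ((\<lambda>y. f y w) has_vector_derivative f' y w) (at y)"
    and B: "\<And>y w. y \<in> {a<..<b} ==> w \<in> space M ==> norm (f' y w) <= B"
    and i: "\<And>y. y \<in> {a<..<b} ==> integrable M (f y)"
    and m: "f' x \<in> borel_measurable M"
  shows "((\<lambda>y. \<integral>w. f y w \<partial>M) has_vector_derivative (\<integral>w. f' x w \<partial>M)) (at x)"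
proof -
  interpret finite_measure M by (rule M)
  have i': "integrable M (f' x)" by (rule integrable_const_bound[of _ B]) (use B x m in auto)
  have op: "at x within {a<..<b} = at x" by (rule at_within_open) (use x in auto)
  have lip: "norm (f y w - f x w) <= B * norm (y - x)" if "y \<in> {a<..<b}" "w \<in> space M" for y w
  proof (rule differentiable_bound[of "{a<..<b}" "\<lambda>y. f y w" "\<lambda>y h. h *\<^sub>R f' y w"])
    fix y assume y: "y \<in> {a<..<b}"
    show "((\<lambda>y. f y w) has_derivative (\<lambda>h. h *\<^sub>R f' y w)) (at y within {a<..<b})"
      using d[OF y that(2)] unfolding has_vector_derivative_def by (rule has_derivative_at_withinI)
    show "onorm (\<lambda>h. h *\<^sub>R f' y w) <= B"
    proof (rule onorm_le)
      fix h
      show "norm (h *\<^sub>R f' y w) <= B * norm h"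
        using mult_right_mono[OF B[OF y that(2)], of "\<bar>h\<bar>"] by (simp add: mult.commute)
    qed
  qed (use x that in auto)
  show ?thesis
    unfolding has_vector_derivative_def has_derivative_iff_norm op[symmetric]
    unfolding tendsto_at_iff_sequentially
  proof (intro conjI allI impI bounded_linear_scaleR_left)
    fix X :: "nat => real"
    assume X: "\<forall>i. X i \<in> {a<..<b} - {x}" "X \<longlonglongrightarrow> x"
    have "(\<lambda>n. \<integral>w. (1 / (X n - x)) *\<^sub>R (f (X n) w - f x w) \<partial>M) \<longlonglongrightarrow> (\<integral>w. f' x w \<partial>M)"
    proof (rule integral_dominated_convergence[where w="\<lambda>_. B"])
      show "AE w in M. (\<lambda>n. (1 / (X n - x)) *\<^sub>R (f (X n) w - f x w)) \<longlonglongrightarrow> f' x w"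
      proof (rule AE_I2)
        fix w assume w: "w \<in> space M"
        have "((\<lambda>y. norm ((f y w - f x w) - (y - x) *\<^sub>R f' x w) / norm (y - x)) \<longlongrightarrow> 0) (at x within {a<..<b})"
          using d[OF x w] unfolding has_vector_derivative_def has_derivative_iff_norm op by simp
        then have "(\<lambda>n. norm ((f (X n) w - f x w) - (X n - x) *\<^sub>R f' x w) / norm (X n - x)) \<longlonglongrightarrow> 0"
          unfolding tendsto_at_iff_sequentially using X by (auto simp: o_def)
        moreover have "norm ((f (X n) w - f x w) - (X n - x) *\<^sub>R f' x w) / norm (X n - x)
           = norm ((1 / (X n - x)) *\<^sub>R (f (X n) w - f x w) - f' x w)" for n
        proof -
          have "X n - x \<noteq> 0" using X by auto
          then have "(1 / (X n - x)) *\<^sub>R (f (X n) w - f x w) - f' x w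
             = (1 / (X n - x)) *\<^sub>R ((f (X n) w - f x w) - (X n - x) *\<^sub>R f' x w)"
            by (simp add: scaleR_diff_right)
          then show ?thesis by simp
        qed
        ultimately have "(\<lambda>n. norm ((1 / (X n - x)) *\<^sub>R (f (X n) w - f x w) - f' x w)) \<longlonglongrightarrow> 0" by simp
        then show "(\<lambda>n. (1 / (X n - x)) *\<^sub>R (f (X n) w - f x w)) \<longlonglongrightarrow> f' x w"
          by (simp add: tendsto_norm_zero_iff LIM_zero_iff)
      qed
      fix n
      have Xn: "X n \<in> {a<..<b}" "X n \<noteq> x" using X by auto
      show "(\<lambda>w. (1 / (X n - x)) *\<^sub>R (f (X n) w - f x w)) \<in> borel_measurable M"
        using i[OF Xn(1)] i[OF x] by (intro borel_measurable_integrable) auto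
      show "AE w in M. norm ((1 / (X n - x)) *\<^sub>R (f (X n) w - f x w)) <= B"
      proof (rule AE_I2)
        fix w assume "w \<in> space M"
        from lip[OF Xn(1) this] show "norm ((1 / (X n - x)) *\<^sub>R (f (X n) w - f x w)) <= B"
          using Xn(2) by (simp only: norm_scaleR real_norm_def abs_divide abs_one) (simp add: field_simps)
      qed
    qed (use m in auto)
    then have "(\<lambda>n. norm ((\<integral>w. (1 / (X n - x)) *\<^sub>R (f (X n) w - f x w) \<partial>M) - (\<integral>w. f' x w \<partial>M))) \<longlonglongrightarrow> 0"
      by (intro tendsto_norm_zero LIM_zero)
    moreover have "norm ((\<integral>w. (1 / (X n - x)) *\<^sub>R (f (X n) w - f x w) \<partial>M) - (\<integral>w. f' x w \<partial>M))
       = norm ((\<integral>w. f (X n) w \<partial>M) - (\<integral>w. f x w \<partial>M) - (X n - x) *\<^sub>R (\<integral>w. f' x w \<partial>M)) / norm (X n - x)" for n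
    proof -
      have ne: "X n - x \<noteq> 0" and Xn: "X n \<in> {a<..<b}" using X by auto
      have "(\<integral>w. (1 / (X n - x)) *\<^sub>R (f (X n) w - f x w) \<partial>M) = (1 / (X n - x)) *\<^sub>R ((\<integral>w. f (X n) w \<partial>M) - (\<integral>w. f x w \<partial>M))"
        using i[OF Xn] i[OF x] by simp
      then have "(\<integral>w. (1 / (X n - x)) *\<^sub>R (f (X n) w - f x w) \<partial>M) - (\<integral>w. f' x w \<partial>M)
         = (1 / (X n - x)) *\<^sub>R ((\<integral>w. f (X n) w \<partial>M) - (\<integral>w. f x w \<partial>M) - (X n - x) *\<^sub>R (\<integral>w. f' x w \<partial>M))"
        using ne by (simp add: scaleR_diff_right)
      then show ?thesis by simp
    qed
    ultimately show "((\<lambda>y. norm ((\<integral>w. f y w \<partial>M) - (\<integral>w. f x w \<partial>M) - (y - x) *\<^sub>R (\<integral>w. f' x w \<partial>M)) / norm (y - x)) \<circ> X) \<longlonglongrightarrow> 0"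
      by (simp add: o_def)
  qed
qed

section \<open>The Plancherel density\<close>

text \<open>Along a horizontal line log |z + s| need not be concave in s, but its second derivative
  is at most 1 / (Re z)^2. Subtracting it from the matching quadratic gives a convex function, and
  convexity between s = 0 and s = 1 is the claim up to this error. Over the points z + k the errors
  are summable.\<close>

lemma norm_log_interp:
  fixes z :: complex and d :: real
  assumes z: "Re z > 0" and d: "0 <= d" "d <= 1"
  shows "norm z powr (1 - d) * norm (z + 1) powr d <= exp (1 / (Re z)\<^sup>2) * norm (z + of_real d)"
proof -
  define t y where "t = Re z" and "y = Im z"
  have t: "t > 0" using z by (simp add: t_def)
  define B where "B = 1 / t\<^sup>2"
  let ?f = "\<lambda>s. ln ((t + s)\<^sup>2 + y\<^sup>2) / 2"
  have pos: "(t + s)\<^sup>2 + y\<^sup>2 > 0" if "s >= 0" for s using t that by (intro add_pos_nonneg) auto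
  let ?g = "\<lambda>s. B * s\<^sup>2 / 2 - ?f s"
  let ?g1 = "\<lambda>s. B * s - (t + s) / ((t + s)\<^sup>2 + y\<^sup>2)"
  let ?g2 = "\<lambda>s. B - (y\<^sup>2 - (t + s)\<^sup>2) / ((t + s)\<^sup>2 + y\<^sup>2)\<^sup>2"
  have cv: "convex_on {0..1} ?g"
  proof (rule f''_ge0_imp_convex[of "{0..1}" ?g ?g1 ?g2])
    fix s :: real assume "s \<in> {0..1}"
    then have s: "s >= 0" by simp
    show "(?g has_real_derivative ?g1 s) (at s)"
      using pos[OF s] by (auto intro!: derivative_eq_intros simp: field_simps)
    show "(?g1 has_real_derivative ?g2 s) (at s)"
      using pos[OF s] by (auto intro!: derivative_eq_intros simp: field_simps power2_eq_square)
    have "(y\<^sup>2 - (t + s)\<^sup>2) / ((t + s)\<^sup>2 + y\<^sup>2)\<^sup>2 <= ((t + s)\<^sup>2 + y\<^sup>2) / ((t + s)\<^sup>2 + y\<^sup>2)\<^sup>2"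
      by (intro divide_right_mono) (auto simp: sum_squares_ge_zero)
    also have "... = 1 / ((t + s)\<^sup>2 + y\<^sup>2)" using pos[OF s] by (simp add: power2_eq_square)
    also have "... <= 1 / t\<^sup>2"
    proof (rule divide_left_mono)
      have "t\<^sup>2 <= (t + s)\<^sup>2" using t s by (intro power_mono) auto
      then show "t\<^sup>2 <= (t + s)\<^sup>2 + y\<^sup>2" using zero_le_power2[of y] by linarith
    qed (use pos[OF s] t in auto)
    finally show "?g2 s >= 0" by (simp add: B_def)
  qed simp
  have "?g ((1 - d) *\<^sub>R 0 + d *\<^sub>R 1) <= (1 - d) * ?g 0 + d * ?g 1"
    by (rule convex_onD[OF cv]) (use d in auto)
  then have "(1 - d) * ?f 0 + d * ?f 1 <= ?f d + B * (d - d\<^sup>2) / 2"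
    by (simp add: algebra_simps add_divide_distrib diff_divide_distrib)
  also have "B * (d - d\<^sup>2) / 2 <= B"
  proof -
    have "d - d\<^sup>2 <= 2" using d zero_le_power2[of d] by linarith
    then have "B * (d - d\<^sup>2) <= B * 2" by (intro mult_left_mono) (auto simp: B_def)
    then show ?thesis by simp
  qed
  finally have main: "(1 - d) * ?f 0 + d * ?f 1 <= ?f d + B" by simp
  have nrm: "norm (z + of_real s) = exp (?f s)" if "s >= 0" for s
  proof -
    have "norm (z + of_real s) = sqrt ((t + s)\<^sup>2 + y\<^sup>2)" by (simp add: cmod_def t_def y_def)
    also have "... = exp (?f s)" using pos[OF that]
      by (simp add: ln_sqrt[symmetric])
    finally show ?thesis .
  qed
  have "norm z powr (1 - d) * norm (z + 1) powr d = exp ((1 - d) * ?f 0) * exp (d * ?f 1)"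
    using nrm[of 0] nrm[of 1] by (simp add: powr_def)
  also have "... = exp ((1 - d) * ?f 0 + d * ?f 1)" by (simp add: exp_add)
  also have "... <= exp (?f d + B)" using main by simp
  also have "... = exp (1 / (Re z)\<^sup>2) * norm (z + of_real d)" using nrm[OF d(1)]
    by (simp add: exp_add B_def t_def)
  finally show ?thesis .
qed

lemma summable_inverse_shifted_squares:
  assumes "t > (0::real)" shows "summable (\<lambda>k. 1 / (t + real k)\<^sup>2)"
proof (rule summable_comparison_test'[where N=1])
  show "summable (\<lambda>k. 1 / (real k)\<^sup>2)" using inverse_power_summable[of 2, where 'a=real] by (simp add: field_simps)
  fix k :: nat assume "k >= 1"
  then show "norm (1 / (t + real k)\<^sup>2) <= 1 / (real k)\<^sup>2" using assms by (auto intro!: divide_left_mono power_mono)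
qed

text \<open>In Gauss' limit for the Gamma function each factor z + k + d is compared with z + k and
  z + k + 1 by \<open>norm_log_interp\<close>. The products telescope to a power of |z|, and the
  errors add up to the series in the exponent.\<close>

lemma Gamma_shift_le_unit:
  fixes z :: complex and d :: real
  assumes z: "Re z > 0" and d: "0 <= d" "d <= 1"
  shows "norm (Gamma (z + of_real d)) <= exp (\<Sum>k. 1 / (Re z + real k)\<^sup>2) * norm z powr d * norm (Gamma z)"
proof -
  let ?S = "\<Sum>k. 1 / (Re z + real k)\<^sup>2"
  have zk: "norm (z + of_nat k) > 0" for k
  proof -
    have "Re (z + of_nat k) > 0" using z by simp
    then show ?thesis by (metis complex_Re_numeral less_irrefl norm_eq_zero zero_complex.sel(1) zero_less_norm_iff)
  qed
  have zdk: "norm (z + of_real d + of_nat k) > 0" for k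
  proof -
    have "Re (z + of_real d + of_nat k) > 0" using z d by simp
    then show ?thesis by (metis less_irrefl norm_eq_zero zero_complex.sel(1) zero_less_norm_iff)
  qed
  \<comment> \<open>The last factor |z + m|^d is carried along: combined with |z + m|^(1-d) it
    restores the full factor |z + m| for the next step. In the end it dominates the extra n^d of the
    Gamma series at z + d.\<close>
  have P: "(\<Prod>k<m. norm (z + of_nat k)) * norm (z + of_nat m) powr d
      <= exp (\<Sum>k<m. 1 / (Re z + real k)\<^sup>2) * norm z powr d * (\<Prod>k<m. norm (z + of_real d + of_nat k))" for m
  proof (induction m)
    case (Suc m)
    have st: "norm (z + of_nat m) powr (1 - d) * norm (z + of_nat m + 1) powr d
       <= exp (1 / (Re z + real m)\<^sup>2) * norm (z + of_real d + of_nat m)"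
      using norm_log_interp[of "z + of_nat m" d] z d by (simp add: add_ac)
    have e: "norm (z + of_nat m) = norm (z + of_nat m) powr (1 - d) * norm (z + of_nat m) powr d"
      using zk[of m] by (simp add: powr_add[symmetric])
    have "(\<Prod>k<Suc m. norm (z + of_nat k)) * norm (z + of_nat (Suc m)) powr d
       = ((\<Prod>k<m. norm (z + of_nat k)) * norm (z + of_nat m) powr d) * (norm (z + of_nat m) powr (1 - d) * norm (z + of_nat m + 1) powr d)"
      using e by (simp add: add_ac mult_ac)
    also have "... <= (exp (\<Sum>k<m. 1 / (Re z + real k)\<^sup>2) * norm z powr d * (\<Prod>k<m. norm (z + of_real d + of_nat k)))
        * (exp (1 / (Re z + real m)\<^sup>2) * norm (z + of_real d + of_nat m))"
      by (intro mult_mono Suc.IH st mult_nonneg_nonneg prod_nonneg) auto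
    also have "... = exp (\<Sum>k<Suc m. 1 / (Re z + real k)\<^sup>2) * norm z powr d * (\<Prod>k<Suc m. norm (z + of_real d + of_nat k))"
      by (simp add: exp_add mult_ac)
    finally show ?case .
  qed simp
  have S: "(\<Sum>k<m. 1 / (Re z + real k)\<^sup>2) <= ?S" for m
    by (rule sum_le_suminf[OF summable_inverse_shifted_squares[OF z]]) auto
  have G: "norm (Gamma_series (z + of_real d) n) <= exp ?S * norm z powr d * norm (Gamma_series z n)" if n: "n >= 1" for n
  proof -
    let ?P = "\<Prod>k<Suc n. norm (z + of_nat k)" and ?Q = "\<Prod>k<Suc n. norm (z + of_real d + of_nat k)"
    have P0: "?P > 0" "?Q > 0" by (intro prod_pos ballI zk zdk)+
    have nG: "norm (Gamma_series w n) = fact n * real n powr (Re w) / (\<Prod>k<Suc n. norm (w + of_nat k))" for w :: complex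
      using n by (simp add: Gamma_series_def norm_mult norm_divide pochhammer_prod prod_norm[symmetric]
          atLeast0LessThan norm_exp_eq_Re powr_def del: prod.lessThan_Suc)
    have "real n powr d <= norm (z + of_nat (Suc n)) powr d"
    proof (rule powr_mono2)
      have "real n <= Re (z + of_nat (Suc n))" using z by simp
      also have "... <= norm (z + of_nat (Suc n))" by (rule complex_Re_le_cmod)
      finally show "real n <= norm (z + of_nat (Suc n))" .
    qed (use d in auto)
    then have "?P * real n powr d <= ?P * norm (z + of_nat (Suc n)) powr d" using P0 by (intro mult_left_mono) auto
    also have "... <= exp (\<Sum>k<Suc n. 1 / (Re z + real k)\<^sup>2) * norm z powr d * ?Q" by (rule P)
    also have "... <= exp ?S * norm z powr d * ?Q" using S[of "Suc n"] P0(2)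
      by (intro mult_right_mono) auto
    finally have "real n powr d / ?Q <= exp ?S * norm z powr d / ?P"
      using P0 by (simp add: field_simps del: prod.lessThan_Suc)
    then have "fact n * real n powr Re z * (real n powr d / ?Q) <= fact n * real n powr Re z * (exp ?S * norm z powr d / ?P)"
      by (intro mult_left_mono) auto
    then show ?thesis unfolding nG by (simp add: powr_add mult_ac del: prod.lessThan_Suc)
  qed
  show ?thesis
  proof (rule LIMSEQ_le)
    show "(\<lambda>n. norm (Gamma_series (z + of_real d) n)) \<longlonglongrightarrow> norm (Gamma (z + of_real d))" by (intro tendsto_intros)
    show "(\<lambda>n. exp ?S * norm z powr d * norm (Gamma_series z n)) \<longlonglongrightarrow> exp ?S * norm z powr d * norm (Gamma z)"
      by (intro tendsto_intros)
  qed (use G in blast)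
qed

text \<open>Shifts longer than 1 are reduced by the functional equation, one unit at a time; the
  factor picked up is at most a constant times |t + iy|, uniformly in y, because t > 0.\<close>

lemma Gamma_shift_le:
  assumes t: "t > (0::real)" and d: "d >= 0"
  shows "\<exists>C>0. \<forall>y. norm (Gamma (Complex (t + d) y)) <= C * norm (Complex t y) powr d * norm (Gamma (Complex t y))"
proof -
  have "\<exists>C>0. \<forall>y. norm (Gamma (Complex (t + d) y)) <= C * norm (Complex t y) powr d * norm (Gamma (Complex t y))"
    if "0 <= d" "d <= real n + 1" for n d using that
  proof (induction n arbitrary: d)
    case 0
    show ?case
    proof (intro exI conjI allI)
      fix y
      show "norm (Gamma (Complex (t + d) y)) <= exp (\<Sum>k. 1 / (t + real k)\<^sup>2) * norm (Complex t y) powr d * norm (Gamma (Complex t y))"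
        using Gamma_shift_le_unit[of "Complex t y" d] t 0
        by (simp add: complex_of_real_def complex_add)
    qed simp
  next
    case (Suc n)
    show ?case
    proof (cases "d <= real n + 1")
      case True then show ?thesis using Suc by blast
    next
      case False
      then obtain C where C: "C > 0" "\<And>y. norm (Gamma (Complex (t + (d - 1)) y)) <= C * norm (Complex t y) powr (d - 1) * norm (Gamma (Complex t y))"
        using Suc.IH[of "d - 1"] Suc.prems by auto
      define E where "E = (t + d) / t"
      have E: "E > 0" using t Suc.prems by (simp add: E_def)
      have "norm (Gamma (Complex (t + d) y)) <= (E * C) * norm (Complex t y) powr d * norm (Gamma (Complex t y))" for y
      proof -
        let ?w = "Complex (t + (d - 1)) y"
        have Ct: "norm (Complex t y) > 0" using t by (simp add: complex_eq_iff)
        have w0: "Re ?w > 0" using t False by simp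
        have "?w \<notin> \<int>\<^sub>\<le>\<^sub>0" using w0 by (auto elim!: nonpos_Ints_cases dest!: arg_cong[where f=Re])
        then have "Gamma (?w + 1) = ?w * Gamma ?w" by (rule Gamma_plus1)
        moreover have "?w + 1 = Complex (t + d) y" by (simp add: complex_eq_iff)
        ultimately have "norm (Gamma (Complex (t + d) y)) = norm ?w * norm (Gamma ?w)" by (simp add: norm_mult)
        also have "norm ?w <= E * norm (Complex t y)"
        proof -
          have "norm ?w <= norm (Complex t y) + norm (Complex (d - 1) 0)"
            using norm_triangle_ineq[of "Complex t y" "Complex (d - 1) 0"] by (simp add: complex_add)
          also have "norm (Complex (d - 1) 0) = d - 1" using False by (simp add: cmod_def)
          also have "d - 1 <= (d / t) * t" using t by simp
          also have "... <= (d / t) * norm (Complex t y)"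
            using complex_Re_le_cmod[of "Complex t y"] t Suc.prems by (intro mult_left_mono) auto
          finally show ?thesis using t by (simp add: E_def field_simps)
        qed
        also have "E * norm (Complex t y) * norm (Gamma ?w)
            <= E * norm (Complex t y) * (C * norm (Complex t y) powr (d - 1) * norm (Gamma (Complex t y)))"
          using C(2)[of y] E by (intro mult_left_mono) auto
        also have "... = (E * C) * (norm (Complex t y) powr (d - 1) * norm (Complex t y) powr 1) * norm (Gamma (Complex t y))"
          using Ct by (simp add: mult_ac)
        also have "norm (Complex t y) powr (d - 1) * norm (Complex t y) powr 1 = norm (Complex t y) powr d"
          by (subst powr_add[symmetric]) simp
        finally show ?thesis by (simp add: mult_right_mono)
      qed
      then show ?thesis using E C(1) by (intro exI[of _ "E * C"]) auto
    qed
  qed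
  moreover obtain n :: nat where "d <= real n" using real_arch_simple by blast
  ultimately show ?thesis using d by (meson add_increasing2 zero_le_one order_trans)
qed

lemma powr_half_compare:
  assumes "t > (0::real)" "t / 2 <= s" "s <= t"
  shows "s powr e <= 2 powr \<bar>e\<bar> * t powr e"
proof (cases "e >= 0")
  case True
  have "s powr e <= t powr e" using assms True by (intro powr_mono2) auto
  also have "... <= 2 powr \<bar>e\<bar> * t powr e" using ge_one_powr_ge_zero[of 2 "\<bar>e\<bar>"] by (simp add: mult_le_cancel_right1)
  finally show ?thesis .
next
  case False
  have "s powr e <= (t / 2) powr e" using assms False by (intro powr_mono2') auto
  also have "... = 2 powr \<bar>e\<bar> * t powr e" using False assms by (simp add: powr_divide powr_minus_divide)
  finally show ?thesis .
qed

context jacobi begin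

text \<open>An elementary majorant of the Plancherel density, up to a constant: of order l^2 at 0
  and of order l^(2\<alpha>+1) at infinity, for every admissible \<alpha>.\<close>

definition wt :: "real => real" where "wt l = l\<^sup>2 * (1 + l) powr (2*\<alpha> - 1)"

lemma wt_pos: "l > 0 ==> wt l > 0" by (simp add: wt_def)

text \<open>Legendre duplication replaces Gamma(il) by values at height y = l/2 on the lines Re = 1
  and Re = 1/2. The density is then a quotient of Gamma values at the same height, and shift bounds
  replace each quotient by a power of 1 + y; the exponents \<rho>/2 - 1 and (\<alpha>-\<beta>)/2 add
  up to \<alpha> - 1/2.\<close>

lemma plancherel_density_le: "\<exists>C>0. \<forall>l>0. 1 / (cmod (jac_c \<alpha> \<beta> l))\<^sup>2 <= C * wt l"
proof -
  define d where "d = (\<alpha> - \<beta>) / 2"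
  have d: "d >= 0" using \<alpha>\<beta> by (simp add: d_def)
  have r2: "\<rho> / 2 > 0" using \<rho>_pos by simp
  \<comment> \<open>Shifts are allowed only to the right, and \<rho>/2 may be smaller than 1. So
    Gamma at \<rho>/2 + iy is reached from 1 + iy by going to 1 + \<rho>/2 + iy and dividing once by
    \<rho>/2 + iy.\<close>
  obtain C1 where C1: "C1 > 0" "\<And>y. norm (Gamma (Complex (1 + \<rho>/2) y)) <= C1 * norm (Complex 1 y) powr (\<rho>/2) * norm (Gamma (Complex 1 y))"
    using Gamma_shift_le[of 1 "\<rho>/2"] r2 by auto
  obtain C2 where C2: "C2 > 0" "\<And>y. norm (Gamma (Complex (1/2 + d) y)) <= C2 * norm (Complex (1/2) y) powr d * norm (Gamma (Complex (1/2) y))"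
    using Gamma_shift_le[of "1/2" d] d by auto
  \<comment> \<open>Chosen so that m (1 + y) is a lower bound for |\<rho>/2 + iy|: the modulus is at
    least the mean of \<rho>/2 and y.\<close>
  define m where "m = min 1 (\<rho> / 2) / 2"
  have m: "m > 0" using r2 by (simp add: m_def)
  define K where "K = 2 * sqrt pi / (2 powr \<rho> * Gamma (\<alpha> + 1))"
  have Ga: "Gamma (\<alpha> + 1) > 0" using \<alpha>_gt by (intro Gamma_real_pos) auto
  have K: "K > 0" using Ga by (simp add: K_def)
  define D where "D = K * (C1 / m) * C2 * 2 powr \<bar>\<alpha> - 1/2\<bar>"
  have D: "D > 0" using K C1 C2 m by (simp add: D_def)
  have main: "1 / cmod (jac_c \<alpha> \<beta> l) <= D * (l * (1 + l) powr (\<alpha> - 1/2))" if l: "l > 0" for l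
  proof -
    define y where "y = l / 2"
    have y: "y > 0" using l by (simp add: y_def)
    let ?G = "\<lambda>t. norm (Gamma (Complex t y))"
    have G0: "?G t > 0" if "t > 0" for t
    proof -
      have "Complex t y \<notin> \<int>\<^sub>\<le>\<^sub>0" using y by (auto elim!: nonpos_Ints_cases simp: complex_eq_iff)
      then show ?thesis by (simp add: Gamma_eq_zero_iff)
    qed
    have rec: "?G (t + 1) = norm (Complex t y) * ?G t" for t
    proof -
      have "Complex t y \<notin> \<int>\<^sub>\<le>\<^sub>0" using y by (auto elim!: nonpos_Ints_cases simp: complex_eq_iff)
      then have "Gamma (Complex t y + 1) = Complex t y * Gamma (Complex t y)" by (rule Gamma_plus1)
      moreover have "Complex t y + 1 = Complex (t + 1) y" by (simp add: complex_eq_iff)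
      ultimately show ?thesis by (simp add: norm_mult)
    qed
    have z0: "Complex 0 y \<notin> \<int>\<^sub>\<le>\<^sub>0" "Complex 0 y + 1/2 \<notin> \<int>\<^sub>\<le>\<^sub>0"
      using y by (auto elim!: nonpos_Ints_cases simp: complex_eq_iff)
    have Gil: "norm (Gamma (\<i> * of_real l)) = ?G 1 * ?G (1/2) / (2 * sqrt pi * y)"
    proof -
      have "Gamma (Complex 0 y) * Gamma (Complex 0 y + 1/2) =
         exp ((1 - 2 * Complex 0 y) * of_real (ln 2)) * of_real (sqrt pi) * Gamma (2 * Complex 0 y)"
        by (rule Gamma_legendre_duplication[OF z0])
      moreover have "2 * Complex 0 y = \<i> * of_real l" "Complex 0 y + 1/2 = Complex (1/2) y"
        by (simp_all add: complex_eq_iff y_def)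
      ultimately have "norm (Gamma (Complex 0 y) * Gamma (Complex (1/2) y)) =
         norm (exp ((1 - 2 * Complex 0 y) * of_real (ln 2)) * of_real (sqrt pi) * Gamma (\<i> * of_real l))" by simp
      then have "?G 0 * ?G (1/2) = 2 * sqrt pi * norm (Gamma (\<i> * of_real l))"
        by (simp add: norm_mult norm_exp_eq_Re)
      moreover have "?G 1 = y * ?G 0" using rec[of 0] y by (simp add: cmod_def)
      ultimately show ?thesis using y by (simp add: field_simps)
    qed
    have n1: "norm (Complex 1 y) <= 1 + y" "norm (Complex (1/2) y) <= 1 + y"
      using cmod_le[of "Complex 1 y"] cmod_le[of "Complex (1/2) y"] y by auto
    have n2: "m * (1 + y) <= norm (Complex (\<rho>/2) y)"
    proof -
      have "m * (1 + y) <= (\<rho> / 2 + y) / 2" unfolding m_def using y r2 by (auto simp: min_def field_simps)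
      moreover have "\<rho> / 2 <= norm (Complex (\<rho>/2) y)" using complex_Re_le_cmod[of "Complex (\<rho>/2) y"] by simp
      moreover have "y <= norm (Complex (\<rho>/2) y)" using abs_Im_le_cmod[of "Complex (\<rho>/2) y"] y by simp
      moreover have "s <= N" if "s <= (r / 2 + y) / 2" "r / 2 <= N" "y <= N" for s r N :: real
      proof -
        have "r / 2 + y <= N + N" using that by (intro add_mono)
        then have "(r / 2 + y) / 2 <= N" by simp
        with that(1) show ?thesis by (rule order_trans)
      qed
      ultimately show ?thesis by blast
    qed
    have "?G (\<rho>/2) = ?G (1 + \<rho>/2) / norm (Complex (\<rho>/2) y)"
    proof -
      have "norm (Complex (\<rho>/2) y) > 0" using r2 by (simp add: complex_eq_iff)
      then show ?thesis using rec[of "\<rho>/2"] by (simp add: add.commute field_simps)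
    qed
    also have "... <= (C1 * norm (Complex 1 y) powr (\<rho>/2) * ?G 1) / (m * (1 + y))"
      using C1 n2 m y by (intro frac_le) auto
    also have "... <= (C1 * (1 + y) powr (\<rho>/2) * ?G 1) / (m * (1 + y))"
      using n1 C1(1) m y r2 by (intro divide_right_mono mult_right_mono mult_left_mono powr_mono2) auto
    also have "... = C1 / m * (1 + y) powr (\<rho>/2 - 1) * ?G 1"
      using y by (simp add: powr_diff)
    finally have g1: "?G (\<rho>/2) <= C1 / m * (1 + y) powr (\<rho>/2 - 1) * ?G 1" .
    have "?G (1/2 + d) <= C2 * norm (Complex (1/2) y) powr d * ?G (1/2)" by (rule C2)
    also have "... <= C2 * (1 + y) powr d * ?G (1/2)"
      using n1 C2(1) d by (intro mult_right_mono mult_left_mono powr_mono2) auto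
    finally have g2: "?G (1/2 + d) <= C2 * (1 + y) powr d * ?G (1/2)" .
    have e1: "(\<i> * of_real l + of_real \<rho>) / 2 = Complex (\<rho>/2) y"
      and e2: "(\<i> * of_real l + of_real (\<alpha> - \<beta> + 1)) / 2 = Complex (1/2 + d) y"
      by (simp_all add: complex_eq_iff y_def d_def field_simps)
    have nc: "cmod (jac_c \<alpha> \<beta> l) = 2 powr \<rho> * Gamma (\<alpha> + 1) * (?G 1 * ?G (1/2) / (2 * sqrt pi * y)) / (?G (\<rho>/2) * ?G (1/2 + d))"
    proof -
      have "cmod (2 powr (of_real \<rho> - \<i> * of_real l)) = 2 powr \<rho>"
        by (simp add: norm_powr_real_powr)
      moreover have "cmod (Gamma (of_real (\<alpha> + 1))) = Gamma (\<alpha> + 1)"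
        using Ga by (subst Gamma_complex_of_real) simp
      ultimately show ?thesis unfolding jac_c_def e1 e2 by (simp add: norm_mult norm_divide Gil)
    qed
    have "1 / cmod (jac_c \<alpha> \<beta> l) = K * y * (?G (\<rho>/2) * ?G (1/2 + d)) / (?G 1 * ?G (1/2))"
      unfolding nc K_def using Ga y G0[of 1] G0[of "1/2"] by (simp add: field_simps)
    also have "... <= K * y * ((C1 / m * (1 + y) powr (\<rho>/2 - 1) * ?G 1) * (C2 * (1 + y) powr d * ?G (1/2))) / (?G 1 * ?G (1/2))"
      using K y C1 m by (intro divide_right_mono mult_left_mono mult_mono g1 g2) auto
    also have "... = K * (C1 / m) * C2 * y * ((1 + y) powr (\<rho>/2 - 1) * (1 + y) powr d)"
      using G0[of 1] G0[of "1/2"] by (simp add: field_simps)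
    also have "(1 + y) powr (\<rho>/2 - 1) * (1 + y) powr d = (1 + y) powr (\<alpha> - 1/2)"
      by (subst powr_add[symmetric]) (simp add: d_def jac_rho_def field_simps)
    also have "K * (C1 / m) * C2 * y * (1 + y) powr (\<alpha> - 1/2)
        <= K * (C1 / m) * C2 * l * (2 powr \<bar>\<alpha> - 1/2\<bar> * (1 + l) powr (\<alpha> - 1/2))"
    proof (rule mult_mono)
      show "(1 + y) powr (\<alpha> - 1/2) <= 2 powr \<bar>\<alpha> - 1/2\<bar> * (1 + l) powr (\<alpha> - 1/2)"
        using l by (intro powr_half_compare) (auto simp: y_def)
      show "K * (C1 / m) * C2 * y <= K * (C1 / m) * C2 * l"
        by (rule mult_left_mono) (use K C1(1) C2(1) m l in \<open>auto simp: y_def\<close>)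
    qed (use K C1(1) C2(1) m l in auto)
    finally show ?thesis by (simp add: D_def mult_ac)
  qed
  have "1 / (cmod (jac_c \<alpha> \<beta> l))\<^sup>2 <= D\<^sup>2 * wt l" if l: "l > 0" for l
  proof -
    have "(1 / cmod (jac_c \<alpha> \<beta> l))\<^sup>2 <= (D * (l * (1 + l) powr (\<alpha> - 1/2)))\<^sup>2"
      by (rule power_mono[OF main[OF l]]) simp
    also have "... = D\<^sup>2 * (l\<^sup>2 * ((1 + l) powr (\<alpha> - 1/2) * (1 + l) powr (\<alpha> - 1/2)))"
      by (simp add: power_mult_distrib power2_eq_square)
    also have "(1 + l) powr (\<alpha> - 1/2) * (1 + l) powr (\<alpha> - 1/2) = (1 + l) powr (2*\<alpha> - 1)"
      by (subst powr_add[symmetric]) simp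
    finally show ?thesis by (simp add: wt_def power_divide)
  qed
  then show ?thesis using D by (intro exI[of _ "D\<^sup>2"]) auto
qed

lemma plancherel_density_measurable:
  "(\<lambda>l. 1 / (cmod (jac_c \<alpha> \<beta> l))\<^sup>2) \<in> borel_measurable (restrict_space borel {0<..})"
proof -
  have "continuous_on {0<..} (\<lambda>l. jac_c \<alpha> \<beta> l)"
  proof -
    have 1: "\<i> * complex_of_real l \<notin> \<int>\<^sub>\<le>\<^sub>0" "(\<i> * of_real l + of_real c) / 2 \<notin> \<int>\<^sub>\<le>\<^sub>0" if "l > 0" for l c
      using that by (auto elim!: nonpos_Ints_cases simp: complex_eq_iff)
    have 2: "Gamma ((\<i> * of_real l + of_real c) / 2) \<noteq> 0" if "l > 0" for l c
      using 1(2)[OF that, of c] by (simp add: Gamma_eq_zero_iff)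
    have 3: "continuous_on {0<..} (\<lambda>l. Gamma (g l))" if "continuous_on {0<..} g" "\<And>l. l > 0 ==> g l \<notin> \<int>\<^sub>\<le>\<^sub>0"
      for g :: "real => complex"
      by (rule continuous_on_compose2[OF continuous_on_Gamma[of "g ` {0<..}"] that(1)]) (use that in auto)
    show ?thesis unfolding jac_c_def
      by (intro continuous_on_divide continuous_on_mult 3 continuous_intros) (use 1 2 in \<open>auto simp del: of_real_add of_real_diff\<close>)
  qed
  then have "(\<lambda>l. jac_c \<alpha> \<beta> l) \<in> borel_measurable (restrict_space borel {0<..})"
    by (rule borel_measurable_continuous_on_restrict)
  then show ?thesis by measurable
qed

end

section \<open>The product formula\<close>

text \<open>The second-order part. When the Jacobi operator in x acts on F(T), the coefficient of
  F'' differs from the one in the equation of F by T_x^2 - 4T(1+T). This excess is the derivative of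
  T along a vector field in (u, \<theta>) with components 4(1-u^2) n and 8 k \<theta>(1-\<theta>);
  \<open>e\<close>, \<open>g\<close>, \<open>f\<close> are the coefficients for which this holds.
  Multiplication by s c clears all denominators.\<close>

lemma stein_field_identity_1:
  fixes s c S C u th :: real
  assumes "s \<noteq> 0" "c \<noteq> 0" and cs: "c^2 = 1 + s^2" and CS: "C^2 = 1 + S^2"
  defines "p \<equiv> c * C" and "r \<equiv> s * S" and "p1 \<equiv> s * C" and "r1 \<equiv> c * S"
  defines "T \<equiv> (p+u * r)^2+(1-u^2) * th * r^2-1"
  defines "Tx \<equiv> 2 * (p+u * r) * (p1+u * r1)+2 * (1-u^2) * th * (r * r1)"
  defines "Tu \<equiv> 2 * (p+u * r) * r-2 * u * th * r^2" and "Tt \<equiv> (1-u^2) * r^2"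
  defines "e \<equiv> -(c * S * C)/(2 * s)" and "g \<equiv> - (S^2)/2" and "f \<equiv> -(S * C)/(2 * s * c)"
  defines "n \<equiv> (1-th) * (e+g * u)+f * th" and "k \<equiv> g+u * (e-f)"
  shows "Tx^2-4 * T * (1+T) = 4 * ((1-u^2) * n * Tu+2 * k * th * (1-th) * Tt)"
proof -
  have e: "2 * s * e = -(c * S * C)" and g: "2 * g = - (S^2)" and f: "2 * s * c * f = -(S * C)"
    using assms(1,2) by (simp_all add: e_def g_def f_def)
  have "s * c * (Tx^2-4 * T * (1+T)) = s * c * (4 * ((1-u^2) * n * Tu+2 * k * th * (1-th) * Tt))"
    unfolding Tx_def T_def Tu_def Tt_def n_def k_def p_def r_def p1_def r1_def
    using e g f cs CS by algebra
  then show ?thesis using assms(1,2) by simp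
qed

text \<open>The first-order part: the excess in the coefficient of F' is the weighted divergence of
  the same vector field with respect to the densities (1-u^2)^(\<alpha>-1/2) and
  \<theta>^(\<beta>-1/2) (1-\<theta>)^(\<alpha>-\<beta>-1). The two identities together make the
  whole excess a divergence, which integrates to 0.\<close>

lemma stein_field_identity_2:
  fixes s c S C u th al be :: real
  assumes "s \<noteq> 0" "c \<noteq> 0" and cs: "c^2 = 1 + s^2" and CS: "C^2 = 1 + S^2"
  defines "p \<equiv> c * C" and "r \<equiv> s * S" and "p1 \<equiv> s * C" and "r1 \<equiv> c * S"
  defines "T \<equiv> (p+u * r)^2+(1-u^2) * th * r^2-1"
  defines "Tx \<equiv> 2 * (p+u * r) * (p1+u * r1)+2 * (1-u^2) * th * (r * r1)"
  defines "Txx \<equiv> 2 * (p1+u * r1)^2+2 * (p+u * r)^2+2 * (1-u^2) * th * (r1^2+r^2)"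
  defines "e \<equiv> -(c * S * C)/(2 * s)" and "g \<equiv> - (S^2)/2" and "f \<equiv> -(S * C)/(2 * s * c)"
  defines "n \<equiv> (1-th) * (e+g * u)+f * th" and "k \<equiv> g+u * (e-f)"
  shows "Txx+2 * ((al+1/2) * c/s+(be+1/2) * s/c) * Tx-4 * ((al+1)+(al+be+2) * T)
    = 4 * ((1-u^2) * ((1-th) * g) - (2 * al+1) * u * n + 2 * k * ((be+1/2)-(al+1/2) * th))"
proof -
  have e: "2 * s * e = -(c * S * C)" and g: "2 * g = - (S^2)" and f: "2 * s * c * f = -(S * C)"
    using assms(1,2) by (simp_all add: e_def g_def f_def)
  define h where "h = 2 * ((al+1/2) * c/s+(be+1/2) * s/c)"
  have h: "s * c * h = (2 * al+1) * c^2+(2 * be+1) * s^2" using assms(1,2) by (simp add: h_def field_simps power2_eq_square)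
  have e2: "4 * ((1-u^2) * ((1-th) * g) - (2 * al+1) * u * n + 2 * k * ((be+1/2)-(al+1/2) * th))
    = 4 * (1-u^2) * ((1-th) * g) - 4 * (2 * al+1) * u * n + 4 * k * ((2 * be+1)-(2 * al+1) * th)" by (simp add: algebra_simps)
  have "s * c * (Txx+h * Tx-4 * ((al+1)+(al+be+2) * T)) = s * c * (4 * (1-u^2) * ((1-th) * g) - 4 * (2 * al+1) * u * n + 4 * k * ((2 * be+1)-(2 * al+1) * th))"
    unfolding Tx_def Txx_def T_def n_def k_def p_def r_def p1_def r1_def
    using e g f cs CS h by algebra
  then show ?thesis unfolding e2 h_def[symmetric] using assms(1,2) by simp
qed

section \<open>The third side of a generalized hyperbolic triangle as a function of two random
  variables\<close>

lemma beta_measurableI: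
  fixes f :: "real => 'a::topological_space"
  shows "continuous_on UNIV f ==> f \<in> borel_measurable (beta_measure a b)"
  using borel_measurable_continuous_onI[of f] by (simp add: measurable_cong_sets[OF sets_beta_measure refl])

text \<open>The Beta laws live on [0, 1], so clamping alters nothing almost surely, while functions
  of the clamped variables are bounded and defined everywhere.\<close>

definition clamp01 :: "real => real" where "clamp01 t = max 0 (min 1 t)"

lemma clamp01: "0 <= clamp01 t" "clamp01 t <= 1" by (auto simp: clamp01_def)

lemma clamp01_id: "0 <= t ==> t <= 1 ==> clamp01 t = t" by (auto simp: clamp01_def)

lemma clamp01_cont [continuous_intros]: "continuous_on S f ==> continuous_on S (\<lambda>x. clamp01 (f x))"
  unfolding clamp01_def by (intro continuous_intros)

text \<open>Koornwinder's product formula in other coordinates: 1 + T is the squared modulus of cosh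
  x cosh y + \<zeta> sinh x sinh y, where \<zeta> = u + i sqrt((1-u^2)\<theta>) runs through the
  closed upper half of the unit disc. In (u, \<theta>) the measure on the disc becomes a
  product.\<close>

definition Tq :: "real => real => real => real => real" where
  "Tq x y u \<theta> = (cosh x * cosh y + u * (sinh x * sinh y))\<^sup>2 + (1 - u\<^sup>2) * \<theta> * (sinh x * sinh y)\<^sup>2 - 1"

definition TT :: "real => real => real \<times> real => real" where
  "TT x y w = Tq x y (2 * clamp01 (fst w) - 1) (clamp01 (snd w))"

definition tt :: "real => real => real \<times> real => real" where
  "tt x y w = arsinh (sqrt (TT x y w))"

lemma u_range: "2 * clamp01 t - 1 >= -1" "2 * clamp01 t - 1 <= 1" "(2 * clamp01 t - 1)\<^sup>2 <= 1"
  using clamp01[of t] by (auto simp: abs_square_le_1 abs_le_iff)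

lemma abs_le_imp_sq_le: "-1 <= u ==> u <= 1 ==> u\<^sup>2 <= (1::real)"
  by (simp add: abs_square_le_1 abs_le_iff)

text \<open>The number \<zeta> has modulus at most 1 and sinh x sinh y is at most cosh x cosh y, so
  the modulus lies between cosh(x-y) and cosh(x+y).\<close>

lemma Tq_bounds:
  assumes u: "-1 <= u" "u <= 1" and \<theta>: "0 <= \<theta>" "\<theta> <= 1" and xy: "0 <= x" "0 <= y"
  shows "(sinh (x - y))\<^sup>2 <= Tq x y u \<theta>" "Tq x y u \<theta> <= (sinh (x + y))\<^sup>2"
proof -
  let ?p = "cosh x * cosh y" and ?r = "sinh x * sinh y"
  have u2: "u\<^sup>2 <= 1" by (rule abs_le_imp_sq_le[OF u])
  have r0: "?r >= 0" using xy by simp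
  have pr: "?r <= ?p" using xy sinh_less_cosh_real[of x] sinh_less_cosh_real[of y]
    by (intro mult_mono) auto
  have a: "cosh (x - y) = ?p - ?r" "cosh (x + y) = ?p + ?r" by (simp_all add: cosh_diff cosh_add)
  have "(?p - ?r)\<^sup>2 <= (?p + u * ?r)\<^sup>2"
  proof (rule power_mono)
    have "- 1 * ?r <= u * ?r" using u r0 by (intro mult_right_mono) auto
    then show "?p - ?r <= ?p + u * ?r" by simp
  qed (use pr in auto)
  also have "... <= (?p + u * ?r)\<^sup>2 + (1 - u\<^sup>2) * \<theta> * ?r\<^sup>2" using u2 \<theta> by simp
  finally have "(cosh (x - y))\<^sup>2 - 1 <= Tq x y u \<theta>" unfolding a Tq_def by simp
  then show "(sinh (x - y))\<^sup>2 <= Tq x y u \<theta>" by (simp add: cosh_square_eq)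
  have "(1 - u\<^sup>2) * \<theta> * ?r\<^sup>2 <= (1 - u\<^sup>2) * 1 * ?r\<^sup>2"
    using u2 \<theta> by (intro mult_right_mono mult_left_mono) auto
  moreover have "(?p + u * ?r)\<^sup>2 = ?p\<^sup>2 + 2 * u * (?p * ?r) + u\<^sup>2 * ?r\<^sup>2" by (simp add: power2_eq_square algebra_simps)
  moreover have "2 * u * (?p * ?r) <= 2 * 1 * (?p * ?r)" using u r0 by (intro mult_right_mono mult_left_mono) auto
  moreover have "X + Y - 1 <= a + 2 * b + c - 1"
    if "Y <= (1 - v) * 1 * c" "X = a + 2 * u * b + v * c" "2 * u * b <= 2 * 1 * b" for X Y a b c v :: real
    using that by (simp add: algebra_simps)
  ultimately have "Tq x y u \<theta> <= ?p\<^sup>2 + 2 * (?p * ?r) + ?r\<^sup>2 - 1" unfolding Tq_def by blast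
  also have "... = (cosh (x + y))\<^sup>2 - 1" unfolding a by (simp add: power2_eq_square algebra_simps)
  finally show "Tq x y u \<theta> <= (sinh (x + y))\<^sup>2" by (simp add: cosh_square_eq)
qed

lemma Tq_neg: "Tq (- x) y u \<theta> = Tq x y (- u) \<theta>" "Tq x (- y) u \<theta> = Tq x y (- u) \<theta>"
  by (simp_all add: Tq_def)

text \<open>Negative x matters because the expectation is differentiated on a full neighbourhood of
  x = 0. A change of sign of x or y is absorbed by a change of sign of u.\<close>

lemma Tq_nonneg:
  assumes u: "-1 <= u" "u <= 1" and \<theta>: "0 <= \<theta>" "\<theta> <= 1"
  shows "Tq x y u \<theta> >= 0"
proof -
  have *: "Tq x y u \<theta> >= 0" if "-1 <= u" "u <= 1" "0 <= x" "0 <= y" for x y u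
    using Tq_bounds(1)[OF that(1,2) \<theta> that(3,4)] zero_le_power2[of "sinh (x - y)"] by linarith
  show ?thesis
    using *[of u x y] *[of "-u" "-x" y] *[of "-u" x "-y"] *[of u "-x" "-y"] u
    by (cases "x >= 0"; cases "y >= 0") (auto simp: Tq_neg)
qed

lemma TT_nonneg: "TT x y w >= 0"
  unfolding TT_def by (intro Tq_nonneg u_range clamp01)

lemma TT_cont: "continuous_on UNIV (TT x y)"
  unfolding TT_def[abs_def] Tq_def by (intro continuous_intros)

lemma tt_cont: "continuous_on UNIV (tt x y)"
  unfolding tt_def[abs_def]
  by (rule continuous_on_compose2[OF continuous_on_arsinh[of UNIV]]) (auto intro!: continuous_intros TT_cont)

lemma sinh_tt: "(sinh (tt x y w))\<^sup>2 = TT x y w"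
  using TT_nonneg by (simp add: tt_def)

lemma tt_bounds: assumes "0 <= x" "0 <= y" shows "\<bar>x - y\<bar> <= tt x y w" "tt x y w <= x + y"
proof -
  have T: "(sinh (x - y))\<^sup>2 <= TT x y w" "TT x y w <= (sinh (x + y))\<^sup>2"
    unfolding TT_def by (intro Tq_bounds u_range clamp01 assms)+
  have "sinh (tt x y w) >= 0" using TT_nonneg by (simp add: tt_def)
  then have t0: "tt x y w >= 0" by simp
  have "\<bar>sinh (x - y)\<bar> <= \<bar>sinh (tt x y w)\<bar>" using T(1) unfolding sinh_tt[symmetric] by (simp add: abs_le_square_iff)
  moreover have "sinh \<bar>z\<bar> = \<bar>sinh z\<bar>" for z :: real by (auto simp: abs_if)
  ultimately have "sinh \<bar>x - y\<bar> <= sinh (tt x y w)" using t0 by simp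
  then show "\<bar>x - y\<bar> <= tt x y w" by (simp only: sinh_real_le_iff)
  have "\<bar>sinh (tt x y w)\<bar> <= \<bar>sinh (x + y)\<bar>" using T(2) unfolding sinh_tt[symmetric] by (simp add: abs_le_square_iff)
  then show "tt x y w <= x + y" using t0 assms by simp
qed

definition Tx :: "real => real => real => real => real" where
  "Tx x y u \<theta> = 2 * (cosh x * cosh y + u * (sinh x * sinh y)) * (sinh x * cosh y + u * (cosh x * sinh y))
     + 2 * (1 - u\<^sup>2) * \<theta> * (sinh x * sinh y * (cosh x * sinh y))"

definition Txx :: "real => real => real => real => real" where
  "Txx x y u \<theta> = 2 * (sinh x * cosh y + u * (cosh x * sinh y))\<^sup>2 + 2 * (cosh x * cosh y + u * (sinh x * sinh y))\<^sup>2
     + 2 * (1 - u\<^sup>2) * \<theta> * ((cosh x * sinh y)\<^sup>2 + (sinh x * sinh y)\<^sup>2)"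

definition Tu :: "real => real => real => real => real" where
  "Tu x y u \<theta> = 2 * (cosh x * cosh y + u * (sinh x * sinh y)) * (sinh x * sinh y) - 2 * u * \<theta> * (sinh x * sinh y)\<^sup>2"

lemma Tq_deriv_x: "((\<lambda>x. Tq x y u \<theta>) has_real_derivative Tx x y u \<theta>) (at x)"
  unfolding Tq_def Tx_def by (auto intro!: derivative_eq_intros simp: power2_eq_square algebra_simps)

lemma Tx_deriv_x: "((\<lambda>x. Tx x y u \<theta>) has_real_derivative Txx x y u \<theta>) (at x)"
  unfolding Tx_def Txx_def by (auto intro!: derivative_eq_intros simp: power2_eq_square algebra_simps)

lemma Tq_deriv_u: "((\<lambda>u. Tq x y u \<theta>) has_real_derivative Tu x y u \<theta>) (at u)"
  unfolding Tq_def Tu_def by (auto intro!: derivative_eq_intros simp: power2_eq_square algebra_simps)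

lemma Tq_deriv_\<theta>: "((\<lambda>\<theta>. Tq x y u \<theta>) has_real_derivative (1 - u\<^sup>2) * (sinh x * sinh y)\<^sup>2) (at \<theta>)"
  unfolding Tq_def by (auto intro!: derivative_eq_intros)

lemma has_vector_derivative_comp_real:
  assumes "(g has_real_derivative g') (at x)" "(F has_vector_derivative F') (at (g x))"
  shows "((\<lambda>x. F (g x)) has_vector_derivative of_real g' * (F' :: complex)) (at x)"
  using vector_diff_chain_at[OF assms(1)[unfolded has_real_derivative_iff_has_vector_derivative] assms(2)]
  by (simp add: o_def scaleR_conv_of_real)

lemma continuous_on_comp_nonneg:
  assumes "continuous_on {-1/2<..} (\<Phi> :: real => complex)" "continuous_on S g" "\<And>z. z \<in> S ==> g z >= 0"
  shows "continuous_on S (\<lambda>z. \<Phi> (g z))"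
  by (rule continuous_on_compose2[OF assms(1,2)]) (use assms(3) in force)

text \<open>Compactness supplies the uniform bound that differentiation under the integral requires,
  for all outcomes at once.\<close>

lemma bounded_on_clamped:
  fixes f :: "real => real => real => complex"
  assumes "continuous_on ({a..b} \<times> {-1..1} \<times> {0..1}) (\<lambda>z. f (fst z) (fst (snd z)) (snd (snd z)))"
  shows "\<exists>B. \<forall>x\<in>{a..b}. \<forall>w. norm (f x (2 * clamp01 (fst w) - 1) (clamp01 (snd w))) <= B"
proof -
  have "compact ((\<lambda>z. f (fst z) (fst (snd z)) (snd (snd z))) ` ({a..b} \<times> {-1..1} \<times> {0..1}))"
    by (intro compact_continuous_image assms compact_Times compact_Icc)
  then obtain B where "\<And>z. z \<in> {a..b} \<times> {-1..1} \<times> {0..1} ==> norm (f (fst z) (fst (snd z)) (snd (snd z))) <= B"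
    by (meson bounded_iff compact_imp_bounded image_eqI)
  then have "norm (f x (2 * clamp01 (fst w) - 1) (clamp01 (snd w))) <= B" if "x \<in> {a..b}" for x w
    using u_range[of "fst w"] clamp01[of "snd w"] that
    by (metis (no_types, lifting) SigmaI atLeastAtMost_iff fst_conv snd_conv)
  then show ?thesis by blast
qed

section \<open>The joint law of the two variables and the product formula\<close>

context jacobi begin

text \<open>With u = 2t - 1 and without degeneration, the law of \<zeta> = u + iv in the upper half
  disc has density proportional to v^(2\<beta>) (1 - |\<zeta>|^2)^(\<alpha>-\<beta>-1). For \<beta>
  = -1/2 it sits on \<theta> = 0, for \<alpha> = \<beta> on \<theta> = 1.\<close>

definition \<Omega> :: "(real \<times> real) measure" where
  "\<Omega> = beta_measure (\<alpha> + 1/2) (\<alpha> + 1/2) \<Otimes>\<^sub>M beta_measure (\<beta> + 1/2) (\<alpha> - \<beta>)"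

lemma beta1: "prob_space (beta_measure (\<alpha> + 1/2) (\<alpha> + 1/2))" using \<alpha>_gt by (intro prob_space_beta_measure) auto
lemma beta2: "prob_space (beta_measure (\<beta> + 1/2) (\<alpha> - \<beta>))" using \<alpha>\<beta> \<beta>_ge by (intro prob_space_beta_measure) auto

lemma sets_\<Omega> [measurable_cong, simp]: "sets \<Omega> = sets borel"
  unfolding \<Omega>_def borel_prod[symmetric] by (intro sets_pair_measure_cong) auto

lemma space_\<Omega> [simp]: "space \<Omega> = UNIV" using sets_eq_imp_space_eq[OF sets_\<Omega>] by simp

lemma prob_\<Omega>: "prob_space \<Omega>"
proof -
  interpret B1: prob_space "beta_measure (\<alpha> + 1/2) (\<alpha> + 1/2)" by (rule beta1)
  interpret B2: prob_space "beta_measure (\<beta> + 1/2) (\<alpha> - \<beta>)" by (rule beta2)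
  interpret pair_prob_space "beta_measure (\<alpha> + 1/2) (\<alpha> + 1/2)" "beta_measure (\<beta> + 1/2) (\<alpha> - \<beta>)" ..
  show ?thesis unfolding \<Omega>_def by unfold_locales
qed

lemma measurable_TT [measurable]: "TT x y \<in> borel_measurable borel"
  by (rule borel_measurable_continuous_onI[OF TT_cont])

lemma measurable_tt [measurable]: "tt x y \<in> borel_measurable borel"
  by (rule borel_measurable_continuous_onI[OF tt_cont])

lemma integrable_clamped:
  fixes f :: "real => real => complex"
  assumes "continuous_on UNIV (\<lambda>w. f (2 * clamp01 (fst w) - 1) (clamp01 (snd w)))"
  shows "integrable \<Omega> (\<lambda>w. f (2 * clamp01 (fst w) - 1) (clamp01 (snd w)))"
proof -
  interpret prob_space \<Omega> by (rule prob_\<Omega>)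
  let ?g = "\<lambda>w :: real \<times> real. f (2 * clamp01 (fst w) - 1) (clamp01 (snd w))"
  have "compact (?g ` ({0..1} \<times> {0..1}))"
    by (intro compact_continuous_image continuous_on_subset[OF assms] compact_Times compact_Icc) auto
  then obtain B where B: "\<And>w. w \<in> {0..1} \<times> {0..1} ==> norm (?g w) <= B"
    by (meson bounded_iff compact_imp_bounded image_eqI)
  have "norm (?g w) <= B" for w
    using B[of "(clamp01 (fst w), clamp01 (snd w))"] clamp01[of "fst w"] clamp01[of "snd w"]
    by (simp add: clamp01_id)
  then show ?thesis
    by (intro integrable_const_bound[of _ B] AE_I2)
       (auto simp: measurable_cong_sets[OF sets_\<Omega> refl] intro!: borel_measurable_continuous_onI assms)
qed

lemma integral_\<Omega>_fst:
  fixes f :: "real \<times> real => complex"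
  assumes f: "integrable \<Omega> f" and z: "\<And>\<theta>. (\<integral>t. f (t, \<theta>) \<partial>beta_measure (\<alpha> + 1/2) (\<alpha> + 1/2)) = 0"
  shows "(\<integral>w. f w \<partial>\<Omega>) = 0"
proof -
  interpret B1: prob_space "beta_measure (\<alpha> + 1/2) (\<alpha> + 1/2)" by (rule beta1)
  interpret B2: prob_space "beta_measure (\<beta> + 1/2) (\<alpha> - \<beta>)" by (rule beta2)
  interpret pair_prob_space "beta_measure (\<alpha> + 1/2) (\<alpha> + 1/2)" "beta_measure (\<beta> + 1/2) (\<alpha> - \<beta>)" ..
  show ?thesis using integral_snd[of "\<lambda>t \<theta>. f (t, \<theta>)"] f z unfolding \<Omega>_def by simp
qed

lemma integral_\<Omega>_snd:
  fixes f :: "real \<times> real => complex"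
  assumes f: "integrable \<Omega> f" and z: "\<And>t. (\<integral>\<theta>. f (t, \<theta>) \<partial>beta_measure (\<beta> + 1/2) (\<alpha> - \<beta>)) = 0"
  shows "(\<integral>w. f w \<partial>\<Omega>) = 0"
proof -
  interpret B1: prob_space "beta_measure (\<alpha> + 1/2) (\<alpha> + 1/2)" by (rule beta1)
  interpret B2: prob_space "beta_measure (\<beta> + 1/2) (\<alpha> - \<beta>)" by (rule beta2)
  interpret pair_prob_space "beta_measure (\<alpha> + 1/2) (\<alpha> + 1/2)" "beta_measure (\<beta> + 1/2) (\<alpha> - \<beta>)" ..
  show ?thesis using integral_fst'[of f] f z unfolding \<Omega>_def by simp
qed

text \<open>The two Stein identities, applied along a vector field in the variables (u, \<theta>), turn the
  action of the Jacobi operator in x on F(T) into its action inside the expectation.\<close>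

lemma expectation_ode:
  fixes F1 F2 :: "real => complex"
  assumes F1: "\<And>T. T > -1/2 ==> (F1 has_vector_derivative F2 T) (at T)"
    and F2: "continuous_on {-1/2<..} F2" and x: "x > 0"
  defines "U \<equiv> (\<lambda>w::real \<times> real. 2 * clamp01 (fst w) - 1)" and "V \<equiv> (\<lambda>w::real \<times> real. clamp01 (snd w))"
  shows "(\<integral>w. of_real ((Tx x y (U w) (V w))\<^sup>2 - 4 * (TT x y w * (1 + TT x y w))) * F2 (TT x y w)
       + of_real (Txx x y (U w) (V w) + 2 * hA x * Tx x y (U w) (V w)
           - 4 * ((\<alpha> + 1) + (\<alpha> + \<beta> + 2) * TT x y w)) * F1 (TT x y w) \<partial>\<Omega>) = 0"
proof -
  have F1c: "continuous_on {-1/2<..} F1"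
    by (intro continuous_at_imp_continuous_on ballI has_vector_derivative_continuous[OF F1]) auto
  define e g f where "e = - (cosh x * sinh y * cosh y) / (2 * sinh x)" and "g = - ((sinh y)\<^sup>2) / 2"
    and "f = - (sinh y * cosh y) / (2 * sinh x * cosh x)"
  define n where "n = (\<lambda>u \<theta>. (1 - \<theta>) * (e + g * u) + f * \<theta>)"
  define k where "k = (\<lambda>u. g + u * (e - f))"
  \<comment> \<open>\<open>P\<close> and \<open>Q\<close> are the Stein integrands of the vector
    field in the directions u and \<theta>; the excess in the Jacobi operator is 4 (P + Q), and the
    two integrals vanish separately.\<close>
  define P where "P = (\<lambda>u \<theta>. of_real ((1 - u\<^sup>2) * n u \<theta> * Tu x y u \<theta>) * F2 (Tq x y u \<theta>)
      + of_real ((1 - u\<^sup>2) * ((1 - \<theta>) * g) - (2 * \<alpha> + 1) * u * n u \<theta>) * F1 (Tq x y u \<theta>))"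
  define Q where "Q = (\<lambda>u \<theta>. of_real (2 * k u * \<theta> * (1 - \<theta>) * ((1 - u\<^sup>2) * (sinh x * sinh y)\<^sup>2)) * F2 (Tq x y u \<theta>)
      + of_real (2 * k u * ((\<beta> + 1/2) - (\<alpha> + 1/2) * \<theta>)) * F1 (Tq x y u \<theta>))"
  have s: "sinh x \<noteq> 0" "cosh x \<noteq> 0" "(cosh x)\<^sup>2 = 1 + (sinh x)\<^sup>2" "(cosh y)\<^sup>2 = 1 + (sinh y)\<^sup>2"
    using x by (auto simp: cosh_square_eq)
  have I1: "(Tx x y u \<theta>)\<^sup>2 - 4 * (Tq x y u \<theta> * (1 + Tq x y u \<theta>))
      = 4 * ((1 - u\<^sup>2) * n u \<theta> * Tu x y u \<theta> + 2 * k u * \<theta> * (1 - \<theta>) * ((1 - u\<^sup>2) * (sinh x * sinh y)\<^sup>2))" for u \<theta>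
    using stein_field_identity_1[OF s, of u \<theta>]
    unfolding Tx_def Tq_def Tu_def n_def k_def e_def g_def f_def by (simp only: mult.assoc)
  have I2: "Txx x y u \<theta> + 2 * hA x * Tx x y u \<theta> - 4 * ((\<alpha> + 1) + (\<alpha> + \<beta> + 2) * Tq x y u \<theta>)
      = 4 * ((1 - u\<^sup>2) * ((1 - \<theta>) * g) - (2 * \<alpha> + 1) * u * n u \<theta> + 2 * k u * ((\<beta> + 1/2) - (\<alpha> + 1/2) * \<theta>))" for u \<theta>
    using stein_field_identity_2[OF s, of u \<theta> \<alpha> \<beta>]
    unfolding Tx_def Txx_def Tq_def n_def k_def e_def g_def f_def hA_def by (simp only: mult.assoc)
  have eq: "of_real ((Tx x y (U w) (V w))\<^sup>2 - 4 * (TT x y w * (1 + TT x y w))) * F2 (TT x y w)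
       + of_real (Txx x y (U w) (V w) + 2 * hA x * Tx x y (U w) (V w)
           - 4 * ((\<alpha> + 1) + (\<alpha> + \<beta> + 2) * TT x y w)) * F1 (TT x y w)
     = 4 * (P (U w) (V w) + Q (U w) (V w))" for w
  proof -
    have "TT x y w = Tq x y (U w) (V w)" by (simp add: TT_def U_def V_def)
    then show ?thesis unfolding P_def Q_def by (simp only: I1 I2) (simp add: algebra_simps)
  qed
  have UVc: "continuous_on S U" "continuous_on S V" for S unfolding U_def V_def by (intro continuous_intros)+
  have T0: "Tq x y (U w) (V w) >= 0" for w unfolding U_def V_def by (intro Tq_nonneg u_range clamp01)
  have Tc: "continuous_on S (\<lambda>w. Tq x y (U w) (V w))" for S unfolding Tq_def by (intro continuous_intros UVc)
  have Tuc: "continuous_on S (\<lambda>w. Tu x y (U w) (V w))" for S unfolding Tu_def by (intro continuous_intros UVc)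
  have F1T: "continuous_on S (\<lambda>w. F1 (Tq x y (U w) (V w)))" for S by (rule continuous_on_comp_nonneg[OF F1c Tc T0])
  have F2T: "continuous_on S (\<lambda>w. F2 (Tq x y (U w) (V w)))" for S by (rule continuous_on_comp_nonneg[OF F2 Tc T0])
  have nc: "continuous_on S (\<lambda>w. n (U w) (V w))" "continuous_on S (\<lambda>w. k (U w))" for S
    unfolding n_def k_def by (intro continuous_intros UVc)+
  have Pc: "continuous_on UNIV (\<lambda>w. P (U w) (V w))" and Qc: "continuous_on UNIV (\<lambda>w. Q (U w) (V w))"
    unfolding P_def Q_def by (intro continuous_intros UVc nc Tuc F1T F2T)+
  have Pi: "integrable \<Omega> (\<lambda>w. P (U w) (V w))" and Qi: "integrable \<Omega> (\<lambda>w. Q (U w) (V w))"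
    using integrable_clamped[of P] integrable_clamped[of Q] Pc Qc unfolding U_def V_def by auto
  have slice1: "continuous_on UNIV (\<lambda>t. h (t, \<theta>))" if "continuous_on UNIV (h :: real \<times> real => complex)" for h \<theta>
    by (rule continuous_on_compose2[OF that]) (auto intro!: continuous_intros)
  have slice2: "continuous_on UNIV (\<lambda>\<theta>. h (t, \<theta>))" if "continuous_on UNIV (h :: real \<times> real => complex)" for h t
    by (rule continuous_on_compose2[OF that]) (auto intro!: continuous_intros)
  have P0: "(\<integral>w. P (U w) (V w) \<partial>\<Omega>) = 0"
  proof (rule integral_\<Omega>_fst[OF Pi])
    fix \<theta>
    define v where "v = clamp01 \<theta>"
    have v: "0 <= v" "v <= 1" unfolding v_def by (rule clamp01)+
    let ?h = "\<lambda>w. of_real (n (U w) (V w)) * F1 (Tq x y (U w) (V w))"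
    let ?h' = "\<lambda>w. 2 * (of_real ((1 - V w) * g) * F1 (Tq x y (U w) (V w)) + of_real (n (U w) (V w) * Tu x y (U w) (V w)) * F2 (Tq x y (U w) (V w)))"
    have "(\<integral>t. of_real (t * (1 - t)) * ?h' (t, \<theta>) + of_real ((\<alpha> + 1/2) - ((\<alpha> + 1/2) + (\<alpha> + 1/2)) * t) * ?h (t, \<theta>)
        \<partial>beta_measure (\<alpha> + 1/2) (\<alpha> + 1/2)) = 0"
    proof (rule beta_stein)
      show "continuous_on UNIV (\<lambda>t. ?h (t, \<theta>))"
        by (rule slice1[of ?h]) (intro continuous_intros nc F1T)
      show "continuous_on UNIV (\<lambda>t. ?h' (t, \<theta>))"
        by (rule slice1[of ?h']) (intro continuous_intros nc F1T F2T UVc Tuc)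
      fix t :: real assume t: "0 < t" "t < 1"
      let ?u = "2 * t - 1"
      have T: "Tq x y ?u v > -1/2" using Tq_nonneg[of ?u v x y] t v by simp
      have d1: "((\<lambda>t. Tq x y (2 * t - 1) v) has_real_derivative Tu x y ?u v * 2) (at t)"
        by (rule DERIV_chain2[OF Tq_deriv_u]) (auto intro!: derivative_eq_intros)
      have d2: "((\<lambda>t. F1 (Tq x y (2 * t - 1) v)) has_vector_derivative of_real (Tu x y ?u v * 2) * F2 (Tq x y ?u v)) (at t)"
        by (rule has_vector_derivative_comp_real[OF d1 F1[OF T]])
      have d3: "((\<lambda>t. n (2 * t - 1) v) has_real_derivative (1 - v) * g * 2) (at t)"
        unfolding n_def by (auto intro!: derivative_eq_intros)
      have "((\<lambda>t. n (2 * t - 1) v *\<^sub>R F1 (Tq x y (2 * t - 1) v)) has_vector_derivative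
         n ?u v *\<^sub>R (of_real (Tu x y ?u v * 2) * F2 (Tq x y ?u v)) + ((1 - v) * g * 2) *\<^sub>R F1 (Tq x y ?u v)) (at t)"
        by (rule has_vector_derivative_scaleR[OF d3 d2])
      moreover have "n ?u v *\<^sub>R (of_real (Tu x y ?u v * 2) * F2 (Tq x y ?u v)) + ((1 - v) * g * 2) *\<^sub>R F1 (Tq x y ?u v)
         = ?h' (t, \<theta>)"
        using t by (simp add: U_def V_def v_def[symmetric] clamp01_id scaleR_conv_of_real algebra_simps)
      ultimately have "((\<lambda>t. n (2 * t - 1) v *\<^sub>R F1 (Tq x y (2 * t - 1) v)) has_vector_derivative ?h' (t, \<theta>)) (at t)"
        by simp
      then show "((\<lambda>t. ?h (t, \<theta>)) has_vector_derivative ?h' (t, \<theta>)) (at t)"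
        by (rule has_vector_derivative_transform_within_open[where S="{0<..<1}"])
           (use t in \<open>auto simp: U_def V_def v_def[symmetric] clamp01_id scaleR_conv_of_real\<close>)
    qed (use \<alpha>_gt in auto)
    \<comment> \<open>The factor 2 accounts for u = 2t - 1: here 4t(1-t) = 1 - u^2, and the linear
      Beta term becomes -(2\<alpha>+1) u. Clamping is the identity almost surely.\<close>
    moreover have ae: "AE t in beta_measure (\<alpha> + 1/2) (\<alpha> + 1/2).
        2 * (of_real (t * (1 - t)) * ?h' (t, \<theta>) + of_real ((\<alpha> + 1/2) - ((\<alpha> + 1/2) + (\<alpha> + 1/2)) * t) * ?h (t, \<theta>)) = P (U (t, \<theta>)) (V (t, \<theta>))"
      using beta_AE
    proof eventually_elim
      fix t :: real assume t: "0 <= t \<and> t <= 1"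
      then have U: "U (t, \<theta>) = 2 * t - 1" by (simp add: U_def clamp01_id)
      show "2 * (of_real (t * (1 - t)) * ?h' (t, \<theta>) + of_real ((\<alpha> + 1/2) - ((\<alpha> + 1/2) + (\<alpha> + 1/2)) * t) * ?h (t, \<theta>)) = P (U (t, \<theta>)) (V (t, \<theta>))"
        unfolding P_def U by (simp add: algebra_simps power2_eq_square)
    qed
    then have "(\<integral>t. P (U (t, \<theta>)) (V (t, \<theta>)) \<partial>beta_measure (\<alpha> + 1/2) (\<alpha> + 1/2))
       = (\<integral>t. 2 * (of_real (t * (1 - t)) * ?h' (t, \<theta>) + of_real ((\<alpha> + 1/2) - ((\<alpha> + 1/2) + (\<alpha> + 1/2)) * t) * ?h (t, \<theta>)) \<partial>beta_measure (\<alpha> + 1/2) (\<alpha> + 1/2))"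
    proof -
      define H H' where "H = (\<lambda>t. ?h (t, \<theta>))" and "H' = (\<lambda>t. ?h' (t, \<theta>))"
      have Hc: "continuous_on UNIV H" unfolding H_def by (rule slice1[of ?h]) (intro continuous_intros nc F1T)
      have H'c: "continuous_on UNIV H'" unfolding H'_def by (rule slice1[of ?h']) (intro continuous_intros nc F1T F2T UVc Tuc)
      have m1: "(\<lambda>t. P (U (t, \<theta>)) (V (t, \<theta>))) \<in> borel_measurable (beta_measure (\<alpha> + 1/2) (\<alpha> + 1/2))"
        by (rule beta_measurableI[OF slice1[of "\<lambda>w. P (U w) (V w)", OF Pc]])
      have m2: "(\<lambda>t. 2 * (of_real (t * (1 - t)) * H' t + of_real ((\<alpha> + 1/2) - ((\<alpha> + 1/2) + (\<alpha> + 1/2)) * t) * H t)) \<in> borel_measurable (beta_measure (\<alpha> + 1/2) (\<alpha> + 1/2))"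
        by (intro beta_measurableI continuous_intros Hc H'c)
      show ?thesis
        by (rule integral_cong_AE[OF m1 m2[unfolded H_def H'_def]]) (use ae in \<open>eventually_elim, simp only:\<close>)
    qed
    ultimately show "(\<integral>t. P (U (t, \<theta>)) (V (t, \<theta>)) \<partial>beta_measure (\<alpha> + 1/2) (\<alpha> + 1/2)) = 0"
      by (simp only: integral_mult_right_zero mult_zero_right)
  qed
  have Q0: "(\<integral>w. Q (U w) (V w) \<partial>\<Omega>) = 0"
  proof (rule integral_\<Omega>_snd[OF Qi])
    fix t
    define u where "u = 2 * clamp01 t - 1"
    have u: "-1 <= u" "u <= 1" unfolding u_def by (rule u_range)+
    let ?h = "\<lambda>w. of_real (2 * k (U w)) * F1 (Tq x y (U w) (V w))"
    let ?h' = "\<lambda>w. of_real (2 * k (U w) * ((1 - (U w)\<^sup>2) * (sinh x * sinh y)\<^sup>2)) * F2 (Tq x y (U w) (V w))"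
    have "(\<integral>\<theta>. of_real (\<theta> * (1 - \<theta>)) * ?h' (t, \<theta>) + of_real ((\<beta> + 1/2) - ((\<beta> + 1/2) + (\<alpha> - \<beta>)) * \<theta>) * ?h (t, \<theta>)
        \<partial>beta_measure (\<beta> + 1/2) (\<alpha> - \<beta>)) = 0"
    proof (rule beta_stein)
      show "continuous_on UNIV (\<lambda>\<theta>. ?h (t, \<theta>))"
        by (rule slice2[of ?h]) (intro continuous_intros nc F1T)
      show "continuous_on UNIV (\<lambda>\<theta>. ?h' (t, \<theta>))"
        by (rule slice2[of ?h']) (intro continuous_intros nc F2T UVc)
      fix \<theta> :: real assume \<theta>: "0 < \<theta>" "\<theta> < 1"
      have T: "Tq x y u \<theta> > -1/2" using Tq_nonneg[of u \<theta> x y] \<theta> u by simp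
      have "((\<lambda>\<theta>. F1 (Tq x y u \<theta>)) has_vector_derivative of_real ((1 - u\<^sup>2) * (sinh x * sinh y)\<^sup>2) * F2 (Tq x y u \<theta>)) (at \<theta>)"
        by (rule has_vector_derivative_comp_real[OF Tq_deriv_\<theta> F1[OF T]])
      note that = has_vector_derivative_mult_right[OF this, of "of_real (2 * k u)"]
      have "((\<lambda>\<theta>. of_real (2 * k u) * F1 (Tq x y u \<theta>)) has_vector_derivative ?h' (t, \<theta>)) (at \<theta>)"
      proof -
        have Ut: "U (t, \<theta>) = u" "V (t, \<theta>) = \<theta>" using \<theta> by (simp_all add: U_def V_def u_def clamp01_id)
        have "?h' (t, \<theta>) = of_real (2 * k u) * (of_real ((1 - u\<^sup>2) * (sinh x * sinh y)\<^sup>2) * F2 (Tq x y u \<theta>))"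
          unfolding Ut by simp
        then show ?thesis using that by (simp only:)
      qed
      then show "((\<lambda>\<theta>. ?h (t, \<theta>)) has_vector_derivative ?h' (t, \<theta>)) (at \<theta>)"
        by (rule has_vector_derivative_transform_within_open[where S="{0<..<1}"])
           (use \<theta> in \<open>auto simp: U_def V_def u_def[symmetric] clamp01_id\<close>)
    qed (use \<alpha>\<beta> \<beta>_ge in auto)
    moreover have ae: "AE \<theta> in beta_measure (\<beta> + 1/2) (\<alpha> - \<beta>).
        of_real (\<theta> * (1 - \<theta>)) * ?h' (t, \<theta>) + of_real ((\<beta> + 1/2) - ((\<beta> + 1/2) + (\<alpha> - \<beta>)) * \<theta>) * ?h (t, \<theta>) = Q (U (t, \<theta>)) (V (t, \<theta>))"
      using beta_AE
    proof eventually_elim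
      fix \<theta> :: real assume \<theta>: "0 <= \<theta> \<and> \<theta> <= 1"
      then have V: "V (t, \<theta>) = \<theta>" by (simp add: V_def clamp01_id)
      show "of_real (\<theta> * (1 - \<theta>)) * ?h' (t, \<theta>) + of_real ((\<beta> + 1/2) - ((\<beta> + 1/2) + (\<alpha> - \<beta>)) * \<theta>) * ?h (t, \<theta>) = Q (U (t, \<theta>)) (V (t, \<theta>))"
        unfolding Q_def V by (simp add: algebra_simps)
    qed
    then have "(\<integral>\<theta>. Q (U (t, \<theta>)) (V (t, \<theta>)) \<partial>beta_measure (\<beta> + 1/2) (\<alpha> - \<beta>))
       = (\<integral>\<theta>. of_real (\<theta> * (1 - \<theta>)) * ?h' (t, \<theta>) + of_real ((\<beta> + 1/2) - ((\<beta> + 1/2) + (\<alpha> - \<beta>)) * \<theta>) * ?h (t, \<theta>) \<partial>beta_measure (\<beta> + 1/2) (\<alpha> - \<beta>))"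
    proof -
      define H H' where "H = (\<lambda>\<theta>. ?h (t, \<theta>))" and "H' = (\<lambda>\<theta>. ?h' (t, \<theta>))"
      have Hc: "continuous_on UNIV H" unfolding H_def by (rule slice2[of ?h]) (intro continuous_intros nc F1T)
      have H'c: "continuous_on UNIV H'" unfolding H'_def by (rule slice2[of ?h']) (intro continuous_intros nc F1T F2T UVc)
      have m1: "(\<lambda>\<theta>. Q (U (t, \<theta>)) (V (t, \<theta>))) \<in> borel_measurable (beta_measure (\<beta> + 1/2) (\<alpha> - \<beta>))"
        by (rule beta_measurableI[OF slice2[of "\<lambda>w. Q (U w) (V w)", OF Qc]])
      have m2: "(\<lambda>\<theta>. (of_real (\<theta> * (1 - \<theta>)) * H' \<theta> + of_real ((\<beta> + 1/2) - ((\<beta> + 1/2) + (\<alpha> - \<beta>)) * \<theta>) * H \<theta>)) \<in> borel_measurable (beta_measure (\<beta> + 1/2) (\<alpha> - \<beta>))"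
        by (intro beta_measurableI continuous_intros Hc H'c)
      show ?thesis
        by (rule integral_cong_AE[OF m1 m2[unfolded H_def H'_def]]) (use ae in \<open>eventually_elim, simp only:\<close>)
    qed
    ultimately show "(\<integral>\<theta>. Q (U (t, \<theta>)) (V (t, \<theta>)) \<partial>beta_measure (\<beta> + 1/2) (\<alpha> - \<beta>)) = 0"
      by simp
  qed
  show ?thesis unfolding eq using Pi Qi P0 Q0 by simp
qed


lemma product_formula:
  assumes x: "x >= 0" and y: "y >= 0"
  shows "integrable \<Omega> (\<lambda>w. \<phi> l (tt x y w))" "(\<integral>w. \<phi> l (tt x y w) \<partial>\<Omega>) = \<phi> l x * \<phi> l y"
proof -
  obtain F F1 F2 where F: "\<And>x. \<phi> l x = F ((sinh x)\<^sup>2)" "F 0 = 1"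
    "\<And>T. T > -1/2 ==> (F has_vector_derivative F1 T) (at T)"
    "\<And>T. T > -1/2 ==> (F1 has_vector_derivative F2 T) (at T)"
    "continuous_on {-1/2<..} F2"
    "\<And>T. T > -1/2 ==> of_real (4 * (T * (1 + T))) * F2 T + of_real (4 * ((\<alpha> + 1) + (\<alpha> + \<beta> + 2) * T)) * F1 T
        + (l\<^sup>2 + of_real (\<rho>\<^sup>2)) * F T = 0" by (rule phi_F[of l]) (rule that)
  interpret prob_space \<Omega> by (rule prob_\<Omega>)
  have F0c: "continuous_on {-1/2<..} F"
    by (intro continuous_at_imp_continuous_on ballI has_vector_derivative_continuous[OF F(3)]) auto
  have F1c: "continuous_on {-1/2<..} F1"
    by (intro continuous_at_imp_continuous_on ballI has_vector_derivative_continuous[OF F(4)]) auto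
  define U V where "U = (\<lambda>w::real \<times> real. 2 * clamp01 (fst w) - 1)" and "V = (\<lambda>w::real \<times> real. clamp01 (snd w))"
  have UVc: "continuous_on S U" "continuous_on S V" for S unfolding U_def V_def by (intro continuous_intros)+
  have TTU: "TT z y w = Tq z y (U w) (V w)" for z w by (simp add: TT_def U_def V_def)
  have T0: "Tq z y (U w) (V w) >= 0" for z w using TT_nonneg[of z y w] by (simp add: TTU)
  have Tgt: "Tq z y (U w) (V w) > -1/2" for z w using T0[of z w] by simp
  have Tc: "continuous_on S (\<lambda>w. Tq z y (U w) (V w))" "continuous_on S (\<lambda>w. Tx z y (U w) (V w))"
    "continuous_on S (\<lambda>w. Txx z y (U w) (V w))" for S z unfolding Tq_def Tx_def Txx_def by (intro continuous_intros UVc)+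
  have FT: "continuous_on S (\<lambda>w. F (Tq z y (U w) (V w)))" "continuous_on S (\<lambda>w. F1 (Tq z y (U w) (V w)))"
     "continuous_on S (\<lambda>w. F2 (Tq z y (U w) (V w)))" for S z
    using T0 by (auto intro!: continuous_on_comp_nonneg F0c F1c F(5) Tc)
  define f1 where "f1 = (\<lambda>z u \<theta>. of_real (Tx z y u \<theta>) * F1 (Tq z y u \<theta>))"
  define f2 where "f2 = (\<lambda>z u \<theta>. of_real (Txx z y u \<theta>) * F1 (Tq z y u \<theta>) + of_real ((Tx z y u \<theta>)\<^sup>2) * F2 (Tq z y u \<theta>))"
  have i0: "integrable \<Omega> (\<lambda>w. F (Tq z y (U w) (V w)))" for z
    using integrable_clamped[of "\<lambda>u \<theta>. F (Tq z y u \<theta>)"] FT(1)[of UNIV z] unfolding U_def V_def by simp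
  have i1: "integrable \<Omega> (\<lambda>w. f1 z (U w) (V w))" for z
  proof -
    have "continuous_on UNIV (\<lambda>w. f1 z (U w) (V w))" unfolding f1_def by (intro continuous_intros Tc FT)
    then show ?thesis using integrable_clamped[of "f1 z"] unfolding U_def V_def by simp
  qed
  have i2: "integrable \<Omega> (\<lambda>w. f2 z (U w) (V w))" for z
  proof -
    have "continuous_on UNIV (\<lambda>w. f2 z (U w) (V w))" unfolding f2_def by (intro continuous_intros Tc FT)
    then show ?thesis using integrable_clamped[of "f2 z"] unfolding U_def V_def by simp
  qed
  have phiF: "\<phi> l (tt z y w) = F (Tq z y (U w) (V w))" for z w by (simp add: F(1) sinh_tt TTU)
  show "integrable \<Omega> (\<lambda>w. \<phi> l (tt x y w))" unfolding phiF by (rule i0)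
  define G where "G = (\<lambda>z. \<integral>w. F (Tq z y (U w) (V w)) \<partial>\<Omega>)"
  define G1 where "G1 = (\<lambda>z. \<integral>w. f1 z (U w) (V w) \<partial>\<Omega>)"
  define G2 where "G2 = (\<lambda>z. \<integral>w. f2 z (U w) (V w) \<partial>\<Omega>)"
  \<comment> \<open>The interval extends to the left of 0, so that 0 is an interior point and the
    derivatives of the expectation are continuous there.\<close>
  let ?K = "{-1..x+1} \<times> {-1..1} \<times> {0..1::real}"
  have Kc: "continuous_on ?K (\<lambda>z. Tq (fst z) y (fst (snd z)) (snd (snd z)))"
    "continuous_on ?K (\<lambda>z. Tx (fst z) y (fst (snd z)) (snd (snd z)))"
    "continuous_on ?K (\<lambda>z. Txx (fst z) y (fst (snd z)) (snd (snd z)))"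
    unfolding Tq_def Tx_def Txx_def by (intro continuous_intros)+
  have K0: "Tq (fst z) y (fst (snd z)) (snd (snd z)) >= 0" if "z \<in> ?K" for z
    using that by (intro Tq_nonneg) auto
  have "continuous_on ?K (\<lambda>z. f1 (fst z) (fst (snd z)) (snd (snd z)))"
    unfolding f1_def by (intro continuous_intros Kc continuous_on_comp_nonneg[OF F1c] K0)
  from bounded_on_clamped[OF this] obtain B1 where B1: "\<And>z w. z \<in> {-1..x+1} ==> norm (f1 z (U w) (V w)) <= B1"
    unfolding U_def V_def by blast
  have "continuous_on ?K (\<lambda>z. f2 (fst z) (fst (snd z)) (snd (snd z)))"
    unfolding f2_def by (intro continuous_intros Kc continuous_on_comp_nonneg[OF F1c] continuous_on_comp_nonneg[OF F(5)] K0)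
  from bounded_on_clamped[OF this] obtain B2 where B2: "\<And>z w. z \<in> {-1..x+1} ==> norm (f2 z (U w) (V w)) <= B2"
    unfolding U_def V_def by blast
  have dF: "((\<lambda>z. F (Tq z y (U w) (V w))) has_vector_derivative f1 z (U w) (V w)) (at z)" for z w
    unfolding f1_def by (rule has_vector_derivative_comp_real[OF Tq_deriv_x F(3)[OF Tgt]])
  have df1: "((\<lambda>z. f1 z (U w) (V w)) has_vector_derivative f2 z (U w) (V w)) (at z)" for z w
  proof -
    have "((\<lambda>z. Tx z y (U w) (V w) *\<^sub>R F1 (Tq z y (U w) (V w))) has_vector_derivative
       Tx z y (U w) (V w) *\<^sub>R (of_real (Tx z y (U w) (V w)) * F2 (Tq z y (U w) (V w))) + Txx z y (U w) (V w) *\<^sub>R F1 (Tq z y (U w) (V w))) (at z)"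
      by (rule has_vector_derivative_scaleR[OF Tx_deriv_x has_vector_derivative_comp_real[OF Tq_deriv_x F(4)[OF Tgt]]])
    then show ?thesis unfolding f1_def f2_def by (simp add: scaleR_conv_of_real power2_eq_square add.commute mult.assoc)
  qed
  have dG: "(G has_vector_derivative G1 z) (at z)" if "z \<in> {-1<..<x+1}" for z
    unfolding G_def G1_def
    by (rule has_vector_derivative_integral[where a="-1" and b="x+1" and B=B1])
       (use that dF B1 i0 i1 in \<open>auto intro!: finite_measure_axioms borel_measurable_integrable\<close>)
  have dG1: "(G1 has_vector_derivative G2 z) (at z)" if "z \<in> {-1<..<x+1}" for z
    unfolding G1_def G2_def
    by (rule has_vector_derivative_integral[where a="-1" and b="x+1" and B=B2])
       (use that df1 B2 i1 i2 in \<open>auto intro!: finite_measure_axioms borel_measurable_integrable\<close>)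
  have ode: "G2 z + of_real (2 * hA z) * G1 z = - (l\<^sup>2 + of_real (\<rho>\<^sup>2)) * G z" if z: "z > 0" for z
  proof -
    have "0 = (\<integral>w. of_real ((Tx z y (U w) (V w))\<^sup>2 - 4 * (TT z y w * (1 + TT z y w))) * F2 (TT z y w)
       + of_real (Txx z y (U w) (V w) + 2 * hA z * Tx z y (U w) (V w)
           - 4 * ((\<alpha> + 1) + (\<alpha> + \<beta> + 2) * TT z y w)) * F1 (TT z y w) \<partial>\<Omega>)"
      unfolding U_def V_def by (rule expectation_ode[OF F(4,5) z, symmetric])
    also have "... = (\<integral>w. f2 z (U w) (V w) + of_real (2 * hA z) * f1 z (U w) (V w) + (l\<^sup>2 + of_real (\<rho>\<^sup>2)) * F (Tq z y (U w) (V w)) \<partial>\<Omega>)"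
    proof (rule Bochner_Integration.integral_cong[OF refl])
      fix w
      let ?T = "Tq z y (U w) (V w)"
      have "(l\<^sup>2 + of_real (\<rho>\<^sup>2)) * F ?T = - (of_real (4 * (?T * (1 + ?T))) * F2 ?T + of_real (4 * ((\<alpha> + 1) + (\<alpha> + \<beta> + 2) * ?T)) * F1 ?T)"
        using F(6)[OF Tgt[of z w]] by (simp only: add_eq_0_iff2 minus_minus)
      then show "of_real ((Tx z y (U w) (V w))\<^sup>2 - 4 * (TT z y w * (1 + TT z y w))) * F2 (TT z y w)
       + of_real (Txx z y (U w) (V w) + 2 * hA z * Tx z y (U w) (V w)
           - 4 * ((\<alpha> + 1) + (\<alpha> + \<beta> + 2) * TT z y w)) * F1 (TT z y w)
       = f2 z (U w) (V w) + of_real (2 * hA z) * f1 z (U w) (V w) + (l\<^sup>2 + of_real (\<rho>\<^sup>2)) * F ?T"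
        unfolding TTU f1_def f2_def by (simp only:) (simp add: algebra_simps)
    qed
    also have "... = G2 z + of_real (2 * hA z) * G1 z + (l\<^sup>2 + of_real (\<rho>\<^sup>2)) * G z"
      unfolding G_def G1_def G2_def using i0 i1 i2 by simp
    finally show ?thesis by (simp add: add_eq_0_iff2 algebra_simps)
  qed
  \<comment> \<open>At x = 0 the third side is y for every outcome, so the expectation is taken of a
    constant.\<close>
  have G0: "G 0 = \<phi> l y"
    by (simp add: G_def F(1) Tq_def cosh_square_eq prob_space[unfolded space_\<Omega>])
  have "G x = \<phi> l x * \<phi> l y"
  proof (cases "x = 0")
    case False
    then have x0: "x > 0" using x by simp
    have "norm (G x - \<phi> l x * \<phi> l y) <= 2 * x^2 * exp ((2 * norm (l\<^sup>2 + of_real (\<rho>\<^sup>2)) * x + 1) * x) * 0"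
    proof (rule gronwall(1)[of x "norm (l\<^sup>2 + of_real (\<rho>\<^sup>2))" 0 "\<lambda>z. G z - \<phi> l z * \<phi> l y" "\<lambda>z. G1 z - dphi l z * \<phi> l y"
         "\<lambda>z. - (l\<^sup>2 + of_real (\<rho>\<^sup>2)) * of_real (A z) * (G z - \<phi> l z * \<phi> l y)"])
      fix z :: real assume z: "0 < z" "z <= x"
      then have zI: "z \<in> {-1<..<x+1}" by auto
      show "((\<lambda>z. G z - \<phi> l z * \<phi> l y) has_vector_derivative G1 z - dphi l z * \<phi> l y) (at z)"
        by (intro has_vector_derivative_diff has_vector_derivative_mult_left dG[OF zI] phi_deriv)
      have 1: "((\<lambda>z. A z *\<^sub>R G1 z) has_vector_derivative A z *\<^sub>R G2 z + (2 * hA z * A z) *\<^sub>R G1 z) (at z)"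
        by (rule has_vector_derivative_scaleR[OF A_deriv[OF z(1)] dG1[OF zI]])
      have 2: "A z *\<^sub>R G2 z + (2 * hA z * A z) *\<^sub>R G1 z = of_real (A z) * (G2 z + of_real (2 * hA z) * G1 z)"
        by (simp add: scaleR_conv_of_real algebra_simps)
      have "((\<lambda>z. A z *\<^sub>R G1 z - A z *\<^sub>R dphi l z * \<phi> l y) has_vector_derivative
         of_real (A z) * (- (l\<^sup>2 + of_real (\<rho>\<^sup>2)) * G z) - (- (l\<^sup>2 + of_real (\<rho>\<^sup>2)) * of_real (A z) * \<phi> l z) * \<phi> l y) (at z)"
        using 1 unfolding 2 ode[OF z(1)]
        by (intro has_vector_derivative_diff has_vector_derivative_mult_left A_dphi_deriv z) auto
      then show "((\<lambda>z. A z *\<^sub>R (G1 z - dphi l z * \<phi> l y)) has_vector_derivative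
         - (l\<^sup>2 + of_real (\<rho>\<^sup>2)) * of_real (A z) * (G z - \<phi> l z * \<phi> l y)) (at z)"
        by (simp add: scaleR_conv_of_real algebra_simps)
      show "norm (- (l\<^sup>2 + of_real (\<rho>\<^sup>2)) * of_real (A z) * (G z - \<phi> l z * \<phi> l y))
          <= A z * (norm (l\<^sup>2 + of_real (\<rho>\<^sup>2)) * norm (G z - \<phi> l z * \<phi> l y) + 0)"
        using A_nonneg[of z] by (simp only: norm_mult norm_minus_cancel norm_of_real abs_of_nonneg) (simp add: mult_ac)
    next
      have z: "0 \<in> {-1<..<x+1}" using x by auto
      have cG: "(G \<longlongrightarrow> G 0) (at_right 0)" and cG1: "(G1 \<longlongrightarrow> G1 0) (at_right 0)"
        using has_vector_derivative_continuous[OF dG[OF z]] has_vector_derivative_continuous[OF dG1[OF z]]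
        unfolding isCont_def by (auto intro: tendsto_mono[OF at_le[OF subset_UNIV]])
      have "((\<lambda>z. G z - \<phi> l z * \<phi> l y) \<longlongrightarrow> G 0 - 1 * \<phi> l y) (at_right 0)"
        by (rule tendsto_diff[OF cG tendsto_mult[OF phi_tendsto_1 tendsto_const]])
      then show "((\<lambda>z. G z - \<phi> l z * \<phi> l y) \<longlongrightarrow> 0) (at_right 0)" by (simp add: G0)
      have "((\<lambda>z. A z *\<^sub>R G1 z - A z *\<^sub>R dphi l z * \<phi> l y) \<longlongrightarrow> 0 *\<^sub>R G1 0 - 0 * \<phi> l y) (at_right 0)"
        by (rule tendsto_diff[OF tendsto_scaleR[OF A_tendsto_0 cG1] tendsto_mult[OF A_dphi_tendsto tendsto_const]])
      then show "((\<lambda>z. A z *\<^sub>R (G1 z - dphi l z * \<phi> l y)) \<longlongrightarrow> 0) (at_right 0)"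
        by (simp add: scaleR_conv_of_real algebra_simps)
    qed (use x0 in auto)
    then show ?thesis by simp
  qed (simp add: G0)
  then show "(\<integral>w. \<phi> l (tt x y w) \<partial>\<Omega>) = \<phi> l x * \<phi> l y" unfolding phiF G_def .
qed

text \<open>At this parameter the first hypergeometric parameter is -n and the series terminates,
  while the Pfaff factor (1 + sinh^2 x)^n clears the denominators. The other numerator parameter is
  -\<beta> - n, so the signs in the Pochhammer symbols cancel in pairs, and \<beta> + n - j > 0 for
  j < n makes every coefficient positive.\<close>

lemma phi_poly:
  fixes n :: nat
  obtains q :: "nat => real" where "\<And>k. k <= n ==> q k > 0"
    "\<And>x. \<phi> (- \<i> * of_real (\<rho> + 2 * real n)) x
        = (\<Sum>k\<le>n. of_real (q k * ((sinh x)\<^sup>2 ^ k * (1 + (sinh x)\<^sup>2) ^ (n - k))))"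
proof -
  define l where "l = - \<i> * of_real (\<rho> + 2 * real n)"
  define q where "q = (\<lambda>k. (\<Prod>j<k. (real n - real j) * (\<beta> + real n - real j)) / (pochhammer (\<alpha> + 1) k * fact k))"
  have il: "\<i> * l = of_real (\<rho> + 2 * real n)" by (simp add: l_def)
  have a: "(of_real \<rho> - \<i> * l) / 2 = - of_nat n" unfolding il by simp
  have b: "(of_real (\<alpha> + 1) - (of_real \<rho> + \<i> * l) / 2) = complex_of_real (- \<beta> - real n)"
    unfolding il by (simp add: jac_rho_def field_simps)
  have q: "q k > 0" if "k <= n" for k
  proof -
    have "(\<Prod>j<k. (real n - real j) * (\<beta> + real n - real j)) > 0"
      using that \<beta>_ge by (intro prod_pos) (auto intro!: mult_pos_pos)
    moreover have "pochhammer (\<alpha> + 1) k > 0" using \<alpha>_gt by (intro pochhammer_pos) auto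
    ultimately show ?thesis by (simp add: q_def)
  qed
  have c: "hg_coeff (- of_nat n) (of_real (- \<beta> - real n)) (of_real (\<alpha> + 1)) k = of_real (if k <= n then q k else 0)" for k
  proof (cases "k <= n")
    case True
    have "pochhammer (- of_nat n) k * pochhammer (complex_of_real (- \<beta> - real n)) k
       = (\<Prod>j<k. (- of_nat n + of_nat j) * (of_real (- \<beta> - real n) + of_nat j))"
      by (simp add: pochhammer_prod prod.distrib atLeast0LessThan)
    also have "... = (\<Prod>j<k. of_real ((real n - real j) * (\<beta> + real n - real j)))"
      by (intro prod.cong refl) (simp add: algebra_simps)
    finally have 1: "pochhammer (- of_nat n) k * pochhammer (complex_of_real (- \<beta> - real n)) k
       = of_real (\<Prod>j<k. (real n - real j) * (\<beta> + real n - real j))" by (simp only: of_real_prod)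
    show ?thesis unfolding hg_coeff_def 1 unfolding pochhammer_of_real using True by (simp add: q_def)
  next
    case False
    then have "pochhammer (- of_nat n :: complex) k = 0" by (simp add: pochhammer_of_nat_eq_0_lemma)
    then show ?thesis using False by (simp add: hg_coeff_def)
  qed
  have "\<phi> l x = (\<Sum>k\<le>n. of_real (q k * ((sinh x)\<^sup>2 ^ k * (1 + (sinh x)\<^sup>2) ^ (n - k))))" for x
  proof -
    let ?s = "(sinh x)\<^sup>2"
    have s: "1 + ?s > 0" by (simp add: add_pos_nonneg)
    have z: "complex_of_real (- ?s / (- ?s - 1)) = of_real (?s / (1 + ?s))"
    proof -
      have "- r / (- r - 1) = r / (1 + r)" if "1 + r > 0" for r :: real using that by (simp add: field_simps)
      from this[OF s] show ?thesis by (simp only:)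
    qed
    have pw: "complex_of_real (1 - - ?s) powr (- (- of_nat n)) = of_real ((1 + ?s) ^ n)"
    proof -
      have "complex_of_real (1 + ?s) \<noteq> 0" using s by (simp only: of_real_eq_0_iff)
      then show ?thesis by (simp only: minus_minus diff_minus_eq_add of_real_power) (rule powr_nat', simp)
    qed
    have ser: "hyp2F1_series (- of_nat n) (of_real (- \<beta> - real n)) (of_real (\<alpha> + 1)) (of_real (?s / (1 + ?s)))
       = (\<Sum>k\<le>n. of_real (q k * (?s / (1 + ?s)) ^ k))"
    proof -
      have "(\<Sum>k. hg_coeff (- of_nat n) (of_real (- \<beta> - real n)) (of_real (\<alpha> + 1)) k * of_real (?s / (1 + ?s)) ^ k)
        = (\<Sum>k\<le>n. hg_coeff (- of_nat n) (of_real (- \<beta> - real n)) (of_real (\<alpha> + 1)) k * of_real (?s / (1 + ?s)) ^ k)"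
        by (rule suminf_finite) (simp_all only: c atMost_iff if_False of_real_0 mult_zero_left finite_atMost)
      also have "... = (\<Sum>k\<le>n. of_real (q k * (?s / (1 + ?s)) ^ k))"
        by (intro sum.cong refl) (simp only: c atMost_iff if_True of_real_mult of_real_power)
      finally show ?thesis unfolding hyp2F1_series_def hg_coeff_def .
    qed
    have "\<phi> l x = of_real ((1 + ?s) ^ n) * (\<Sum>k\<le>n. of_real (q k * (?s / (1 + ?s)) ^ k))"
      unfolding jacobi_phi_def hyp2F1_def a b z ser pw ..
    also have "... = (\<Sum>k\<le>n. of_real (q k * (?s ^ k * (1 + ?s) ^ (n - k))))"
      unfolding sum_distrib_left
    proof (intro sum.cong refl)
      fix k assume "k \<in> {..n}"
      then have "(1 + ?s) ^ n = (1 + ?s) ^ k * (1 + ?s) ^ (n - k)" by (simp add: power_add[symmetric])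
      then have "(1 + ?s) ^ n * (q k * (?s / (1 + ?s)) ^ k) = q k * (?s ^ k * (1 + ?s) ^ (n - k))"
        using s by (simp add: power_divide)
      then show "of_real ((1 + ?s) ^ n) * of_real (q k * (?s / (1 + ?s)) ^ k) = complex_of_real (q k * (?s ^ k * (1 + ?s) ^ (n - k)))"
        by (metis of_real_mult)
    qed
    finally show ?thesis .
  qed
  then show thesis using q by (intro that[of q]) (auto simp: l_def)
qed

end

section \<open>The generalized translation as an expectation\<close>

text \<open>Bounded support makes the exponential series integrable term by term, so the
  characteristic function is a power series in the moments; Levy's theorem then identifies the
  measures.\<close>

lemma real_distribution_eq_moments:
  fixes M N :: "real measure"
  assumes M: "real_distribution M" and N: "real_distribution N"
    and SM: "AE x in M. \<bar>x\<bar> <= S" and SN: "AE x in N. \<bar>x\<bar> <= S"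
    and eq: "\<And>n::nat. (\<integral>x. x ^ n \<partial>M) = (\<integral>x. x ^ n \<partial>N)"
  shows "M = N"
proof (rule Levy_uniqueness[OF M N], rule ext)
  fix t :: real
  have main: "(\<lambda>n. (\<i> * of_real t) ^ n / fact n * of_real (\<integral>x. x ^ n \<partial>P)) sums char P t"
    if P: "real_distribution P" and SP: "AE x in P. \<bar>x\<bar> <= S" for P
  proof -
    interpret real_distribution P by (rule P)
    let ?f = "\<lambda>n x. (\<i> * of_real (t * x)) ^ n /\<^sub>R fact n"
    have mf: "?f n \<in> borel_measurable P" for n by measurable
    have S0: "S >= 0"
    proof -
      have "AE x in P. 0 <= S" using SP by eventually_elim auto
      then show ?thesis using emeasure_space_1 by (cases "0 <= S") (auto simp: AE_iff_measurable[OF _ refl] emeasure_space_1)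
    qed
    have b: "AE x in P. norm (?f n x) <= (\<bar>t\<bar> * S) ^ n / fact n" for n
      using SP
    proof eventually_elim
      fix x assume "\<bar>x\<bar> <= S"
      then have "(\<bar>t\<bar> * \<bar>x\<bar>) ^ n <= (\<bar>t\<bar> * S) ^ n" by (intro power_mono mult_left_mono) auto
      then show "norm (?f n x) <= (\<bar>t\<bar> * S) ^ n / fact n"
        by (simp add: norm_mult norm_power abs_mult divide_simps)
    qed
    have i: "integrable P (?f n)" for n by (rule integrable_const_bound[OF b mf])
    have "(\<lambda>n. \<integral>x. ?f n x \<partial>P) sums (\<integral>x. (\<Sum>n. ?f n x) \<partial>P)"
    proof (rule sums_integral[OF i])
      show "AE x in P. summable (\<lambda>n. norm (?f n x))" by (intro AE_I2 summable_norm_exp)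
      have "(\<integral>x. norm (?f n x) \<partial>P) <= (\<integral>x. (\<bar>t\<bar> * S) ^ n / fact n \<partial>P)" for n
        by (rule integral_mono_AE[OF integrable_norm[OF i] integrable_const b])
      then have "norm (\<integral>x. norm (?f n x) \<partial>P) <= (\<bar>t\<bar> * S) ^ n /\<^sub>R fact n" for n
        by (subst real_norm_def, subst abs_of_nonneg) (auto simp: prob_space[simplified] divide_inverse mult.commute)
      then show "summable (\<lambda>n. \<integral>x. norm (?f n x) \<partial>P)"
        by (intro summable_comparison_test'[OF summable_exp_generic[of "\<bar>t\<bar> * S"]])
    qed
    moreover have "(\<integral>x. ?f n x \<partial>P) = (\<i> * of_real t) ^ n / fact n * of_real (\<integral>x. x ^ n \<partial>P)" for n
    proof -
      have "(\<integral>x. ?f n x \<partial>P) = (\<integral>x. (\<i> * of_real t) ^ n / fact n * of_real (x ^ n) \<partial>P)"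
        by (intro Bochner_Integration.integral_cong refl) (simp add: scaleR_conv_of_real power_mult_distrib field_simps)
      then show ?thesis by (simp only: integral_mult_right_zero integral_complex_of_real)
    qed
    moreover have "(\<integral>x. (\<Sum>n. ?f n x) \<partial>P) = char P t"
      unfolding char_def by (intro Bochner_Integration.integral_cong refl) (simp add: exp_def)
    ultimately show ?thesis by simp
  qed
  show "char M t = char N t"
    using main[OF M SM] main[OF N SN] unfolding eq by (rule sums_unique2)
qed

section \<open>Uniqueness of the representing measure\<close>

context jacobi begin

text \<open>With s = sinh^2 t, let D(k,j) be the difference of the two integrals of s^k (1+s)^j. By
  induction all D(k,j) with k + j = n agree, and the polynomial at level n makes a positive multiple
  of their common value vanish. So the laws of s have the same moments, and s determines t on the
  support because a is nonnegative.\<close>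

lemma measure_eq_phi:
  fixes M N :: "real measure"
  assumes sM: "sets M = sets borel" and sN: "sets N = sets borel"
    and eM: "emeasure M UNIV = 1" and eN: "emeasure N UNIV = 1"
    and a: "0 <= a" and sup: "emeasure M {a..b} = 1" "emeasure N {a..b} = 1"
    and eq: "\<And>l. (\<integral>t. \<phi> l t \<partial>M) = (\<integral>t. \<phi> l t \<partial>N)"
  shows "M = N"
proof -
  have spM: "space M = UNIV" and spN: "space N = UNIV" 
    using sets_eq_imp_space_eq[OF sM] sets_eq_imp_space_eq[OF sN] by simp_all
  interpret M: prob_space M by (rule prob_spaceI) (simp add: spM eM)
  interpret N: prob_space N by (rule prob_spaceI) (simp add: spN eN)
  have aeM: "AE t in M. t \<in> {a..b}"
    by (subst M.AE_in_set_eq_1) (use sup sM in \<open>auto simp: M.emeasure_eq_measure\<close>)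
  have aeN: "AE t in N. t \<in> {a..b}"
    by (subst N.AE_in_set_eq_1) (use sup sN in \<open>auto simp: N.emeasure_eq_measure\<close>)
  define g where "g = (\<lambda>k j t. (sinh t)\<^sup>2 ^ k * (1 + (sinh t)\<^sup>2) ^ j :: real)"
  have gc: "continuous_on UNIV (g k j)" for k j unfolding g_def by (intro continuous_intros)
  have gm: "g k j \<in> borel_measurable borel" for k j by (rule borel_measurable_continuous_onI[OF gc])
  have gb: "\<exists>B. \<forall>t\<in>{a..b}. norm (g k j t) <= B" for k j
  proof -
    have "compact (g k j ` {a..b})" by (rule compact_continuous_image[OF continuous_on_subset[OF gc]]) auto
    then show ?thesis by (meson bounded_iff compact_imp_bounded image_eqI)
  qed
  have iM: "integrable M (g k j)" for k j
  proof -
    obtain B where "\<forall>t\<in>{a..b}. norm (g k j t) <= B" using gb by blast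
    then have "AE t in M. norm (g k j t) <= B" using aeM by (auto simp del: atLeastAtMost_iff elim!: eventually_mono)
    then show ?thesis
      by (rule M.integrable_const_bound) (auto simp: measurable_cong_sets[OF sM refl] gm)
  qed
  have iN: "integrable N (g k j)" for k j
  proof -
    obtain B where "\<forall>t\<in>{a..b}. norm (g k j t) <= B" using gb by blast
    then have "AE t in N. norm (g k j t) <= B" using aeN by (auto simp del: atLeastAtMost_iff elim!: eventually_mono)
    then show ?thesis
      by (rule N.integrable_const_bound) (auto simp: measurable_cong_sets[OF sN refl] gm)
  qed
  define D where "D = (\<lambda>k j. (\<integral>t. g k j t \<partial>M) - (\<integral>t. g k j t \<partial>N))"
  have Drec: "D k (Suc j) = D (Suc k) j + D k j" for k j
  proof -
    have "g k (Suc j) = (\<lambda>t. g (Suc k) j t + g k j t)" by (rule ext) (simp add: g_def algebra_simps)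
    then show ?thesis unfolding D_def using iM iN by simp
  qed
  have D0: "D k j = 0" if "k + j = n" for n k j using that
  proof (induction n arbitrary: k j rule: less_induct)
    case (less n)
    \<comment> \<open>Expanding one factor 1 + s gives D(k,j+1) = D(k+1,j) + D(k,j), and the last
      term belongs to a lower level, where the induction hypothesis applies.\<close>
    have same: "D k j = D (k + j) 0" if "k + j = n" for k j
      using that
    proof (induction j arbitrary: k)
      case (Suc j)
      have "D k (Suc j) = D (Suc k) j" using Drec less.IH[of "k + j" k j] Suc.prems by simp
      also have "... = D (Suc k + j) 0" by (rule Suc.IH) (use Suc.prems in simp)
      finally show ?case by simp
    qed simp
    obtain q where q: "\<And>k. k <= n ==> q k > 0"
      and phi: "\<And>x. \<phi> (- \<i> * of_real (\<rho> + 2 * real n)) x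
        = (\<Sum>k\<le>n. of_real (q k * ((sinh x)\<^sup>2 ^ k * (1 + (sinh x)\<^sup>2) ^ (n - k))))" by (rule phi_poly[of n]) (rule that)
    have I: "(\<integral>t. \<phi> (- \<i> * of_real (\<rho> + 2 * real n)) t \<partial>P) = of_real (\<Sum>k\<le>n. q k * (\<integral>t. g k (n - k) t \<partial>P))"
      if "\<And>k j. integrable P (g k j)" for P
    proof -
      have "(\<integral>t. \<phi> (- \<i> * of_real (\<rho> + 2 * real n)) t \<partial>P) = (\<integral>t. complex_of_real (\<Sum>k\<le>n. q k * g k (n - k) t) \<partial>P)"
        unfolding phi g_def by simp
      also have "... = of_real (\<integral>t. (\<Sum>k\<le>n. q k * g k (n - k) t) \<partial>P)" by (rule integral_complex_of_real)
      also have "(\<integral>t. (\<Sum>k\<le>n. q k * g k (n - k) t) \<partial>P) = (\<Sum>k\<le>n. q k * (\<integral>t. g k (n - k) t \<partial>P))"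
        using that by simp
      finally show ?thesis .
    qed
    have "(\<Sum>k\<le>n. q k * (\<integral>t. g k (n - k) t \<partial>M)) = (\<Sum>k\<le>n. q k * (\<integral>t. g k (n - k) t \<partial>N))"
      using eq[of "- \<i> * of_real (\<rho> + 2 * real n)"] unfolding I[OF iM] I[OF iN] by (simp only: of_real_eq_iff)
    then have "0 = (\<Sum>k\<le>n. q k * D k (n - k))" unfolding D_def right_diff_distrib sum_subtractf by simp
    also have "... = (\<Sum>k\<le>n. q k * D n 0)"
    proof (intro sum.cong refl)
      fix k assume "k \<in> {..n}"
      then show "q k * D k (n - k) = q k * D n 0" using same[of k "n - k"] by simp
    qed
    also have "... = (\<Sum>k\<le>n. q k) * D n 0" by (simp add: sum_distrib_right)
    finally have "(\<Sum>k\<le>n. q k) * D n 0 = 0" by simp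
    moreover have "(\<Sum>k\<le>n. q k) > 0" by (intro sum_pos) (use q in auto)
    ultimately have "D n 0 = 0" by simp
    then show ?case using same[OF less.prems] less.prems by simp
  qed
  define h where "h = (\<lambda>t::real. (sinh t)\<^sup>2)"
  have hm[measurable]: "h \<in> borel_measurable borel" unfolding h_def by (intro borel_measurable_continuous_onI continuous_intros)
  have hM: "h \<in> measurable M borel" "h \<in> measurable N borel"
    by (auto simp: measurable_cong_sets[OF sM refl] measurable_cong_sets[OF sN refl])
  have dd: "distr M borel h = distr N borel h"
  proof (rule real_distribution_eq_moments[where S="(sinh b)\<^sup>2"])
    show "real_distribution (distr M borel h)" "real_distribution (distr N borel h)"
      using M.prob_space_distr[OF hM(1)] N.prob_space_distr[OF hM(2)]
      by (auto simp: real_distribution_def real_distribution_axioms_def)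
    have "\<bar>h t\<bar> <= (sinh b)\<^sup>2" if "t \<in> {a..b}" for t
      using that a by (auto simp: h_def intro!: power_mono)
    then show "AE x in distr M borel h. \<bar>x\<bar> <= (sinh b)\<^sup>2" "AE x in distr N borel h. \<bar>x\<bar> <= (sinh b)\<^sup>2"
      using aeM aeN hM by (auto simp: AE_distr_iff)
    fix n :: nat
    have "(\<integral>x. x ^ n \<partial>distr M borel h) = (\<integral>t. g n 0 t \<partial>M)" "(\<integral>x. x ^ n \<partial>distr N borel h) = (\<integral>t. g n 0 t \<partial>N)"
      using hM by (simp_all add: integral_distr g_def h_def)
    then show "(\<integral>x. x ^ n \<partial>distr M borel h) = (\<integral>x. x ^ n \<partial>distr N borel h)"
      using D0[of n 0 n] by (simp add: D_def)
  qed
  \<comment> \<open>On the support t is nonnegative, so t is recovered from sinh^2 t as arsinh of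
    the square root; values off the support are negligible.\<close>
  have pull: "distr (distr P borel h) borel (\<lambda>s. arsinh (sqrt s)) = P"
    if sP: "sets P = sets borel" and ae: "AE t in P. t \<in> {a..b}" for P
  proof -
    have hP: "h \<in> measurable P borel" by (auto simp: measurable_cong_sets[OF sP refl])
    have am: "(\<lambda>s::real. arsinh (sqrt s)) \<in> borel_measurable borel"
      by (intro borel_measurable_continuous_onI continuous_intros)
    have "distr (distr P borel h) borel (\<lambda>s. arsinh (sqrt s)) = distr P borel (\<lambda>t. arsinh (sqrt (h t)))"
      using distr_distr[OF am hP] by (simp add: o_def)
    also have "... = distr P borel (\<lambda>t. t)"
    proof (rule distr_cong_AE)
      show "AE t in P. arsinh (sqrt (h t)) = t" using ae
        by eventually_elim (use a in \<open>auto simp: h_def arsinh_sinh_real\<close>)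
    qed (use hP am sP in \<open>auto simp: measurable_cong_sets[OF sP refl]\<close>)
    also have "... = P" by (rule distr_id2) (use sP in simp)
    finally show ?thesis .
  qed
  show ?thesis using pull[OF sM aeM] pull[OF sN aeN] dd by metis
qed

lemma phi_cont: "continuous_on UNIV (\<phi> l)"
  by (intro continuous_at_imp_continuous_on ballI has_vector_derivative_continuous[OF phi_deriv])

lemma measurable_phi [measurable]: "\<phi> l \<in> borel_measurable borel"
  by (rule borel_measurable_continuous_onI[OF phi_cont])

text \<open>Both halves of the definite description: the product formula makes the law of
  \<open>tt x y\<close> a candidate, and \<open>measure_eq_phi\<close> excludes any other.\<close>

lemma hyp_conv_eq:
  assumes x: "x >= 0" and y: "y >= 0"
  shows "hyp_conv \<alpha> \<beta> x y = distr \<Omega> borel (tt x y)"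
  unfolding hyp_conv_def
proof (rule the_equality)
  interpret prob_space \<Omega> by (rule prob_\<Omega>)
  have m: "tt x y \<in> measurable \<Omega> borel" by measurable
  interpret D: prob_space "distr \<Omega> borel (tt x y)" by (rule prob_space_distr[OF m])
  show P: "sets (distr \<Omega> borel (tt x y)) = sets borel \<and> emeasure (distr \<Omega> borel (tt x y)) UNIV = 1 \<and>
      emeasure (distr \<Omega> borel (tt x y)) {\<bar>x - y\<bar>..x + y} = 1 \<and>
      (\<forall>l. integrable (distr \<Omega> borel (tt x y)) (\<phi> l) \<and> (\<integral>t. \<phi> l t \<partial>distr \<Omega> borel (tt x y)) = \<phi> l x * \<phi> l y)"
  proof (intro conjI allI)
    show "emeasure (distr \<Omega> borel (tt x y)) UNIV = 1" using D.emeasure_space_1 by simp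
    have "tt x y -` {\<bar>x - y\<bar>..x + y} = UNIV" using tt_bounds[OF x y] by auto
    then show "emeasure (distr \<Omega> borel (tt x y)) {\<bar>x - y\<bar>..x + y} = 1"
      using emeasure_space_1 m by (simp add: emeasure_distr)
    fix l
    show "integrable (distr \<Omega> borel (tt x y)) (\<phi> l)"
      using product_formula(1)[OF x y] m by (subst integrable_distr_eq) auto
    show "(\<integral>t. \<phi> l t \<partial>distr \<Omega> borel (tt x y)) = \<phi> l x * \<phi> l y"
      using product_formula(2)[OF x y] m by (subst integral_distr) auto
  qed simp
  fix N assume N: "sets N = sets borel \<and> emeasure N UNIV = 1 \<and> emeasure N {\<bar>x - y\<bar>..x + y} = 1 \<and>
      (\<forall>l. integrable N (\<phi> l) \<and> (\<integral>t. \<phi> l t \<partial>N) = \<phi> l x * \<phi> l y)"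
  show "N = distr \<Omega> borel (tt x y)"
    by (rule measure_eq_phi[where a="\<bar>x - y\<bar>" and b="x + y"]) (use N P in auto)
qed

lemma gen_transl_eq:
  assumes "x >= 0" "y >= 0" and f: "f \<in> borel_measurable borel"
  shows "gen_transl \<alpha> \<beta> x f y = (\<integral>w. f (tt x y w) \<partial>\<Omega>)"
  unfolding gen_transl_def hyp_conv_eq[OF assms(1,2)] by (rule integral_distr) (use f in measurable)

end

section \<open>Oscillation of Jacobi functions\<close>

context jacobi begin

definition sA :: "real => real" where "sA x = sqrt (A x)"
text \<open>The Liouville transform sqrt(A) \<phi>, with derivative \<open>vn\<close>. It satisfies
  u'' = (q - l^2) u, a Schroedinger equation without first-order term, at energy l^2.\<close>

definition un :: "real => real => real" where "un l x = sA x * rphi l x"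
definition vn :: "real => real => real" where "vn l x = sA x * (rdphi l x + hA x * rphi l x)"
text \<open>The Poeschl-Teller potential of the normal form: at most of order x^(-2) at 0 and
  exponentially small at infinity.\<close>

definition qA :: "real => real" where "qA x = (\<alpha>\<^sup>2 - 1/4) / (sinh x)\<^sup>2 + (1/4 - \<beta>\<^sup>2) / (cosh x)\<^sup>2"
definition Cq :: real where "Cq = \<bar>\<alpha>\<^sup>2 - 1/4\<bar> + \<bar>1/4 - \<beta>\<^sup>2\<bar>"

lemma Cq_nonneg: "Cq >= 0" by (simp add: Cq_def)

lemma sA_deriv: assumes "x > 0" shows "(sA has_real_derivative hA x * sA x) (at x)"
proof -
  have "((\<lambda>x. sqrt (A x)) has_real_derivative 2 * hA x * A x * (inverse (sqrt (A x)) / 2)) (at x)"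
    using DERIV_chain2[OF DERIV_real_sqrt[OF A_pos[OF assms]] A_deriv[OF assms]] by (simp add: mult.commute)
  moreover have "2 * hA x * A x * (inverse (sqrt (A x)) / 2) = hA x * sqrt (A x)"
    using A_pos[OF assms] by (simp add: field_simps)
  ultimately show ?thesis unfolding sA_def[abs_def] by (simp only:)
qed

lemma coth_deriv: assumes "x > (0::real)" shows "((\<lambda>x. cosh x / sinh x) has_real_derivative - 1 / (sinh x)\<^sup>2) (at x)"
proof -
  have s: "sinh x \<noteq> 0" using assms by auto
  have c: "cosh x * cosh x = 1 + sinh x * sinh x" using cosh_square_eq[of x] by (simp add: power2_eq_square)
  show ?thesis
    by (rule derivative_eq_intros refl s | simp)+ (use s in \<open>simp add: field_simps power2_eq_square c\<close>)
qed

lemma tanh_quot_deriv: "((\<lambda>x::real. sinh x / cosh x) has_real_derivative 1 / (cosh x)\<^sup>2) (at x)"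
proof -
  have c: "cosh x * cosh x - sinh x * sinh x = 1" using cosh_square_eq[of x] by (simp add: power2_eq_square)
  show ?thesis
    by (rule derivative_eq_intros refl | simp)+ (simp add: c power2_eq_square)
qed

lemma hA_deriv: assumes "x > 0"
  shows "(hA has_real_derivative - (\<alpha> + 1/2) / (sinh x)\<^sup>2 + (\<beta> + 1/2) / (cosh x)\<^sup>2) (at x)"
proof -
  have "((\<lambda>x. (\<alpha> + 1/2) * (cosh x / sinh x) + (\<beta> + 1/2) * (sinh x / cosh x)) has_real_derivative
      (\<alpha> + 1/2) * (- 1 / (sinh x)\<^sup>2) + (\<beta> + 1/2) * (1 / (cosh x)\<^sup>2)) (at x)"
    by (intro DERIV_add DERIV_cmult coth_deriv tanh_quot_deriv assms)
  then show ?thesis unfolding hA_def[abs_def] by (simp only: times_divide_eq_right mult_minus_right mult_1_right)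
qed

text \<open>The potential produced by the Liouville transform is h^2 + h'. Its limit \<rho>^2 at
  infinity is split off and cancels the \<rho>^2 in the eigenvalue, which leaves l^2.\<close>

lemma hA_riccati: assumes "x > 0"
  shows "(hA x)\<^sup>2 + (- (\<alpha> + 1/2) / (sinh x)\<^sup>2 + (\<beta> + 1/2) / (cosh x)\<^sup>2) = qA x + \<rho>\<^sup>2"
proof -
  define s c where "s = sinh x" and "c = cosh x"
  have s: "s \<noteq> 0" "c \<noteq> 0" and c: "c\<^sup>2 = 1 + s\<^sup>2" using assms by (auto simp: s_def c_def cosh_square_eq)
  have "(hA x)\<^sup>2 + (- (\<alpha> + 1/2) / s\<^sup>2 + (\<beta> + 1/2) / c\<^sup>2)
     = (\<alpha> + 1/2)\<^sup>2 * (c\<^sup>2 / s\<^sup>2) + (\<beta> + 1/2)\<^sup>2 * (s\<^sup>2 / c\<^sup>2) + 2 * (\<alpha> + 1/2) * (\<beta> + 1/2) + (- (\<alpha> + 1/2) / s\<^sup>2 + (\<beta> + 1/2) / c\<^sup>2)"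
    unfolding hA_def s_def[symmetric] c_def[symmetric] using s by (simp add: power2_eq_square field_simps)
  also have "c\<^sup>2 / s\<^sup>2 = 1 + 1 / s\<^sup>2" using s by (simp add: c field_simps)
  also have "s\<^sup>2 / c\<^sup>2 = 1 - 1 / c\<^sup>2"
  proof -
    have "s\<^sup>2 = c\<^sup>2 - 1" using c by simp
    then show ?thesis using s by (simp add: field_simps)
  qed
  also have "(\<alpha> + 1/2)\<^sup>2 * (1 + 1 / s\<^sup>2) + (\<beta> + 1/2)\<^sup>2 * (1 - 1 / c\<^sup>2) + 2 * (\<alpha> + 1/2) * (\<beta> + 1/2) + (- (\<alpha> + 1/2) / s\<^sup>2 + (\<beta> + 1/2) / c\<^sup>2)
    = ((\<alpha> + 1/2)\<^sup>2 - (\<alpha> + 1/2)) / s\<^sup>2 + ((\<beta> + 1/2) - (\<beta> + 1/2)\<^sup>2) / c\<^sup>2 + ((\<alpha> + 1/2) + (\<beta> + 1/2))\<^sup>2"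
    by (simp add: power2_eq_square algebra_simps diff_divide_distrib add_divide_distrib)
  also have "(\<alpha> + 1/2)\<^sup>2 - (\<alpha> + 1/2) = \<alpha>\<^sup>2 - 1/4" by (simp add: power2_eq_square algebra_simps)
  also have "(\<beta> + 1/2) - (\<beta> + 1/2)\<^sup>2 = 1/4 - \<beta>\<^sup>2" by (simp add: power2_eq_square algebra_simps)
  finally show ?thesis by (simp add: qA_def s_def c_def jac_rho_def add_ac)
qed

lemma un_deriv: "x > 0 ==> (un l has_real_derivative vn l x) (at x)"
  unfolding un_def[abs_def] vn_def
  by (rule DERIV_cong[OF DERIV_mult[OF sA_deriv rphi_deriv]]) (auto simp: algebra_simps)

lemma vn_deriv: assumes x: "x > 0" shows "(vn l has_real_derivative (qA x - l\<^sup>2) * un l x) (at x)"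
proof -
  let ?h' = "- (\<alpha> + 1/2) / (sinh x)\<^sup>2 + (\<beta> + 1/2) / (cosh x)\<^sup>2"
  have "(vn l has_real_derivative hA x * sA x * (rdphi l x + hA x * rphi l x)
      + ((- 2 * hA x * rdphi l x - \<kappa> l * rphi l x) + (?h' * rphi l x + rdphi l x * hA x)) * sA x) (at x)"
    unfolding vn_def[abs_def]
    by (rule DERIV_mult[OF sA_deriv[OF x] DERIV_add[OF rdphi_deriv[OF x] DERIV_mult[OF hA_deriv[OF x] rphi_deriv]]])
  moreover have "hA x * sA x * (rdphi l x + hA x * rphi l x)
      + ((- 2 * hA x * rdphi l x - \<kappa> l * rphi l x) + (?h' * rphi l x + rdphi l x * hA x)) * sA x
    = (((hA x)\<^sup>2 + ?h') - \<kappa> l) * un l x" unfolding un_def by (simp only: power2_eq_square) (simp only: algebra_simps)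
  ultimately show ?thesis unfolding hA_riccati[OF x] \<kappa>_def by simp
qed

lemma qA_le: assumes "x > 0" shows "\<bar>qA x\<bar> <= Cq / (sinh x)\<^sup>2"
proof -
  have "(sinh x)\<^sup>2 <= (cosh x)\<^sup>2" by (simp add: cosh_square_eq)
  then have "\<bar>1/4 - \<beta>\<^sup>2\<bar> / (cosh x)\<^sup>2 <= \<bar>1/4 - \<beta>\<^sup>2\<bar> / (sinh x)\<^sup>2"
    using assms by (intro divide_left_mono) auto
  moreover have "\<bar>qA x\<bar> <= \<bar>\<alpha>\<^sup>2 - 1/4\<bar> / (sinh x)\<^sup>2 + \<bar>1/4 - \<beta>\<^sup>2\<bar> / (cosh x)\<^sup>2"
    unfolding qA_def by (rule order_trans[OF abs_triangle_ineq]) simp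
  ultimately show ?thesis by (simp add: Cq_def add_divide_distrib)
qed

text \<open>The energy of a free oscillation of frequency l; it would be constant in x if the
  potential vanished.\<close>

definition en :: "real => real => real" where "en l x = (vn l x)\<^sup>2 + l\<^sup>2 * (un l x)\<^sup>2"

lemma en_deriv: "x > 0 ==> (en l has_real_derivative 2 * qA x * (un l x * vn l x)) (at x)"
  unfolding en_def[abs_def]
  by (rule derivative_eq_intros un_deriv vn_deriv refl | assumption)+ (simp add: algebra_simps power2_eq_square)

text \<open>The left-hand side is the integral of 1/sinh^2 from x to y, the total effect of the
  bound for the potential.\<close>

lemma coth_diff: assumes "0 < x" "x <= (y::real)" shows "cosh x / sinh x - cosh y / sinh y <= 1 / x"
proof -
  have "1 <= cosh y / sinh y" using assms sinh_less_cosh_real[of y] by (simp add: field_simps less_imp_le)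
  moreover have "cosh x / sinh x - 1 <= 1 / x"
  proof -
    have "cosh x / sinh x - 1 = exp (- x) / sinh x" using assms by (simp add: field_simps cosh_minus_sinh[symmetric])
    also have "... <= 1 / x" using assms sinh_real_ge_self[of x] by (intro frac_le) auto
    finally show ?thesis .
  qed
  ultimately show ?thesis by linarith
qed

text \<open>The logarithmic derivative of the energy is at most \<open>Cq\<close> / (l sinh^2) in
  absolute value, since l |u v| is at most half the energy. The antiderivative of this bound is a
  multiple of coth, which gives the integrating factor in both directions.\<close>

lemma en_growth:
  assumes l: "l > 0" and x: "0 < x" "x <= y"
  shows "en l y <= en l x * exp (Cq / (l * x))" "en l x * exp (- (Cq / (l * x))) <= en l y"
proof -
  define k where "k = Cq / l"
  have k: "k >= 0" using Cq_nonneg l by (simp add: k_def)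
  have en0: "en l z >= 0" for z by (simp add: en_def)
  let ?c = "\<lambda>z. cosh z / sinh z :: real"
  have b: "\<bar>2 * qA z * (un l z * vn l z)\<bar> <= k / (sinh z)\<^sup>2 * en l z" if "z > 0" for z
  proof -
    have "2 * (l * \<bar>un l z\<bar> * \<bar>vn l z\<bar>) <= en l z"
      using sum_squares_bound[of "l * \<bar>un l z\<bar>" "\<bar>vn l z\<bar>"] by (simp add: en_def power_mult_distrib mult.assoc)
    then have "2 * (\<bar>un l z\<bar> * \<bar>vn l z\<bar>) <= en l z / l" using l by (simp add: field_simps)
    then have "\<bar>qA z\<bar> * (2 * (\<bar>un l z\<bar> * \<bar>vn l z\<bar>)) <= (Cq / (sinh z)\<^sup>2) * (en l z / l)"
      using qA_le[OF that] by (intro mult_mono) auto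
    then show ?thesis by (simp add: abs_mult k_def mult_ac)
  qed
  have up: "en l y * exp (k * ?c y) <= en l x * exp (k * ?c x)"
  proof (rule DERIV_nonpos_imp_nonincreasing[OF x(2)])
    fix z assume z: "x <= z" "z <= y"
    then have z0: "z > 0" using x by simp
    have "((\<lambda>z. en l z * exp (k * ?c z)) has_real_derivative
       2 * qA z * (un l z * vn l z) * exp (k * ?c z) + exp (k * ?c z) * (k * (- 1 / (sinh z)\<^sup>2)) * en l z) (at z)"
      by (intro DERIV_mult en_deriv z0 DERIV_chain2[OF DERIV_exp] DERIV_cmult coth_deriv)
    moreover have "2 * qA z * (un l z * vn l z) * exp (k * ?c z) + exp (k * ?c z) * (k * (- 1 / (sinh z)\<^sup>2)) * en l z
      = exp (k * ?c z) * (2 * qA z * (un l z * vn l z) - k / (sinh z)\<^sup>2 * en l z)" by (simp add: algebra_simps)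
    moreover have "exp (k * ?c z) * (2 * qA z * (un l z * vn l z) - k / (sinh z)\<^sup>2 * en l z) <= 0"
      using b[OF z0] by (intro mult_nonneg_nonpos) auto
    ultimately show "\<exists>d. ((\<lambda>z. en l z * exp (k * ?c z)) has_real_derivative d) (at z) \<and> d <= 0"
      by (intro exI conjI) (assumption, simp only:)
  qed
  have lo: "en l x * exp (- k * ?c x) <= en l y * exp (- k * ?c y)"
  proof (rule DERIV_nonneg_imp_nondecreasing[OF x(2)])
    fix z assume z: "x <= z" "z <= y"
    then have z0: "z > 0" using x by simp
    have "((\<lambda>z. en l z * exp (- k * ?c z)) has_real_derivative
       2 * qA z * (un l z * vn l z) * exp (- k * ?c z) + exp (- k * ?c z) * (- k * (- 1 / (sinh z)\<^sup>2)) * en l z) (at z)"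
      by (intro DERIV_mult en_deriv z0 DERIV_chain2[OF DERIV_exp] DERIV_cmult coth_deriv)
    moreover have "2 * qA z * (un l z * vn l z) * exp (- k * ?c z) + exp (- k * ?c z) * (- k * (- 1 / (sinh z)\<^sup>2)) * en l z
      = exp (- k * ?c z) * (2 * qA z * (un l z * vn l z) + k / (sinh z)\<^sup>2 * en l z)" by (simp add: algebra_simps)
    moreover have "exp (- k * ?c z) * (2 * qA z * (un l z * vn l z) + k / (sinh z)\<^sup>2 * en l z) >= 0"
      using b[OF z0] by (intro mult_nonneg_nonneg) auto
    ultimately show "\<exists>d. ((\<lambda>z. en l z * exp (- k * ?c z)) has_real_derivative d) (at z) \<and> d >= 0"
      by (intro exI conjI) (assumption, simp only:)
  qed
  have kc: "k * (?c x - ?c y) <= Cq / (l * x)"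
    using mult_left_mono[OF coth_diff[OF x] k] by (simp add: k_def)
  have "en l y = en l y * exp (k * ?c y) * exp (- k * ?c y)" by (simp add: exp_minus)
  also have "... <= en l x * exp (k * ?c x) * exp (- k * ?c y)" using up by (intro mult_right_mono) auto
  also have "... = en l x * exp (k * (?c x - ?c y))" by (simp add: right_diff_distrib exp_diff exp_minus divide_inverse)
  also have "... <= en l x * exp (Cq / (l * x))" using kc en0 by (intro mult_left_mono) auto
  finally show "en l y <= en l x * exp (Cq / (l * x))" .
  have "en l x * exp (- (Cq / (l * x))) <= en l x * exp (- (k * (?c x - ?c y)))" using kc en0 by (intro mult_left_mono) auto
  also have "... = en l x * exp (- k * ?c x) * exp (k * ?c y)" by (simp add: algebra_simps exp_diff exp_minus divide_inverse)
  also have "... <= en l y * exp (- k * ?c y) * exp (k * ?c y)" using lo by (intro mult_right_mono) auto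
  also have "... = en l y" by (simp add: exp_minus)
  finally show "en l x * exp (- (Cq / (l * x))) <= en l y" .
qed

lemma inverse_sinh_sq_le: assumes "x >= (1::real)" shows "1 / (sinh x)\<^sup>2 <= 16 * exp (- 2 * x)"
proof -
  have "exp (1::real) >= 2" using exp_ge_add_one_self[of "1::real"] by simp
  also have "exp 1 <= exp x" using assms by simp
  finally have e2: "exp x >= 2" .
  have "exp (- x) <= 1" using assms by simp
  moreover have "sinh x = exp x / 2 - exp (- x) / 2" by (simp add: sinh_field_def field_simps)
  ultimately have "sinh x >= exp x / 4" using e2 by linarith
  then have "(exp x / 4)\<^sup>2 <= (sinh x)\<^sup>2" by (intro power_mono) auto
  then have "1 / (sinh x)\<^sup>2 <= 1 / (exp x / 4)\<^sup>2" using assms by (intro divide_left_mono mult_pos_pos) auto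
  also have "... = 16 * exp (- 2 * x)"
  proof -
    have "exp (- 2 * x) = 1 / (exp x)\<^sup>2"
      by (simp add: exp_minus power2_eq_square exp_add[symmetric] divide_inverse)
    then show ?thesis by (simp add: power_divide)
  qed
  finally show ?thesis .
qed

text \<open>The bound of \<open>en_growth\<close> deteriorates like exp(const / l) for small l. The
  added term exp(-x) u^2 keeps the energy from degenerating: beyond x = 1 the potential is at most a
  multiple of exp(-2x), and the logarithmic growth rate of the modified energy is at most M
  exp(-z/2), which is integrable uniformly in l.\<close>

lemma low_energy:
  assumes x: "x >= 1"
  shows "l\<^sup>2 * (un l x)\<^sup>2 <= ((vn l 1)\<^sup>2 + (l\<^sup>2 + 1) * (un l 1)\<^sup>2) * exp (2 * (16 * Cq + 1))"
proof -
  define M where "M = 16 * Cq + 1"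
  have M: "M >= 0" using Cq_nonneg by (simp add: M_def)
  define E where "E = (\<lambda>x. (vn l x)\<^sup>2 + (l\<^sup>2 + exp (- x)) * (un l x)\<^sup>2)"
  have "E x * exp (2 * M * exp (- x / 2)) <= E 1 * exp (2 * M * exp (- 1 / 2))"
  proof (rule DERIV_nonpos_imp_nonincreasing[OF x])
    fix z assume z: "1 <= z" "z <= x"
    then have z0: "z > 0" by simp
    let ?u = "un l z" and ?v = "vn l z"
    let ?D = "2 * ?v * ((qA z - l\<^sup>2) * ?u) + (- exp (- z) * ?u\<^sup>2 + (l\<^sup>2 + exp (- z)) * (2 * ?u * ?v))"
    have dE: "(E has_real_derivative ?D) (at z)"
      unfolding E_def
      by (rule derivative_eq_intros un_deriv vn_deriv refl z0 | simp)+ (simp add: power2_eq_square algebra_simps)?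
    have d: "((\<lambda>z. E z * exp (2 * M * exp (- z / 2))) has_real_derivative
       ?D * exp (2 * M * exp (- z / 2)) + exp (2 * M * exp (- z / 2)) * (2 * M * (exp (- z / 2) * (- 1 / 2))) * E z) (at z)"
      by (intro DERIV_mult dE DERIV_chain2[OF DERIV_exp] DERIV_cmult DERIV_cdivide DERIV_minus DERIV_ident)
    have "?D = 2 * (qA z + exp (- z)) * (?u * ?v) - exp (- z) * ?u\<^sup>2" by (simp add: algebra_simps power2_eq_square)
    also have "... <= \<bar>2 * (qA z + exp (- z)) * (?u * ?v)\<bar>" 
    proof -
      have "a - b <= \<bar>a\<bar>" if "b >= 0" for a b :: real using that by linarith
      from this show ?thesis by simp
    qed
    also have "... = \<bar>qA z + exp (- z)\<bar> * (2 * (\<bar>?u\<bar> * \<bar>?v\<bar>))" by (simp only: abs_mult abs_numeral mult_ac)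
    also have "... <= (M * exp (- z)) * (exp (z / 2) * E z)"
    proof (rule mult_mono)
      have "\<bar>qA z\<bar> <= Cq * (1 / (sinh z)\<^sup>2)" using qA_le[OF z0] by simp
      also have "... <= Cq * (16 * exp (- 2 * z))" using inverse_sinh_sq_le[OF z(1)] Cq_nonneg by (intro mult_left_mono)
      also have "... <= Cq * (16 * exp (- z))" using Cq_nonneg z0 by (intro mult_left_mono) auto
      finally have q1: "\<bar>qA z\<bar> <= Cq * (16 * exp (- z))" .
      have "\<bar>qA z + exp (- z)\<bar> <= \<bar>qA z\<bar> + exp (- z)" by (rule order_trans[OF abs_triangle_ineq]) simp
      with q1 show "\<bar>qA z + exp (- z)\<bar> <= M * exp (- z)" by (simp add: M_def algebra_simps)
      have "2 * (exp (- z / 2) * \<bar>?u\<bar>) * \<bar>?v\<bar> <= (exp (- z / 2) * \<bar>?u\<bar>)\<^sup>2 + \<bar>?v\<bar>\<^sup>2" by (rule sum_squares_bound)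
      also have "(exp (- z / 2) * \<bar>?u\<bar>)\<^sup>2 = exp (- z) * ?u\<^sup>2"
        by (simp add: power_mult_distrib power2_eq_square[of "exp _"] exp_add[symmetric])
      also have "exp (- z) * ?u\<^sup>2 + \<bar>?v\<bar>\<^sup>2 <= E z" unfolding E_def by (simp add: algebra_simps)
      finally have "exp (z / 2) * (2 * (exp (- z / 2) * \<bar>?u\<bar>) * \<bar>?v\<bar>) <= exp (z / 2) * E z" by (intro mult_left_mono) auto
      then show "2 * (\<bar>?u\<bar> * \<bar>?v\<bar>) <= exp (z / 2) * E z" by (simp add: exp_minus field_simps)
    qed (use M in auto)
    also have "... = M * exp (- z / 2) * E z"
    proof -
      have "exp (- z) * exp (z / 2) = exp (- z / 2)" by (simp add: exp_add[symmetric])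
      then show ?thesis by (metis mult.assoc)
    qed
    finally have "?D - M * exp (- z / 2) * E z <= 0" by simp
    then have "exp (2 * M * exp (- z / 2)) * (?D - M * exp (- z / 2) * E z) <= 0" by (intro mult_nonneg_nonpos) auto
    moreover have "?D * exp (2 * M * exp (- z / 2)) + exp (2 * M * exp (- z / 2)) * (2 * M * (exp (- z / 2) * (- 1 / 2))) * E z
       = exp (2 * M * exp (- z / 2)) * (?D - M * exp (- z / 2) * E z)" by (simp add: algebra_simps)
    ultimately show "\<exists>d. ((\<lambda>z. E z * exp (2 * M * exp (- z / 2))) has_real_derivative d) (at z) \<and> d <= 0"
      using d by (intro exI conjI) (assumption, simp only:)
  qed
  moreover have "l\<^sup>2 * (un l x)\<^sup>2 <= E x * exp (2 * M * exp (- x / 2))"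
  proof -
    have "l\<^sup>2 * (un l x)\<^sup>2 <= E x" unfolding E_def by (simp add: algebra_simps)
    also have "... <= E x * exp (2 * M * exp (- x / 2))"
    proof -
      have "E x >= 0" unfolding E_def by (intro add_nonneg_nonneg mult_nonneg_nonneg) auto
      moreover have "1 <= exp (2 * M * exp (- x / 2))" using M by simp
      ultimately show ?thesis using mult_left_mono[of 1 "exp (2 * M * exp (- x / 2))" "E x"] by simp
    qed
    finally show ?thesis .
  qed
  moreover have "E 1 * exp (2 * M * exp (- 1 / 2)) <= ((vn l 1)\<^sup>2 + (l\<^sup>2 + 1) * (un l 1)\<^sup>2) * exp (2 * M)"
    unfolding E_def using M by (intro mult_mono add_mono mult_right_mono) (auto intro: mult_left_le)
  ultimately show ?thesis unfolding M_def by linarith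
qed

lemma A_small: "\<exists>C>0. \<forall>x. 0 < x \<and> x <= 1 \<longrightarrow> A x <= C * x powr (2*\<alpha>+1)"
proof -
  define C where "C = 2 powr (2*\<rho>) * cosh 1 powr (2*\<alpha>+1) * cosh 1 powr (2*\<beta>+1)"
  have "C > 0" by (simp add: C_def)
  moreover have "A x <= C * x powr (2*\<alpha>+1)" if x: "0 < x" "x <= 1" for x
  proof -
    have c: "cosh x <= cosh 1" using x by (simp add: cosh_real_nonneg_le_iff)
    have "cosh 1 * 0 - sinh 0 <= cosh 1 * x - sinh x"
    proof (rule DERIV_nonneg_imp_nondecreasing[where f="\<lambda>x. cosh 1 * x - sinh x" and a=0 and b=x])
      fix z assume z: "0 <= z" "z <= x"
      have "((\<lambda>x. cosh 1 * x - sinh x) has_real_derivative cosh 1 - cosh z) (at z)"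
        by (auto intro!: derivative_eq_intros)
      moreover have "cosh 1 - cosh z >= 0" using z x by (simp add: cosh_real_nonneg_le_iff)
      ultimately show "\<exists>d. ((\<lambda>x. cosh 1 * x - sinh x) has_real_derivative d) (at z) \<and> 0 <= d" by blast
    qed (use x in simp)
    then have s: "sinh x <= cosh 1 * x" by simp
    have "sinh x powr (2*\<alpha>+1) <= (cosh 1 * x) powr (2*\<alpha>+1)" using s x \<alpha>_gt by (intro powr_mono2) auto
    moreover have "cosh x powr (2*\<beta>+1) <= cosh 1 powr (2*\<beta>+1)" using c \<beta>_ge by (intro powr_mono2) auto
    ultimately have "A x <= 2 powr (2*\<rho>) * (cosh 1 * x) powr (2*\<alpha>+1) * cosh 1 powr (2*\<beta>+1)"
      unfolding jac_A_def by (intro mult_mono) auto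
    also have "... = C * x powr (2*\<alpha>+1)" using x by (simp add: C_def powr_mult)
    finally show ?thesis .
  qed
  ultimately show ?thesis by blast
qed

end

lemma real_root_between:
  fixes f :: "real => real"
  assumes "p <= q" "continuous_on {p..q} f" "f p * f q <= 0"
  shows "\<exists>z. p <= z \<and> z <= q \<and> f z = 0"
proof (cases "f p <= 0")
  case True
  show ?thesis
  proof (cases "f q >= 0")
    case True
    then show ?thesis using IVT'[of f p 0 q] \<open>f p <= 0\<close> assms by auto
  next
    case False
    then have "f p = 0" using True assms(3) by (metis mult_le_0_iff order_antisym linorder_not_le)
    then show ?thesis using assms(1) by blast
  qed
next
  case False
  then have "f q <= 0" using assms(3) by (simp add: mult_le_0_iff)
  then show ?thesis using IVT2'[of f q 0 p] False assms by auto
qed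

section \<open>Amplitude of the Jacobi functions and their zeros in the spectral parameter\<close>

context jacobi begin

lemma wt_le: "\<exists>K>0. (\<forall>l\<ge>1. wt l <= K * l powr (2*\<alpha>+1)) \<and> (\<forall>l. 0 < l \<and> l <= 1 \<longrightarrow> wt l <= K * l\<^sup>2)"
proof -
  define e where "e = 2*\<alpha> - 1"
  define K where "K = 2 powr \<bar>e\<bar> * 2 powr e"
  have K: "K > 0" by (simp add: K_def)
  have 1: "wt l <= K * l powr (2*\<alpha>+1)" if l: "l >= 1" for l
  proof -
    have "(1 + l) powr e <= 2 powr \<bar>e\<bar> * (2 * l) powr e" using l by (intro powr_half_compare) auto
    also have "... = K * l powr e" using l by (simp add: K_def powr_mult)
    finally have "l\<^sup>2 * (1 + l) powr e <= l\<^sup>2 * (K * l powr e)" by (intro mult_left_mono) auto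
    also have "... = K * (l powr 2 * l powr e)" using l by (simp add: powr_numeral)
    also have "l powr 2 * l powr e = l powr (2*\<alpha>+1)" by (subst powr_add[symmetric]) (simp add: e_def add.commute)
    finally show ?thesis by (simp add: wt_def e_def)
  qed
  have 2: "wt l <= K * l\<^sup>2" if l: "0 < l" "l <= 1" for l
  proof -
    have "(1 + l) powr e <= 2 powr \<bar>e\<bar> * 2 powr e" using l by (intro powr_half_compare) auto
    then have "l\<^sup>2 * (1 + l) powr e <= l\<^sup>2 * K" unfolding K_def by (intro mult_left_mono) auto
    then show ?thesis by (simp add: wt_def e_def mult.commute)
  qed
  show ?thesis using K 1 2 by blast
qed

lemma sA_sq: "(sA x)\<^sup>2 = A x" by (simp add: sA_def A_nonneg)

lemma un_sq: "(un l x)\<^sup>2 = A x * (rphi l x)\<^sup>2" by (simp add: un_def power_mult_distrib sA_sq)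

lemma vn_sq_le: assumes "x >= 0" shows "(vn l x)\<^sup>2 <= A x * (2 * \<kappa> l + 2 * (hA x)\<^sup>2)"
proof -
  have "(rdphi l x + hA x * rphi l x)\<^sup>2 <= 2 * (rdphi l x)\<^sup>2 + 2 * (hA x * rphi l x)\<^sup>2"
    using sum_squares_bound[of "rdphi l x" "hA x * rphi l x"] by (simp add: power2_sum)
  also have "(hA x * rphi l x)\<^sup>2 <= (hA x)\<^sup>2"
    using rphi_le_1[OF assms, of l] by (simp add: power_mult_distrib mult_left_le abs_square_le_1)
  also have "(rdphi l x)\<^sup>2 <= \<kappa> l" by (rule rdphi_sq_le[OF assms])
  finally have "(rdphi l x + hA x * rphi l x)\<^sup>2 <= 2 * \<kappa> l + 2 * (hA x)\<^sup>2" by simp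
  then show ?thesis unfolding vn_def power_mult_distrib sA_sq by (intro mult_left_mono A_nonneg)
qed

text \<open>Up to x = 1/l (for l at least 1) or x = 1 (for l at most 1) the bound |\<phi>| at most 1
  and the size of A suffice. Beyond that point the energy estimate started there takes over,
  \<open>en_growth\<close> in the first case and \<open>low_energy\<close> in the second. The result
  bounds the squared norm of \<phi>_l on [0, R] by R C / \<open>wt l\<close>, the normalisation that
  Bessel's inequality needs.\<close>

lemma amplitude: "\<exists>C>0. \<forall>l>0. \<forall>x>0. A x * (rphi l x)\<^sup>2 * wt l <= C"
proof -
  obtain C1 where C1: "C1 > 0" "\<And>x. 0 < x ==> x <= 1 ==> A x <= C1 * x powr (2*\<alpha>+1)" using A_small by blast
  obtain K where K: "K > 0" "\<And>l. l >= 1 ==> wt l <= K * l powr (2*\<alpha>+1)" "\<And>l. 0 < l ==> l <= 1 ==> wt l <= K * l\<^sup>2"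
    using wt_le by blast
  have r1: "(rphi l x)\<^sup>2 <= 1" if "x > 0" for l x using rphi_le_1[of x l] that by (simp add: abs_square_le_1)
  have unA: "A x * (rphi l x)\<^sup>2 <= A x" if "x > 0" for l x using r1[OF that] A_nonneg[of x] by (simp add: mult_left_le)
  define C4 where "C4 = 2 * (1 + \<rho>\<^sup>2) + 2 * Hc\<^sup>2 + 1"
  define C5 where "C5 = A 1 * (2 * (1 + \<rho>\<^sup>2) + 2 * (hA 1)\<^sup>2 + 2) * exp (2 * (16 * Cq + 1))"
  have C4: "C4 > 0" unfolding C4_def by (intro add_nonneg_pos add_nonneg_nonneg) auto
  have C5: "C5 >= 0" unfolding C5_def using A_nonneg[of 1] by (intro mult_nonneg_nonneg add_nonneg_nonneg) auto
  have hi1: "A x * (rphi l x)\<^sup>2 * wt l <= C1 * K" if l: "l >= 1" and x: "0 < x" "x <= 1 / l" for l x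
  proof -
    have i: "0 < 1 / l" "1 / l <= 1" using l by auto
    have "A x * (rphi l x)\<^sup>2 <= A x" by (rule unA[OF x(1)])
    also have "... <= A (1 / l)" using x by (intro A_mono) auto
    also have "... <= C1 * (1 / l) powr (2*\<alpha>+1)" by (rule C1(2)[OF i])
    finally have b: "A x * (rphi l x)\<^sup>2 <= C1 * (1 / l) powr (2*\<alpha>+1)" .
    have "A x * (rphi l x)\<^sup>2 * wt l <= C1 * (1 / l) powr (2*\<alpha>+1) * (K * l powr (2*\<alpha>+1))"
      by (rule mult_mono[OF b K(2)[OF l]]) (use C1(1) wt_pos[of l] l in auto)
    also have "... = C1 * K * (1 / l * l) powr (2*\<alpha>+1)" using l by (subst powr_mult) auto
    finally show ?thesis using l by simp
  qed
  have hi2: "A x * (rphi l x)\<^sup>2 * wt l <= C4 * exp Cq * (C1 * K)" if l: "l >= 1" and x: "1 / l <= x" for l x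
  proof -
    \<comment> \<open>The scale at which oscillation sets in: there l t = 1, so the exponential in
      \<open>en_growth\<close> is the constant exp \<open>Cq\<close>.\<close>
    define t where "t = 1 / l"
    have t: "0 < t" "t <= 1" "t <= x" "l * t = 1" using l x by (auto simp: t_def)
    have "(vn l t)\<^sup>2 <= A t * (2 * \<kappa> l + 2 * (hA t)\<^sup>2)" using t by (intro vn_sq_le) auto
    also have "... <= A t * (2 * (l\<^sup>2 * (1 + \<rho>\<^sup>2)) + 2 * (l\<^sup>2 * Hc\<^sup>2))"
    proof (intro mult_left_mono add_mono A_nonneg)
      have "1 <= l\<^sup>2" using l by (simp add: power2_eq_square mult_ge1_I)
      then have "\<rho>\<^sup>2 * 1 <= \<rho>\<^sup>2 * l\<^sup>2" by (intro mult_left_mono) auto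
      then show "\<kappa> l <= l\<^sup>2 * (1 + \<rho>\<^sup>2)" by (simp add: \<kappa>_def algebra_simps)
      have "t * hA t <= Hc" by (rule x_hA_le[OF t(1,2)])
      then have "hA t <= l * Hc" using l by (simp add: t_def field_simps)
      then have "(hA t)\<^sup>2 <= (l * Hc)\<^sup>2" using hA_nonneg[OF t(1)] by (intro power_mono) auto
      then show "(hA t)\<^sup>2 <= l\<^sup>2 * Hc\<^sup>2" by (simp add: power_mult_distrib)
    qed auto
    finally have "en l t <= A t * (2 * (l\<^sup>2 * (1 + \<rho>\<^sup>2)) + 2 * (l\<^sup>2 * Hc\<^sup>2)) + l\<^sup>2 * A t"
      unfolding en_def un_sq using unA[OF t(1), of l] by (intro add_mono mult_left_mono) auto
    also have "... = l\<^sup>2 * (C4 * A t)" by (simp add: C4_def algebra_simps)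
    finally have et: "en l t <= l\<^sup>2 * (C4 * A t)" .
    have "l\<^sup>2 * (un l x)\<^sup>2 <= en l x" by (simp add: en_def)
    also have "... <= en l t * exp (Cq / (l * t))" using l t by (intro en_growth) auto
    also have "... <= l\<^sup>2 * (C4 * A t) * exp Cq" using et t by (simp add: mult_right_mono)
    finally have "l\<^sup>2 * (un l x)\<^sup>2 <= l\<^sup>2 * (C4 * A t * exp Cq)" by (simp add: mult_ac)
    then have "(un l x)\<^sup>2 <= C4 * A t * exp Cq" using l by (simp add: mult_le_cancel_left_pos)
    also have "... <= C4 * (C1 * t powr (2*\<alpha>+1)) * exp Cq" using C1(2)[OF t(1,2)] C4 by (intro mult_right_mono mult_left_mono) auto
    finally have b: "A x * (rphi l x)\<^sup>2 <= C4 * (C1 * t powr (2*\<alpha>+1)) * exp Cq" unfolding un_sq .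
    have "A x * (rphi l x)\<^sup>2 * wt l <= C4 * (C1 * t powr (2*\<alpha>+1)) * exp Cq * (K * l powr (2*\<alpha>+1))"
      by (rule mult_mono[OF b K(2)[OF l]]) (use C1(1) C4 wt_pos[of l] l in auto)
    also have "... = C4 * exp Cq * (C1 * K) * (t * l) powr (2*\<alpha>+1)" using l t by (subst powr_mult) auto
    also have "t * l = 1" using t by (simp add: mult.commute)
    finally show ?thesis by simp
  qed
  have lo1: "A x * (rphi l x)\<^sup>2 * wt l <= A 1 * K" if l: "0 < l" "l <= 1" and x: "0 < x" "x <= 1" for l x
  proof -
    have "wt l <= K * l\<^sup>2" by (rule K(3)[OF l])
    also have "... <= K" using l K(1) by (simp add: abs_square_le_1 mult_left_le)
    finally have w: "wt l <= K" .
    have "A x * (rphi l x)\<^sup>2 <= A x" by (rule unA[OF x(1)])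
    also have "... <= A 1" using x by (intro A_mono) auto
    finally have b: "A x * (rphi l x)\<^sup>2 <= A 1" .
    show ?thesis by (rule mult_mono[OF b w]) (use wt_pos[OF l(1)] A_nonneg[of 1] in auto)
  qed
  have lo2: "A x * (rphi l x)\<^sup>2 * wt l <= C5 * K" if l: "0 < l" "l <= 1" and x: "x >= 1" for l x
  proof -
    have l2: "l\<^sup>2 <= 1" using l by (simp add: abs_square_le_1)
    have "(vn l 1)\<^sup>2 <= A 1 * (2 * \<kappa> l + 2 * (hA 1)\<^sup>2)" by (intro vn_sq_le) auto
    also have "... <= A 1 * (2 * (1 + \<rho>\<^sup>2) + 2 * (hA 1)\<^sup>2)"
      using l2 by (intro mult_left_mono A_nonneg add_mono) (auto simp: \<kappa>_def)
    finally have "(vn l 1)\<^sup>2 + (l\<^sup>2 + 1) * (un l 1)\<^sup>2 <= A 1 * (2 * (1 + \<rho>\<^sup>2) + 2 * (hA 1)\<^sup>2) + 2 * A 1"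
      unfolding un_sq using unA[of 1 l] l2 by (intro add_mono mult_mono) (auto simp: A_nonneg)
    also have "... = A 1 * (2 * (1 + \<rho>\<^sup>2) + 2 * (hA 1)\<^sup>2 + 2)" by (simp add: algebra_simps)
    finally have "((vn l 1)\<^sup>2 + (l\<^sup>2 + 1) * (un l 1)\<^sup>2) * exp (2 * (16 * Cq + 1)) <= C5"
      unfolding C5_def by (intro mult_right_mono) auto
    with low_energy[OF x, of l] have 1: "l\<^sup>2 * (un l x)\<^sup>2 <= C5" by linarith
    have "A x * (rphi l x)\<^sup>2 * wt l <= A x * (rphi l x)\<^sup>2 * (K * l\<^sup>2)"
      using K(3)[OF l] A_nonneg[of x] by (intro mult_left_mono) auto
    also have "... = (l\<^sup>2 * (un l x)\<^sup>2) * K" by (simp add: un_sq mult_ac)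
    also have "... <= C5 * K" using 1 K(1) by (intro mult_right_mono) auto
    finally show ?thesis .
  qed
  define C where "C = C1 * K + C4 * exp Cq * (C1 * K) + A 1 * K + C5 * K"
  have pos: "C1 * K > 0" "C4 * exp Cq * (C1 * K) > 0" "A 1 * K > 0" "C5 * K >= 0"
    using C1(1) K(1) C4 C5 A_pos[of 1] by auto
  have "A x * (rphi l x)\<^sup>2 * wt l <= C" if "l > 0" "x > 0" for l x
  proof (cases "l >= 1")
    case True
    show ?thesis using hi1[OF True that(2)] hi2[OF True, of x] pos unfolding C_def
      by (cases "x <= 1 / l") auto
  next
    case False
    then have "l <= 1" by simp
    from lo1[OF that(1) this that(2)] lo2[OF that(1) this, of x] pos show ?thesis unfolding C_def
      by (cases "x <= 1") auto
  qed
  moreover have "C > 0" using pos unfolding C_def by linarith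
  ultimately show ?thesis by blast
qed

lemma wt_ge: assumes "0 < a" shows "\<exists>w>0. \<forall>l. a <= l \<and> l <= b \<longrightarrow> w <= wt l"
proof -
  define e where "e = 2*\<alpha> - 1"
  have main: "a\<^sup>2 * (1 + b) powr (- \<bar>e\<bar>) <= wt l" if l: "a <= l" "l <= b" for l
  proof -
    have "(1 + b) powr (- \<bar>e\<bar>) <= (1 + l) powr e"
    proof (cases "e >= 0")
      case True
      have "(1 + b) powr (- \<bar>e\<bar>) <= (1 + b) powr 0" using assms l by (intro powr_mono) auto
      also have "... = 1" using assms l by simp
      also have "1 <= (1 + l) powr e" using assms l True by (intro ge_one_powr_ge_zero) auto
      finally show ?thesis .
    next
      case False
      then show ?thesis using assms l by (auto intro!: powr_mono2')
    qed
    moreover have "a\<^sup>2 <= l\<^sup>2" using assms l by (intro power_mono) auto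
    ultimately show ?thesis unfolding wt_def e_def by (intro mult_mono) auto
  qed
  show ?thesis
  proof (cases "b >= 0")
    case True
    then have "a\<^sup>2 * (1 + b) powr (- \<bar>e\<bar>) > 0" using assms by simp
    then show ?thesis using main by blast
  next
    case False
    then show ?thesis using assms by (intro exI[of _ 1]) auto
  qed
qed

text \<open>The free rotation is removed: for zero potential v + i l u is a multiple of exp(i l x),
  so this quantity would not depend on x. Its actual derivative contains only the integrable term q
  u.\<close>

definition yn :: "real => real => complex" where
  "yn l x = cis (- l * x) * Complex (vn l x) (l * un l x)"

lemma yn_deriv: assumes "x > 0" shows "(yn l has_vector_derivative cis (- l * x) * of_real (qA x * un l x)) (at x)"
proof -
  have 1: "((\<lambda>x. cis (- l * x)) has_vector_derivative (- l) *\<^sub>R (\<i> * cis (- l * x))) (at x)"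
    by (auto intro!: derivative_eq_intros simp: has_vector_derivative_def scaleR_conv_of_real)
  have 2: "((\<lambda>x. Complex (vn l x) (l * un l x)) has_vector_derivative Complex ((qA x - l\<^sup>2) * un l x) (l * vn l x)) (at x)"
    unfolding Complex_eq
    by (intro has_vector_derivative_add has_vector_derivative_mult_right
          bounded_linear.has_vector_derivative[OF bounded_linear_of_real])
       (use vn_deriv[OF assms] un_deriv[OF assms] in
         \<open>simp_all only: has_real_derivative_iff_has_vector_derivative\<close>)
  have "(yn l has_vector_derivative cis (- l * x) * Complex ((qA x - l\<^sup>2) * un l x) (l * vn l x)
      + (- l) *\<^sub>R (\<i> * cis (- l * x)) * Complex (vn l x) (l * un l x)) (at x)"
    unfolding yn_def[abs_def] by (rule has_vector_derivative_mult[OF 1 2])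
  moreover have "cis (- l * x) * Complex ((qA x - l\<^sup>2) * un l x) (l * vn l x)
      + (- l) *\<^sub>R (\<i> * cis (- l * x)) * Complex (vn l x) (l * un l x) = cis (- l * x) * of_real (qA x * un l x)"
    by (simp add: complex_eq_iff algebra_simps power2_eq_square)
  ultimately show ?thesis by simp
qed

lemma norm_yn: "norm (yn l x) = sqrt (en l x)"
  by (simp only: yn_def norm_mult norm_cis mult_1_left complex_norm) (simp add: en_def power_mult_distrib)

text \<open>For large R the amplitude \<open>yn l R\<close> is close to \<open>yn l x0\<close> at a
  fixed x0, hence almost constant while l moves by a multiple of 1/R. Over that range exp(i l R)
  turns appreciably, so the imaginary part l u(R) changes sign. This puts an eigenvalue of the
  problem on [0, R] with zero boundary value at R into every window of length 2 pi / R.\<close>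

lemma phi_zeros:
  assumes a: "0 < a" and ab: "a < b"
  shows "\<exists>R0>0. \<forall>R\<ge>R0. \<forall>l1. a <= l1 \<and> l1 + 2 * pi / R <= b \<longrightarrow>
      (\<exists>l. l1 <= l \<and> l <= l1 + 3 * pi / (2 * R) \<and> rphi l R = 0)"
proof -
  obtain C where C: "C > 0" "\<And>l x. l > 0 ==> x > 0 ==> A x * (rphi l x)\<^sup>2 * wt l <= C" using amplitude by blast
  obtain w where w: "w > 0" "\<And>l. a <= l ==> l <= b ==> w <= wt l" using wt_ge[OF a] by blast
  define Mu where "Mu = sqrt (C / w)"
  have Mu: "\<bar>un l x\<bar> <= Mu" if "a <= l" "l <= b" "x > 0" for l x
  proof -
    have "(un l x)\<^sup>2 * w <= (un l x)\<^sup>2 * wt l" using w(2)[OF that(1,2)] by (intro mult_left_mono) auto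
    also have "... <= C" unfolding un_sq using C(2)[of l x] that a by auto
    finally have "(un l x)\<^sup>2 <= C / w" using w(1) by (simp add: field_simps)
    then show ?thesis unfolding Mu_def by (rule real_le_rsqrt[of "\<bar>un l x\<bar>", simplified])
  qed
  have Mu0: "Mu >= 0" using C(1) w(1) by (simp add: Mu_def)
  \<comment> \<open>Near the origin the function is at least 1/2 for every l in [a, b]; this starts
    a uniform lower bound m^2 for the energy at all later points.\<close>
  define xb where "xb = min 1 (1 / sqrt (\<kappa> b))"
  have xb: "0 < xb" "xb <= 1" using \<kappa>_pos[of b] by (auto simp: xb_def)
  have kxb: "\<kappa> l * xb\<^sup>2 <= 1" if "a <= l" "l <= b" for l
  proof -
    have "\<kappa> l <= \<kappa> b" using that a by (auto simp: \<kappa>_def intro!: power_mono)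
    moreover have "xb\<^sup>2 <= (1 / sqrt (\<kappa> b))\<^sup>2" using xb(1) by (intro power_mono) (auto simp: xb_def)
    ultimately have "\<kappa> l * xb\<^sup>2 <= \<kappa> b * (1 / sqrt (\<kappa> b))\<^sup>2" using \<kappa>_pos[of b] \<kappa>_pos[of l] by (intro mult_mono) auto
    also have "... = 1" using \<kappa>_pos[of b] by (simp add: power_divide)
    finally show ?thesis .
  qed
  define m2 where "m2 = a\<^sup>2 * A xb / 4 * exp (- (Cq / (a * xb)))"
  define m where "m = sqrt m2"
  have m: "m > 0" using a A_pos[OF xb(1)] by (simp add: m_def m2_def)
  have enm: "m <= norm (yn l x)" if l: "a <= l" "l <= b" and x: "xb <= x" for l x
  proof -
    have "rphi l xb >= 1/2" using rphi_ge[of xb l] kxb[OF l] xb by simp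
    then have "(1/2)\<^sup>2 <= (rphi l xb)\<^sup>2" by (intro power_mono) auto
    then have b: "A xb * (1/2)\<^sup>2 <= A xb * (rphi l xb)\<^sup>2" by (intro mult_left_mono A_nonneg)
    have "a\<^sup>2 <= l\<^sup>2" using a l by (intro power_mono) auto
    from mult_mono[OF this b] have "a\<^sup>2 * (A xb * (1/2)\<^sup>2) <= l\<^sup>2 * (A xb * (rphi l xb)\<^sup>2)"
      using A_nonneg[of xb] by auto
    also have "... <= en l xb" by (simp add: en_def un_sq)
    finally have "a\<^sup>2 * A xb / 4 <= en l xb" by (simp add: power2_eq_square)
    moreover have "exp (- (Cq / (a * xb))) <= exp (- (Cq / (l * xb)))"
      using a l xb Cq_nonneg by (auto intro!: divide_left_mono mult_right_mono)
    ultimately have "m2 <= en l xb * exp (- (Cq / (l * xb)))"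
      unfolding m2_def using A_nonneg[of xb] by (intro mult_mono) (auto simp: en_def)
    also have "... <= en l x" using a l xb x by (intro en_growth(2)) auto
    finally show ?thesis by (simp add: m_def norm_yn)
  qed
  \<comment> \<open>From x0 on, the remaining potential moves the amplitude by at most
    \<open>Mu * Cq / x0\<close>, which is at most m/8.\<close>
  define x0 where "x0 = max xb (8 * (Mu * Cq) / m + 1)"
  have x0: "xb <= x0" "0 < x0" using xb by (auto simp: x0_def)
  have yR: "norm (yn l R - yn l x0) <= m / 8" if l: "a <= l" "l <= b" and R: "x0 < R" for l R
  proof -
    have "norm (yn l R - yn l x0) <= (- (Mu * Cq) * (cosh R / sinh R)) - (- (Mu * Cq) * (cosh x0 / sinh x0))"
    proof (rule differentiable_bound_general[OF R, where f'="\<lambda>x. cis (- l * x) * of_real (qA x * un l x)"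
          and \<phi>'="\<lambda>x. - (Mu * Cq) * (- 1 / (sinh x)\<^sup>2)"])
      fix x assume x: "x0 < x" "x < R"
      then have xp: "x > 0" using x0 by simp
      show "(yn l has_vector_derivative cis (- l * x) * of_real (qA x * un l x)) (at x)" by (rule yn_deriv[OF xp])
      show "((\<lambda>x. - (Mu * Cq) * (cosh x / sinh x)) has_vector_derivative - (Mu * Cq) * (- 1 / (sinh x)\<^sup>2)) (at x)"
        using DERIV_cmult[OF coth_deriv[OF xp], of "- (Mu * Cq)"] by (simp only: has_real_derivative_iff_has_vector_derivative)
      have "norm (cis (- l * x) * of_real (qA x * un l x)) = \<bar>un l x\<bar> * \<bar>qA x\<bar>" by (simp add: norm_mult abs_mult)
      also have "... <= Mu * (Cq / (sinh x)\<^sup>2)" using Mu[OF l xp] qA_le[OF xp] Mu0 by (intro mult_mono) auto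
      finally show "norm (cis (- l * x) * of_real (qA x * un l x)) <= - (Mu * Cq) * (- 1 / (sinh x)\<^sup>2)" by simp
    next
      show "continuous_on {x0..R} (yn l)"
        by (intro continuous_at_imp_continuous_on ballI has_vector_derivative_continuous[OF yn_deriv]) (use x0 in auto)
      show "continuous_on {x0..R} (\<lambda>x. - (Mu * Cq) * (cosh x / sinh x))"
        using x0 by (intro continuous_intros) auto
    qed
    also have "... = (Mu * Cq) * (cosh x0 / sinh x0 - cosh R / sinh R)" by (simp add: algebra_simps)
    also have "... <= (Mu * Cq) * (1 / x0)" using coth_diff[OF x0(2), of R] R Mu0 Cq_nonneg by (intro mult_left_mono) auto
    also have "... <= m / 8"
    proof -
      have "8 * (Mu * Cq) / m <= x0" by (simp add: x0_def)
      then show ?thesis using m x0 by (simp add: field_simps)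
    qed
    finally show ?thesis .
  qed
  have cont: "continuous_on {a..b} (\<lambda>l. yn l x0)"
    unfolding yn_def Complex_eq un_def vn_def
    by (intro continuous_intros continuous_at_imp_continuous_on ballI rphi_param_cont x0)
  have "uniformly_continuous_on {a..b} (\<lambda>l. yn l x0)" by (rule compact_uniformly_continuous[OF cont]) simp
  then obtain d where d: "d > 0" "\<And>l l'. l \<in> {a..b} ==> l' \<in> {a..b} ==> dist l' l < d ==> dist (yn l' x0) (yn l x0) < m / 8"
    unfolding uniformly_continuous_on_def using m by (metis zero_less_divide_iff zero_less_numeral)
  define R0 where "R0 = max (x0 + 1) (2 * pi / d)"
  have R0: "R0 > 0" "x0 < R0" using x0 by (auto simp: R0_def)
  show ?thesis
  proof (rule exI[of _ R0], intro conjI allI impI R0)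
    fix R l1 assume R: "R0 <= R" and l1: "a <= l1 \<and> l1 + 2 * pi / R <= b"
    have Rp: "R > 0" "x0 < R" using R R0 by auto
    have "2 * pi / d <= R" using R by (simp add: R0_def)
    then have Rd: "2 * pi / R <= d" using d(1) Rp by (simp add: field_simps)
    \<comment> \<open>Raising l by pi / (2R) multiplies exp(i l R) by i. Four such points lie inside
      one window and show the four quarter turns of the nearly constant amplitude.\<close>
    define lk where "lk = (\<lambda>k::nat. l1 + real k * (pi / (2 * R)))"
    have lk: "a <= lk k" "lk k <= b" "lk k - l1 < d" "l1 <= lk k" "lk k <= l1 + 3 * pi / (2 * R)" if "k <= 3" for k
    proof -
      have p: "pi / (2 * R) > 0" using Rp by simp
      have k3: "real k * (pi / (2 * R)) <= 3 * (pi / (2 * R))" using that p by (intro mult_right_mono) auto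
      have "3 * (pi / (2 * R)) < 2 * pi / R" using Rp by (simp add: field_simps)
      then show "lk k - l1 < d" "lk k <= b" using k3 Rd l1 unfolding lk_def by auto
      have k0: "real k * (pi / (2 * R)) >= 0" using p by (intro mult_nonneg_nonneg) auto
      show "a <= lk k" "l1 <= lk k" using k0 l1 unfolding lk_def by linarith+
      show "lk k <= l1 + 3 * pi / (2 * R)" using k3 unfolding lk_def by simp
    qed
    define W where "W = yn l1 x0"
    define om where "om = cis (l1 * R) * W"
    have "l1 \<in> {a..b}" using lk[of 0] l1 by (auto simp: lk_def)
    then have "m <= norm W" unfolding W_def using enm[of l1 x0] x0 by auto
    then have om: "m <= norm om" by (simp add: om_def norm_mult)
    have f: "\<bar>lk k * un (lk k) R - Im (\<i> ^ k * om)\<bar> <= m / 4" if k: "k <= 3" for k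
    proof -
      have "dist (yn (lk k) x0) (yn l1 x0) < m / 8"
        by (rule d(2)) (use lk[OF k] \<open>l1 \<in> {a..b}\<close> in \<open>auto simp: dist_real_def\<close>)
      moreover have "norm (yn (lk k) R - yn (lk k) x0) <= m / 8" using yR[of "lk k" R] lk[OF k] Rp by auto
      ultimately have E: "norm (yn (lk k) R - W) <= m / 4"
        unfolding W_def dist_norm using norm_triangle_ineq[of "yn (lk k) R - yn (lk k) x0" "yn (lk k) x0 - yn l1 x0"] by simp
      have ck: "cis (lk k * R) = \<i> ^ k * cis (l1 * R)"
      proof -
        have "lk k * R = real k * (pi / 2) + l1 * R" using Rp by (simp add: lk_def field_simps)
        then have "cis (lk k * R) = cis (real k * (pi / 2)) * cis (l1 * R)" by (simp add: cis_mult)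
        also have "cis (real k * (pi / 2)) = cis (pi / 2) ^ k" by (simp only: Complex.DeMoivre)
        finally show ?thesis by simp
      qed
      have "cis (lk k * R) * yn (lk k) R = Complex (vn (lk k) R) (lk k * un (lk k) R)"
        unfolding yn_def by (simp add: mult.assoc[symmetric] cis_mult)
      then have "lk k * un (lk k) R = Im (cis (lk k * R) * yn (lk k) R)" by simp
      then have "lk k * un (lk k) R - Im (\<i> ^ k * om) = Im (cis (lk k * R) * (yn (lk k) R - W))"
        unfolding om_def ck by (simp add: algebra_simps)
      also have "\<bar>...\<bar> <= norm (cis (lk k * R) * (yn (lk k) R - W))" by (rule abs_Im_le_cmod)
      also have "... <= m / 4" using E by (simp add: norm_mult)
      finally show ?thesis .
    qed
    have zero: "\<exists>l. l1 <= l \<and> l <= l1 + 3 * pi / (2 * R) \<and> rphi l R = 0"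
      if ij: "i <= 3" "j <= 3" "i < j" and s: "(lk i * un (lk i) R) * (lk j * un (lk j) R) <= 0" for i j
    proof -
      have ij': "lk i <= lk j" using ij Rp unfolding lk_def by (intro add_left_mono mult_right_mono) auto
      have "lk i > 0" "lk j > 0" using lk[OF ij(1)] lk[OF ij(2)] a by auto
      then have pos: "lk i * lk j * A R > 0" using A_pos[OF Rp(1)] by simp
      have "(lk i * un (lk i) R) * (lk j * un (lk j) R) = (lk i * lk j * A R) * (rphi (lk i) R * rphi (lk j) R)"
        unfolding un_def sA_sq[symmetric] power2_eq_square by (simp only: mult_ac)
      with s pos have "(lk i * lk j * A R) * (rphi (lk i) R * rphi (lk j) R) <= 0" "lk i * lk j * A R > 0" by simp_all
      moreover have "Y <= 0" if "c * Y <= 0" "c > 0" for c Y :: real using that by (simp add: mult_le_0_iff)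
      ultimately have "rphi (lk i) R * rphi (lk j) R <= 0" by blast
      then have "\<exists>z. lk i <= z \<and> z <= lk j \<and> rphi z R = 0"
        using ij' by (intro real_root_between continuous_at_imp_continuous_on ballI rphi_param_cont Rp)
      then show ?thesis using lk(4)[OF ij(1)] lk(5)[OF ij(2)] by (meson order_trans)
    qed
    \<comment> \<open>Two steps reverse the sign of the main term. The main term is at least m/2 and
      each error at most m/4, so the actual values have opposite signs. Whether the pair (0, 2) or
      (1, 3) is used depends on the larger of the imaginary and real parts.\<close>
    have opp: "X * Y <= 0" if "\<bar>X - c\<bar> <= m / 4" "\<bar>Y - - c\<bar> <= m / 4" "\<bar>c\<bar> >= m / 2" for X Y c :: real
      using that m by (auto simp: abs_if mult_le_0_iff split: if_splits)
    have "norm om <= \<bar>Re om\<bar> + \<bar>Im om\<bar>" by (rule cmod_le)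
    then consider "\<bar>Im om\<bar> >= m / 2" | "\<bar>Re om\<bar> >= m / 2" using om by linarith
    then show "\<exists>l. l1 <= l \<and> l <= l1 + 3 * pi / (2 * R) \<and> rphi l R = 0"
    proof cases
      case 1
      show ?thesis
        by (rule zero[of 0 2], simp, simp, simp, rule opp[of _ "Im om"])
           (use f[of 0] f[of 2] 1 in \<open>auto simp: power2_eq_square\<close>)
    next
      case 2
      show ?thesis
        by (rule zero[of 1 3], simp, simp, simp, rule opp[of _ "Re om"])
           (use f[of 1] f[of 3] 2 in \<open>auto simp: power3_eq_cube\<close>)
    qed
  qed
qed

end

section \<open>Plancherel and Hausdorff-Young inequalities\<close>

text \<open>The square of f minus a combination of the e_i is integrated, with coefficients the
  inner products divided by B i. Dividing by an upper bound for the squared norm instead of the norm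
  itself only loses in the favourable direction.\<close>

lemma bessel_inequality:
  fixes e :: "'i => 'a => real" and f :: "'a => real"
  assumes I: "finite I" and f: "integrable M (\<lambda>x. (f x)\<^sup>2)"
    and fe: "\<And>i. i \<in> I ==> integrable M (\<lambda>x. f x * e i x)"
    and ee: "\<And>i j. i \<in> I ==> j \<in> I ==> integrable M (\<lambda>x. e i x * e j x)"
    and orth: "\<And>i j. i \<in> I ==> j \<in> I ==> i \<noteq> j ==> (\<integral>x. e i x * e j x \<partial>M) = 0"
    and B: "\<And>i. i \<in> I ==> (\<integral>x. e i x * e i x \<partial>M) <= B i" "\<And>i. i \<in> I ==> B i > 0"
  shows "(\<Sum>i\<in>I. (\<integral>x. f x * e i x \<partial>M)\<^sup>2 / B i) <= (\<integral>x. (f x)\<^sup>2 \<partial>M)"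
proof -
  define a where "a = (\<lambda>i. \<integral>x. f x * e i x \<partial>M)"
  define c where "c = (\<lambda>i. a i / B i)"
  have pw: "(f x - (\<Sum>i\<in>I. c i * e i x))\<^sup>2
     = (f x)\<^sup>2 - 2 * (\<Sum>i\<in>I. c i * (f x * e i x)) + (\<Sum>i\<in>I. \<Sum>j\<in>I. c i * c j * (e i x * e j x))" for x
    by (simp add: power2_eq_square algebra_simps sum_distrib_left sum_distrib_right sum_product)
  have "0 <= (\<integral>x. (f x - (\<Sum>i\<in>I. c i * e i x))\<^sup>2 \<partial>M)" by simp
  also have "... = (\<integral>x. (f x)\<^sup>2 - 2 * (\<Sum>i\<in>I. c i * (f x * e i x)) + (\<Sum>i\<in>I. \<Sum>j\<in>I. c i * c j * (e i x * e j x)) \<partial>M)"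
    unfolding pw ..
  also have "... = (\<integral>x. (f x)\<^sup>2 \<partial>M) - 2 * (\<Sum>i\<in>I. c i * a i) + (\<Sum>i\<in>I. \<Sum>j\<in>I. c i * c j * (\<integral>x. e i x * e j x \<partial>M))"
    unfolding a_def using f fe ee by simp
  also have "(\<Sum>i\<in>I. \<Sum>j\<in>I. c i * c j * (\<integral>x. e i x * e j x \<partial>M)) = (\<Sum>i\<in>I. c i * c i * (\<integral>x. e i x * e i x \<partial>M))"
  proof (rule sum.cong[OF refl])
    fix i assume i: "i \<in> I"
    have "(\<Sum>j\<in>I. c i * c j * (\<integral>x. e i x * e j x \<partial>M)) = (\<Sum>j\<in>I. if j = i then c i * c i * (\<integral>x. e i x * e i x \<partial>M) else 0)"
      by (rule sum.cong[OF refl]) (use orth i in auto)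
    then show "(\<Sum>j\<in>I. c i * c j * (\<integral>x. e i x * e j x \<partial>M)) = c i * c i * (\<integral>x. e i x * e i x \<partial>M)" using I i by simp
  qed
  also have "(\<Sum>i\<in>I. c i * c i * (\<integral>x. e i x * e i x \<partial>M)) <= (\<Sum>i\<in>I. c i * a i)"
  proof (rule sum_mono)
    fix i assume i: "i \<in> I"
    have "c i * c i * (\<integral>x. e i x * e i x \<partial>M) <= c i * c i * B i" using B(1)[OF i] by (intro mult_left_mono) auto
    also have "... = c i * a i" using B(2)[OF i] by (simp add: c_def)
    finally show "c i * c i * (\<integral>x. e i x * e i x \<partial>M) <= c i * a i" .
  qed
  finally have "(\<Sum>i\<in>I. c i * a i) <= (\<integral>x. (f x)\<^sup>2 \<partial>M)" by simp
  then show ?thesis by (simp add: c_def a_def power2_eq_square)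
qed

lemma integral_le_step_sum:
  fixes H :: "real => real"
  assumes c: "continuous_on {a..b} H" and d: "d >= 0" and n: "a + real n * d <= b"
    and le: "\<And>j l. j < n ==> a + real j * d <= l ==> l <= a + real (Suc j) * d ==> H l <= c j"
  shows "integral {a..a + real n * d} H <= d * (\<Sum>j<n. c j)"
  using n le
proof (induction n)
  case (Suc n)
  have n: "a + real n * d <= b" "a + real n * d <= a + real (Suc n) * d" "a <= a + real n * d"
    using Suc.prems(1) d by (auto simp: algebra_simps)
  have ii: "H integrable_on {a..a + real (Suc n) * d}"
    by (intro integrable_continuous_real continuous_on_subset[OF c]) (use Suc.prems(1) in auto)
  have "integral {a..a + real (Suc n) * d} H = integral {a..a + real n * d} H + integral {a + real n * d..a + real (Suc n) * d} H"
    using Henstock_Kurzweil_Integration.integral_combine[OF n(3,2) ii] by simp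
  also have "integral {a + real n * d..a + real (Suc n) * d} H <= integral {a + real n * d..a + real (Suc n) * d} (\<lambda>_. c n)"
    by (rule integral_le) (use Suc.prems(2)[of n] integrable_subinterval_real[OF ii] n in auto)
  also have "... = d * c n" using d by (simp add: algebra_simps)
  also have "integral {a..a + real n * d} H <= d * (\<Sum>j<n. c j)" by (rule Suc.IH[OF n(1)]) (use Suc.prems(2) in auto)
  finally show ?case by (simp add: algebra_simps)
qed simp

section \<open>Eigenfunctions on bounded intervals and a local Plancherel inequality\<close>

context jacobi begin

text \<open>A copy of \<open>jac_measure\<close> on the whole line: its space is
  \<open>UNIV\<close>, its sets are the Borel sets, and it charges only the positive half-line.
  Working here avoids restricted spaces.\<close>

definition J :: "real measure" where "J = density lborel (\<lambda>x. ennreal (indicator {0<..} x * A x))"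

lemma sets_J [measurable_cong, simp]: "sets J = sets borel" by (simp add: J_def)
lemmas measurable_J = measurable_cong_sets[OF sets_J refl]
lemma space_J [simp]: "space J = UNIV" by (simp add: J_def)

lemma measurable_A [measurable]: "A \<in> borel_measurable borel"
proof -
  have [measurable]: "(sinh :: real => real) \<in> borel_measurable borel" "(cosh :: real => real) \<in> borel_measurable borel"
    by (auto intro!: borel_measurable_continuous_onI continuous_intros)
  show ?thesis unfolding jac_A_def[abs_def] by measurable
qed

lemma AE_J: "AE x in J. x > 0"
  unfolding J_def by (subst AE_density) (auto simp: indicator_def)

lemma nn_integral_jac:
  assumes [measurable]: "f \<in> borel_measurable borel"
  shows "(\<integral>\<^sup>+x. f x \<partial>jac_measure \<alpha> \<beta>) = (\<integral>\<^sup>+x. f x \<partial>J)"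
proof -
  have [measurable]: "A \<in> borel_measurable (restrict_space lborel {0<..})" "f \<in> borel_measurable (restrict_space lborel {0<..})"
    by (auto intro!: measurable_restrict_space1)
  have "(\<integral>\<^sup>+x. f x \<partial>jac_measure \<alpha> \<beta>) = (\<integral>\<^sup>+x. ennreal (A x) * f x \<partial>restrict_space lborel {0<..})"
    unfolding jac_measure_def by (rule nn_integral_density) measurable
  also have "... = (\<integral>\<^sup>+x. ennreal (A x) * f x * indicator {0<..} x \<partial>lborel)"
    by (rule nn_integral_restrict_space) simp
  also have "... = (\<integral>\<^sup>+x. ennreal (indicator {0<..} x * A x) * f x \<partial>lborel)"
    by (intro nn_integral_cong) (auto simp: indicator_def)
  also have "... = (\<integral>\<^sup>+x. f x \<partial>J)" unfolding J_def by (rule nn_integral_density[symmetric]) measurable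
  finally show ?thesis .
qed

lemma integral_J:
  fixes f :: "real => 'b::{banach, second_countable_topology}"
  assumes [measurable]: "f \<in> borel_measurable borel"
  shows "(\<integral>x. f x \<partial>J) = (\<integral>x. indicator {0<..} x *\<^sub>R (A x *\<^sub>R f x) \<partial>lborel)"
    and "integrable J f \<longleftrightarrow> integrable lborel (\<lambda>x. indicator {0<..} x *\<^sub>R (A x *\<^sub>R f x))"
proof -
  have "(\<integral>x. f x \<partial>J) = (\<integral>x. (indicator {0<..} x * A x) *\<^sub>R f x \<partial>lborel)"
    unfolding J_def by (rule integral_density) (auto simp: A_nonneg)
  then show "(\<integral>x. f x \<partial>J) = (\<integral>x. indicator {0<..} x *\<^sub>R (A x *\<^sub>R f x) \<partial>lborel)" by simp
  have "integrable J f \<longleftrightarrow> integrable lborel (\<lambda>x. (indicator {0<..} x * A x) *\<^sub>R f x)"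
    unfolding J_def by (rule integrable_density) (auto simp: A_nonneg)
  then show "integrable J f \<longleftrightarrow> integrable lborel (\<lambda>x. indicator {0<..} x *\<^sub>R (A x *\<^sub>R f x))" by simp
qed

lemma integral_jac:
  fixes f :: "real => 'b::{banach, second_countable_topology}"
  assumes [measurable]: "f \<in> borel_measurable borel"
  shows "(\<integral>x. f x \<partial>jac_measure \<alpha> \<beta>) = (\<integral>x. f x \<partial>J)"
proof -
  have [measurable]: "A \<in> borel_measurable (restrict_space lborel {0<..})" "f \<in> borel_measurable (restrict_space lborel {0<..})"
    by (auto intro!: measurable_restrict_space1)
  have "(\<integral>x. f x \<partial>jac_measure \<alpha> \<beta>) = (\<integral>x. A x *\<^sub>R f x \<partial>restrict_space lborel {0<..})"
    unfolding jac_measure_def by (rule integral_density) (auto simp: A_nonneg)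
  also have "... = (\<integral>x. indicator {0<..} x *\<^sub>R (A x *\<^sub>R f x) \<partial>lborel)"
    by (rule integral_restrict_space) simp
  finally show ?thesis by (simp add: integral_J)
qed

lemma integral_J_Ioo:
  fixes g :: "real => real"
  assumes gm [measurable]: "g \<in> borel_measurable borel" and g: "continuous_on {0..R} g" and R: "R > 0"
  shows "integrable J (\<lambda>x. indicator {0<..<R} x * g x)"
    and "(\<integral>x. indicator {0<..<R} x * g x \<partial>J) = integral {0..R} (\<lambda>x. A x * g x)"
proof -
  have c: "continuous_on {0..R} (\<lambda>x. A x * g x)" by (intro continuous_intros g continuous_on_subset[OF A_cont]) auto
  have "set_integrable lborel {0..R} (\<lambda>x. A x * g x)" by (rule borel_integrable_atLeastAtMost'[OF c])
  then have s: "set_integrable lborel {0<..<R} (\<lambda>x. A x * g x)" by (rule set_integrable_subset) auto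
  have e: "indicator {0<..} x *\<^sub>R (A x *\<^sub>R (indicator {0<..<R} x * g x)) = indicator {0<..<R} x *\<^sub>R (A x * g x)" for x
    by (auto simp: indicator_def)
  have im: "(\<lambda>x. indicator {0<..<R} x * g x) \<in> borel_measurable borel" by measurable
  show "integrable J (\<lambda>x. indicator {0<..<R} x * g x)"
    using s unfolding set_integrable_def by (subst integral_J(2)[OF im]) (simp only: e)
  have "(\<integral>x. indicator {0<..<R} x * g x \<partial>J) = (LINT x:{0<..<R}|lborel. A x * g x)"
    unfolding set_lebesgue_integral_def by (subst integral_J(1)[OF im]) (simp only: e)
  also have "... = integral {0<..<R} (\<lambda>x. A x * g x)" by (rule set_borel_integral_eq_integral[OF s])
  also have "... = integral {0..R} (\<lambda>x. A x * g x)"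
    by (metis box_real(1) cbox_interval integral_open_interval)
  finally show "(\<integral>x. indicator {0<..<R} x * g x \<partial>J) = integral {0..R} (\<lambda>x. A x * g x)" .
qed

lemma rphi_measurable [measurable]: "rphi l \<in> borel_measurable borel"
  by (rule borel_measurable_continuous_onI[OF rphi_cont])

text \<open>Green's formula: the derivative of A times the Wronskian is the difference of the
  eigenvalues times A \<phi>_l \<phi>_m. The boundary term vanishes at 0 because A(0) = 0 and at R
  because both functions vanish there.\<close>

lemma rphi_orth:
  assumes R: "R > 0" and lm: "l\<^sup>2 \<noteq> m\<^sup>2" and z: "rphi l R = 0" "rphi m R = 0"
  shows "integral {0..R} (\<lambda>x. A x * (rphi l x * rphi m x)) = 0"
proof -
  let ?W = "\<lambda>x. rphi l x * (A x * rdphi m x) - rphi m x * (A x * rdphi l x)"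
  have "((\<lambda>x. (\<kappa> l - \<kappa> m) * (A x * (rphi l x * rphi m x))) has_integral (?W R - ?W 0)) {0..R}"
  proof (rule fundamental_theorem_of_calculus_interior)
    show "continuous_on {0..R} ?W"
      by (intro continuous_intros rphi_cont rdphi_cont continuous_on_subset[OF A_cont]) auto
    fix x assume "x \<in> {0<..<R}"
    then have x: "x > 0" by simp
    have "(?W has_real_derivative (rdphi l x * (A x * rdphi m x) + (- \<kappa> m * A x * rphi m x) * rphi l x)
       - (rdphi m x * (A x * rdphi l x) + (- \<kappa> l * A x * rphi l x) * rphi m x)) (at x)"
      by (intro DERIV_diff DERIV_mult rphi_deriv A_rdphi_deriv x)
    moreover have "(rdphi l x * (A x * rdphi m x) + (- \<kappa> m * A x * rphi m x) * rphi l x)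
       - (rdphi m x * (A x * rdphi l x) + (- \<kappa> l * A x * rphi l x) * rphi m x) = (\<kappa> l - \<kappa> m) * (A x * (rphi l x * rphi m x))"
      by (simp add: algebra_simps)
    ultimately show "(?W has_vector_derivative (\<kappa> l - \<kappa> m) * (A x * (rphi l x * rphi m x))) (at x)"
      by (simp add: has_real_derivative_iff_has_vector_derivative)
  qed (use R in simp)
  from integral_unique[OF this] have "(\<kappa> l - \<kappa> m) * integral {0..R} (\<lambda>x. A x * (rphi l x * rphi m x)) = ?W R - ?W 0"
    by (simp only: Henstock_Kurzweil_Integration.integral_mult_right)
  then have "(\<kappa> l - \<kappa> m) * integral {0..R} (\<lambda>x. A x * (rphi l x * rphi m x)) = 0" by (simp add: z)
  moreover have "\<kappa> l - \<kappa> m \<noteq> 0" using lm by (simp add: \<kappa>_def)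
  ultimately show ?thesis by simp
qed

definition rF :: "(real => real) => real => real" where "rF f l = (\<integral>x. f x * rphi l x \<partial>J)"

lemma rF_cont:
  assumes f: "integrable J f"
  shows "isCont (rF f) l"
  unfolding continuous_at_sequentially o_def
proof (intro allI impI)
  fix X assume X: "X \<longlonglongrightarrow> l"
  have m: "f \<in> borel_measurable borel" using borel_measurable_integrable[OF f] by (simp add: measurable_J)
  show "(\<lambda>n. rF f (X n)) \<longlonglongrightarrow> rF f l" unfolding rF_def
  proof (rule integral_dominated_convergence[where w="\<lambda>x. norm (f x)"])
    show "AE x in J. (\<lambda>n. f x * rphi (X n) x) \<longlonglongrightarrow> f x * rphi l x"
      using AE_J
    proof eventually_elim
      fix x :: real assume "x > 0"
      from rphi_param_cont(1)[OF this, of l] X have "(\<lambda>n. rphi (X n) x) \<longlonglongrightarrow> rphi l x"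
        by (rule isCont_tendsto_compose[of l "\<lambda>l. rphi l x"])
      then show "(\<lambda>n. f x * rphi (X n) x) \<longlonglongrightarrow> f x * rphi l x" by (intro tendsto_intros)
    qed
    show "AE x in J. norm (f x * rphi (X n) x) <= norm (f x)" for n
      using AE_J by eventually_elim (use rphi_le_1 in \<open>auto simp: abs_mult mult_left_le\<close>)
  qed (use m f in \<open>auto simp: measurable_J\<close>)
qed

lemma wt_cont: assumes "0 < a" shows "continuous_on {a..b} wt"
  unfolding wt_def[abs_def] using assms by (intro continuous_intros) auto

text \<open>Each of N windows of length \<delta> = 2 pi / R in [a, b] contains one zero, and the N
  eigenfunctions are orthogonal on [0, R]. Bessel's inequality, with squared norms at most R C /
  \<open>wt\<close>, bounds a Riemann sum for the integral; as \<delta> R = 2 pi, the constant does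
  not depend on the number of windows.\<close>

lemma plancherel_interval:
  "\<exists>C>0. \<forall>f M a b. integrable J f \<and> integrable J (\<lambda>x. (f x)\<^sup>2) \<and> (\<forall>x>M. f x = 0) \<and> 0 < a \<and> a < b
     \<longrightarrow> integral {a..b} (\<lambda>l. (rF f l)\<^sup>2 * wt l) <= C * (\<integral>x. (f x)\<^sup>2 \<partial>J)"
proof -
  obtain C where C: "C > 0" "\<And>l x. l > 0 ==> x > 0 ==> A x * (rphi l x)\<^sup>2 * wt l <= C" using amplitude by blast
  have "integral {a..b} (\<lambda>l. (rF f l)\<^sup>2 * wt l) <= 2 * pi * C * (\<integral>x. (f x)\<^sup>2 \<partial>J)"
    if f: "integrable J f" "integrable J (\<lambda>x. (f x)\<^sup>2)" "\<forall>x>M. f x = 0" and ab: "0 < a" "a < b" for f M a b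
  proof (rule field_le_epsilon)
    fix \<epsilon> :: real assume \<epsilon>: "\<epsilon> > 0"
    let ?H = "\<lambda>l. (rF f l)\<^sup>2 * wt l"
    have fm [measurable]: "f \<in> borel_measurable borel" using borel_measurable_integrable[OF f(1)] by (simp add: measurable_J)
    have Hc: "continuous_on {a..b} ?H"
      by (intro continuous_intros wt_cont[OF ab(1)] continuous_at_imp_continuous_on ballI rF_cont[OF f(1)])
    have "uniformly_continuous_on {a..b} ?H" by (rule compact_uniformly_continuous[OF Hc]) simp
    moreover have "\<epsilon> / (b - a) > 0" using \<epsilon> ab by simp
    ultimately obtain d where d: "d > 0" "\<And>l l'. l \<in> {a..b} ==> l' \<in> {a..b} ==> dist l' l < d ==> dist (?H l') (?H l) < \<epsilon> / (b - a)"
      unfolding uniformly_continuous_on_def by metis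
    obtain R0 where R0: "R0 > 0" "\<And>R l1. R >= R0 ==> a <= l1 ==> l1 + 2 * pi / R <= b ==>
        \<exists>l. l1 <= l \<and> l <= l1 + 3 * pi / (2 * R) \<and> rphi l R = 0" using phi_zeros[OF ab] by blast
    \<comment> \<open>The three summands make the windows finer than the modulus of continuity, R
      larger than the threshold of \<open>phi_zeros\<close>, and R larger than the support of
      f.\<close>
    obtain N :: nat where N: "real N > (b - a) * (1 / d + R0 / (2 * pi) + \<bar>M\<bar> / (2 * pi)) + 1"
      using reals_Archimedean2 by blast
    have p0: "(b - a) * (1 / d + R0 / (2 * pi) + \<bar>M\<bar> / (2 * pi)) >= 0" using ab d(1) R0(1) by simp
    have Np: "real N > 0" using N p0 by linarith
    define \<delta> where "\<delta> = (b - a) / real N"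
    define R where "R = 2 * pi / \<delta>"
    have \<delta>: "\<delta> > 0" using ab Np by (simp add: \<delta>_def)
    have N\<delta>: "real N * \<delta> = b - a" using Np by (simp add: \<delta>_def)
    have R2: "2 * pi / R = \<delta>" using \<delta> by (simp add: R_def)
    have Rp: "R > 0" using \<delta> by (simp add: R_def)
    have Req: "R = real N * (2 * pi) / (b - a)" using ab Np by (simp add: R_def \<delta>_def)
    have big: "real N > (b - a) * (1 / d)" "real N > (b - a) * (R0 / (2 * pi))" "real N > (b - a) * (\<bar>M\<bar> / (2 * pi))"
    proof -
      have "(b - a) * (1 / d) >= 0" "(b - a) * (R0 / (2 * pi)) >= 0" "(b - a) * (\<bar>M\<bar> / (2 * pi)) >= 0" using ab d(1) R0(1) by auto
      then show "real N > (b - a) * (1 / d)" "real N > (b - a) * (R0 / (2 * pi))" "real N > (b - a) * (\<bar>M\<bar> / (2 * pi))"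
        using N unfolding distrib_left by linarith+
    qed
    have dd: "\<delta> < d" using big(1) d(1) Np by (simp add: \<delta>_def field_simps)
    have RR0: "R0 <= R" using big(2) ab unfolding Req by (simp add: field_simps)
    have "\<bar>M\<bar> < R" using big(3) ab unfolding Req by (simp add: field_simps)
    then have RM: "M < R" by linarith
    have "\<exists>l. a + real j * \<delta> <= l \<and> l <= a + real j * \<delta> + 3 * pi / (2 * R) \<and> rphi l R = 0" if j: "j < N" for j
    proof (rule R0(2)[OF RR0])
      show "a <= a + real j * \<delta>" using \<delta> by simp
      have "real (Suc j) * \<delta> <= real N * \<delta>" using j \<delta> by (intro mult_right_mono) auto
      then show "a + real j * \<delta> + 2 * pi / R <= b" unfolding R2 using N\<delta> by (simp add: algebra_simps)
    qed
    then obtain L where L: "\<And>j. j < N ==> a + real j * \<delta> <= L j \<and> L j <= a + real j * \<delta> + 3 * pi / (2 * R) \<and> rphi (L j) R = 0"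
      by metis
    \<comment> \<open>Each zero lies in the first three quarters of its window, so zeros from
      different windows are distinct.\<close>
    have R34: "3 * pi / (2 * R) = 3/4 * \<delta>" using Rp R2 by (simp add: field_simps)
    have L1: "a + real j * \<delta> <= L j" "L j < a + real (Suc j) * \<delta>" "rphi (L j) R = 0" "L j \<in> {a..b}" if j: "j < N" for j
    proof -
      show 1: "a + real j * \<delta> <= L j" and "rphi (L j) R = 0" using L[OF j] by auto
      have "L j <= a + real j * \<delta> + 3/4 * \<delta>" using L[OF j] R34 by simp
      then show 2: "L j < a + real (Suc j) * \<delta>" using \<delta> by (simp add: algebra_simps)
      have "real (Suc j) * \<delta> <= real N * \<delta>" using j \<delta> by (intro mult_right_mono) auto
      moreover have "real j * \<delta> >= 0" using \<delta> by simp
      ultimately show "L j \<in> {a..b}" using 1 2 N\<delta> by auto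
    qed
    have Lpos: "L j > 0" if "j < N" for j using L1(4)[OF that] ab by auto
    have Lmono: "L i < L j" if "i < j" "j < N" for i j
    proof -
      have "real (Suc i) * \<delta> <= real j * \<delta>" using that \<delta> by (intro mult_right_mono) auto
      then show ?thesis using L1(2)[of i] L1(1)[of j] that by linarith
    qed
    have Lsq: "(L i)\<^sup>2 \<noteq> (L j)\<^sup>2" if "i < N" "j < N" "i \<noteq> j" for i j
    proof -
      have "L i \<noteq> L j" using that Lmono[of i j] Lmono[of j i] by (cases "i < j") auto
      then show ?thesis using Lpos[OF that(1)] Lpos[OF that(2)] by (simp add: power2_eq_iff)
    qed
    define e where "e = (\<lambda>j x. indicator {0<..<R} x * rphi (L j) x :: real)"
    have eem: "e i x * e j x = indicator {0<..<R} x * (rphi (L i) x * rphi (L j) x)" for i j x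
      by (auto simp: e_def indicator_def)
    have ee: "integrable J (\<lambda>x. e i x * e j x)" "(\<integral>x. e i x * e j x \<partial>J) = integral {0..R} (\<lambda>x. A x * (rphi (L i) x * rphi (L j) x))" for i j
      unfolding eem by (rule integral_J_Ioo; (intro continuous_intros rphi_cont Rp | measurable))+
    have fe: "integrable J (\<lambda>x. f x * e j x)" for j
    proof (rule Bochner_Integration.integrable_bound[OF f(1)])
      show "AE x in J. norm (f x * e j x) <= norm (f x)"
        using AE_J by eventually_elim (use rphi_le_1[of _ "L j"] in \<open>auto simp: e_def abs_mult mult_left_le indicator_def\<close>)
    qed (auto simp: e_def measurable_J)
    \<comment> \<open>The cut at R costs nothing, because f vanishes beyond M < R: the inner product
      with the truncated eigenfunction is the full transform.\<close>
    have fe2: "(\<integral>x. f x * e j x \<partial>J) = rF f (L j)" for j unfolding rF_def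
    proof (rule integral_cong_AE)
      show "AE x in J. f x * e j x = f x * rphi (L j) x"
        using AE_J by eventually_elim (use f(3) RM in \<open>auto simp: e_def indicator_def\<close>)
    qed (auto simp: e_def measurable_J)
    define B where "B = (\<lambda>j. R * C / wt (L j))"
    have Bp: "B j > 0" if "j < N" for j using Rp C(1) wt_pos[OF Lpos[OF that]] by (simp add: B_def)
    have eB: "(\<integral>x. e j x * e j x \<partial>J) <= B j" if j: "j < N" for j
    proof -
      have "integral {0..R} (\<lambda>x. A x * (rphi (L j) x * rphi (L j) x)) <= integral {0..R} (\<lambda>_. C / wt (L j))"
      proof (rule integral_le)
        show "(\<lambda>x. A x * (rphi (L j) x * rphi (L j) x)) integrable_on {0..R}"
          by (intro integrable_continuous_real continuous_intros rphi_cont continuous_on_subset[OF A_cont]) auto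
        fix x assume "x \<in> {0..R}"
        then show "A x * (rphi (L j) x * rphi (L j) x) <= C / wt (L j)"
          using C(2)[OF Lpos[OF j], of x] C(1) wt_pos[OF Lpos[OF j]]
          by (cases "x = 0") (auto simp: field_simps power2_eq_square)
      qed auto
      also have "... = B j" using Rp by (simp add: B_def)
      finally show ?thesis unfolding ee .
    qed
    have "(\<Sum>j<N. (\<integral>x. f x * e j x \<partial>J)\<^sup>2 / B j) <= (\<integral>x. (f x)\<^sup>2 \<partial>J)"
    proof (rule bessel_inequality)
      fix i j assume "i \<in> {..<N}" "j \<in> {..<N}" "i \<noteq> j"
      then show "(\<integral>x. e i x * e j x \<partial>J) = 0" unfolding ee using Lsq L1(3) by (intro rphi_orth Rp) auto
    qed (use f(2) fe ee eB Bp in auto)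
    also have "(\<Sum>j<N. (\<integral>x. f x * e j x \<partial>J)\<^sup>2 / B j) = (\<Sum>j<N. ?H (L j)) / (R * C)"
      unfolding fe2 sum_divide_distrib by (intro sum.cong refl) (simp add: B_def)
    finally have "(\<Sum>j<N. ?H (L j)) <= R * C * (\<integral>x. (f x)\<^sup>2 \<partial>J)" using Rp C(1) by (simp add: field_simps)
    then have sumH: "\<delta> * (\<Sum>j<N. ?H (L j)) <= \<delta> * (R * C * (\<integral>x. (f x)\<^sup>2 \<partial>J))" using \<delta> by (intro mult_left_mono) auto
    have "integral {a..a + real N * \<delta>} ?H <= \<delta> * (\<Sum>j<N. ?H (L j) + \<epsilon> / (b - a))"
    proof (rule integral_le_step_sum[OF Hc])
      fix j l assume j: "j < N" and l: "a + real j * \<delta> <= l" "l <= a + real (Suc j) * \<delta>"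
      have "real (Suc j) * \<delta> <= real N * \<delta>" using j \<delta> by (intro mult_right_mono) auto
      moreover have "real j * \<delta> >= 0" using \<delta> by simp
      ultimately have lab: "l \<in> {a..b}" using l N\<delta> by auto
      have "dist l (L j) < d" using l L1(1,2)[OF j] dd by (auto simp: dist_real_def algebra_simps)
      then have "dist (?H l) (?H (L j)) < \<epsilon> / (b - a)" by (rule d(2)[OF L1(4)[OF j] lab])
      then show "?H l <= ?H (L j) + \<epsilon> / (b - a)" by (auto simp: dist_real_def)
    qed (use \<delta> N\<delta> in auto)
    also have "... = \<delta> * (\<Sum>j<N. ?H (L j)) + real N * \<delta> * (\<epsilon> / (b - a))" by (simp add: sum.distrib algebra_simps)
    also have "real N * \<delta> * (\<epsilon> / (b - a)) = \<epsilon>" using N\<delta> ab by simp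
    also have "\<delta> * (\<Sum>j<N. ?H (L j)) <= 2 * pi * C * (\<integral>x. (f x)\<^sup>2 \<partial>J)"
      using sumH \<delta> by (simp add: R_def)
    finally show "integral {a..b} ?H <= 2 * pi * C * (\<integral>x. (f x)\<^sup>2 \<partial>J) + \<epsilon>" using N\<delta> by simp
  qed
  then show ?thesis using C(1) by (intro exI[of _ "2 * pi * C"]) auto
qed

end

lemma nn_integral_fatou_le:
  fixes u :: "nat => 'a => ennreal"
  assumes [measurable]: "\<And>n. u n \<in> borel_measurable M" "v \<in> borel_measurable M"
    and lim: "AE x in M. (\<lambda>n. u n x) \<longlonglongrightarrow> v x" and le: "\<And>n. (\<integral>\<^sup>+x. u n x \<partial>M) <= K"
  shows "(\<integral>\<^sup>+x. v x \<partial>M) <= K"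
proof -
  have "(\<integral>\<^sup>+x. v x \<partial>M) = (\<integral>\<^sup>+x. liminf (\<lambda>n. u n x) \<partial>M)"
    by (rule nn_integral_cong_AE) (use lim in \<open>eventually_elim, simp add: lim_imp_Liminf\<close>)
  also have "... <= liminf (\<lambda>n. \<integral>\<^sup>+x. u n x \<partial>M)" by (rule nn_integral_liminf) simp
  also have "... <= limsup (\<lambda>n. \<integral>\<^sup>+x. u n x \<partial>M)" by (rule Liminf_le_Limsup) simp
  also have "... <= K" by (rule Limsup_bounded) (use le in auto)
  finally show ?thesis .
qed

lemma nn_integral_powr_Ioo:
  assumes r: "r > 0" and L: "L >= (0::real)"
  shows "(\<integral>\<^sup>+t. ennreal (if 0 < t \<and> t < L then t powr (r - 1) else 0) \<partial>lborel) = ennreal (L powr r / r)"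
proof -
  have "((\<lambda>t. t powr (r - 1)) has_integral (L powr r / r)) {0<..<L}"
    using has_integral_powr_from_0[of "r - 1" L] r L by (simp add: has_integral_Icc_iff_Ioo)
  then have "((\<lambda>t. if t \<in> {0<..<L} then t powr (r - 1) else 0) has_integral (L powr r / r)) UNIV"
    by (subst has_integral_restrict_UNIV)
  then have "(\<integral>\<^sup>+t. ennreal (if t \<in> {0<..<L} then t powr (r - 1) else 0) \<partial>lborel) = ennreal (L powr r / r)"
    by (intro nn_integral_has_integral_lborel) auto
  then show ?thesis by simp
qed

section \<open>The transform of integrable functions and its norm inequalities\<close>

context jacobi begin

definition pd :: "real => real" where "pd l = indicator {0<..} l * (1 / (cmod (jac_c \<alpha> \<beta> l))\<^sup>2)"

lemma pd_nonneg: "pd l >= 0" by (simp add: pd_def)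

lemma measurable_pd [measurable]: "pd \<in> borel_measurable borel"
  using plancherel_density_measurable
  by (subst (asm) borel_measurable_restrict_space_iff) (auto simp: pd_def[abs_def])

text \<open>The whole-line copy of the Plancherel measure, as \<open>J\<close> is that of the
  weighted measure.\<close>

definition N :: "real measure" where "N = density lborel (\<lambda>l. ennreal (pd l))"

lemma sets_N [measurable_cong, simp]: "sets N = sets borel" by (simp add: N_def)
lemmas measurable_N = measurable_cong_sets[OF sets_N refl]
lemma space_N [simp]: "space N = UNIV" by (simp add: N_def)

lemma nn_integral_N: "f \<in> borel_measurable borel ==> (\<integral>\<^sup>+l. f l \<partial>N) = (\<integral>\<^sup>+l. ennreal (pd l) * f l \<partial>lborel)"
  unfolding N_def by (rule nn_integral_density) auto

lemma nn_integral_plancherel: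
  assumes [measurable]: "f \<in> borel_measurable borel"
  shows "(\<integral>\<^sup>+x. f x \<partial>plancherel_measure \<alpha> \<beta>) = (\<integral>\<^sup>+x. f x \<partial>N)"
proof -
  have [measurable]: "(\<lambda>l. ennreal (1 / (cmod (jac_c \<alpha> \<beta> l))\<^sup>2)) \<in> borel_measurable (restrict_space lborel {0<..})"
    "f \<in> borel_measurable (restrict_space lborel {0<..})"
    using plancherel_density_measurable
    by (auto intro!: measurable_restrict_space1 measurable_compose[OF _ measurable_ennreal] cong: measurable_cong_sets sets_restrict_space_cong)
  have "(\<integral>\<^sup>+x. f x \<partial>plancherel_measure \<alpha> \<beta>) = (\<integral>\<^sup>+x. ennreal (1 / (cmod (jac_c \<alpha> \<beta> x))\<^sup>2) * f x \<partial>restrict_space lborel {0<..})"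
    unfolding plancherel_measure_def by (rule nn_integral_density) measurable
  also have "... = (\<integral>\<^sup>+x. ennreal (1 / (cmod (jac_c \<alpha> \<beta> x))\<^sup>2) * f x * indicator {0<..} x \<partial>lborel)"
    by (rule nn_integral_restrict_space) simp
  also have "... = (\<integral>\<^sup>+x. ennreal (pd x) * f x \<partial>lborel)"
    by (intro nn_integral_cong) (auto simp: indicator_def pd_def)
  finally show ?thesis by (simp add: nn_integral_N)
qed

lemma sigma_finite_J: "sigma_finite_measure J"
  unfolding J_def by (subst sigma_finite_measure.sigma_finite_iff_density_finite[OF sigma_finite_lborel]) auto

lemma sigma_finite_N: "sigma_finite_measure N"
  unfolding N_def by (subst sigma_finite_measure.sigma_finite_iff_density_finite[OF sigma_finite_lborel]) auto

definition Ft :: "(real => complex) => real => complex" where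
  "Ft f l = (\<integral>x. f x * of_real (rphi l x) \<partial>J)"

lemma integrable_J_measurable: "integrable J (f :: real => 'b::{banach,second_countable_topology}) ==> f \<in> borel_measurable borel"
  using borel_measurable_integrable[of J f] by (simp add: measurable_J)

lemma integrable_Ft: assumes f: "integrable J f" shows "integrable J (\<lambda>x. f x * complex_of_real (rphi l x))"
proof (rule Bochner_Integration.integrable_bound[OF f])
  show "AE x in J. norm (f x * complex_of_real (rphi l x)) <= norm (f x)"
    using AE_J by eventually_elim (use rphi_le_1[of _ l] in \<open>auto simp: norm_mult mult_left_le\<close>)
  show "(\<lambda>x. f x * complex_of_real (rphi l x)) \<in> borel_measurable J"
    using integrable_J_measurable[OF f] by measurable
qed

lemma Ft_le: assumes f: "integrable J f" shows "norm (Ft f l) <= (\<integral>x. norm (f x) \<partial>J)"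
proof -
  have "norm (Ft f l) <= (\<integral>x. norm (f x * complex_of_real (rphi l x)) \<partial>J)"
    unfolding Ft_def by (rule integral_norm_bound)
  also have "... <= (\<integral>x. norm (f x) \<partial>J)"
  proof (rule integral_mono_AE)
    show "AE x in J. norm (f x * complex_of_real (rphi l x)) <= norm (f x)"
      using AE_J by eventually_elim (use rphi_le_1[of _ l] in \<open>auto simp: norm_mult mult_left_le\<close>)
  qed (use f integrable_Ft[OF f] in auto)
  finally show ?thesis .
qed

lemma Ft_add: "integrable J f ==> integrable J g ==> Ft (\<lambda>x. f x + g x) l = Ft f l + Ft g l"
  unfolding Ft_def using integrable_Ft by (simp add: distrib_right)

lemma Ft_diff: "integrable J f ==> integrable J g ==> Ft (\<lambda>x. f x - g x) l = Ft f l - Ft g l"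
  unfolding Ft_def using integrable_Ft by (simp add: left_diff_distrib)

lemma Ft_scale: "Ft (\<lambda>x. c * f x) l = c * Ft f l"
  unfolding Ft_def by (simp add: mult.assoc)

lemma Ft_Re_Im:
  assumes f: "integrable J f"
  shows "Re (Ft f l) = rF (\<lambda>x. Re (f x)) l" "Im (Ft f l) = rF (\<lambda>x. Im (f x)) l"
  unfolding Ft_def rF_def using integrable_Ft[OF f] by (simp_all flip: integral_Re integral_Im)

lemma Ft_measurable: assumes f: "integrable J f" shows "Ft f \<in> borel_measurable borel"
proof -
  have "Ft f = (\<lambda>l. Complex (rF (\<lambda>x. Re (f x)) l) (rF (\<lambda>x. Im (f x)) l))"
    using Ft_Re_Im[OF f] by (auto simp: complex_eq_iff)
  also have "continuous_on UNIV ..." unfolding Complex_eq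
    by (intro continuous_intros continuous_at_imp_continuous_on ballI rF_cont integrable_Re integrable_Im f)
  then have "(\<lambda>l. Complex (rF (\<lambda>x. Re (f x)) l) (rF (\<lambda>x. Im (f x)) l)) \<in> borel_measurable borel"
    by (rule borel_measurable_continuous_onI)
  finally show ?thesis .
qed

lemma rF_measurable: "integrable J f ==> rF f \<in> borel_measurable borel"
  by (intro borel_measurable_continuous_onI continuous_at_imp_continuous_on ballI rF_cont)

text \<open>The local inequality has a constant independent of the interval and of the support.
  Fatou's lemma removes first the compact interval of parameters and then the truncation of f; real
  and imaginary parts are treated separately, and \<open>wt\<close> is exchanged for the density at
  the price of D.\<close>

lemma plancherel_ineq:
  "\<exists>C>0. \<forall>f. integrable J f \<and> integrable J (\<lambda>x. (norm (f x))\<^sup>2)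
     \<longrightarrow> (\<integral>\<^sup>+l. ennreal ((norm (Ft f l))\<^sup>2) \<partial>N) <= ennreal (C * (\<integral>x. (norm (f x))\<^sup>2 \<partial>J))"
proof -
  obtain C where C: "C > 0" "\<And>f M a b. integrable J f ==> integrable J (\<lambda>x. (f x)\<^sup>2) ==> (\<forall>x>M. f x = 0) ==> 0 < a ==> a < b
     ==> integral {a..b} (\<lambda>l. (rF f l)\<^sup>2 * wt l) <= C * (\<integral>x. (f x)\<^sup>2 \<partial>J)" using plancherel_interval by blast
  obtain D where D: "D > 0" "\<And>l. l > 0 ==> 1 / (cmod (jac_c \<alpha> \<beta> l))\<^sup>2 <= D * wt l" using plancherel_density_le by blast
  have wtm [measurable]: "wt \<in> borel_measurable borel" unfolding wt_def[abs_def] by measurable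
  let ?g = "\<lambda>f l. indicator {0<..} l * ((rF f l)\<^sup>2 * wt l)"
  have step1: "(\<integral>\<^sup>+l. ennreal (?g f l) \<partial>lborel) <= ennreal (C * (\<integral>x. (f x)\<^sup>2 \<partial>J))"
    if f: "integrable J f" "integrable J (\<lambda>x. (f x)\<^sup>2)" "\<forall>x>M. f x = 0" for f M
  proof (rule nn_integral_fatou_le[where u="\<lambda>n l. ennreal (indicator {1 / real (n + 2)..real (n + 2)} l * ((rF f l)\<^sup>2 * wt l))"])
    have rm [measurable]: "rF f \<in> borel_measurable borel" by (rule rF_measurable[OF f(1)])
    show "(\<lambda>l. ennreal (indicator {1 / real (n + 2)..real (n + 2)} l * ((rF f l)\<^sup>2 * wt l))) \<in> borel_measurable lborel" for n by measurable
    show "(\<lambda>l. ennreal (?g f l)) \<in> borel_measurable lborel" by measurable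
    show "AE l in lborel. (\<lambda>n. ennreal (indicator {1 / real (n + 2)..real (n + 2)} l * ((rF f l)\<^sup>2 * wt l))) \<longlonglongrightarrow> ennreal (?g f l)"
    proof (rule AE_I2)
      fix l :: real
      show "(\<lambda>n. ennreal (indicator {1 / real (n + 2)..real (n + 2)} l * ((rF f l)\<^sup>2 * wt l))) \<longlonglongrightarrow> ennreal (?g f l)"
      proof (cases "l > 0")
        case True
        obtain m :: nat where m: "real m > l + 1 / l" using reals_Archimedean2 by blast
        have "indicator {1 / real (n + 2)..real (n + 2)} l = (1::real)" if "n >= m" for n
        proof -
          have n: "real (n + 2) > l + 1 / l" using that m by linarith
          moreover have "1 / l > 0" using True by simp
          ultimately have "l <= real (n + 2)" "1 / l <= real (n + 2)" using True by linarith+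
          then have "1 / real (n + 2) <= l" using True by (simp add: field_simps)
          then show ?thesis using \<open>l <= real (n + 2)\<close> by simp
        qed
        then have "eventually (\<lambda>n. ennreal (indicator {1 / real (n + 2)..real (n + 2)} l * ((rF f l)\<^sup>2 * wt l)) = ennreal (?g f l)) sequentially"
          using True unfolding eventually_sequentially by (intro exI[of _ m]) simp
        then show ?thesis by (rule tendsto_eventually)
      next
        case False
        then have "indicator {1 / real (n + 2)..real (n + 2)} l = (0::real)" for n
          by (auto simp: indicator_def) (smt (verit) divide_pos_pos of_nat_0_le_iff)
        then show ?thesis using False by simp
      qed
    qed
    fix n :: nat
    let ?a = "1 / real (n + 2)" and ?b = "real (n + 2)"
    have ab: "0 < ?a" "?a < ?b" by (auto simp: field_simps) (smt (verit) mult_nonneg_nonneg of_nat_0_le_iff)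
    have Hc: "continuous_on {?a..?b} (\<lambda>l. (rF f l)\<^sup>2 * wt l)"
      by (intro continuous_intros wt_cont[OF ab(1)] continuous_at_imp_continuous_on ballI rF_cont[OF f(1)])
    have "((\<lambda>l. (rF f l)\<^sup>2 * wt l) has_integral integral {?a..?b} (\<lambda>l. (rF f l)\<^sup>2 * wt l)) {?a..?b}"
      by (intro integrable_integral integrable_continuous_real Hc)
    then have "((\<lambda>l. if l \<in> {?a..?b} then (rF f l)\<^sup>2 * wt l else 0) has_integral integral {?a..?b} (\<lambda>l. (rF f l)\<^sup>2 * wt l)) UNIV"
      by (subst has_integral_restrict_UNIV)
    also have "(\<lambda>l. if l \<in> {?a..?b} then (rF f l)\<^sup>2 * wt l else 0) = (\<lambda>l. indicator {?a..?b} l * ((rF f l)\<^sup>2 * wt l))"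
      by (auto simp: indicator_def)
    finally have "(\<integral>\<^sup>+l. ennreal (indicator {?a..?b} l * ((rF f l)\<^sup>2 * wt l)) \<partial>lborel) = ennreal (integral {?a..?b} (\<lambda>l. (rF f l)\<^sup>2 * wt l))"
      using rm by (intro nn_integral_has_integral_lborel) (auto simp: wt_def)
    also have "... <= ennreal (C * (\<integral>x. (f x)\<^sup>2 \<partial>J))" using C(2)[OF f ab] by (rule ennreal_leI)
    finally show "(\<integral>\<^sup>+l. ennreal (indicator {?a..?b} l * ((rF f l)\<^sup>2 * wt l)) \<partial>lborel) <= ennreal (C * (\<integral>x. (f x)\<^sup>2 \<partial>J))" .
  qed
  have step2: "(\<integral>\<^sup>+l. ennreal (?g f l) \<partial>lborel) <= ennreal (C * (\<integral>x. (f x)\<^sup>2 \<partial>J))"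
    if f: "integrable J f" "integrable J (\<lambda>x. (f x)\<^sup>2)" for f
  proof -
    define fn where "fn = (\<lambda>n::nat. \<lambda>x. indicator {..real n} x * f x)"
    have fm [measurable]: "f \<in> borel_measurable borel" by (rule integrable_J_measurable[OF f(1)])
    have fnm [measurable]: "fn n \<in> borel_measurable borel" for n unfolding fn_def by measurable
    have fni: "integrable J (fn n)" for n
      by (rule Bochner_Integration.integrable_bound[OF f(1)]) (auto simp: fn_def indicator_def measurable_J)
    have fni2: "integrable J (\<lambda>x. (fn n x)\<^sup>2)" for n
      by (rule Bochner_Integration.integrable_bound[OF f(2)]) (auto simp: fn_def indicator_def measurable_J)
    show ?thesis
    proof (rule nn_integral_fatou_le[where u="\<lambda>n l. ennreal (?g (fn n) l)"])
      show "(\<lambda>l. ennreal (?g (fn n) l)) \<in> borel_measurable lborel" for n using rF_measurable[OF fni[of n]] by measurable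
      show "(\<lambda>l. ennreal (?g f l)) \<in> borel_measurable lborel" using rF_measurable[OF f(1)] by measurable
      have "(\<lambda>n. rF (fn n) l) \<longlonglongrightarrow> rF f l" for l unfolding rF_def
      proof (rule integral_dominated_convergence[where w="\<lambda>x. norm (f x)"])
        show "AE x in J. (\<lambda>n. fn n x * rphi l x) \<longlonglongrightarrow> f x * rphi l x"
        proof (rule AE_I2)
          fix x
          obtain m :: nat where "x <= real m" using real_arch_simple by blast
          then have "eventually (\<lambda>n. fn n x * rphi l x = f x * rphi l x) sequentially"
            by (auto simp: fn_def eventually_sequentially intro!: exI[of _ m])
          then show "(\<lambda>n. fn n x * rphi l x) \<longlonglongrightarrow> f x * rphi l x" by (rule tendsto_eventually)
        qed
        show "AE x in J. norm (fn n x * rphi l x) <= norm (f x)" for n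
          using AE_J by eventually_elim (use rphi_le_1[of _ l] in \<open>auto simp: fn_def indicator_def abs_mult mult_left_le\<close>)
      qed (use f in \<open>auto simp: measurable_J\<close>)
      then show "AE l in lborel. (\<lambda>n. ennreal (?g (fn n) l)) \<longlonglongrightarrow> ennreal (?g f l)"
        by (intro AE_I2 tendsto_ennrealI tendsto_intros)
      fix n
      have "(\<integral>\<^sup>+l. ennreal (?g (fn n) l) \<partial>lborel) <= ennreal (C * (\<integral>x. (fn n x)\<^sup>2 \<partial>J))"
        by (rule step1[OF fni fni2, of "real n"]) (auto simp: fn_def)
      also have "(\<integral>x. (fn n x)\<^sup>2 \<partial>J) <= (\<integral>x. (f x)\<^sup>2 \<partial>J)"
        by (rule integral_mono[OF fni2 f(2)]) (auto simp: fn_def indicator_def)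
      finally show "(\<integral>\<^sup>+l. ennreal (?g (fn n) l) \<partial>lborel) <= ennreal (C * (\<integral>x. (f x)\<^sup>2 \<partial>J))"
        using C(1) by (simp add: ennreal_leI mult_left_mono)
    qed
  qed
  have "(\<integral>\<^sup>+l. ennreal ((norm (Ft f l))\<^sup>2) \<partial>N) <= ennreal ((D * C) * (\<integral>x. (norm (f x))\<^sup>2 \<partial>J))"
    if f: "integrable J f" "integrable J (\<lambda>x. (norm (f x))\<^sup>2)" for f
  proof -
    have fm [measurable]: "f \<in> borel_measurable borel" by (rule integrable_J_measurable[OF f(1)])
    let ?r = "\<lambda>x. Re (f x)" and ?i = "\<lambda>x. Im (f x)"
    have ri: "integrable J ?r" "integrable J ?i" using f(1) by auto
    have r2: "integrable J (\<lambda>x. (?r x)\<^sup>2)"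
      by (rule Bochner_Integration.integrable_bound[OF f(2)]) (auto simp: cmod_power2 measurable_J)
    have i2: "integrable J (\<lambda>x. (?i x)\<^sup>2)"
      by (rule Bochner_Integration.integrable_bound[OF f(2)]) (auto simp: cmod_power2 measurable_J)
    have rm [measurable]: "rF ?r \<in> borel_measurable borel" "rF ?i \<in> borel_measurable borel" by (intro rF_measurable ri)+
    have "(\<integral>\<^sup>+l. ennreal ((norm (Ft f l))\<^sup>2) \<partial>N) = (\<integral>\<^sup>+l. ennreal (pd l) * ennreal ((norm (Ft f l))\<^sup>2) \<partial>lborel)"
      using Ft_measurable[OF f(1)] by (intro nn_integral_N) measurable
    also have "... <= (\<integral>\<^sup>+l. ennreal D * (ennreal (?g ?r l) + ennreal (?g ?i l)) \<partial>lborel)"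
    proof (rule nn_integral_mono)
      fix l :: real
      have "pd l * (norm (Ft f l))\<^sup>2 <= D * (?g ?r l + ?g ?i l)"
      proof (cases "l > 0")
        case True
        have "pd l * (norm (Ft f l))\<^sup>2 <= (D * wt l) * (norm (Ft f l))\<^sup>2"
          using D(2)[OF True] True by (intro mult_right_mono) (auto simp: pd_def)
        also have "... = D * (?g ?r l + ?g ?i l)" using True by (simp add: cmod_power2 Ft_Re_Im[OF f(1)] algebra_simps)
        finally show ?thesis .
      qed (auto simp: pd_def)
      moreover have "?g ?r l >= 0" "?g ?i l >= 0" by (auto simp: wt_def)
      ultimately show "ennreal (pd l) * ennreal ((norm (Ft f l))\<^sup>2) <= ennreal D * (ennreal (?g ?r l) + ennreal (?g ?i l))"
        using D(1) pd_nonneg by (simp add: ennreal_mult[symmetric] ennreal_plus[symmetric] del: ennreal_plus)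
    qed
    also have "... = ennreal D * ((\<integral>\<^sup>+l. ennreal (?g ?r l) \<partial>lborel) + (\<integral>\<^sup>+l. ennreal (?g ?i l) \<partial>lborel))"
      by (subst nn_integral_cmult, measurable) (subst nn_integral_add, auto)
    also have "... <= ennreal D * (ennreal (C * (\<integral>x. (?r x)\<^sup>2 \<partial>J)) + ennreal (C * (\<integral>x. (?i x)\<^sup>2 \<partial>J)))"
      by (intro mult_left_mono add_mono step2 ri r2 i2) auto
    also have "... = ennreal (D * (C * (\<integral>x. (?r x)\<^sup>2 \<partial>J) + C * (\<integral>x. (?i x)\<^sup>2 \<partial>J)))"
      using D(1) C(1) by (simp add: ennreal_mult ennreal_plus)
    also have "D * (C * (\<integral>x. (?r x)\<^sup>2 \<partial>J) + C * (\<integral>x. (?i x)\<^sup>2 \<partial>J)) = (D * C) * ((\<integral>x. (?r x)\<^sup>2 \<partial>J) + (\<integral>x. (?i x)\<^sup>2 \<partial>J))"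
      by (simp add: algebra_simps)
    also have "(\<integral>x. (?r x)\<^sup>2 \<partial>J) + (\<integral>x. (?i x)\<^sup>2 \<partial>J) = (\<integral>x. (norm (f x))\<^sup>2 \<partial>J)"
      unfolding cmod_power2 using r2 i2 by simp
    finally show ?thesis .
  qed
  then show ?thesis using C(1) D(1) by (intro exI[of _ "D * C"]) auto
qed

text \<open>Marcinkiewicz interpolation between the bound from L^1 to the supremum norm, whose
  constant is 1, and the bound on L^2. The part of f above the level contributes at most t/2 to the
  transform, so where |F f| > t the other part contributes more than t/2; Chebyshev, layer cakes and
  Fubini finish. The unit normalisation makes the level an explicit function of t.\<close>

lemma hausdorff_young_unit:
  assumes p: "1 < p" "p < 2"
  shows "\<exists>C>0. \<forall>f. integrable J f \<and> Lpow J p f <= 1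
     \<longrightarrow> Lpow N (p / (p - 1)) (Ft f) <= ennreal C"
proof -
  obtain C where C: "C > 0" "\<And>f. integrable J f ==> integrable J (\<lambda>x. (norm (f x))\<^sup>2)
     ==> (\<integral>\<^sup>+l. ennreal ((norm (Ft f l))\<^sup>2) \<partial>N) <= ennreal (C * (\<integral>x. (norm (f x))\<^sup>2 \<partial>J))" using plancherel_ineq by blast
  define q where "q = p / (p - 1)"
  have q: "q > 2" "(p - 1) * (q - 2) = 2 - p" "q > 0" using p by (auto simp: q_def field_simps)
  \<comment> \<open>Here 4 comes from Chebyshev at t/2, C from the Plancherel inequality, q from the
    layer cake, and the quotient from integrating t^(q-3) up to \<open>L\<close>. That integral
    converges at 0 because p < 2 makes q > 2.\<close>
  define K where "K = 4 * C * q * (2 powr (q - 2) / (q - 2))"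
  have K: "K > 0" using C(1) q by (simp add: K_def)
  have "Lpow N q (Ft f) <= ennreal K"
    if f: "integrable J f" and f1: "Lpow J p f <= 1" for f
  proof -
    interpret N: sigma_finite_measure N by (rule sigma_finite_N)
    interpret JJ: sigma_finite_measure J by (rule sigma_finite_J)
    interpret P1: pair_sigma_finite lborel N ..
    interpret P2: pair_sigma_finite lborel J ..
    have fm [measurable]: "f \<in> borel_measurable borel" by (rule integrable_J_measurable[OF f])
    have Fm [measurable]: "Ft f \<in> borel_measurable borel" by (rule Ft_measurable[OF f])
    \<comment> \<open>The level for which h(t)^(1-p) = t/2, so that the part of f above it has L^1
      norm at most t/2.\<close>
    define h where "h = (\<lambda>t. (t / 2) powr (- 1 / (p - 1)))"
    have hm [measurable]: "h \<in> borel_measurable borel" unfolding h_def by measurable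
    define w where "w = (\<lambda>t x. if 0 < t \<and> norm (f x) < h t then ennreal (4 * C * q * t powr (q - 3) * (norm (f x))\<^sup>2) else 0)"
    have weak: "(\<integral>\<^sup>+l. (if 0 < t \<and> t < norm (Ft f l) then ennreal (q * t powr (q - 1)) else 0) \<partial>N)
       <= (\<integral>\<^sup>+x. w t x \<partial>J)" for t
    proof (cases "t > 0")
      case True
      have h0: "h t > 0" using True by (simp add: h_def)
      define fa where "fa = (\<lambda>x. if norm (f x) < h t then 0 else f x)"
      define fb where "fb = (\<lambda>x. if norm (f x) < h t then f x else 0)"
      have [measurable]: "fa \<in> borel_measurable borel" "fb \<in> borel_measurable borel" unfolding fa_def fb_def by measurable
      have ia: "integrable J fa"
        by (rule Bochner_Integration.integrable_bound[OF f]) (auto simp: fa_def measurable_J)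
      have ib: "integrable J fb"
        by (rule Bochner_Integration.integrable_bound[OF f]) (auto simp: fb_def measurable_J)
      have ib2: "integrable J (\<lambda>x. (norm (fb x))\<^sup>2)"
      proof (rule Bochner_Integration.integrable_bound)
        show "integrable J (\<lambda>x. h t * norm (f x))" using f by simp
        show "AE x in J. norm ((norm (fb x))\<^sup>2) <= norm (h t * norm (f x))"
          using h0 by (intro AE_I2) (auto simp: fb_def power2_eq_square intro!: mult_right_mono)
      qed (auto simp: measurable_J)
      have na: "(\<integral>x. norm (fa x) \<partial>J) <= t / 2"
      proof -
        have "ennreal (\<integral>x. norm (fa x) \<partial>J) = (\<integral>\<^sup>+x. ennreal (norm (fa x)) \<partial>J)"
          by (rule nn_integral_eq_integral[symmetric]) (use ia in auto)
        also have "... <= (\<integral>\<^sup>+x. ennreal (h t powr (1 - p)) * ennreal (norm (f x) powr p) \<partial>J)"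
        proof (rule nn_integral_mono)
          fix x
          have "norm (fa x) <= h t powr (1 - p) * norm (f x) powr p"
          proof (cases "norm (f x) < h t")
            case False
            then have fx: "norm (f x) >= h t" "norm (f x) > 0" using h0 by auto
            have "norm (f x) = norm (f x) powr (1 - p) * norm (f x) powr p"
              using fx by (simp add: powr_add[symmetric])
            also have "... <= h t powr (1 - p) * norm (f x) powr p"
              using fx h0 p by (intro mult_right_mono powr_mono2') auto
            finally show ?thesis using False by (simp add: fa_def)
          qed (simp add: fa_def)
          then show "ennreal (norm (fa x)) <= ennreal (h t powr (1 - p)) * ennreal (norm (f x) powr p)"
            by (simp add: ennreal_mult[symmetric] ennreal_leI)
        qed
        also have "... = ennreal (h t powr (1 - p)) * (Lpow J p f)"
          by (rule nn_integral_cmult) measurable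
        also have "... <= ennreal (h t powr (1 - p)) * 1" by (intro mult_left_mono f1) auto
        also have "h t powr (1 - p) = t / 2"
        proof -
          have "- 1 / (p - 1) * (1 - p) = 1" using p by (simp add: field_simps)
          then show ?thesis using True by (simp add: h_def powr_powr)
        qed
        finally show ?thesis using True by simp
      qed
      have Fsplit: "Ft f l = Ft fa l + Ft fb l" for l
        using Ft_add[OF ia ib, of l] by (simp add: fa_def fb_def if_distrib cong: if_cong)
      have "(\<integral>\<^sup>+l. (if 0 < t \<and> t < norm (Ft f l) then ennreal (q * t powr (q - 1)) else 0) \<partial>N)
         <= (\<integral>\<^sup>+l. ennreal (4 * q * t powr (q - 3)) * ennreal ((norm (Ft fb l))\<^sup>2) \<partial>N)"
      proof (rule nn_integral_mono)
        fix l
        show "(if 0 < t \<and> t < norm (Ft f l) then ennreal (q * t powr (q - 1)) else 0)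
            <= ennreal (4 * q * t powr (q - 3)) * ennreal ((norm (Ft fb l))\<^sup>2)"
        proof (cases "t < norm (Ft f l)")
          case tt: True
          have "norm (Ft fa l) <= t / 2" using Ft_le[OF ia, of l] na by simp
          then have "norm (Ft fb l) >= t / 2" using tt norm_triangle_ineq[of "Ft fa l" "Ft fb l"] unfolding Fsplit by simp
          then have "(t / 2)\<^sup>2 <= (norm (Ft fb l))\<^sup>2" using True by (intro power_mono) auto
          then have "t\<^sup>2 <= 4 * (norm (Ft fb l))\<^sup>2" by (simp add: power_divide)
          then have "q * t powr (q - 3) * t\<^sup>2 <= q * t powr (q - 3) * (4 * (norm (Ft fb l))\<^sup>2)"
            using q by (intro mult_left_mono) auto
          moreover have "t powr (q - 1) = t powr (q - 3) * t\<^sup>2"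
            using True powr_add[of t "q - 3" 2] by (simp add: powr_numeral)
          ultimately have "q * t powr (q - 1) <= 4 * q * t powr (q - 3) * (norm (Ft fb l))\<^sup>2" by (simp add: mult_ac)
          then show ?thesis using tt True q by (simp add: ennreal_mult[symmetric] ennreal_leI)
        qed simp
      qed
      also have "... = ennreal (4 * q * t powr (q - 3)) * (\<integral>\<^sup>+l. ennreal ((norm (Ft fb l))\<^sup>2) \<partial>N)"
        using Ft_measurable[OF ib] by (intro nn_integral_cmult) measurable
      also have "... <= ennreal (4 * q * t powr (q - 3)) * ennreal (C * (\<integral>x. (norm (fb x))\<^sup>2 \<partial>J))"
        by (intro mult_left_mono C(2) ib ib2) auto
      also have "... = ennreal (4 * C * q * t powr (q - 3)) * ennreal (\<integral>x. (norm (fb x))\<^sup>2 \<partial>J)"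
        using q C(1) by (simp add: ennreal_mult[symmetric] mult_ac)
      also have "ennreal (\<integral>x. (norm (fb x))\<^sup>2 \<partial>J) = (\<integral>\<^sup>+x. ennreal ((norm (fb x))\<^sup>2) \<partial>J)"
        by (rule nn_integral_eq_integral[symmetric]) (use ib2 in auto)
      also have "ennreal (4 * C * q * t powr (q - 3)) * ... = (\<integral>\<^sup>+x. ennreal (4 * C * q * t powr (q - 3)) * ennreal ((norm (fb x))\<^sup>2) \<partial>J)"
        by (rule nn_integral_cmult[symmetric]) measurable
      also have "... = (\<integral>\<^sup>+x. w t x \<partial>J)"
        using True q C(1) by (intro nn_integral_cong) (auto simp: w_def fb_def ennreal_mult[symmetric])
      finally show ?thesis .
    qed simp
    have "(Lpow N q (Ft f))
       = (\<integral>\<^sup>+l. (\<integral>\<^sup>+t. (if 0 < t \<and> t < norm (Ft f l) then ennreal (q * t powr (q - 1)) else 0) \<partial>lborel) \<partial>N)"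
    proof (rule nn_integral_cong)
      fix l
      have "(\<integral>\<^sup>+t. (if 0 < t \<and> t < norm (Ft f l) then ennreal (q * t powr (q - 1)) else 0) \<partial>lborel)
         = (\<integral>\<^sup>+t. ennreal q * ennreal (if 0 < t \<and> t < norm (Ft f l) then t powr (q - 1) else 0) \<partial>lborel)"
        using q by (intro nn_integral_cong) (auto simp: ennreal_mult)
      also have "... = ennreal q * ennreal (norm (Ft f l) powr q / q)"
        using nn_integral_powr_Ioo[of q "norm (Ft f l)"] q by (subst nn_integral_cmult) auto
      also have "... = ennreal (norm (Ft f l) powr q)" using q by (simp add: ennreal_mult[symmetric])
      finally show "ennreal (norm (Ft f l) powr q) = (\<integral>\<^sup>+t. (if 0 < t \<and> t < norm (Ft f l) then ennreal (q * t powr (q - 1)) else 0) \<partial>lborel)" ..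
    qed
    also have "... = (\<integral>\<^sup>+t. (\<integral>\<^sup>+l. (if 0 < t \<and> t < norm (Ft f l) then ennreal (q * t powr (q - 1)) else 0) \<partial>N) \<partial>lborel)"
      by (rule P1.Fubini') measurable
    also have "... <= (\<integral>\<^sup>+t. (\<integral>\<^sup>+x. w t x \<partial>J) \<partial>lborel)" by (intro nn_integral_mono weak)
    also have "... = (\<integral>\<^sup>+x. (\<integral>\<^sup>+t. w t x \<partial>lborel) \<partial>J)"
      by (rule P2.Fubini'[symmetric]) (unfold w_def, measurable)
    also have "... <= (\<integral>\<^sup>+x. ennreal K * ennreal (norm (f x) powr p) \<partial>J)"
    proof (rule nn_integral_mono)
      fix x
      show "(\<integral>\<^sup>+t. w t x \<partial>lborel) <= ennreal K * ennreal (norm (f x) powr p)"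
      proof (cases "f x = 0")
        case True
        then have "w t x = 0" for t by (simp add: w_def)
        then show ?thesis by simp
      next
        case False
        define r where "r = norm (f x)"
        have r: "r > 0" using False by (simp add: r_def)
        \<comment> \<open>The threshold solved for t: r < h(t) forces t < L, so for fixed x the
          integral over t runs over a bounded interval.\<close>
        define L where "L = 2 * r powr (- (p - 1))"
        have L: "L > 0" using r by (simp add: L_def)
        have tL: "t < L" if t: "0 < t" "r < h t" for t
        proof -
          have "r powr (p - 1) < h t powr (p - 1)" using t r p by (intro powr_less_mono2) auto
          also have "h t powr (p - 1) = (t / 2) powr (- 1)" using p by (simp add: h_def powr_powr)
          also have "... = 2 / t" using t by (simp add: powr_minus_divide)
          finally have "t * r powr (p - 1) < 2" using t by (simp add: field_simps)
          moreover have "L = 2 / r powr (p - 1)" unfolding L_def powr_minus_divide by simp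
          ultimately show ?thesis using r by (simp add: pos_less_divide_eq)
        qed
        have "(\<integral>\<^sup>+t. w t x \<partial>lborel) <= (\<integral>\<^sup>+t. ennreal (4 * C * q * r\<^sup>2) * ennreal (if 0 < t \<and> t < L then t powr ((q - 2) - 1) else 0) \<partial>lborel)"
        proof (rule nn_integral_mono)
          fix t :: real
          show "w t x <= ennreal (4 * C * q * r\<^sup>2) * ennreal (if 0 < t \<and> t < L then t powr ((q - 2) - 1) else 0)"
            using tL[of t] C(1) q unfolding w_def r_def[symmetric] by (auto simp: ennreal_mult[symmetric] mult_ac)
        qed
        also have "... = ennreal (4 * C * q * r\<^sup>2) * ennreal (L powr (q - 2) / (q - 2))"
          using nn_integral_powr_Ioo[of "q - 2" L] q L by (subst nn_integral_cmult) auto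
        also have "... = ennreal (4 * C * q * r\<^sup>2 * (L powr (q - 2) / (q - 2)))"
          using C(1) q by (simp add: ennreal_mult[symmetric])
        also have "4 * C * q * r\<^sup>2 * (L powr (q - 2) / (q - 2)) = K * r powr p"
        proof -
          have "L powr (q - 2) = 2 powr (q - 2) * r powr (- (p - 1) * (q - 2))"
            using r by (simp add: L_def powr_mult powr_powr)
          also have "- (p - 1) * (q - 2) = p - 2" using q(2) by (simp add: algebra_simps)
          finally have "r\<^sup>2 * L powr (q - 2) = 2 powr (q - 2) * (r powr 2 * r powr (p - 2))" using r by (simp add: powr_numeral)
          also have "r powr 2 * r powr (p - 2) = r powr p" by (subst powr_add[symmetric]) simp
          finally have *: "r\<^sup>2 * L powr (q - 2) = 2 powr (q - 2) * r powr p" .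
          have "4 * C * q * r\<^sup>2 * (L powr (q - 2) / (q - 2)) = 4 * C * q * ((r\<^sup>2 * L powr (q - 2)) / (q - 2))" by simp
          then show ?thesis unfolding * K_def by simp
        qed
        finally show ?thesis using K by (simp add: r_def ennreal_mult[symmetric])
      qed
    qed
    also have "... = ennreal K * (Lpow J p f)" by (rule nn_integral_cmult) measurable
    also have "... <= ennreal K * 1" by (intro mult_left_mono f1) auto
    finally show ?thesis by simp
  qed
  then show ?thesis using K unfolding q_def by blast
qed

text \<open>Rescaling f by K^(-1/p) reduces to the unit case; the exponent 1/(p-1) is q/p. For p = 2
  the statement is the Plancherel inequality itself.\<close>

lemma hausdorff_young:
  assumes p: "1 < p" "p <= 2"
  shows "\<exists>C>0. \<forall>f K. integrable J f \<and> K > 0 \<and> Lpow J p f <= ennreal K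
     \<longrightarrow> Lpow N (p / (p - 1)) (Ft f) <= ennreal (C * K powr (1 / (p - 1)))"
proof (cases "p = 2")
  case True
  obtain C where C: "C > 0" "\<And>f. integrable J f ==> integrable J (\<lambda>x. (norm (f x))\<^sup>2)
     ==> (\<integral>\<^sup>+l. ennreal ((norm (Ft f l))\<^sup>2) \<partial>N) <= ennreal (C * (\<integral>x. (norm (f x))\<^sup>2 \<partial>J))" using plancherel_ineq by blast
  have "Lpow N 2 (Ft f) <= ennreal (C * K)"
    if f: "integrable J f" and K: "K > 0" "Lpow J 2 f <= ennreal K" for f K
  proof -
    have fm [measurable]: "f \<in> borel_measurable borel" by (rule integrable_J_measurable[OF f])
    have p2: "norm z powr 2 = (norm z)\<^sup>2" for z :: complex by (simp add: powr_numeral)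
    have i2: "integrable J (\<lambda>x. (norm (f x))\<^sup>2)"
      using K by (intro integrableI_bounded) (auto simp: p2 measurable_J less_top[symmetric] top_unique intro: le_less_trans)
    have "ennreal (\<integral>x. (norm (f x))\<^sup>2 \<partial>J) = (\<integral>\<^sup>+x. ennreal ((norm (f x))\<^sup>2) \<partial>J)"
      by (rule nn_integral_eq_integral[symmetric]) (use i2 in auto)
    also have "... <= ennreal K" using K by (simp add: p2)
    finally have "(\<integral>x. (norm (f x))\<^sup>2 \<partial>J) <= K" using K by (simp add: ennreal_le_iff)
    then have "ennreal (C * (\<integral>x. (norm (f x))\<^sup>2 \<partial>J)) <= ennreal (C * K)" using C(1) by (intro ennreal_leI mult_left_mono) auto
    with C(2)[OF f i2] show ?thesis unfolding p2 by (rule order_trans)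
  qed
  then show ?thesis using True C(1) by (intro exI[of _ C]) auto
next
  case False
  then have p': "1 < p" "p < 2" using p by auto
  obtain C where C: "C > 0" "\<And>f. integrable J f ==> Lpow J p f <= 1
     ==> Lpow N (p / (p - 1)) (Ft f) <= ennreal C" using hausdorff_young_unit[OF p'] by blast
  have "Lpow N (p / (p - 1)) (Ft f) <= ennreal (C * K powr (1 / (p - 1)))"
    if f: "integrable J f" and K: "K > 0" "Lpow J p f <= ennreal K" for f K
  proof -
    have fm [measurable]: "f \<in> borel_measurable borel" by (rule integrable_J_measurable[OF f])
    define q where "q = p / (p - 1)"
    define c where "c = K powr (- 1 / p)"
    have c: "c > 0" using K by (simp add: c_def)
    have cp: "c powr p = 1 / K"
    proof -
      have "- 1 / p * p = - 1" using p by simp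
      then show ?thesis unfolding c_def powr_powr using K by (simp add: powr_minus_divide)
    qed
    have cq: "c powr q * K powr (1 / (p - 1)) = 1"
    proof -
      have "- 1 / p * q + 1 / (p - 1) = 0" using p by (simp add: q_def field_simps)
      then show ?thesis using K by (simp add: c_def powr_powr powr_add[symmetric])
    qed
    let ?f = "\<lambda>x. of_real c * f x"
    have fi: "integrable J ?f" using f by simp
    have "Lpow J p ?f = (\<integral>\<^sup>+x. ennreal (1 / K) * ennreal (norm (f x) powr p) \<partial>J)"
      using c K by (intro nn_integral_cong) (simp add: norm_mult powr_mult cp ennreal_mult[symmetric])
    also have "... = ennreal (1 / K) * (Lpow J p f)" by (rule nn_integral_cmult) measurable
    also have "... <= ennreal (1 / K) * ennreal K" by (intro mult_left_mono K) auto
    also have "... = 1" using K by (simp add: ennreal_mult[symmetric])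
    finally have le1: "Lpow J p ?f <= 1" .
    have "Lpow N q (Ft f) = (\<integral>\<^sup>+l. ennreal (K powr (1 / (p - 1))) * ennreal (norm (Ft ?f l) powr q) \<partial>N)"
    proof (rule nn_integral_cong)
      fix l
      have "K powr (1 / (p - 1)) * norm (Ft ?f l) powr q = (c powr q * K powr (1 / (p - 1))) * norm (Ft f l) powr q"
        using c by (simp add: Ft_scale norm_mult powr_mult)
      then show "ennreal (norm (Ft f l) powr q) = ennreal (K powr (1 / (p - 1))) * ennreal (norm (Ft ?f l) powr q)"
        unfolding cq by (simp add: ennreal_mult[symmetric])
    qed
    also have "... = ennreal (K powr (1 / (p - 1))) * (Lpow N q (Ft ?f))"
      using Ft_measurable[OF fi] by (intro nn_integral_cmult) measurable
    also have "... <= ennreal (K powr (1 / (p - 1))) * ennreal C"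
      unfolding q_def by (intro mult_left_mono C(2) fi le1) auto
    also have "... = ennreal (C * K powr (1 / (p - 1)))" using C(1) by (simp add: ennreal_mult[symmetric] mult.commute)
    finally show ?thesis unfolding q_def .
  qed
  then show ?thesis using C(1) by (intro exI[of _ C]) auto
qed

end

section \<open>Symmetry of the translation\<close>

text \<open>Substitution on [0, n+1] and monotone convergence. The substitution is given on the
  nonnegative half-line only, so measurability is obtained from products with its indicator; single
  points are negligible.\<close>

lemma nn_integral_substitution_Ioi:
  fixes F :: "real => ennreal" and G G' :: "real => real"
  assumes [measurable]: "F \<in> borel_measurable borel"
    and dG: "\<And>y. y >= 0 ==> (G has_real_derivative G' y) (at y)"
    and cG': "continuous_on {0..} G'" and G'0: "\<And>y. y >= 0 ==> G' y >= 0"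
    and lim: "filterlim G at_top at_top"
  shows "(\<integral>\<^sup>+z. F z * indicator {G 0<..} z \<partial>lborel) = (\<integral>\<^sup>+y. F (G y) * ennreal (G' y) * indicator {0<..} y \<partial>lborel)"
proof -
  have G'm: "(\<lambda>y. indicator {0..} y * G' y) \<in> borel_measurable borel"
    using borel_measurable_continuous_on_indicator[OF _ cG'] by simp
  have Gc: "continuous_on {0..} G" by (intro continuous_at_imp_continuous_on ballI DERIV_isCont[OF dG]) auto
  have Gm: "(\<lambda>y. indicator {0..} y * G y) \<in> borel_measurable borel"
    using borel_measurable_continuous_on_indicator[OF _ Gc] by simp
  have mono: "G y <= G z" if "0 <= y" "y <= z" for y z
  proof (rule DERIV_nonneg_imp_nondecreasing[OF that(2)])
    fix w assume "y <= w" "w <= z"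
    then show "\<exists>d. (G has_real_derivative d) (at w) \<and> 0 <= d"
      using dG[of w] G'0[of w] that(1) by (intro exI[of _ "G' w"]) auto
  qed
  let ?L = "\<lambda>n z. F z * indicator {G 0..G (real (Suc n))} z"
  let ?R = "\<lambda>n y. F (G y) * ennreal (G' y) * indicator {0..real (Suc n)} y"
  have eq: "(\<integral>\<^sup>+z. ?L n z \<partial>lborel) = (\<integral>\<^sup>+y. ?R n y \<partial>lborel)" for n
  proof (rule nn_integral_substitution_aux)
    show "continuous_on {0..real (Suc n)} G'" by (rule continuous_on_subset[OF cG']) auto
  qed (use dG G'0 in auto)
  have Rm: "?R n \<in> borel_measurable lborel" for n
  proof -
    have "?R n = (\<lambda>y. F (indicator {0..} y * G y) * ennreal (indicator {0..} y * G' y) * indicator {0..real (Suc n)} y)"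
      by (auto simp: indicator_def)
    then show ?thesis using Gm G'm by simp
  qed
  have Lm: "?L n \<in> borel_measurable lborel" for n by measurable
  have iL: "incseq ?L"
  proof (intro incseq_SucI le_funI mult_left_mono)
    fix n z show "indicator {G 0..G (real (Suc n))} z <= (indicator {G 0..G (real (Suc (Suc n)))} z :: ennreal)"
      using mono[of "real (Suc n)" "real (Suc (Suc n))"] by (auto simp: indicator_def)
  qed auto
  have iR: "incseq ?R" by (intro incseq_SucI le_funI mult_left_mono) (auto simp: indicator_def)
  have l1: "(\<lambda>n. \<integral>\<^sup>+z. ?L n z \<partial>lborel) \<longlonglongrightarrow> (\<integral>\<^sup>+z. F z * indicator {G 0..} z \<partial>lborel)"
  proof (rule nn_integral_LIMSEQ[OF iL Lm])
    fix z
    have "eventually (\<lambda>y. G y >= z) at_top" using lim by (auto simp: filterlim_at_top)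
    then obtain y0 where y0: "\<And>y. y >= y0 ==> G y >= z" by (auto simp: eventually_at_top_linorder)
    obtain m :: nat where m: "y0 <= real m" using real_arch_simple by blast
    have "eventually (\<lambda>n. ?L n z = F z * indicator {G 0..} z) sequentially"
      unfolding eventually_sequentially
    proof (intro exI[of _ m] allI impI)
      fix n assume "m <= n"
      then have "G (real (Suc n)) >= z" using m by (intro y0) auto
      then show "?L n z = F z * indicator {G 0..} z" by (auto simp: indicator_def)
    qed
    then show "(\<lambda>n. ?L n z) \<longlonglongrightarrow> F z * indicator {G 0..} z" by (rule tendsto_eventually)
  qed
  have l2: "(\<lambda>n. \<integral>\<^sup>+y. ?R n y \<partial>lborel) \<longlonglongrightarrow> (\<integral>\<^sup>+y. F (G y) * ennreal (G' y) * indicator {0..} y \<partial>lborel)"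
  proof (rule nn_integral_LIMSEQ[OF iR Rm])
    fix y
    obtain m :: nat where m: "y <= real m" using real_arch_simple by blast
    have "eventually (\<lambda>n. ?R n y = F (G y) * ennreal (G' y) * indicator {0..} y) sequentially"
      unfolding eventually_sequentially
      by (intro exI[of _ m] allI impI) (use m in \<open>auto simp: indicator_def\<close>)
    then show "(\<lambda>n. ?R n y) \<longlonglongrightarrow> F (G y) * ennreal (G' y) * indicator {0..} y" by (rule tendsto_eventually)
  qed
  have "(\<integral>\<^sup>+z. F z * indicator {G 0<..} z \<partial>lborel) = (\<integral>\<^sup>+z. F z * indicator {G 0..} z \<partial>lborel)"
    by (rule nn_integral_cong_AE) (use AE_lborel_singleton[of "G 0"] in \<open>eventually_elim, auto simp: indicator_def\<close>)
  also have "... = (\<integral>\<^sup>+y. F (G y) * ennreal (G' y) * indicator {0..} y \<partial>lborel)"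
    using LIMSEQ_unique[OF l1] l2 unfolding eq by blast
  also have "... = (\<integral>\<^sup>+y. F (G y) * ennreal (G' y) * indicator {0<..} y \<partial>lborel)"
    by (rule nn_integral_cong_AE) (use AE_lborel_singleton[of "0::real"] in \<open>eventually_elim, auto simp: indicator_def\<close>)
  finally show ?thesis .
qed

section \<open>Symmetry of an integral operator given by a kernel\<close>

context jacobi begin

lemma nn_integral_J: "f \<in> borel_measurable borel ==> (\<integral>\<^sup>+x. f x \<partial>J) = (\<integral>\<^sup>+x. ennreal (indicator {0<..} x * A x) * f x \<partial>lborel)"
  unfolding J_def by (rule nn_integral_density) auto

lemma nn_integral_\<Omega>:
  assumes [measurable]: "h \<in> borel_measurable borel"
  shows "(\<integral>\<^sup>+w. h w \<partial>\<Omega>) = (\<integral>\<^sup>+t. \<integral>\<^sup>+\<theta>. h (t, \<theta>) \<partial>beta_measure (\<beta> + 1/2) (\<alpha> - \<beta>) \<partial>beta_measure (\<alpha> + 1/2) (\<alpha> + 1/2))"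
proof -
  interpret B2: prob_space "beta_measure (\<beta> + 1/2) (\<alpha> - \<beta>)" by (rule beta2)
  have "h \<in> borel_measurable (beta_measure (\<alpha> + 1/2) (\<alpha> + 1/2) \<Otimes>\<^sub>M beta_measure (\<beta> + 1/2) (\<alpha> - \<beta>))"
    unfolding \<Omega>_def[symmetric] by (simp add: measurable_cong_sets[OF sets_\<Omega> refl])
  from B2.nn_integral_fst[OF this] show ?thesis unfolding \<Omega>_def by simp
qed

text \<open>The translation of functions with values in [0, \<infinity>]: orders of integration can
  be exchanged without integrability conditions.\<close>

definition transl_nn :: "real => (real => ennreal) => real => ennreal" where
  "transl_nn x f y = (\<integral>\<^sup>+w. f (tt x y w) \<partial>\<Omega>)"

text \<open>Once the translation is given, in a coordinate z = G(y), by a kernel that is symmetric up to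
  the density of the measure, symmetry is a matter of interchanging two integrals.\<close>

lemma kernel_symmetry:
  fixes G G' Gi v k1 k2 :: "real => real" and k :: "real => real => ennreal" and c1 c2 :: real
  assumes [measurable]: "f \<in> borel_measurable borel" "g \<in> borel_measurable borel"
    and km [measurable]: "case_prod k \<in> borel_measurable (borel \<Otimes>\<^sub>M borel)"
      "v \<in> borel_measurable borel" "k1 \<in> borel_measurable borel" "k2 \<in> borel_measurable borel" "Gi \<in> borel_measurable borel"
    and dG: "\<And>y. y >= 0 ==> (G has_real_derivative G' y) (at y)" "continuous_on {0..} G'" "\<And>y. y >= 0 ==> G' y >= 0"
      "filterlim G at_top at_top" "G 0 = 1" "\<And>y. y > 0 ==> Gi (G y) = y"
    and A: "\<And>y. y > 0 ==> A y = c1 * v (G y) * G' y"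
    and nn: "c1 >= 0" "c2 >= 0" "\<And>z. v z >= 0" "\<And>z. k1 z >= 0" "\<And>z. k2 z >= 0"
    and vk: "\<And>z. z > 1 ==> v z * k1 z = c2 * k2 z"
    and ks: "\<And>z W. k z W = k W z" "\<And>z W. z > 1 ==> W <= 1 ==> k z W = 0"
    and T: "\<And>h y. h \<in> borel_measurable borel ==> y > 0 ==>
        transl_nn x h y = (\<integral>\<^sup>+W. h (Gi W) * (ennreal (k1 (G y) * k2 W) * k (G y) W) \<partial>lborel)"
  shows "(\<integral>\<^sup>+y. g y * transl_nn x f y \<partial>J) = (\<integral>\<^sup>+y. f y * transl_nn x g y \<partial>J)"
proof -
  \<comment> \<open>The integrand in the coordinates z and W, symmetric under exchange of the two
    variables together with f and g. Both range over (1, \<infinity>), because the coordinate starts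
    at \<open>G 0 = 1\<close> and the kernel vanishes for smaller W.\<close>
  define S where "S = (\<lambda>(f::real => ennreal) (g::real => ennreal) z W. indicator {1<..} z * indicator {1<..} W *
      (ennreal (c1 * c2 * (k2 z * k2 W)) * k z W * (g (Gi z) * f (Gi W))))"
  have main: "(\<integral>\<^sup>+y. g y * transl_nn x f y \<partial>J) = (\<integral>\<^sup>+z. \<integral>\<^sup>+W. S f g z W \<partial>lborel \<partial>lborel)"
    if [measurable]: "f \<in> borel_measurable borel" "g \<in> borel_measurable borel" for f g
  proof -
    define F where "F = (\<lambda>z. ennreal (c1 * v z) * (g (Gi z) * (\<integral>\<^sup>+W. f (Gi W) * (ennreal (k1 z * k2 W) * k z W) \<partial>lborel)))"
    have Fm [measurable]: "F \<in> borel_measurable borel" unfolding F_def by measurable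
    have "(\<integral>\<^sup>+y. g y * transl_nn x f y \<partial>J) = (\<integral>\<^sup>+y. (F (G y) * ennreal (G' y)) * indicator {0<..} y \<partial>lborel)"
    proof -
      have "(\<integral>\<^sup>+y. g y * transl_nn x f y \<partial>J) = (\<integral>\<^sup>+y. g y * (\<integral>\<^sup>+W. f (Gi W) * (ennreal (k1 (indicator {0..} y * G y) * k2 W) * k (indicator {0..} y * G y) W) \<partial>lborel) \<partial>J)"
        by (rule nn_integral_cong_AE) (use AE_J in \<open>eventually_elim, simp add: T\<close>)
      also have "... = (\<integral>\<^sup>+y. ennreal (indicator {0<..} y * A y) * (g y * (\<integral>\<^sup>+W. f (Gi W) * (ennreal (k1 (indicator {0..} y * G y) * k2 W) * k (indicator {0..} y * G y) W) \<partial>lborel)) \<partial>lborel)"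
      proof (rule nn_integral_J)
        \<comment> \<open>Only values of \<open>G\<close> on the nonnegative half-line are
          controlled, so measurability on the line is shown for its product with the
          indicator.\<close>
        have Gc: "continuous_on {0..} G" by (intro continuous_at_imp_continuous_on ballI DERIV_isCont[OF dG(1)]) auto
        have [measurable]: "(\<lambda>y. indicator {0..} y * G y) \<in> borel_measurable borel"
          using borel_measurable_continuous_on_indicator[OF _ Gc] by simp
        show "(\<lambda>y. g y * (\<integral>\<^sup>+W. f (Gi W) * (ennreal (k1 (indicator {0..} y * G y) * k2 W) * k (indicator {0..} y * G y) W) \<partial>lborel)) \<in> borel_measurable borel"
          by measurable
      qed
      also have "... = (\<integral>\<^sup>+y. (F (G y) * ennreal (G' y)) * indicator {0<..} y \<partial>lborel)"
      proof (rule nn_integral_cong)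
        fix y :: real
        show "ennreal (indicator {0<..} y * A y) * (g y * (\<integral>\<^sup>+W. f (Gi W) * (ennreal (k1 (indicator {0..} y * G y) * k2 W) * k (indicator {0..} y * G y) W) \<partial>lborel))
          = (F (G y) * ennreal (G' y)) * indicator {0<..} y"
        proof (cases "y > 0")
          case True
          have "ennreal (A y) = ennreal (c1 * v (G y)) * ennreal (G' y)"
            unfolding A[OF True] using nn dG(3)[of y] True by (intro ennreal_mult) auto
          then show ?thesis using True dG(6)[OF True] by (simp add: F_def mult_ac)
        qed simp
      qed
      finally show ?thesis .
    qed
    also have "... = (\<integral>\<^sup>+z. F z * indicator {1<..} z \<partial>lborel)"
      using nn_integral_substitution_Ioi[OF Fm dG(1,2,3,4)] unfolding dG(5) by simp
    also have "... = (\<integral>\<^sup>+z. \<integral>\<^sup>+W. S f g z W \<partial>lborel \<partial>lborel)"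
    proof (rule nn_integral_cong)
      fix z :: real
      have "F z * indicator {1<..} z = (\<integral>\<^sup>+W. indicator {1<..} z * (ennreal (c1 * v z) * (g (Gi z) * (f (Gi W) * (ennreal (k1 z * k2 W) * k z W)))) \<partial>lborel)"
        unfolding F_def by (simp add: nn_integral_cmult mult.commute)
      also have "... = (\<integral>\<^sup>+W. S f g z W \<partial>lborel)"
      proof (rule nn_integral_cong)
        fix W :: real
        show "indicator {1<..} z * (ennreal (c1 * v z) * (g (Gi z) * (f (Gi W) * (ennreal (k1 z * k2 W) * k z W)))) = S f g z W"
        proof (cases "z > 1 \<and> W > 1")
          case True
          have "c1 * c2 * (k2 z * k2 W) = (c1 * v z) * (k1 z * k2 W)" using vk[of z] True by (simp add: mult_ac)
          then have "ennreal (c1 * c2 * (k2 z * k2 W)) = ennreal (c1 * v z) * ennreal (k1 z * k2 W)"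
            using nn by (simp add: ennreal_mult[symmetric])
          then show ?thesis using True by (simp add: S_def mult_ac)
        next
          case False
          then show ?thesis using ks(2)[of z W] by (auto simp: S_def indicator_def)
        qed
      qed
      finally show "F z * indicator {1<..} z = (\<integral>\<^sup>+W. S f g z W \<partial>lborel)" .
    qed
    finally show ?thesis .
  qed
  have "(\<integral>\<^sup>+z. \<integral>\<^sup>+W. S f g z W \<partial>lborel \<partial>lborel) = (\<integral>\<^sup>+W. \<integral>\<^sup>+z. S f g z W \<partial>lborel \<partial>lborel)"
    by (rule lborel_pair.Fubini'[symmetric]) (unfold S_def, measurable)
  also have "... = (\<integral>\<^sup>+W. \<integral>\<^sup>+z. S g f W z \<partial>lborel \<partial>lborel)"
    by (intro nn_integral_cong) (simp add: S_def mult_ac ks(1))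
  finally show ?thesis using main[of f g] main[of g f] by simp
qed

text \<open>With a = p + (2t-1) r the density becomes a power of m(a) = r^2 - (a-p)^2, since t(1-t)
  = m(a) / (4 r^2). The normalisation is written as (r^2)^(-\<alpha>) because r^2 factors into a
  part in x and a part in y.\<close>

lemma beta1_affine:
  fixes p r :: real
  assumes r: "r > 0" and [measurable]: "h \<in> borel_measurable borel" "\<Phi> \<in> borel_measurable borel"
    and h: "\<And>t. 0 < t ==> t < 1 ==> h t = \<Phi> (p + (2 * t - 1) * r)"
  defines "m \<equiv> \<lambda>a. r\<^sup>2 - (a - p)\<^sup>2"
  shows "(\<integral>\<^sup>+t. h t \<partial>beta_measure (\<alpha> + 1/2) (\<alpha> + 1/2))
    = (\<integral>\<^sup>+a. ennreal (4 powr (1/2 - \<alpha>) / (2 * Beta (\<alpha> + 1/2) (\<alpha> + 1/2)) * (r\<^sup>2) powr (- \<alpha>)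
        * (if m a > 0 then m a powr (\<alpha> - 1/2) else 0)) * \<Phi> a \<partial>lborel)"
proof -
  define B where "B = Beta (\<alpha> + 1/2) (\<alpha> + 1/2)"
  have a0: "\<alpha> + 1/2 > 0" using \<alpha>_gt by simp
  have B: "B > 0" unfolding B_def by (rule Beta_real_pos[OF a0 a0])
  define d where "d = (\<lambda>t. indicator {0<..<1} t * (t powr (\<alpha> + 1/2 - 1) * (1 - t) powr (\<alpha> + 1/2 - 1) / B) :: real)"
  have dm [measurable]: "d \<in> borel_measurable borel" unfolding d_def by measurable
  have bm: "beta_measure (\<alpha> + 1/2) (\<alpha> + 1/2) = density lborel (\<lambda>t. ennreal (d t))"
    using a0 by (auto simp: beta_measure_def d_def B_def)
  have "(\<integral>\<^sup>+t. h t \<partial>beta_measure (\<alpha> + 1/2) (\<alpha> + 1/2)) = (\<integral>\<^sup>+t. ennreal (d t) * h t \<partial>lborel)"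
    unfolding bm by (rule nn_integral_density) measurable
  also have "... = (\<integral>\<^sup>+t. ennreal (d t) * \<Phi> (p + (2 * t - 1) * r) \<partial>lborel)"
    using h by (intro nn_integral_cong) (auto simp: d_def indicator_def)
  also have "... = ennreal \<bar>1 / (2 * r)\<bar> * (\<integral>\<^sup>+a. ennreal (d ((1/2 - p / (2 * r)) + 1 / (2 * r) * a)) *
       \<Phi> (p + (2 * ((1/2 - p / (2 * r)) + 1 / (2 * r) * a) - 1) * r) \<partial>lborel)"
    using r by (intro nn_integral_real_affine) auto
  also have "... = (\<integral>\<^sup>+a. ennreal (1 / (2 * r)) * (ennreal (d ((1/2 - p / (2 * r)) + 1 / (2 * r) * a)) *
       \<Phi> (p + (2 * ((1/2 - p / (2 * r)) + 1 / (2 * r) * a) - 1) * r)) \<partial>lborel)"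
    using r by (subst nn_integral_cmult) auto
  also have "... = (\<integral>\<^sup>+a. ennreal (4 powr (1/2 - \<alpha>) / (2 * B) * (r\<^sup>2) powr (- \<alpha>)
        * (if m a > 0 then m a powr (\<alpha> - 1/2) else 0)) * \<Phi> a \<partial>lborel)"
  proof (rule nn_integral_cong)
    fix a :: real
    define t where "t = (1/2 - p / (2 * r)) + 1 / (2 * r) * a"
    have u: "2 * t - 1 = (a - p) / r" using r by (simp add: t_def field_simps)
    then have ua: "p + (2 * t - 1) * r = a" using r by simp
    have tt: "t * (1 - t) = m a / (4 * r\<^sup>2)"
    proof -
      have "4 * (t * (1 - t)) = 1 - (2 * t - 1)\<^sup>2" by (simp add: power2_eq_square algebra_simps)
      also have "... = m a / r\<^sup>2" unfolding u m_def power_divide using r by (simp add: field_simps)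
      finally show ?thesis by simp
    qed
    have "1 / (2 * r) * d t = 4 powr (1/2 - \<alpha>) / (2 * B) * (r\<^sup>2) powr (- \<alpha>) * (if m a > 0 then m a powr (\<alpha> - 1/2) else 0)"
    proof (cases "0 < t \<and> t < 1")
      case True
      then have "0 < t * (1 - t)" by simp
      then have m0: "m a > 0" unfolding tt using r by (simp add: zero_less_divide_iff)
      have "d t = (t * (1 - t)) powr (\<alpha> - 1/2) / B" using True by (simp add: d_def powr_mult)
      also have "(t * (1 - t)) powr (\<alpha> - 1/2) = m a powr (\<alpha> - 1/2) / (4 * r\<^sup>2) powr (\<alpha> - 1/2)"
        unfolding tt using m0 r by (simp add: powr_divide)
      also have "(4 * r\<^sup>2) powr (\<alpha> - 1/2) = 4 powr (\<alpha> - 1/2) * (r\<^sup>2) powr (\<alpha> - 1/2)" by (simp add: powr_mult)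
      finally have d: "d t = m a powr (\<alpha> - 1/2) / (4 powr (\<alpha> - 1/2) * (r\<^sup>2) powr (\<alpha> - 1/2)) / B" .
      have 4: "4 powr (1/2 - \<alpha>) = 1 / 4 powr (\<alpha> - 1/2)" using powr_minus_divide[of 4 "\<alpha> - 1/2"] by simp
      have ra: "(r\<^sup>2) powr (- \<alpha>) = 1 / ((r\<^sup>2) powr (\<alpha> - 1/2) * r)"
      proof -
        have "(r\<^sup>2) powr \<alpha> = (r\<^sup>2) powr (\<alpha> - 1/2) * (r\<^sup>2) powr (1/2)"
          using powr_add[of "r\<^sup>2" "\<alpha> - 1/2" "1/2"] by (simp only: diff_add_cancel)
        also have "(r\<^sup>2) powr (1/2) = r" using r by (simp add: powr_half_sqrt)
        finally show ?thesis by (simp add: powr_minus_divide)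
      qed
      show ?thesis unfolding d 4 ra using m0 r B by simp
    next
      case False
      then have "t * (1 - t) <= 0" by (auto simp: mult_le_0_iff not_less)
      then have "\<not> m a > 0" unfolding tt using r by (auto simp: divide_le_0_iff)
      then show ?thesis using False by (auto simp: d_def)
    qed
    then show "ennreal (1 / (2 * r)) * (ennreal (d ((1/2 - p / (2 * r)) + 1 / (2 * r) * a)) *
       \<Phi> (p + (2 * ((1/2 - p / (2 * r)) + 1 / (2 * r) * a) - 1) * r))
      = ennreal (4 powr (1/2 - \<alpha>) / (2 * B) * (r\<^sup>2) powr (- \<alpha>) * (if m a > 0 then m a powr (\<alpha> - 1/2) else 0)) * \<Phi> a"
      unfolding t_def[symmetric] ua using r B by (simp add: mult.assoc[symmetric] ennreal_mult[symmetric] d_def)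
  qed
  finally show ?thesis unfolding B_def .
qed

end

text \<open>The expression equals (c^2-1)(z^2-1) - (cz-W)^2; at W = 1 it is minus the square of c -
  z, and smaller W only increases the term subtracted. It makes the kernel vanish where W is not the
  hyperbolic cosine of a positive length.\<close>

lemma kernel_arg_nonpos:
  fixes c z W :: real
  assumes "c >= 1" "z > 1" "W <= 1"
  shows "1 - c\<^sup>2 - z\<^sup>2 - W\<^sup>2 + 2 * c * (z * W) <= 0"
proof -
  have "1 * 1 <= c * z" using assms by (intro mult_mono) auto
  then have "(c * z - 1)\<^sup>2 <= (c * z - W)\<^sup>2" using assms by (intro power_mono) auto
  moreover have "(c * z - 1)\<^sup>2 - (c\<^sup>2 - 1) * (z\<^sup>2 - 1) = (c - z)\<^sup>2" by (simp add: power2_eq_square algebra_simps)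
  moreover have "1 - c\<^sup>2 - z\<^sup>2 - W\<^sup>2 + 2 * c * (z * W) = (c\<^sup>2 - 1) * (z\<^sup>2 - 1) - (c * z - W)\<^sup>2"
    by (simp add: power2_eq_square algebra_simps)
  ultimately show ?thesis using zero_le_power2[of "c - z"] by linarith
qed

lemma filterlim_cosh_at_top: "filterlim (cosh :: real => real) at_top at_top"
proof (rule filterlim_at_top_mono)
  show "filterlim (\<lambda>x::real. x) at_top at_top" by (rule filterlim_ident)
  show "eventually (\<lambda>x::real. x <= cosh x) at_top"
    using eventually_ge_at_top[of 0]
  proof eventually_elim
    fix x :: real assume "x >= 0"
    then show "x <= cosh x" using sinh_real_ge_self[of x] sinh_less_cosh_real[of x] by linarith
  qed
qed

lemma sinh_sq: "(sinh x)\<^sup>2 = (cosh x)\<^sup>2 - (1::real)" by (simp add: cosh_square_eq)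

lemma sinh_powr_double: "x > 0 ==> ((sinh x)\<^sup>2) powr a * sinh x = sinh (x::real) powr (2 * a + 1)"
proof -
  assume "x > 0"
  then have s: "sinh x > 0" by simp
  then have "(sinh x)\<^sup>2 = sinh x powr 2" by (simp add: powr_numeral)
  then have "((sinh x)\<^sup>2) powr a = sinh x powr (2 * a)" by (simp add: powr_powr)
  then show ?thesis using s by (simp add: powr_add)
qed

section \<open>The kernels of the translation\<close>

context jacobi begin

lemma tt_nonneg: "tt x y w >= 0"
proof -
  have "sinh (tt x y w) >= 0" using TT_nonneg by (simp add: tt_def)
  then show ?thesis by simp
qed

lemma cosh_tt_sq: "(cosh (tt x y w))\<^sup>2 = 1 + TT x y w"
  by (simp add: cosh_square_eq sinh_tt)

text \<open>When \<theta> is deterministic, the third side obeys a law of cosines at scale s that is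
  affine in u. In the coordinate cosh(sy) the kernel is a power of 1 - c^2 - z^2 - W^2 + 2czW,
  symmetric in z and W, and the remaining factor (z^2-1)^(-\<alpha>) cancels against the
  weight.\<close>

lemma transl_symmetric_1d:
  assumes x: "x > 0" and s: "s > 0" and \<theta>: "0 <= \<theta>" "\<theta> <= 1"
    and bm: "beta_measure (\<beta> + 1/2) (\<alpha> - \<beta>) = return borel \<theta>"
    and ct: "\<And>y t. y > 0 ==> 0 < t ==> t < 1 ==>
       cosh (s * tt x y (t, \<theta>)) = cosh (s * x) * cosh (s * y) + (2 * t - 1) * (sinh (s * x) * sinh (s * y))"
    and A: "\<And>y. y > 0 ==> A y = c0 * sinh (s * y) powr (2*\<alpha>+1)" and c0: "c0 >= 0"
    and fg [measurable]: "f \<in> borel_measurable borel" "g \<in> borel_measurable borel"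
  shows "(\<integral>\<^sup>+y. g y * transl_nn x f y \<partial>J) = (\<integral>\<^sup>+y. f y * transl_nn x g y \<partial>J)"
proof -
  define c where "c = cosh (s * x)"
  define C where "C = 4 powr (1/2 - \<alpha>) / (2 * Beta (\<alpha> + 1/2) (\<alpha> + 1/2))"
  define M where "M = (\<lambda>z W. 1 - c\<^sup>2 - z\<^sup>2 - W\<^sup>2 + 2 * c * (z * W))"
  define Gi where "Gi = (\<lambda>W::real. arsinh (sqrt (W\<^sup>2 - 1)) / s)"
  have B: "Beta (\<alpha> + 1/2) (\<alpha> + 1/2) > 0" using \<alpha>_gt by (intro Beta_real_pos) auto
  have C0: "C >= 0" using B by (simp add: C_def)
  have c1: "c >= 1" by (simp add: c_def cosh_real_ge_1)
  have sx: "sinh (s * x) > 0" using x s by simp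
  have Gi: "Gi (cosh (s * y)) = y" if "y >= 0" for y
  proof -
    have "sqrt ((cosh (s * y))\<^sup>2 - 1) = sinh (s * y)" using that s by (simp add: sinh_sq[symmetric])
    then show ?thesis using s by (simp add: Gi_def arsinh_sinh_real)
  qed
  have Gim [measurable]: "Gi \<in> borel_measurable borel"
    unfolding Gi_def using s by (intro borel_measurable_continuous_onI continuous_intros) auto
  show ?thesis
  proof (rule kernel_symmetry[where G="\<lambda>y. cosh (s * y)" and G'="\<lambda>y. s * sinh (s * y)" and Gi=Gi and ?c1.0="c0 / s"
        and v="\<lambda>z. (z\<^sup>2 - 1) powr \<alpha>" and ?c2.0="C * ((sinh (s * x))\<^sup>2) powr (- \<alpha>)"
        and ?k1.0="\<lambda>z. C * ((sinh (s * x))\<^sup>2 * (z\<^sup>2 - 1)) powr (- \<alpha>)" and ?k2.0="\<lambda>_. 1"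
        and k="\<lambda>z W. ennreal (if M z W > 0 then M z W powr (\<alpha> - 1/2) else 0)"])
    show "((\<lambda>y. cosh (s * y)) has_real_derivative s * sinh (s * y)) (at y)" for y
      by (auto intro!: derivative_eq_intros)
    show "continuous_on {0..} (\<lambda>y. s * sinh (s * y))" by (intro continuous_intros)
    show "s * sinh (s * y) >= 0" if "y >= 0" for y using that s by simp
    show "filterlim (\<lambda>y. cosh (s * y)) at_top at_top"
      by (rule filterlim_compose[OF filterlim_cosh_at_top])
         (rule filterlim_tendsto_pos_mult_at_top[OF tendsto_const s filterlim_ident])
    show "A y = c0 / s * ((cosh (s * y))\<^sup>2 - 1) powr \<alpha> * (s * sinh (s * y))" if y: "y > 0" for y
    proof -
      have "sinh (s * y) powr (2*\<alpha>+1) = ((sinh (s * y))\<^sup>2) powr \<alpha> * sinh (s * y)"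
        using sinh_powr_double[of "s * y" \<alpha>] y s by simp
      then show ?thesis unfolding A[OF y] sinh_sq using s by (simp add: field_simps)
    qed
    show "(z\<^sup>2 - 1) powr \<alpha> * (C * ((sinh (s * x))\<^sup>2 * (z\<^sup>2 - 1)) powr (- \<alpha>)) = C * ((sinh (s * x))\<^sup>2) powr (- \<alpha>) * 1" if "z > 1" for z
    proof -
      have z: "z\<^sup>2 - 1 > 0" using that by (simp add: power2_eq_square) (simp add: less_1_mult)
      have "(z\<^sup>2 - 1) powr \<alpha> * ((sinh (s * x))\<^sup>2 * (z\<^sup>2 - 1)) powr (- \<alpha>)
         = ((sinh (s * x))\<^sup>2) powr (- \<alpha>) * ((z\<^sup>2 - 1) powr \<alpha> * (z\<^sup>2 - 1) powr (- \<alpha>))"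
        using z by (subst powr_mult) (auto simp: mult_ac)
      also have "(z\<^sup>2 - 1) powr \<alpha> * (z\<^sup>2 - 1) powr (- \<alpha>) = 1" using z by (simp add: powr_add[symmetric])
      finally show ?thesis by (simp add: mult_ac)
    qed
    show "ennreal (if M z W > 0 then M z W powr (\<alpha> - 1/2) else 0) = ennreal (if M W z > 0 then M W z powr (\<alpha> - 1/2) else 0)" for z W
      by (simp add: M_def algebra_simps)
    show "ennreal (if M z W > 0 then M z W powr (\<alpha> - 1/2) else 0) = 0" if "z > 1" "W <= 1" for z W
      using kernel_arg_nonpos[OF c1 that] by (simp add: M_def)
    fix h :: "real => ennreal" and y :: real
    assume hm [measurable]: "h \<in> borel_measurable borel" and y: "y > 0"
    define p r where "p = cosh (s * x) * cosh (s * y)" and "r = sinh (s * x) * sinh (s * y)"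
    have r: "r > 0" using sx y s by (simp add: r_def)
    have mM: "r\<^sup>2 - (a - p)\<^sup>2 = M (cosh (s * y)) a" for a
      unfolding r_def p_def M_def c_def power_mult_distrib sinh_sq by (simp add: power2_eq_square algebra_simps)
    have htm: "(\<lambda>t. h (tt x y (t, \<theta>))) \<in> borel_measurable borel" by measurable
    have "transl_nn x h y = (\<integral>\<^sup>+t. \<integral>\<^sup>+\<theta>'. h (tt x y (t, \<theta>')) \<partial>return borel \<theta> \<partial>beta_measure (\<alpha> + 1/2) (\<alpha> + 1/2))"
      unfolding transl_nn_def by (subst nn_integral_\<Omega>) (auto simp: bm)
    also have "... = (\<integral>\<^sup>+t. h (tt x y (t, \<theta>)) \<partial>beta_measure (\<alpha> + 1/2) (\<alpha> + 1/2))"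
      by (intro nn_integral_cong nn_integral_return) auto
    also have "... = (\<integral>\<^sup>+a. ennreal (C * (r\<^sup>2) powr (- \<alpha>) * (if r\<^sup>2 - (a - p)\<^sup>2 > 0 then (r\<^sup>2 - (a - p)\<^sup>2) powr (\<alpha> - 1/2) else 0)) * h (Gi a) \<partial>lborel)"
      unfolding C_def
    proof (rule beta1_affine[OF r htm])
      fix t :: real assume t: "0 < t" "t < 1"
      have "p + (2 * t - 1) * r = cosh (s * tt x y (t, \<theta>))" using ct[OF y t] by (simp add: p_def r_def)
      then show "h (tt x y (t, \<theta>)) = h (Gi (p + (2 * t - 1) * r))" using Gi tt_nonneg by simp
    qed measurable
    also have "... = (\<integral>\<^sup>+W. h (Gi W) * (ennreal (C * ((sinh (s * x))\<^sup>2 * ((cosh (s * y))\<^sup>2 - 1)) powr (- \<alpha>) * 1)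
        * ennreal (if M (cosh (s * y)) W > 0 then M (cosh (s * y)) W powr (\<alpha> - 1/2) else 0)) \<partial>lborel)"
      unfolding mM using C0 by (intro nn_integral_cong) (auto simp: r_def power_mult_distrib sinh_sq[of "s * y"] ennreal_mult mult_ac)
    finally show "transl_nn x h y = (\<integral>\<^sup>+W. h (Gi W) * (ennreal (C * ((sinh (s * x))\<^sup>2 * ((cosh (s * y))\<^sup>2 - 1)) powr (- \<alpha>) * 1)
        * ennreal (if M (cosh (s * y)) W > 0 then M (cosh (s * y)) W powr (\<alpha> - 1/2) else 0)) \<partial>lborel)" .
  next
    show "(\<lambda>(z, W). ennreal (if M z W > 0 then M z W powr (\<alpha> - 1/2) else 0)) \<in> borel_measurable (borel \<Otimes>\<^sub>M borel)"
      unfolding M_def by measurable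
  qed (use Gi C0 c0 s in \<open>auto intro!: mult_nonneg_nonneg\<close>)
qed

text \<open>The coordinates are z = cosh^2 y and W = cosh^2 of the third side. Write the complex
  number in the product formula with real part a and squared modulus W: integrating out a leaves a
  kernel whose symmetry becomes visible when a = sqrt(W) \<xi>, with \<xi> the cosine of the
  argument.\<close>

lemma transl_symmetric_2d:
  assumes x: "x > 0" and ab: "\<beta> > -1/2" "\<alpha> > \<beta>"
    and fg [measurable]: "f \<in> borel_measurable borel" "g \<in> borel_measurable borel"
  shows "(\<integral>\<^sup>+y. g y * transl_nn x f y \<partial>J) = (\<integral>\<^sup>+y. f y * transl_nn x g y \<partial>J)"
proof -
  define c where "c = cosh x"
  define B2 where "B2 = Beta (\<beta> + 1/2) (\<alpha> - \<beta>)"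
  define C where "C = 4 powr (1/2 - \<alpha>) / (2 * Beta (\<alpha> + 1/2) (\<alpha> + 1/2))"
  have b2: "\<beta> + 1/2 > 0" "\<alpha> - \<beta> > 0" using ab by auto
  have Bp: "Beta (\<alpha> + 1/2) (\<alpha> + 1/2) > 0" using \<alpha>_gt by (intro Beta_real_pos) auto
  have B2p: "B2 > 0" unfolding B2_def by (rule Beta_real_pos[OF b2])
  have C0: "C >= 0" using Bp by (simp add: C_def)
  have c1: "c >= 1" by (simp add: c_def cosh_real_ge_1)
  define M where "M = (\<lambda>z W \<xi>. 1 - c\<^sup>2 - z - W + 2 * c * (sqrt z * sqrt W) * \<xi>)"
  define kk where "kk = (\<lambda>z W \<xi>. if 0 < z \<and> 0 < W \<and> \<xi>\<^sup>2 < 1 \<and> M z W \<xi> > 0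
      then (1 - \<xi>\<^sup>2) powr (\<beta> - 1/2) * M z W \<xi> powr (\<alpha> - \<beta> - 1) else 0)"
  have kk0: "kk z W \<xi> >= 0" for z W \<xi> by (simp add: kk_def)
  define k where "k = (\<lambda>z W. \<integral>\<^sup>+\<xi>. ennreal (kk z W \<xi>) \<partial>lborel)"
  define Gi where "Gi = (\<lambda>W::real. arsinh (sqrt (W - 1)))"
  have Gim [measurable]: "Gi \<in> borel_measurable borel"
    unfolding Gi_def by (intro borel_measurable_continuous_onI continuous_intros)
  have kkm [measurable]: "(\<lambda>(zW, \<xi>). ennreal (kk (fst zW) (snd zW) \<xi>)) \<in> borel_measurable ((borel \<Otimes>\<^sub>M borel) \<Otimes>\<^sub>M lborel)"
    unfolding kk_def M_def by measurable
  have Gi: "Gi ((cosh y)\<^sup>2) = y" if "y >= 0" for y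
    using that by (simp add: Gi_def sinh_sq[symmetric] arsinh_sinh_real)
  define k2 where "k2 = (\<lambda>W::real. if W > 0 then W powr \<beta> else 0)"
  have k2m [measurable]: "k2 \<in> borel_measurable borel" unfolding k2_def by measurable
  show ?thesis
  proof (rule kernel_symmetry[where G="\<lambda>y. (cosh y)\<^sup>2" and G'="\<lambda>y. 2 * (cosh y * sinh y)" and Gi=Gi and ?c1.0="2 powr (2*\<rho>) / 2"
        and v="\<lambda>z. (z - 1) powr \<alpha> * k2 z" and ?c2.0="C / B2 * ((sinh x)\<^sup>2) powr (- \<alpha>)"
        and ?k1.0="\<lambda>z. C / B2 * ((sinh x)\<^sup>2 * (z - 1)) powr (- \<alpha>)" and ?k2.0=k2 and k=k])
    show "((\<lambda>y. (cosh y)\<^sup>2) has_real_derivative 2 * (cosh y * sinh y)) (at y)" for y :: real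
      by (auto intro!: derivative_eq_intros)
    show "continuous_on {0..} (\<lambda>y::real. 2 * (cosh y * sinh y))" by (intro continuous_intros)
    show "filterlim (\<lambda>y::real. (cosh y)\<^sup>2) at_top at_top"
      by (rule filterlim_pow_at_top[OF _ filterlim_cosh_at_top]) simp
    show "A y = 2 powr (2*\<rho>) / 2 * (((cosh y)\<^sup>2 - 1) powr \<alpha> * k2 ((cosh y)\<^sup>2)) * (2 * (cosh y * sinh y))" if y: "y > 0" for y
    proof -
      have c0: "cosh y > 0" by simp
      have 1: "((cosh y)\<^sup>2) powr \<beta> * cosh y = cosh y powr (2*\<beta>+1)"
      proof -
        have "((cosh y)\<^sup>2) powr \<beta> = (cosh y powr 2) powr \<beta>" using c0 by (simp add: powr_numeral)
        also have "... = cosh y powr (2 * \<beta>)" by (rule powr_powr)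
        finally show ?thesis using c0 by (simp add: powr_add)
      qed
      have "A y = 2 powr (2*\<rho>) * (((sinh y)\<^sup>2) powr \<alpha> * sinh y) * (((cosh y)\<^sup>2) powr \<beta> * cosh y)"
        unfolding sinh_powr_double[OF y] 1 jac_A_def ..
      then show ?thesis unfolding sinh_sq k2_def by simp
    qed
    show "(z - 1) powr \<alpha> * k2 z * (C / B2 * ((sinh x)\<^sup>2 * (z - 1)) powr (- \<alpha>)) = C / B2 * ((sinh x)\<^sup>2) powr (- \<alpha>) * k2 z" if z: "z > 1" for z
    proof -
      have "(z - 1) powr \<alpha> * ((sinh x)\<^sup>2 * (z - 1)) powr (- \<alpha>) = ((sinh x)\<^sup>2) powr (- \<alpha>) * ((z - 1) powr \<alpha> * (z - 1) powr (- \<alpha>))"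
        using z by (subst powr_mult) (auto simp: mult_ac)
      also have "(z - 1) powr \<alpha> * (z - 1) powr (- \<alpha>) = 1" using z by (simp add: powr_add[symmetric])
      finally have "(z - 1) powr \<alpha> * ((sinh x)\<^sup>2 * (z - 1)) powr (- \<alpha>) = ((sinh x)\<^sup>2) powr (- \<alpha>)" by simp
      then show ?thesis by (metis mult.assoc mult.commute)
    qed
    have "kk z W \<xi> = kk W z \<xi>" for z W \<xi> by (simp add: kk_def M_def algebra_simps)
    then show "k z W = k W z" for z W unfolding k_def by simp
    show "k z W = 0" if "z > 1" "W <= 1" for z W
    proof -
      have "kk z W \<xi> = 0" for \<xi>
      proof (rule ccontr)
        assume "kk z W \<xi> \<noteq> 0"
        then have *: "0 < W" "\<xi>\<^sup>2 < 1" "M z W \<xi> > 0" by (auto simp: kk_def split: if_splits)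
        then have "\<xi> < 1" by (simp add: abs_square_less_1)
        then have "2 * c * (sqrt z * sqrt W) * \<xi> <= 2 * c * (sqrt z * sqrt W) * 1"
          using c1 that *(1) by (intro mult_left_mono) auto
        moreover have "1 - c\<^sup>2 - (sqrt z)\<^sup>2 - (sqrt W)\<^sup>2 + 2 * c * (sqrt z * sqrt W) <= 0"
          using that *(1) by (intro kernel_arg_nonpos c1) auto
        ultimately show False using *(1,3) that by (simp add: M_def)
      qed
      then show ?thesis by (simp add: k_def)
    qed
    fix h :: "real => ennreal" and y :: real
    assume hm [measurable]: "h \<in> borel_measurable borel" and y: "y > 0"
    define p r where "p = cosh x * cosh y" and "r = sinh x * sinh y"
    define z where "z = (cosh y)\<^sup>2"
    have r: "r > 0" using x y by (simp add: r_def)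
    have z0: "z > 0" by (simp add: z_def)
    define m where "m = (\<lambda>a. r\<^sup>2 - (a - p)\<^sup>2)"
    define d2 where "d2 = (\<lambda>\<theta>. indicator {0<..<1} \<theta> * (\<theta> powr (\<beta> + 1/2 - 1) * (1 - \<theta>) powr (\<alpha> - \<beta> - 1) / B2) :: real)"
    have d2m [measurable]: "d2 \<in> borel_measurable borel" unfolding d2_def by measurable
    have bm: "beta_measure (\<beta> + 1/2) (\<alpha> - \<beta>) = density lborel (\<lambda>\<theta>. ennreal (d2 \<theta>))"
      using b2 by (auto simp: beta_measure_def d2_def B2_def)
    define \<Phi> where "\<Phi> = (\<lambda>a. \<integral>\<^sup>+\<theta>. ennreal (d2 \<theta>) * h (Gi (a\<^sup>2 + m a * \<theta>)) \<partial>lborel)"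
    have \<Phi>m [measurable]: "\<Phi> \<in> borel_measurable borel" unfolding \<Phi>_def m_def by measurable
    \<comment> \<open>The unnormalised joint density of the real part a and the squared modulus W; W
      - a^2 is the squared imaginary part and is the fraction \<theta> of m(a).\<close>
    define \<delta> where "\<delta> = (\<lambda>a W. if W - a\<^sup>2 > 0 \<and> m a - (W - a\<^sup>2) > 0
        then (W - a\<^sup>2) powr (\<beta> - 1/2) * (m a - (W - a\<^sup>2)) powr (\<alpha> - \<beta> - 1) else 0)"
    have \<delta>0: "\<delta> a W >= 0" for a W by (simp add: \<delta>_def)
    have \<delta>m [measurable]: "(\<lambda>(a, W). ennreal (\<delta> a W)) \<in> borel_measurable (borel \<Otimes>\<^sub>M borel)" unfolding \<delta>_def m_def by measurable
    define D where "D = C / B2 * (r\<^sup>2) powr (- \<alpha>)"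
    have D0: "D >= 0" using C0 B2p by (simp add: D_def)
    interpret B2s: prob_space "beta_measure (\<beta> + 1/2) (\<alpha> - \<beta>)" by (rule beta2)
    have him: "(\<lambda>t. \<integral>\<^sup>+\<theta>. h (tt x y (t, \<theta>)) \<partial>beta_measure (\<beta> + 1/2) (\<alpha> - \<beta>)) \<in> borel_measurable borel"
      by (intro B2s.borel_measurable_nn_integral) measurable
    have "transl_nn x h y = (\<integral>\<^sup>+t. \<integral>\<^sup>+\<theta>. h (tt x y (t, \<theta>)) \<partial>beta_measure (\<beta> + 1/2) (\<alpha> - \<beta>) \<partial>beta_measure (\<alpha> + 1/2) (\<alpha> + 1/2))"
      unfolding transl_nn_def by (rule nn_integral_\<Omega>) measurable
    also have "... = (\<integral>\<^sup>+a. ennreal (C * (r\<^sup>2) powr (- \<alpha>) * (if r\<^sup>2 - (a - p)\<^sup>2 > 0 then (r\<^sup>2 - (a - p)\<^sup>2) powr (\<alpha> - 1/2) else 0)) * \<Phi> a \<partial>lborel)"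
      unfolding C_def
    proof (rule beta1_affine[OF r him \<Phi>m])
      fix t :: real assume t: "0 < t" "t < 1"
      have "(\<integral>\<^sup>+\<theta>. h (tt x y (t, \<theta>)) \<partial>beta_measure (\<beta> + 1/2) (\<alpha> - \<beta>)) = (\<integral>\<^sup>+\<theta>. ennreal (d2 \<theta>) * h (tt x y (t, \<theta>)) \<partial>lborel)"
        unfolding bm by (rule nn_integral_density) measurable
      also have "... = \<Phi> (p + (2 * t - 1) * r)" unfolding \<Phi>_def
      proof (rule nn_integral_cong)
        fix \<theta> :: real
        let ?a = "p + (2 * t - 1) * r"
        show "ennreal (d2 \<theta>) * h (tt x y (t, \<theta>)) = ennreal (d2 \<theta>) * h (Gi (?a\<^sup>2 + m ?a * \<theta>))"
        proof (cases "0 < \<theta> \<and> \<theta> < 1")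
          case True
          have "1 + TT x y (t, \<theta>) = ?a\<^sup>2 + m ?a * \<theta>"
            using t True by (simp add: TT_def Tq_def clamp01_id p_def r_def m_def power2_eq_square algebra_simps)
          moreover have "tt x y (t, \<theta>) = Gi (1 + TT x y (t, \<theta>))" by (simp add: tt_def Gi_def)
          ultimately show ?thesis by simp
        qed (auto simp: d2_def)
      qed
      finally show "(\<integral>\<^sup>+\<theta>. h (tt x y (t, \<theta>)) \<partial>beta_measure (\<beta> + 1/2) (\<alpha> - \<beta>)) = \<Phi> (p + (2 * t - 1) * r)" .
    qed
    also have "... = (\<integral>\<^sup>+a. \<integral>\<^sup>+W. ennreal (D * \<delta> a W) * h (Gi W) \<partial>lborel \<partial>lborel)"
    proof (rule nn_integral_cong)
      fix a :: real
      show "ennreal (C * (r\<^sup>2) powr (- \<alpha>) * (if r\<^sup>2 - (a - p)\<^sup>2 > 0 then (r\<^sup>2 - (a - p)\<^sup>2) powr (\<alpha> - 1/2) else 0)) * \<Phi> a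
         = (\<integral>\<^sup>+W. ennreal (D * \<delta> a W) * h (Gi W) \<partial>lborel)"
      proof (cases "m a > 0")
        case False
        then have "\<delta> a W = 0" for W by (auto simp: \<delta>_def)
        then show ?thesis using False by (simp add: m_def)
      next
        case True
        have "\<Phi> a = ennreal \<bar>1 / m a\<bar> * (\<integral>\<^sup>+W. ennreal (d2 (- a\<^sup>2 / m a + 1 / m a * W)) * h (Gi (a\<^sup>2 + m a * (- a\<^sup>2 / m a + 1 / m a * W))) \<partial>lborel)"
          unfolding \<Phi>_def using True by (intro nn_integral_real_affine) auto
        then have "ennreal (C * (r\<^sup>2) powr (- \<alpha>) * m a powr (\<alpha> - 1/2)) * \<Phi> a
           = (\<integral>\<^sup>+W. ennreal (C * (r\<^sup>2) powr (- \<alpha>) * m a powr (\<alpha> - 1/2)) * (ennreal (1 / m a) * (ennreal (d2 (- a\<^sup>2 / m a + 1 / m a * W)) * h (Gi (a\<^sup>2 + m a * (- a\<^sup>2 / m a + 1 / m a * W))))) \<partial>lborel)"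
          using True by (simp add: nn_integral_cmult)
        also have "... = (\<integral>\<^sup>+W. ennreal (D * \<delta> a W) * h (Gi W) \<partial>lborel)"
        proof (rule nn_integral_cong)
          fix W :: real
          define q where "q = - a\<^sup>2 / m a + 1 / m a * W"
          have q: "q = (W - a\<^sup>2) / m a" "1 - q = (m a - (W - a\<^sup>2)) / m a" "a\<^sup>2 + m a * q = W"
            using True by (auto simp: q_def field_simps)
          have "C * (r\<^sup>2) powr (- \<alpha>) * m a powr (\<alpha> - 1/2) * (1 / m a) * d2 q = D * \<delta> a W"
          proof (cases "0 < q \<and> q < 1")
            case q01: True
            have "0 < W - a\<^sup>2" using q01 True q(1) by (simp add: zero_less_divide_iff)
            moreover have "0 < 1 - q" using q01 by simp
            then have "0 < m a - (W - a\<^sup>2)" unfolding q(2) using True by (simp add: zero_less_divide_iff)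
            ultimately have pos: "0 < W - a\<^sup>2" "0 < m a - (W - a\<^sup>2)" .
            have "d2 q = q powr (\<beta> - 1/2) * (1 - q) powr (\<alpha> - \<beta> - 1) / B2" using q01 by (simp add: d2_def)
            also have "q powr (\<beta> - 1/2) = (W - a\<^sup>2) powr (\<beta> - 1/2) / m a powr (\<beta> - 1/2)"
              unfolding q(1) using pos True by (simp only: powr_divide)
            also have "(1 - q) powr (\<alpha> - \<beta> - 1) = (m a - (W - a\<^sup>2)) powr (\<alpha> - \<beta> - 1) / m a powr (\<alpha> - \<beta> - 1)"
              unfolding q(2) using pos True by (simp only: powr_divide)
            finally have d2q: "d2 q = \<delta> a W / (m a powr (\<beta> - 1/2) * m a powr (\<alpha> - \<beta> - 1)) / B2"
              using pos by (simp add: \<delta>_def)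
            have "m a powr (\<beta> - 1/2) * m a powr (\<alpha> - \<beta> - 1) * m a powr 1 = m a powr (\<alpha> - 1/2)"
              unfolding powr_add[symmetric] by simp
            then have mm: "m a powr (\<alpha> - 1/2) = m a powr (\<beta> - 1/2) * m a powr (\<alpha> - \<beta> - 1) * m a" using True by simp
            show ?thesis unfolding d2q mm D_def using True by (simp add: field_simps)
          next
            case False
            then have "\<not> (0 < W - a\<^sup>2 \<and> 0 < m a - (W - a\<^sup>2))"
              using True q by (metis diff_gt_0_iff_gt zero_less_divide_iff)
            then show ?thesis using False by (auto simp: d2_def \<delta>_def)
          qed
          moreover have "d2 q >= 0" using B2p by (auto simp: d2_def indicator_def)
          ultimately show "ennreal (C * (r\<^sup>2) powr (- \<alpha>) * m a powr (\<alpha> - 1/2)) * (ennreal (1 / m a) * (ennreal (d2 (- a\<^sup>2 / m a + 1 / m a * W)) * h (Gi (a\<^sup>2 + m a * (- a\<^sup>2 / m a + 1 / m a * W)))))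
             = ennreal (D * \<delta> a W) * h (Gi W)"
            unfolding q_def[symmetric] q(3) using C0 True by (simp add: mult.assoc[symmetric] ennreal_mult[symmetric])
        qed
        finally show ?thesis using True unfolding m_def by simp
      qed
    qed
    also have "... = (\<integral>\<^sup>+W. \<integral>\<^sup>+a. ennreal (D * \<delta> a W) * h (Gi W) \<partial>lborel \<partial>lborel)"
      using D0 \<delta>0 by (intro lborel_pair.Fubini'[symmetric]) (simp add: ennreal_mult)
    also have "... = (\<integral>\<^sup>+W. h (Gi W) * (ennreal (C / B2 * ((sinh x)\<^sup>2 * (z - 1)) powr (- \<alpha>) * k2 W) * k z W) \<partial>lborel)"
    proof (rule nn_integral_cong)
      fix W :: real
      have Deq: "D = C / B2 * ((sinh x)\<^sup>2 * (z - 1)) powr (- \<alpha>)"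
        by (simp add: D_def r_def z_def power_mult_distrib sinh_sq[of y])
      have [measurable]: "(\<lambda>a. ennreal (\<delta> a W)) \<in> borel_measurable borel" unfolding \<delta>_def m_def by measurable
      have [measurable]: "(\<lambda>\<xi>. ennreal (kk z W \<xi>)) \<in> borel_measurable borel" unfolding kk_def M_def by measurable
      have "(\<integral>\<^sup>+a. ennreal (D * \<delta> a W) * h (Gi W) \<partial>lborel) = h (Gi W) * (ennreal D * (\<integral>\<^sup>+a. ennreal (\<delta> a W) \<partial>lborel))"
      proof -
        have m1: "(\<lambda>a. ennreal (\<delta> a W)) \<in> borel_measurable lborel" by measurable
        have "(\<integral>\<^sup>+a. ennreal (D * \<delta> a W) * h (Gi W) \<partial>lborel) = (\<integral>\<^sup>+a. (h (Gi W) * ennreal D) * ennreal (\<delta> a W) \<partial>lborel)"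
          using D0 \<delta>0 by (intro nn_integral_cong) (simp add: ennreal_mult mult_ac)
        then show ?thesis unfolding nn_integral_cmult[OF m1] by (simp add: mult.assoc)
      qed
      also have "(\<integral>\<^sup>+a. ennreal (\<delta> a W) \<partial>lborel) = ennreal (k2 W) * k z W"
      proof (cases "W > 0")
        case False
        then have "\<delta> a W = 0" for a using zero_le_power2[of a] unfolding \<delta>_def by (smt (verit))
        then show ?thesis using False by (simp add: k2_def)
      next
        case True
        have "(\<integral>\<^sup>+a. ennreal (\<delta> a W) \<partial>lborel) = ennreal \<bar>sqrt W\<bar> * (\<integral>\<^sup>+\<xi>. ennreal (\<delta> (0 + sqrt W * \<xi>) W) \<partial>lborel)"
          using True by (intro nn_integral_real_affine) auto
        also have "... = (\<integral>\<^sup>+\<xi>. ennreal (sqrt W) * ennreal (\<delta> (sqrt W * \<xi>) W) \<partial>lborel)"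
        proof -
          have [measurable]: "(\<lambda>\<xi>. ennreal (\<delta> (sqrt W * \<xi>) W)) \<in> borel_measurable borel" unfolding \<delta>_def m_def by measurable
          have m1: "(\<lambda>\<xi>. ennreal (\<delta> (sqrt W * \<xi>) W)) \<in> borel_measurable lborel" by measurable
          show ?thesis unfolding nn_integral_cmult[OF m1] using True by simp
        qed
        also have "... = (\<integral>\<^sup>+\<xi>. ennreal (W powr \<beta>) * ennreal (kk z W \<xi>) \<partial>lborel)"
        proof (rule nn_integral_cong)
          fix \<xi> :: real
          have 1: "W - (sqrt W * \<xi>)\<^sup>2 = W * (1 - \<xi>\<^sup>2)" using True by (simp add: power_mult_distrib algebra_simps)
          \<comment> \<open>After the substitution the squares of a cancel, and z and W enter only
            through z + W and sqrt(z) sqrt(W).\<close>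
          have 2: "m (sqrt W * \<xi>) - (W - (sqrt W * \<xi>)\<^sup>2) = M z W \<xi>"
          proof -
            have "sqrt z = cosh y" by (simp add: z_def)
            then show ?thesis
              unfolding m_def M_def r_def p_def c_def z_def power_mult_distrib[of "sinh x"] sinh_sq by (simp add: power2_eq_square algebra_simps)
          qed
          have "sqrt W * \<delta> (sqrt W * \<xi>) W = W powr \<beta> * kk z W \<xi>"
          proof (cases "\<xi>\<^sup>2 < 1 \<and> M z W \<xi> > 0")
            case t: True
            then have "W * (1 - \<xi>\<^sup>2) > 0" using True by simp
            then have "sqrt W * \<delta> (sqrt W * \<xi>) W = sqrt W * ((W * (1 - \<xi>\<^sup>2)) powr (\<beta> - 1/2) * M z W \<xi> powr (\<alpha> - \<beta> - 1))"
              unfolding \<delta>_def 1 2[unfolded 1] using t by simp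
            also have "(W * (1 - \<xi>\<^sup>2)) powr (\<beta> - 1/2) = W powr (\<beta> - 1/2) * (1 - \<xi>\<^sup>2) powr (\<beta> - 1/2)"
              using True t by (simp only: powr_mult)
            also have "sqrt W * (W powr (\<beta> - 1/2) * (1 - \<xi>\<^sup>2) powr (\<beta> - 1/2) * M z W \<xi> powr (\<alpha> - \<beta> - 1))
               = (W powr (1/2) * W powr (\<beta> - 1/2)) * ((1 - \<xi>\<^sup>2) powr (\<beta> - 1/2) * M z W \<xi> powr (\<alpha> - \<beta> - 1))"
              using True by (simp add: powr_half_sqrt)
            also have "W powr (1/2) * W powr (\<beta> - 1/2) = W powr \<beta>" by (subst powr_add[symmetric]) simp
            finally show ?thesis using t True z0 by (simp add: kk_def)
          next
            case False
            then have "\<not> (0 < W * (1 - \<xi>\<^sup>2) \<and> 0 < M z W \<xi>)" using True by (auto simp: zero_less_mult_iff)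
            then have "\<delta> (sqrt W * \<xi>) W = 0" unfolding \<delta>_def 1 2[unfolded 1] by auto
            then show ?thesis using False by (auto simp: kk_def)
          qed
          then show "ennreal (sqrt W) * ennreal (\<delta> (sqrt W * \<xi>) W) = ennreal (W powr \<beta>) * ennreal (kk z W \<xi>)"
            using True \<delta>0 kk0 by (simp add: ennreal_mult[symmetric])
        qed
        also have "... = ennreal (k2 W) * k z W"
        proof -
          have m1: "(\<lambda>\<xi>. ennreal (kk z W \<xi>)) \<in> borel_measurable lborel" by measurable
          show ?thesis unfolding nn_integral_cmult[OF m1] using True by (simp add: k2_def k_def)
        qed
        finally show ?thesis .
      qed
      also have "h (Gi W) * (ennreal D * (ennreal (k2 W) * k z W)) = h (Gi W) * (ennreal (D * k2 W) * k z W)"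
        using D0 by (simp add: ennreal_mult k2_def mult.assoc)
      finally show "(\<integral>\<^sup>+a. ennreal (D * \<delta> a W) * h (Gi W) \<partial>lborel)
         = h (Gi W) * (ennreal (C / B2 * ((sinh x)\<^sup>2 * (z - 1)) powr (- \<alpha>) * k2 W) * k z W)" unfolding Deq .
    qed
    finally show "transl_nn x h y = (\<integral>\<^sup>+W. h (Gi W) * (ennreal (C / B2 * ((sinh x)\<^sup>2 * ((cosh y)\<^sup>2 - 1)) powr (- \<alpha>) * k2 W) * k ((cosh y)\<^sup>2) W) \<partial>lborel)"
      unfolding z_def .
  next
    have "(\<lambda>zW. k (fst zW) (snd zW)) \<in> borel_measurable (borel \<Otimes>\<^sub>M borel)"
      unfolding k_def using lborel.borel_measurable_nn_integral[OF kkm] by simp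
    then show "case_prod k \<in> borel_measurable (borel \<Otimes>\<^sub>M borel)" by (simp add: case_prod_unfold)
  qed (use Gi C0 B2p in \<open>auto intro!: mult_nonneg_nonneg simp: k2_def\<close>)
qed

lemma transl_symmetric:
  assumes x: "x > 0" and [measurable]: "f \<in> borel_measurable borel" "g \<in> borel_measurable borel"
  shows "(\<integral>\<^sup>+y. g y * transl_nn x f y \<partial>J) = (\<integral>\<^sup>+y. f y * transl_nn x g y \<partial>J)"
proof (cases "\<beta> = -1/2 \<or> \<alpha> = \<beta>")
  case False
  then show ?thesis using \<alpha>\<beta> \<beta>_ge by (intro transl_symmetric_2d x) auto
next
  case True
  show ?thesis
  proof (cases "\<beta> = -1/2")
    case b: True
    show ?thesis
    \<comment> \<open>For \<theta> = 0 the imaginary part vanishes and cosh of the third side is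
      cosh x cosh y + u sinh x sinh y, the hyperbolic law of cosines.\<close>
    proof (rule transl_symmetric_1d[OF x, of 1 0 "2 powr (2*\<rho>)"])
      show "beta_measure (\<beta> + 1/2) (\<alpha> - \<beta>) = return borel 0" using b by (simp add: beta_measure_def)
      fix y :: real assume y: "y > 0"
      show "A y = 2 powr (2*\<rho>) * sinh (1 * y) powr (2*\<alpha>+1)" using b by (simp add: jac_A_def)
      fix t :: real assume t: "0 < t" "t < 1"
      let ?u = "2 * t - 1"
      have "(cosh (tt x y (t, 0)))\<^sup>2 = (cosh x * cosh y + ?u * (sinh x * sinh y))\<^sup>2"
        using t by (simp add: cosh_tt_sq TT_def Tq_def clamp01_id)
      moreover have "cosh x * cosh y + ?u * (sinh x * sinh y) >= 0"
      proof -
        have "(-1) * (sinh x * sinh y) <= ?u * (sinh x * sinh y)" using t x y by (intro mult_right_mono) auto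
        moreover have "sinh x * sinh y <= cosh x * cosh y"
          using x y sinh_less_cosh_real[of x] sinh_less_cosh_real[of y] by (intro mult_mono) auto
        ultimately show ?thesis by linarith
      qed
      ultimately show "cosh (1 * tt x y (t, 0)) = cosh (1 * x) * cosh (1 * y) + ?u * (sinh (1 * x) * sinh (1 * y))"
        by (simp add: power2_eq_iff_nonneg)
    qed auto
  next
    case False
    then have ab: "\<alpha> = \<beta>" "\<beta> > -1/2" using True \<beta>_ge by auto
    show ?thesis
    \<comment> \<open>For \<theta> = 1 the terms quadratic in u cancel in the squared modulus, so
      cosh of twice the third side is affine in u: a law of cosines for doubled lengths.\<close>
    proof (rule transl_symmetric_1d[OF x, of 2 1 "2 powr (2*\<rho>) * (1/2) powr (2*\<alpha>+1)"])
      show "beta_measure (\<beta> + 1/2) (\<alpha> - \<beta>) = return borel 1" using ab by (simp add: beta_measure_def)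
      fix y :: real assume y: "y > 0"
      have "A y = 2 powr (2*\<rho>) * (sinh y * cosh y) powr (2*\<alpha>+1)"
        unfolding jac_A_def ab(1) using y by (simp add: powr_mult)
      also have "sinh y * cosh y = 1/2 * sinh (2 * y)" by (simp add: sinh_double)
      also have "(1/2 * sinh (2 * y)) powr (2*\<alpha>+1) = (1/2) powr (2*\<alpha>+1) * sinh (2 * y) powr (2*\<alpha>+1)"
        using y by (simp only: powr_mult)
      finally show "A y = 2 powr (2*\<rho>) * (1/2) powr (2*\<alpha>+1) * sinh (2 * y) powr (2*\<alpha>+1)" by simp
      fix t :: real assume t: "0 < t" "t < 1"
      let ?u = "2 * t - 1"
      have c2: "cosh (2 * w) = 2 * (cosh w)\<^sup>2 - 1" for w :: real using cosh_double[of w] by (simp add: sinh_sq)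
      have "cosh (2 * tt x y (t, 1)) = 2 * (1 + TT x y (t, 1)) - 1" unfolding c2 cosh_tt_sq ..
      also have "... = cosh (2 * x) * cosh (2 * y) + ?u * (sinh (2 * x) * sinh (2 * y))"
      proof -
        have cl: "clamp01 t = t" "clamp01 1 = 1" using t by (simp_all add: clamp01_id)
        show ?thesis unfolding c2 sinh_double TT_def Tq_def fst_conv snd_conv cl
          using sinh_sq[of x] sinh_sq[of y] by algebra
      qed
      finally show "cosh (2 * tt x y (t, 1)) = cosh (2 * x) * cosh (2 * y) + ?u * (sinh (2 * x) * sinh (2 * y))" .
    qed auto
  qed
qed

end

section \<open>Translation and transform\<close>

text \<open>The convex function a^p lies above its tangent at m. This linear form of the inequality
  can be integrated in a with m fixed.\<close>

lemma young_powr: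
  fixes a m p :: real
  assumes p: "1 < p" and a: "0 <= a" and m: "0 < m"
  shows "p * m powr (p - 1) * a <= a powr p + (p - 1) * m powr p"
proof -
  let ?q = "p / (p - 1)"
  have "(m powr (p - 1)) powr ?q = m powr p" using p unfolding powr_powr by simp
  moreover have "a * m powr (p - 1) <= a powr p / p + (m powr (p - 1)) powr ?q / ?q"
    by (rule Youngs_inequality) (use p a in \<open>auto simp: field_simps\<close>)
  ultimately have "p * (a * m powr (p - 1)) <= p * (a powr p / p + m powr p / ?q)" using p by simp
  also have "... = a powr p + (p - 1) * m powr p" using p by (simp add: field_simps)
  finally show ?thesis by (simp add: ac_simps)
qed

section \<open>Contraction, adjoint and transform of the translation\<close>

context jacobi begin

lemma measurable_tt_pair [measurable]: "(\<lambda>(y, w). tt x y w) \<in> borel_measurable (borel \<Otimes>\<^sub>M borel)"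
proof -
  have "continuous_on UNIV (\<lambda>z. TT x (fst z) (snd z))"
    unfolding TT_def Tq_def clamp01_def by (intro continuous_intros)
  then have [measurable]: "(\<lambda>z. TT x (fst z) (snd z)) \<in> borel_measurable (borel \<Otimes>\<^sub>M borel)"
    unfolding borel_prod by (rule borel_measurable_continuous_onI)
  have [measurable]: "(arsinh :: real => real) \<in> borel_measurable borel"
    by (intro borel_measurable_continuous_onI continuous_on_arsinh)
  show ?thesis unfolding tt_def case_prod_beta by measurable
qed

definition P :: "(real \<times> real \<times> real) measure" where "P = J \<Otimes>\<^sub>M \<Omega>"

lemma pair_sigma_finite_P: "pair_sigma_finite J \<Omega>"
  unfolding pair_sigma_finite_def using sigma_finite_J prob_\<Omega> prob_space_imp_sigma_finite by blast

lemma sets_P [measurable_cong, simp]: "sets P = sets (borel \<Otimes>\<^sub>M borel)"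
  unfolding P_def by (intro sets_pair_measure_cong) auto

lemma transl_nn_measurable [measurable]:
  assumes [measurable]: "f \<in> borel_measurable borel"
  shows "transl_nn x f \<in> borel_measurable borel"
proof -
  interpret prob_space \<Omega> by (rule prob_\<Omega>)
  have [measurable]: "(\<lambda>(y, w). f (tt x y w)) \<in> borel_measurable (borel \<Otimes>\<^sub>M \<Omega>)"
    using measurable_tt_pair[of x] by (simp add: case_prod_beta measurable_cong_sets[OF sets_pair_measure_cong[OF refl sets_\<Omega>] refl])
  show ?thesis unfolding transl_nn_def[abs_def] by (rule borel_measurable_nn_integral) simp
qed

definition transl :: "real => (real => complex) => real => complex" where
  "transl x f y = (\<integral>w. f (tt x y w) \<partial>\<Omega>)"

lemma transl_measurable [measurable]:
  assumes [measurable]: "f \<in> borel_measurable borel"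
  shows "transl x f \<in> borel_measurable borel"
proof -
  interpret prob_space \<Omega> by (rule prob_\<Omega>)
  have [measurable]: "(\<lambda>(y, w). f (tt x y w)) \<in> borel_measurable (borel \<Otimes>\<^sub>M \<Omega>)"
    using measurable_tt_pair[of x] by (simp add: case_prod_beta measurable_cong_sets[OF sets_pair_measure_cong[OF refl sets_\<Omega>] refl])
  show ?thesis unfolding transl_def[abs_def] by (rule borel_measurable_lebesgue_integral) simp
qed

lemma nn_integral_transl_nn:
  assumes x: "x > 0" and [measurable]: "f \<in> borel_measurable borel"
  shows "(\<integral>\<^sup>+y. transl_nn x f y \<partial>J) = (\<integral>\<^sup>+y. f y \<partial>J)"
proof -
  interpret prob_space \<Omega> by (rule prob_\<Omega>)
  have "transl_nn x (\<lambda>_. 1) y = 1" for y unfolding transl_nn_def using emeasure_space_1 by simp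
  then show ?thesis using transl_symmetric[OF x, of f "\<lambda>_. 1"] by simp
qed

text \<open>The convexity step is Young's inequality with the translate itself as second factor.\<close>

lemma norm_transl_powr_le:
  assumes p1: "1 <= p" and [measurable]: "f \<in> borel_measurable borel"
  shows "ennreal (norm (transl x f y) powr p) <= transl_nn x (\<lambda>t. ennreal (norm (f t) powr p)) y"
proof (cases "transl x f y = 0")
  case True then show ?thesis by simp
next
  case False
  interpret prob_space \<Omega> by (rule prob_\<Omega>)
  define m where "m = norm (transl x f y)"
  have m: "m > 0" using False by (simp add: m_def)
  \<comment> \<open>A Bochner integral of a non-integrable function is 0 by default, so a nonzero
    translate certifies integrability.\<close>
  have "integrable \<Omega> (\<lambda>w. f (tt x y w))"
    using False not_integrable_integral_eq unfolding transl_def by blast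
  then have 1: "ennreal m <= (\<integral>\<^sup>+w. ennreal (norm (f (tt x y w))) \<partial>\<Omega>)"
    unfolding m_def transl_def by (rule integral_norm_bound_ennreal)
  let ?I = "\<integral>\<^sup>+w. ennreal (norm (f (tt x y w)) powr p) \<partial>\<Omega>"
  have "ennreal (m powr p) <= ?I"
  proof (cases "p = 1")
    case True then show ?thesis using 1 m by simp
  next
    case False
    then have p: "1 < p" using p1 by simp
    have c: "p * m powr (p - 1) >= 0" using p by simp
    have "ennreal (p * m powr p) = ennreal (p * m powr (p - 1)) * ennreal m"
      using c m by (simp add: ennreal_mult'' powr_diff flip: ennreal_mult)
    also have "... <= ennreal (p * m powr (p - 1)) * (\<integral>\<^sup>+w. ennreal (norm (f (tt x y w))) \<partial>\<Omega>)"
      by (rule mult_left_mono[OF 1]) simp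
    also have "... = (\<integral>\<^sup>+w. ennreal (p * m powr (p - 1)) * ennreal (norm (f (tt x y w))) \<partial>\<Omega>)"
      by (rule nn_integral_cmult[symmetric]) measurable
    also have "... <= (\<integral>\<^sup>+w. ennreal (norm (f (tt x y w)) powr p) + ennreal ((p - 1) * m powr p) \<partial>\<Omega>)"
      by (intro nn_integral_mono)
        (use young_powr[OF p norm_ge_zero m] p c in \<open>simp flip: ennreal_mult ennreal_plus\<close>)
    also have "... = ?I + ennreal ((p - 1) * m powr p)"
      by (subst nn_integral_add) (use emeasure_space_1 in auto)
    finally have 2: "ennreal (p * m powr p) <= ?I + ennreal ((p - 1) * m powr p)" .
    show ?thesis
    proof (cases ?I)
      case (real r)
      then have "ennreal (p * m powr p) <= ennreal (r + (p - 1) * m powr p)" using 2 p by (simp add: ennreal_plus)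
      then have "p * m powr p <= r + (p - 1) * m powr p" using real p by (subst (asm) ennreal_le_iff) auto
      then show ?thesis using real by (simp add: algebra_simps ennreal_leI)
    qed simp
  qed
  then show ?thesis by (simp add: m_def transl_nn_def)
qed

lemma transl_contraction:
  assumes p: "1 <= p" and x: "x > 0" and [measurable]: "f \<in> borel_measurable borel"
  shows "Lpow J p (transl x f) <= Lpow J p f"
proof -
  have "Lpow J p (transl x f) <= (\<integral>\<^sup>+y. transl_nn x (\<lambda>t. ennreal (norm (f t) powr p)) y \<partial>J)"
    by (intro nn_integral_mono norm_transl_powr_le p) simp
  also have "... = Lpow J p f" by (rule nn_integral_transl_nn[OF x]) measurable
  finally show ?thesis .
qed

text \<open>As a Bochner integral with default value 0, the translate is additive only where the
  functions composed with \<open>tt\<close> are integrable. Since |f| is at most 1 + |f|^p on a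
  probability space, finiteness of the translate of |f|^p is enough.\<close>

lemma AE_transl_integrable:
  assumes p: "1 <= p" and x: "x > 0" and [measurable]: "f \<in> borel_measurable borel"
    and fin: "Lpow J p f < \<infinity>"
  shows "AE y in J. integrable \<Omega> (\<lambda>w. f (tt x y w) :: complex)"
proof -
  interpret prob_space \<Omega> by (rule prob_\<Omega>)
  let ?h = "\<lambda>t. ennreal (norm (f t) powr p)"
  have "(\<integral>\<^sup>+y. transl_nn x ?h y \<partial>J) \<noteq> \<infinity>"
    using fin by (subst nn_integral_transl_nn[OF x]) auto
  then have "AE y in J. transl_nn x ?h y \<noteq> \<infinity>" by (intro nn_integral_PInf_AE) measurable
  then show ?thesis
  proof eventually_elim
    case (elim y)
    have "(\<integral>\<^sup>+w. ennreal (norm (f (tt x y w))) \<partial>\<Omega>) <= (\<integral>\<^sup>+w. 1 + ?h (tt x y w) \<partial>\<Omega>)"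
    proof (rule nn_integral_mono)
      fix w
      let ?a = "norm (f (tt x y w))"
      have "?a <= 1 + ?a powr p"
      proof (cases "?a <= 1")
        case True then show ?thesis using powr_ge_zero[of ?a p] by linarith
      next
        case False
        then have "?a powr 1 <= ?a powr p" using p by (intro powr_mono) auto
        then show ?thesis using False by simp
      qed
      then show "ennreal ?a <= 1 + ennreal (?a powr p)"
        by (simp flip: ennreal_plus ennreal_1)
    qed
    also have "... = 1 + transl_nn x ?h y"
      unfolding transl_nn_def by (subst nn_integral_add) (use emeasure_space_1 in auto)
    also have "... < \<infinity>" using elim by (simp add: less_top)
    finally show ?case by (intro integrableI_bounded) auto
  qed
qed

text \<open>The symmetry restated as an identity of measures: integrating an indicator against the
  translate of g moves the translation to the other side. In this form it applies to Bochner
  integrals of complex functions.\<close>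

lemma distr_P_density:
  assumes x: "x > 0" and [measurable]: "g \<in> borel_measurable borel"
  shows "distr (density P (\<lambda>z. g (fst z))) borel (\<lambda>(y, w). tt x y w) = density J (transl_nn x g)"
proof (rule measure_eqI)
  interpret pair_sigma_finite J \<Omega> by (rule pair_sigma_finite_P)
  fix B assume "B \<in> sets (distr (density P (\<lambda>z. g (fst z))) borel (\<lambda>(y, w). tt x y w))"
  then have [measurable]: "B \<in> sets borel" by simp
  have "emeasure (distr (density P (\<lambda>z. g (fst z))) borel (\<lambda>(y, w). tt x y w)) B
      = (\<integral>\<^sup>+z. indicator B z \<partial>distr (density P (\<lambda>z. g (fst z))) borel (\<lambda>(y, w). tt x y w))" by simp
  also have "... = (\<integral>\<^sup>+z. g (fst z) * indicator B (tt x (fst z) (snd z)) \<partial>P)"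
    by (subst nn_integral_distr) (auto simp: case_prod_beta nn_integral_density)
  also have "... = (\<integral>\<^sup>+y. \<integral>\<^sup>+w. g y * indicator B (tt x y w) \<partial>\<Omega> \<partial>J)"
    unfolding P_def by (subst M2.nn_integral_fst[symmetric]) auto
  also have "... = (\<integral>\<^sup>+y. g y * transl_nn x (indicator B) y \<partial>J)"
    unfolding transl_nn_def by (subst nn_integral_cmult) auto
  also have "... = (\<integral>\<^sup>+y. indicator B y * transl_nn x g y \<partial>J)"
    by (rule transl_symmetric[OF x]) measurable
  also have "... = emeasure (density J (transl_nn x g)) B"
    by (subst emeasure_density) (auto simp: mult.commute)
  finally show "emeasure (distr (density P (\<lambda>z. g (fst z))) borel (\<lambda>(y, w). tt x y w)) B
      = emeasure (density J (transl_nn x g)) B" .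
qed simp

text \<open>Image measures and densities transfer both the integral and integrability. The weight g
  has to be nonnegative to serve as a density; G is a real-valued version of its translate.\<close>

lemma transl_adjoint:
  fixes f :: "real => complex"
  assumes x: "x > 0" and g [measurable]: "g \<in> borel_measurable borel" "\<And>y. 0 <= g y"
    and f [measurable]: "f \<in> borel_measurable borel"
    and G [measurable]: "G \<in> borel_measurable borel" "\<And>y. 0 <= G y"
    and tg: "AE y in J. transl_nn x (\<lambda>t. ennreal (g t)) y = ennreal (G y)"
  shows "(\<integral>z. g (fst z) *\<^sub>R f (tt x (fst z) (snd z)) \<partial>P) = (\<integral>y. G y *\<^sub>R f y \<partial>J)"
    and "integrable P (\<lambda>z. g (fst z) *\<^sub>R f (tt x (fst z) (snd z))) \<longleftrightarrow> integrable J (\<lambda>y. G y *\<^sub>R f y)"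
proof -
  let ?g = "\<lambda>t. ennreal (g t)" and ?T = "\<lambda>(y, w). tt x y w"
  have eq: "distr (density P (\<lambda>z. ?g (fst z))) borel ?T = density J (\<lambda>y. ennreal (G y))"
    unfolding distr_P_density[OF x measurable_compose[OF g(1) measurable_ennreal]]
    by (rule density_cong) (use tg in auto)
  have [measurable]: "?T \<in> measurable (density P (\<lambda>z. ?g (fst z))) borel" by simp
  have fT: "(\<lambda>z. f (?T z)) \<in> borel_measurable P" by measurable
  have "(\<integral>z. g (fst z) *\<^sub>R f (?T z) \<partial>P) = (\<integral>z. f (?T z) \<partial>density P (\<lambda>z. ?g (fst z)))"
    by (rule integral_density[symmetric]) (use g fT in auto)
  also have "... = (\<integral>y. f y \<partial>distr (density P (\<lambda>z. ?g (fst z))) borel ?T)"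
    by (rule integral_distr[symmetric]) auto
  also have "... = (\<integral>y. G y *\<^sub>R f y \<partial>J)" unfolding eq by (rule integral_density) (use G in auto)
  finally show "(\<integral>z. g (fst z) *\<^sub>R f (tt x (fst z) (snd z)) \<partial>P) = (\<integral>y. G y *\<^sub>R f y \<partial>J)"
    by (simp add: case_prod_beta)
  have "integrable P (\<lambda>z. g (fst z) *\<^sub>R f (?T z)) \<longleftrightarrow> integrable (density P (\<lambda>z. ?g (fst z))) (\<lambda>z. f (?T z))"
    by (rule integrable_density[symmetric]) (use g fT in auto)
  also have "... \<longleftrightarrow> integrable (distr (density P (\<lambda>z. ?g (fst z))) borel ?T) f"
    by (rule integrable_distr_eq[symmetric]) auto
  also have "... \<longleftrightarrow> integrable J (\<lambda>y. G y *\<^sub>R f y)" unfolding eq by (rule integrable_density) (use G in auto)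
  finally show "integrable P (\<lambda>z. g (fst z) *\<^sub>R f (tt x (fst z) (snd z))) \<longleftrightarrow> integrable J (\<lambda>y. G y *\<^sub>R f y)"
    by (simp add: case_prod_beta)
qed

lemma rphi_transl:
  assumes x: "x >= 0" and y: "y >= 0"
  shows "integrable \<Omega> (\<lambda>w. rphi l (tt x y w))" "(\<integral>w. rphi l (tt x y w) \<partial>\<Omega>) = rphi l x * rphi l y"
proof -
  have eq: "rphi l (tt x y w) = Re (\<phi> (of_real l) (tt x y w))" for w by (simp add: rphi_def)
  show "integrable \<Omega> (\<lambda>w. rphi l (tt x y w))" unfolding eq
    by (intro integrable_Re product_formula x y)
  have "(\<integral>w. rphi l (tt x y w) \<partial>\<Omega>) = Re (\<phi> (of_real l) x * \<phi> (of_real l) y)"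
    unfolding eq using product_formula[OF x y, of "of_real l"] by (simp add: integral_Re)
  also have "... = rphi l x * rphi l y" using x y by (simp add: phi_real)
  finally show "(\<integral>w. rphi l (tt x y w) \<partial>\<Omega>) = rphi l x * rphi l y" .
qed

text \<open>The Jacobi function changes sign, so the adjoint relation is applied to the nonnegative
  weights 1 and 1 + \<phi>_l, and the two identities are subtracted. By the product formula the
  translate of the second weight is 1 + \<phi>_l(x) \<phi>_l.\<close>

lemma transl_integrable_Ft:
  assumes x: "x > 0" and f: "integrable J f"
  shows "integrable J (transl x f)" "Ft (transl x f) l = of_real (rphi l x) * Ft f l"
proof -
  interpret \<Omega>: prob_space \<Omega> by (rule prob_\<Omega>)
  interpret pair_sigma_finite J \<Omega> by (rule pair_sigma_finite_P)
  have fm [measurable]: "f \<in> borel_measurable borel" by (rule integrable_J_measurable[OF f])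
  have t1: "transl_nn x (\<lambda>t. ennreal 1) y = ennreal 1" for y
    unfolding transl_nn_def using \<Omega>.emeasure_space_1 by simp
  have i1: "integrable P (\<lambda>z. f (tt x (fst z) (snd z)))" "(\<integral>z. f (tt x (fst z) (snd z)) \<partial>P) = (\<integral>y. f y \<partial>J)"
    using transl_adjoint[OF x, of "\<lambda>_. 1" f "\<lambda>_. 1"] t1 f by simp_all
  show "integrable J (transl x f)"
    using integrable_fst'[of "\<lambda>z. f (tt x (fst z) (snd z))"] i1(1) unfolding P_def transl_def[abs_def] by simp
  \<comment> \<open>The maximum makes the weights nonnegative on the whole line; on the nonnegative
    half-line it has no effect because |\<phi>| is at most 1 there.\<close>
  let ?g = "\<lambda>y. max 0 (1 + rphi l y)" and ?G = "\<lambda>y. max 0 (1 + rphi l x * rphi l y)"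
  have g: "?g y = 1 + rphi l y" if "y >= 0" for y using rphi_le_1[OF that, of l] by auto
  have G: "?G y = 1 + rphi l x * rphi l y" if "y >= 0" for y
  proof -
    have "\<bar>rphi l x * rphi l y\<bar> <= 1 * 1" unfolding abs_mult
      using x by (intro mult_mono rphi_le_1) (auto simp: that)
    then show ?thesis by auto
  qed
  have tg: "AE y in J. transl_nn x (\<lambda>t. ennreal (?g t)) y = ennreal (?G y)"
    using AE_J
  proof eventually_elim
    case (elim y)
    then have y: "y >= 0" by simp
    have x': "x >= 0" using x by simp
    have "transl_nn x (\<lambda>t. ennreal (?g t)) y = (\<integral>\<^sup>+w. ennreal (1 + rphi l (tt x y w)) \<partial>\<Omega>)"
      unfolding transl_nn_def by (simp only: g[OF tt_nonneg])
    also have "... = ennreal (\<integral>w. 1 + rphi l (tt x y w) \<partial>\<Omega>)"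
    proof (rule nn_integral_eq_integral)
      show "integrable \<Omega> (\<lambda>w. 1 + rphi l (tt x y w))" using rphi_transl(1)[OF x' y] by simp
      show "AE w in \<Omega>. 0 <= 1 + rphi l (tt x y w)"
      proof (rule AE_I2)
        show "0 <= 1 + rphi l (tt x y w)" for w using rphi_le_1[OF tt_nonneg, of l x y w] by linarith
      qed
    qed
    also have "(\<integral>w. 1 + rphi l (tt x y w) \<partial>\<Omega>) = 1 + rphi l x * rphi l y"
      using rphi_transl[OF x' y, of l] \<Omega>.prob_space by simp
    finally show ?case using G[OF y] by simp
  qed
  have Gi: "integrable J (\<lambda>y. ?G y *\<^sub>R f y)"
  proof (rule Bochner_Integration.integrable_bound[where f="\<lambda>y. 2 * f y"])
    show "AE y in J. norm (?G y *\<^sub>R f y) <= norm (2 * f y)" using AE_J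
    proof eventually_elim
      case (elim y)
      have "\<bar>rphi l x * rphi l y\<bar> <= 1 * 1" unfolding abs_mult
        using x elim by (intro mult_mono rphi_le_1) auto
      then have "?G y <= 2" by auto
      then have "?G y * norm (f y) <= 2 * norm (f y)" by (intro mult_right_mono) auto
      then show ?case by (simp add: norm_mult)
    qed
  qed (use f in auto)
  note ad = transl_adjoint[OF x, of ?g f ?G, OF _ _ fm _ _ tg]
  have i2: "integrable P (\<lambda>z. ?g (fst z) *\<^sub>R f (tt x (fst z) (snd z)))"
    "(\<integral>z. ?g (fst z) *\<^sub>R f (tt x (fst z) (snd z)) \<partial>P) = (\<integral>y. ?G y *\<^sub>R f y \<partial>J)"
    using ad Gi by simp_all
  have tr: "integrable J (transl x f)" by fact
  have "(\<integral>z. ?g (fst z) *\<^sub>R f (tt x (fst z) (snd z)) \<partial>P) = (\<integral>y. (\<integral>w. ?g y *\<^sub>R f (tt x y w) \<partial>\<Omega>) \<partial>J)"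
    using integral_fst'[OF i2(1)[unfolded P_def]] unfolding P_def by simp
  also have "... = (\<integral>y. ?g y *\<^sub>R transl x f y \<partial>J)" unfolding transl_def by simp
  also have "... = (\<integral>y. transl x f y + transl x f y * of_real (rphi l y) \<partial>J)"
  proof (rule integral_cong_AE)
    show "AE y in J. ?g y *\<^sub>R transl x f y = transl x f y + transl x f y * of_real (rphi l y)"
      using AE_J
    proof eventually_elim
      case (elim y)
      then have "y >= 0" by simp
      show ?case unfolding g[OF \<open>y >= 0\<close>] by (simp add: scaleR_conv_of_real algebra_simps)
    qed
  qed (auto simp: measurable_J)
  also have "... = (\<integral>y. transl x f y \<partial>J) + Ft (transl x f) l"
    unfolding Ft_def by (rule Bochner_Integration.integral_add[OF tr integrable_Ft[OF tr]])
  also have "(\<integral>y. transl x f y \<partial>J) = (\<integral>y. f y \<partial>J)"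
    using integral_fst'[OF i1(1)[unfolded P_def]] i1(2) unfolding P_def transl_def by simp
  finally have 1: "(\<integral>y. ?G y *\<^sub>R f y \<partial>J) = (\<integral>y. f y \<partial>J) + Ft (transl x f) l" using i2(2) by simp
  have "(\<integral>y. ?G y *\<^sub>R f y \<partial>J) = (\<integral>y. f y + of_real (rphi l x) * (f y * of_real (rphi l y)) \<partial>J)"
  proof (rule integral_cong_AE)
    show "AE y in J. ?G y *\<^sub>R f y = f y + of_real (rphi l x) * (f y * of_real (rphi l y))"
      using AE_J
    proof eventually_elim
      case (elim y)
      then have "y >= 0" by simp
      show ?case unfolding G[OF \<open>y >= 0\<close>] by (simp add: scaleR_conv_of_real algebra_simps)
    qed
  qed (auto simp: measurable_J)
  also have "... = (\<integral>y. f y \<partial>J) + of_real (rphi l x) * Ft f l"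
    unfolding Ft_def using f integrable_Ft[OF f, of l] by simp
  finally show "Ft (transl x f) l = of_real (rphi l x) * Ft f l" using 1 by simp
qed

end

section \<open>Dyadic decomposition\<close>

lemma powr_add_le:
  fixes a b q :: real
  assumes "a >= 0" "b >= 0" "q > 0"
  shows "(a + b) powr q <= 2 powr q * (a powr q + b powr q)"
proof -
  have "(a + b) powr q <= (2 * max a b) powr q" using assms by (intro powr_mono2) auto
  also have "... = 2 powr q * max a b powr q" using assms by (simp add: powr_mult)
  also have "... <= 2 powr q * (a powr q + b powr q)"
    by (intro mult_left_mono) (auto simp: max_def)
  finally show ?thesis .
qed

lemma Cauchy_geometric_steps:
  fixes u :: "nat => 'a::real_normed_vector"
  assumes "\<And>n. norm (u (Suc n) - u n) <= B * (1/2) ^ n"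
  shows "Cauchy u"
proof -
  have sm: "summable (\<lambda>n. norm (u (Suc n) - u n))"
    by (rule summable_comparison_test'[where g="\<lambda>n. B * (1/2) ^ n" and N=0])
      (use assms in \<open>auto intro!: summable_mult summable_geometric\<close>)
  show ?thesis
  proof (rule CauchyI)
    fix e :: real assume "e > 0"
    then obtain M where M: "\<And>m n. m >= M ==> norm (\<Sum>k\<in>{m..<n}. norm (u (Suc k) - u k)) < e"
      using sm unfolding summable_Cauchy by blast
    have d: "norm (u n - u m) < e" if "m >= M" "m <= n" for m n
    proof -
      have "u n - u m = (\<Sum>k\<in>{m..<n}. u (Suc k) - u k)" using that(2) by (simp add: sum_Suc_diff')
      then have "norm (u n - u m) <= (\<Sum>k\<in>{m..<n}. norm (u (Suc k) - u k))" by (simp add: norm_sum)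
      also have "... < e" using M[OF that(1), of n] by simp
      finally show ?thesis .
    qed
    show "\<exists>M. \<forall>m\<ge>M. \<forall>n\<ge>M. norm (u m - u n) < e"
    proof (intro exI[of _ M] allI impI)
      fix m n assume mn: "m >= M" "n >= M"
      show "norm (u m - u n) < e" using d[of m n] d[of n m] mn by (cases "m <= n") (auto simp: norm_minus_commute)
    qed
  qed
qed

lemma ennreal_term_le_suminf: "f k <= (\<Sum>n. f n :: ennreal)"
  using sum_le_suminf[OF summableI, of "{k}" f] by simp

text \<open>Completeness for a fast Cauchy sequence. Weighting the q-th powers of consecutive
  differences by 2^(nq) still leaves a summable series of integrals, so almost everywhere the
  differences are bounded by a geometric sequence. Fatou's lemma then gives the rate.\<close>

lemma nn_integral_powr_complete:
  fixes u :: "nat => 'a => complex"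
  assumes q: "q >= 1" and K: "K >= 0" and um [measurable]: "\<And>n. u n \<in> borel_measurable M"
    and le: "\<And>n m. n <= m ==> Lpow M q (\<lambda>x. u n x - u m x) <= ennreal (K * (1/4) powr (real n * q))"
  shows "\<exists>g\<in>borel_measurable M. (\<lambda>n. Lpow M q (\<lambda>x. u n x - g x)) \<longlonglongrightarrow> 0"
proof -
  let ?v = "\<lambda>n x. ennreal (2 powr (real n * q)) * ennreal (norm (u n x - u (Suc n) x) powr q)"
  have vle: "(\<integral>\<^sup>+x. ?v n x \<partial>M) <= ennreal (K * (1/2) ^ n)" for n
  proof -
    have "(\<integral>\<^sup>+x. ?v n x \<partial>M) = ennreal (2 powr (real n * q)) * (Lpow M q (\<lambda>x. u n x - u (Suc n) x))"
      by (rule nn_integral_cmult) measurable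
    also have "... <= ennreal (2 powr (real n * q)) * ennreal (K * (1/4) powr (real n * q))"
      by (intro mult_left_mono le) auto
    also have "... = ennreal (K * ((2 * (1/4)) powr (real n * q)))"
      by (simp only: powr_mult ennreal_mult'[symmetric] powr_ge_zero) (simp add: ac_simps)
    also have "... <= ennreal (K * (1/2) powr real n)"
      using q K by (intro ennreal_leI mult_left_mono) (auto intro!: powr_mono' simp: mult_le_cancel_left1)
    also have "(1/2::real) powr real n = (1/2) ^ n" by (simp add: powr_realpow)
    finally show ?thesis .
  qed
  have "(\<integral>\<^sup>+x. (\<Sum>n. ?v n x) \<partial>M) = (\<Sum>n. \<integral>\<^sup>+x. ?v n x \<partial>M)"
    by (rule nn_integral_suminf) measurable
  also have "... <= (\<Sum>n. ennreal (K * (1/2) ^ n))" by (intro suminf_le vle) auto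
  also have "... = ennreal (\<Sum>n. K * (1/2) ^ n)"
    using K by (intro suminf_ennreal2) (auto intro!: summable_mult summable_geometric)
  also have "... < \<infinity>" by simp
  finally have "(\<integral>\<^sup>+x. (\<Sum>n. ?v n x) \<partial>M) \<noteq> \<infinity>" by simp
  then have AE1: "AE x in M. (\<Sum>n. ?v n x) \<noteq> \<infinity>" by (intro nn_integral_PInf_AE) measurable
  have conv: "AE x in M. convergent (\<lambda>n. u n x)" using AE1
  proof eventually_elim
    case (elim x)
    then obtain B where B: "B >= 0" "(\<Sum>n. ?v n x) = ennreal B" by (cases "\<Sum>n. ?v n x") auto
    have "norm (u (Suc n) x - u n x) <= B powr (1/q) * (1/2) ^ n" for n
    proof -
      have "?v n x <= (\<Sum>n. ?v n x)" by (rule ennreal_term_le_suminf)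
      then have "ennreal (2 powr (real n * q) * norm (u n x - u (Suc n) x) powr q) <= ennreal B"
        using B by (simp add: ennreal_mult')
      then have "2 powr (real n * q) * norm (u n x - u (Suc n) x) powr q <= B"
        using B by (subst (asm) ennreal_le_iff) auto
      moreover have "2 powr (real n * q) * norm (u n x - u (Suc n) x) powr q = (2 powr real n * norm (u n x - u (Suc n) x)) powr q"
        by (simp only: powr_mult powr_powr)
      ultimately have "((2 powr real n * norm (u n x - u (Suc n) x)) powr q) powr (1/q) <= B powr (1/q)"
        using q by (intro powr_mono2) auto
      then have "2 powr real n * norm (u n x - u (Suc n) x) <= B powr (1/q)"
        using q unfolding powr_powr by simp
      then show ?thesis by (simp add: powr_realpow norm_minus_commute field_simps)
    qed
    then have "Cauchy (\<lambda>n. u n x)" by (rule Cauchy_geometric_steps)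
    then show ?case by (rule Cauchy_convergent)
  qed
  define g where "g x = lim (\<lambda>n. u n x)" for x
  have gm [measurable]: "g \<in> borel_measurable M" unfolding g_def[abs_def] by measurable
  have bd: "Lpow M q (\<lambda>x. u n x - g x) <= ennreal (K * (1/4) powr (real n * q))" for n
  proof (rule nn_integral_fatou_le[where u="\<lambda>m x. ennreal (norm (u n x - u (m + n) x) powr q)"])
    show "AE x in M. (\<lambda>m. ennreal (norm (u n x - u (m + n) x) powr q)) \<longlonglongrightarrow> ennreal (norm (u n x - g x) powr q)"
      using conv
    proof eventually_elim
      case (elim x)
      then have "(\<lambda>m. u m x) \<longlonglongrightarrow> g x" unfolding g_def by (simp add: convergent_LIMSEQ_iff)
      then have "(\<lambda>m. u (m + n) x) \<longlonglongrightarrow> g x" by (rule LIMSEQ_ignore_initial_segment)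
      then show ?case using q by (intro tendsto_ennrealI tendsto_powr' tendsto_norm tendsto_diff tendsto_const) auto
    qed
    show "Lpow M q (\<lambda>x. u n x - u (m + n) x) <= ennreal (K * (1/4) powr (real n * q))" for m
      by (rule le) simp
  qed measurable
  have lim0: "(\<lambda>n. ennreal (K * (1/4) powr (real n * q))) \<longlonglongrightarrow> 0"
  proof -
    have "(\<lambda>n. K * ((1/4) powr q) ^ n) \<longlonglongrightarrow> K * 0"
    proof (intro tendsto_mult tendsto_const LIMSEQ_realpow_zero)
      show "(1/4::real) powr q < 1" using powr_mono'[of 1 q "1/4"] q by simp
    qed simp
    moreover have "(1/4::real) powr (real n * q) = ((1/4) powr q) ^ n" for n
      by (metis mult.commute powr_powr powr_realpow powr_gt_zero zero_less_divide_1_iff zero_less_numeral)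
    ultimately show ?thesis using tendsto_ennrealI[of "\<lambda>n. K * (1/4) powr (real n * q)" 0 sequentially] by simp
  qed
  have "(\<lambda>n. Lpow M q (\<lambda>x. u n x - g x)) \<longlonglongrightarrow> 0"
  proof (rule tendsto_sandwich[OF _ _ tendsto_const lim0])
    show "\<forall>\<^sub>F n in sequentially. (Lpow M q (\<lambda>x. u n x - g x)) <= ennreal (K * (1/4) powr (real n * q))"
      by (rule always_eventually) (use bd in blast)
  qed simp
  with gm show ?thesis by blast
qed

lemma powr_le_split:
  fixes a \<delta> s q :: real
  assumes "a >= 0" "\<delta> > 0" "0 < s" "s <= q"
  shows "a powr s <= \<delta> powr (s - q) * a powr q + \<delta> powr s"
proof (cases "a <= \<delta>")
  case True
  then have "a powr s <= \<delta> powr s" using assms by (intro powr_mono2) auto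
  then show ?thesis using assms by (simp add: add_increasing)
next
  case False
  then have "a powr s = a powr (s - q) * a powr q" using assms by (simp flip: powr_add)
  also have "... <= \<delta> powr (s - q) * a powr q"
    using False assms by (intro mult_right_mono powr_mono2') auto
  finally show ?thesis by (simp add: add_increasing2)
qed

lemma dyadic_block_exists:
  fixes l :: real assumes "l >= 1"
  shows "\<exists>k::nat. 2 ^ k <= l \<and> l < 2 ^ Suc k"
proof -
  obtain n :: nat where "l < 2 ^ n" using real_arch_pow[of 2 l] by auto
  then have "l < 2 ^ (LEAST n. l < 2 ^ n)" by (rule LeastI)
  moreover obtain k where k: "(LEAST n. l < 2 ^ n) = Suc k"
    using calculation assms by (cases "LEAST n. l < 2 ^ n") auto
  moreover have "\<not> l < 2 ^ k" using not_less_Least[of k "\<lambda>n. l < 2 ^ n"] k by simp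
  ultimately show ?thesis by (intro exI[of _ k]) auto
qed

lemma nn_integral_dyadic_finite:
  fixes g :: "real => complex" and d \<epsilon> q s K V :: real
  assumes gm [measurable]: "g \<in> borel_measurable borel" and sM [measurable_cong]: "sets M = sets borel"
    and pos: "AE l in M. l > 0"
    and q: "0 < s" "s <= q" and K: "K >= 0" "V >= 0"
    and gq: "Lpow M q g < \<infinity>"
    and block: "\<And>k::nat. (\<integral>\<^sup>+l. ennreal (norm (g l) powr q) * indicator {2 ^ k..<2 ^ Suc k} l \<partial>M) <= ennreal (K * 2 powr (- (\<epsilon> * real k)))"
    and vol: "\<And>k::nat. emeasure M {2 ^ k..<2 ^ Suc k} <= ennreal (V * 2 powr (d * real k))"
    and vol0: "emeasure M {0<..<1} < \<infinity>"
    and s: "d * (q - s) < \<epsilon> * s" and d: "d > 0"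
  shows "Lpow M s g < \<infinity>"
proof (cases "s = q")
  case True then show ?thesis using gq by simp
next
  case False
  then have sq: "s < q" using q by simp
  let ?h = "\<lambda>s l. ennreal (norm (g l) powr s)" and ?B = "\<lambda>k::nat. {2 ^ k..<2 ^ Suc k :: real}"
  \<comment> \<open>On the block of index k the threshold is 2^(-\<theta> k). The part above it sums
    if \<theta> < \<epsilon>/(q-s), the part below if \<theta> > d/s; the hypothesis relating d and
    \<epsilon> says that this interval is nonempty, and its midpoint is taken.\<close>
  define \<theta> where "\<theta> = (d / s + \<epsilon> / (q - s)) / 2"
  have "d / s < \<epsilon> / (q - s)" using s sq q by (simp add: field_simps)
  moreover have "a < (a + b) / 2 \<and> (a + b) / 2 < b" if "a < b" for a b :: real using that by simp
  ultimately have "d / s < \<theta>" "\<theta> < \<epsilon> / (q - s)" unfolding \<theta>_def by blast+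
  then have th: "d - \<theta> * s < 0" "\<theta> * (q - s) - \<epsilon> < 0" using sq q by (auto simp: field_simps)
  have Bm [measurable]: "?B k \<in> sets borel" for k by simp
  have split: "(\<integral>\<^sup>+l. ?h s l * indicator S l \<partial>M) <= ennreal (\<delta> powr (s - q)) * (\<integral>\<^sup>+l. ?h q l * indicator S l \<partial>M) + ennreal (\<delta> powr s) * emeasure M S"
    if [measurable]: "S \<in> sets borel" and \<delta>: "\<delta> > 0" for S \<delta>
  proof -
    have "(\<integral>\<^sup>+l. ?h s l * indicator S l \<partial>M) <= (\<integral>\<^sup>+l. ennreal (\<delta> powr (s - q)) * (?h q l * indicator S l) + ennreal (\<delta> powr s) * indicator S l \<partial>M)"
      by (intro nn_integral_mono)
        (use powr_le_split[OF norm_ge_zero \<delta> q] in \<open>auto simp: indicator_def simp flip: ennreal_mult ennreal_plus\<close>)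
    also have "... = ennreal (\<delta> powr (s - q)) * (\<integral>\<^sup>+l. ?h q l * indicator S l \<partial>M) + ennreal (\<delta> powr s) * emeasure M S"
      by (subst nn_integral_add) (auto simp: nn_integral_cmult nn_integral_cmult_indicator sM)
    finally show ?thesis .
  qed
  \<comment> \<open>The parameters below 1 belong to no block; they have finite volume, and the
    threshold 1 suffices.\<close>
  have I0: "(\<integral>\<^sup>+l. ?h s l * indicator {0<..<1} l \<partial>M) < \<infinity>"
  proof -
    have "(\<integral>\<^sup>+l. ?h q l * indicator {0<..<1} l \<partial>M) <= (\<integral>\<^sup>+l. ?h q l \<partial>M)"
      by (intro nn_integral_mono) (auto simp: indicator_def)
    also note gq
    finally have "ennreal (1 powr (s - q)) * (\<integral>\<^sup>+l. ?h q l * indicator {0<..<1} l \<partial>M) + ennreal (1 powr s) * emeasure M {0<..<1} < \<infinity>"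
      using vol0 by (simp add: ennreal_add_less_top)
    then show ?thesis using split[of "{0<..<1}" 1] by (meson borel_open le_less_trans open_greaterThanLessThan zero_less_one)
  qed
  let ?c = "\<lambda>k::nat. K * (2 powr (\<theta> * (q - s) - \<epsilon>)) ^ k + V * (2 powr (d - \<theta> * s)) ^ k"
  have Ik: "(\<integral>\<^sup>+l. ?h s l * indicator (?B k) l \<partial>M) <= ennreal (?c k)" for k :: nat
  proof -
    let ?\<delta> = "2 powr (- \<theta> * real k)"
    have "(\<integral>\<^sup>+l. ?h s l * indicator (?B k) l \<partial>M)
        <= ennreal (?\<delta> powr (s - q)) * ennreal (K * 2 powr (- (\<epsilon> * real k))) + ennreal (?\<delta> powr s) * ennreal (V * 2 powr (d * real k))"
      by (rule order_trans[OF split add_mono[OF mult_left_mono[OF block] mult_left_mono[OF vol]]]) auto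
    also have "... = ennreal (?\<delta> powr (s - q) * (K * 2 powr (- (\<epsilon> * real k))) + ?\<delta> powr s * (V * 2 powr (d * real k)))"
      using K by (simp add: ennreal_mult ennreal_plus)
    also have "?\<delta> powr (s - q) * (K * 2 powr (- (\<epsilon> * real k))) = K * (2 powr (\<theta> * (q - s) - \<epsilon>)) ^ k"
      by (simp add: powr_powr algebra_simps flip: powr_add powr_realpow)
    also have "?\<delta> powr s * (V * 2 powr (d * real k)) = V * (2 powr (d - \<theta> * s)) ^ k"
      by (simp add: powr_powr algebra_simps flip: powr_add powr_realpow)
    finally show ?thesis .
  qed
  have r: "2 powr (\<theta> * (q - s) - \<epsilon>) < 1" "2 powr (d - \<theta> * s) < 1" using th by (simp_all add: powr_less_one)
  have sc: "summable ?c" using r by (intro summable_add summable_mult summable_geometric) auto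
  have c0: "?c k >= 0" for k using K by simp
  have "(\<integral>\<^sup>+l. ?h s l \<partial>M) <= (\<integral>\<^sup>+l. ?h s l * indicator {0<..<1} l + (\<Sum>k. ?h s l * indicator (?B k) l) \<partial>M)"
  proof (rule nn_integral_mono_AE)
    show "AE l in M. ?h s l <= ?h s l * indicator {0<..<1} l + (\<Sum>k. ?h s l * indicator (?B k) l)"
      using pos
    proof eventually_elim
      case (elim l)
      show ?case
      proof (cases "l < 1")
        case True then show ?thesis using elim by simp
      next
        case False
        then obtain k :: nat where k: "2 ^ k <= l" "l < 2 ^ Suc k" using dyadic_block_exists[of l] by auto
        then have "?h s l = ?h s l * indicator (?B k) l" by simp
        also have "... <= (\<Sum>k. ?h s l * indicator (?B k) l)"
          by (rule ennreal_term_le_suminf)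
        finally show ?thesis by (simp add: add_increasing)
      qed
    qed
  qed
  also have "... = (\<integral>\<^sup>+l. ?h s l * indicator {0<..<1} l \<partial>M) + (\<Sum>k. \<integral>\<^sup>+l. ?h s l * indicator (?B k) l \<partial>M)"
  proof -
    have m: "(\<lambda>l. ?h s l * indicator (?B k) l) \<in> borel_measurable M" for k by measurable
    have "(\<integral>\<^sup>+l. (\<Sum>k. ?h s l * indicator (?B k) l) \<partial>M) = (\<Sum>k. \<integral>\<^sup>+l. ?h s l * indicator (?B k) l \<partial>M)"
      by (rule nn_integral_suminf[OF m])
    moreover have "(\<integral>\<^sup>+l. ?h s l * indicator {0<..<1} l + (\<Sum>k. ?h s l * indicator (?B k) l) \<partial>M)
        = (\<integral>\<^sup>+l. ?h s l * indicator {0<..<1} l \<partial>M) + (\<integral>\<^sup>+l. (\<Sum>k. ?h s l * indicator (?B k) l) \<partial>M)"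
      by (rule nn_integral_add) (use m in measurable)
    ultimately show ?thesis by simp
  qed
  also have "(\<Sum>k. \<integral>\<^sup>+l. ?h s l * indicator (?B k) l \<partial>M) <= (\<Sum>k. ennreal (?c k))" by (intro suminf_le Ik) auto
  also have "(\<Sum>k. ennreal (?c k)) = ennreal (\<Sum>k. ?c k)" by (rule suminf_ennreal2[OF c0 sc])
  finally show ?thesis using I0 by (simp add: ennreal_add_less_top order_le_less_trans add_left_mono)
qed

section \<open>Volume of the dyadic blocks and decay of the transform on them\<close>

context jacobi begin

lemma AE_N: "AE l in N. l > 0"
  unfolding N_def by (subst AE_density) (simp, auto simp: pd_def indicator_def)

lemma pd_le: "\<exists>C>0. (\<forall>l\<ge>1. pd l <= C * l powr (2 * \<alpha> + 1)) \<and> (\<forall>l. 0 < l \<and> l <= 1 \<longrightarrow> pd l <= C)"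
proof -
  obtain C where C: "C > 0" "\<And>l. l > 0 ==> 1 / (cmod (jac_c \<alpha> \<beta> l))\<^sup>2 <= C * wt l" using plancherel_density_le by blast
  obtain K where K: "K > 0" "\<And>l. l >= 1 ==> wt l <= K * l powr (2 * \<alpha> + 1)" "\<And>l. 0 < l ==> l <= 1 ==> wt l <= K * l\<^sup>2"
    using wt_le by blast
  have p: "pd l <= C * w" if "l > 0" "wt l <= w" for l w
    using order_trans[OF C(2)[OF that(1)] mult_left_mono[OF that(2) less_imp_le[OF C(1)]]] that(1) by (simp add: pd_def)
  show ?thesis
  proof (intro exI[of _ "C * K"] conjI allI impI)
    show "pd l <= C * K * l powr (2 * \<alpha> + 1)" if "l >= 1" for l
      using p[OF _ K(2)[OF that]] that by (simp add: mult.assoc)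
    show "pd l <= C * K" if l: "0 < l \<and> l <= 1" for l
    proof -
      have "K * l\<^sup>2 <= K * 1" using l K(1) by (intro mult_left_mono) (auto simp: power_le_one)
      then show ?thesis using p[of l K] K(3)[of l] l by simp
    qed
  qed (use C K in simp)
qed

lemma emeasure_N: "S \<in> sets borel ==> emeasure N S = (\<integral>\<^sup>+l. ennreal (pd l) * indicator S l \<partial>lborel)"
  unfolding N_def by (rule emeasure_density) auto

lemma dyadic_volume:
  "\<exists>V\<ge>0. \<forall>k::nat. emeasure N {2 ^ k..<2 ^ Suc k} <= ennreal (V * 2 powr (2 * (\<alpha> + 1) * real k))"
proof -
  obtain C where C: "C > 0" "\<And>l. l >= 1 ==> pd l <= C * l powr (2 * \<alpha> + 1)" using pd_le by blast
  have a: "2 * \<alpha> + 1 >= 0" using \<alpha>_gt by simp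
  show ?thesis
  proof (intro exI[of _ "C * 2 powr (2 * \<alpha> + 1)"] conjI allI)
    fix k :: nat
    let ?b = "C * (2 ^ Suc k) powr (2 * \<alpha> + 1)"
    have "emeasure N {2 ^ k..<2 ^ Suc k} = (\<integral>\<^sup>+l. ennreal (pd l) * indicator {2 ^ k..<2 ^ Suc k} l \<partial>lborel)"
      by (rule emeasure_N) simp
    also have "... <= (\<integral>\<^sup>+l. ennreal ?b * indicator {2 ^ k..<2 ^ Suc k :: real} l \<partial>lborel)"
    proof (rule nn_integral_mono)
      fix l :: real
      show "ennreal (pd l) * indicator {2 ^ k..<2 ^ Suc k} l <= ennreal ?b * indicator {2 ^ k..<2 ^ Suc k} l"
      proof (cases "l \<in> {2 ^ k..<2 ^ Suc k}")
        case True
        have "(1::real) <= 2 ^ k" by simp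
        then have l: "l >= 1" "l <= 2 ^ Suc k" using True by (auto simp del: one_le_power)
        have "pd l <= C * l powr (2 * \<alpha> + 1)" by (rule C(2)[OF l(1)])
        also have "... <= ?b" using C(1) a l by (intro mult_left_mono powr_mono2) auto
        finally show ?thesis using True by (simp add: ennreal_leI)
      qed simp
    qed
    also have "... = ennreal ?b * ennreal (2 ^ k)" by (subst nn_integral_cmult_indicator) auto
    also have "... = ennreal (?b * 2 ^ k)" using C(1) by (simp add: ennreal_mult)
    also have "?b * 2 ^ k = C * 2 powr (2 * \<alpha> + 1) * 2 powr (2 * (\<alpha> + 1) * real k)"
    proof -
      have "(2 ^ Suc k :: real) = 2 powr (real k + 1)" by (simp add: powr_add powr_realpow)
      moreover have "(2 ^ k :: real) = 2 powr real k" by (simp add: powr_realpow)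
      ultimately show ?thesis by (simp only: powr_powr mult.assoc powr_add[symmetric]) (simp add: algebra_simps)
    qed
    finally show "emeasure N {2 ^ k..<2 ^ Suc k} <= ennreal (C * 2 powr (2 * \<alpha> + 1) * 2 powr (2 * (\<alpha> + 1) * real k))" .
  qed (use C in auto)
qed

lemma emeasure_N_Ioo_finite: "emeasure N {0<..<1} < \<infinity>"
proof -
  obtain C where C: "C > 0" "\<And>l. 0 < l ==> l <= 1 ==> pd l <= C" using pd_le by blast
  have "emeasure N {0<..<1} = (\<integral>\<^sup>+l. ennreal (pd l) * indicator {0<..<1} l \<partial>lborel)"
    by (rule emeasure_N) simp
  also have "... <= (\<integral>\<^sup>+l. ennreal C * indicator {0<..<1::real} l \<partial>lborel)"
    by (intro nn_integral_mono) (auto simp: indicator_def intro!: ennreal_leI C)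
  also have "... = ennreal C" by (subst nn_integral_cmult_indicator) auto
  finally show ?thesis by (simp add: order_le_less_trans)
qed

text \<open>On a block the multiplier 1 - \<phi>_l(x), at a step x proportional to 2^(-k), is
  bounded below by a constant. Dividing by it converts the modulus estimate into block decay of
  order 2^(-\<gamma> q k), and \<open>cond\<close> is the balance of this decay against the
  volume.\<close>

lemma modulus_imp_Lp:
  fixes g :: "real => complex"
  assumes gm [measurable]: "g \<in> borel_measurable borel" and s: "0 < s" "s <= q" and q: "q > 0" and K: "K >= 0"
    and gq: "Lpow N q g < \<infinity>"
    and mod: "\<And>x. x > 0 ==> Lpow N q (\<lambda>l. of_real (1 - rphi l x) * g l) <= ennreal (K * x powr (\<gamma> * q))"
    and cond: "2 * (\<alpha> + 1) * q < s * (\<gamma> * q + 2 * (\<alpha> + 1))"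
  shows "Lpow N s g < \<infinity>"
proof -
  obtain V where V: "V >= 0" "\<And>k::nat. emeasure N {2 ^ k..<2 ^ Suc k} <= ennreal (V * 2 powr (2 * (\<alpha> + 1) * real k))"
    using dyadic_volume by blast
  \<comment> \<open>For l < 2^(k+1) the eigenvalue is at most (4 + \<rho>^2) 4^k, so the step b
    2^(-k) keeps eigenvalue times x^2 at most 1, as \<open>one_minus_rphi_ge\<close> demands. For l
    at least 2^k the product is also at least b^2, which yields the constant c.\<close>
  define b where "b = 1 / sqrt (4 + \<rho>\<^sup>2)"
  have b2: "b\<^sup>2 = 1 / (4 + \<rho>\<^sup>2)" by (simp add: b_def power_divide)
  have "sqrt 1 <= sqrt (4 + \<rho>\<^sup>2)" using zero_le_power2[of \<rho>] by (intro real_sqrt_le_mono) linarith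
  then have b: "b > 0" "b <= 1" by (auto simp: b_def add_pos_nonneg)
  define c where "c = b\<^sup>2 / (4 * (1 + 2 * Hc))"
  have c: "c > 0" using b Hc_nonneg by (simp add: c_def)
  have low: "c <= 1 - rphi l (b * (1/2) ^ k)" if l: "2 ^ k <= l" "l < 2 ^ Suc k" for l :: real and k :: nat
  proof -
    let ?x = "b * (1/2) ^ k"
    have l0: "l > 0" by (rule less_le_trans[OF _ l(1)]) simp
    have x: "0 <= ?x" "?x <= 1" using b by (auto intro!: mult_le_one power_le_one)
    have x2: "?x\<^sup>2 * (2 ^ k)\<^sup>2 = b\<^sup>2" by (simp add: power_mult_distrib[symmetric] power_one_over del: power_mult_distrib power_divide)
    have "l\<^sup>2 <= (2 ^ Suc k)\<^sup>2" using l l0 by (intro power_mono) auto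
    then have "\<kappa> l <= 4 * (2 ^ k)\<^sup>2 + \<rho>\<^sup>2 * 1" by (simp add: \<kappa>_def power_mult_distrib)
    also have "... <= 4 * (2 ^ k)\<^sup>2 + \<rho>\<^sup>2 * (2 ^ k)\<^sup>2" by (intro add_left_mono mult_left_mono) (auto simp: one_le_power)
    also have "... = (4 + \<rho>\<^sup>2) * (2 ^ k)\<^sup>2" by (simp add: algebra_simps)
    finally have "\<kappa> l * ?x\<^sup>2 <= (4 + \<rho>\<^sup>2) * (2 ^ k)\<^sup>2 * ?x\<^sup>2" by (rule mult_right_mono) simp
    also have "... = (4 + \<rho>\<^sup>2) * b\<^sup>2" using x2 by (simp only: mult.assoc mult.commute[of "(2 ^ k)\<^sup>2" "?x\<^sup>2"])
    also have "... = 1" using add_pos_nonneg[of 4 "\<rho>\<^sup>2"] by (simp add: b2)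
    finally have k1: "\<kappa> l * ?x\<^sup>2 <= 1" .
    have "(2 ^ k)\<^sup>2 <= l\<^sup>2" using l by (intro power_mono) auto
    then have "(2 ^ k)\<^sup>2 <= \<kappa> l" using zero_le_power2[of \<rho>] unfolding \<kappa>_def by linarith
    then have "(2 ^ k)\<^sup>2 * ?x\<^sup>2 <= \<kappa> l * ?x\<^sup>2" by (rule mult_right_mono) simp
    then have "b\<^sup>2 <= \<kappa> l * ?x\<^sup>2" using x2 by (simp only: mult.commute)
    then have "c <= \<kappa> l * ?x\<^sup>2 / (4 * (1 + 2 * Hc))" unfolding c_def using Hc_nonneg by (intro divide_right_mono) auto
    also have "... <= 1 - rphi l ?x" by (rule one_minus_rphi_ge[OF x k1])
    finally show ?thesis .
  qed
  show ?thesis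
  proof (rule nn_integral_dyadic_finite[where K="c powr (- q) * (K * b powr (\<gamma> * q))" and V=V and d="2 * (\<alpha> + 1)" and \<epsilon>="\<gamma> * q" and q=q])
    fix k :: nat
    let ?B = "{2 ^ k..<2 ^ Suc k :: real}" and ?x = "b * (1/2) ^ k"
    have rm [measurable]: "(\<lambda>l. rphi l ?x) \<in> borel_measurable borel"
      by (intro borel_measurable_continuous_onI continuous_at_imp_continuous_on ballI rphi_param_cont) (use b in simp)
    have "(\<integral>\<^sup>+l. ennreal (norm (g l) powr q) * indicator ?B l \<partial>N)
        <= (\<integral>\<^sup>+l. ennreal (c powr (- q)) * ennreal (norm (of_real (1 - rphi l ?x) * g l) powr q) \<partial>N)"
    proof (rule nn_integral_mono)
      fix l
      show "ennreal (norm (g l) powr q) * indicator ?B l <= ennreal (c powr (- q)) * ennreal (norm (of_real (1 - rphi l ?x) * g l) powr q)"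
      proof (cases "l \<in> ?B")
        case True
        then have "c <= 1 - rphi l ?x" by (intro low) auto
        then have "c * norm (g l) <= norm (of_real (1 - rphi l ?x) * g l)"
          unfolding norm_mult norm_of_real by (intro mult_right_mono) auto
        then have "(c * norm (g l)) powr q <= norm (of_real (1 - rphi l ?x) * g l) powr q"
          using c q by (intro powr_mono2) auto
        then have "c powr (- q) * (c powr q * norm (g l) powr q) <= c powr (- q) * norm (of_real (1 - rphi l ?x) * g l) powr q"
          by (intro mult_left_mono) (simp_all only: powr_mult powr_ge_zero)
        moreover have "c powr (- q) * (c powr q * norm (g l) powr q) = norm (g l) powr q"
          using c by (simp add: mult.assoc[symmetric] flip: powr_add)
        ultimately show ?thesis using True by (simp add: ennreal_leI flip: ennreal_mult)
      qed simp
    qed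
    also have "... = ennreal (c powr (- q)) * (Lpow N q (\<lambda>l. of_real (1 - rphi l ?x) * g l))"
      by (rule nn_integral_cmult) measurable
    also have "... <= ennreal (c powr (- q)) * ennreal (K * ?x powr (\<gamma> * q))"
      using b by (intro mult_left_mono mod) auto
    also have "... = ennreal (c powr (- q) * (K * ?x powr (\<gamma> * q)))" using K by (simp add: ennreal_mult)
    also have "?x powr (\<gamma> * q) = b powr (\<gamma> * q) * 2 powr (- (\<gamma> * q * real k))"
    proof -
      have "(1/2::real) ^ k = 2 powr (- real k)" by (simp add: powr_minus powr_realpow power_one_over inverse_eq_divide)
      then show ?thesis by (simp only: powr_mult powr_powr) (simp add: mult.commute)
    qed
    finally show "(\<integral>\<^sup>+l. ennreal (norm (g l) powr q) * indicator ?B l \<partial>N)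
        <= ennreal (c powr (- q) * (K * b powr (\<gamma> * q)) * 2 powr (- (\<gamma> * q * real k)))"
      by (simp only: mult.assoc)
  next
    show "2 * (\<alpha> + 1) * (q - s) < \<gamma> * q * s" using cond by (simp add: algebra_simps)
    show "2 * (\<alpha> + 1) > 0" using \<alpha>_gt by simp
  qed (use s K V gq AE_N emeasure_N_Ioo_finite in auto)
qed

end

section \<open>The transform on power classes\<close>

lemma ennreal_tendsto_0_le:
  fixes a :: "nat => ennreal"
  assumes "a \<longlonglongrightarrow> 0" "e > (0::real)"
  shows "\<exists>m. \<forall>n\<ge>m. a n <= ennreal e"
proof -
  have "\<forall>\<^sub>F n in sequentially. a n < ennreal e" by (rule order_tendstoD(2)[OF assms(1)]) (simp add: assms(2))
  then show ?thesis unfolding eventually_sequentially by (auto intro: less_imp_le)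
qed

lemma nn_integral_powr_add_le:
  fixes f g :: "'a => complex"
  assumes [measurable]: "f \<in> borel_measurable M" "g \<in> borel_measurable M" and q: "q > 0"
  shows "(Lpow M q (\<lambda>x. f x + g x))
    <= ennreal (2 powr q) * ((Lpow M q f) + (Lpow M q g))"
proof -
  have "(Lpow M q (\<lambda>x. f x + g x))
      <= (\<integral>\<^sup>+x. ennreal (2 powr q) * (ennreal (norm (f x) powr q) + ennreal (norm (g x) powr q)) \<partial>M)"
  proof (rule nn_integral_mono)
    fix x
    have "norm (f x + g x) powr q <= (norm (f x) + norm (g x)) powr q"
      using q by (intro powr_mono2 norm_triangle_ineq) auto
    also have "... <= 2 powr q * (norm (f x) powr q + norm (g x) powr q)"
      by (rule powr_add_le) (use q in auto)
    finally show "ennreal (norm (f x + g x) powr q) <= ennreal (2 powr q) * (ennreal (norm (f x) powr q) + ennreal (norm (g x) powr q))"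
      by (simp add: ennreal_leI flip: ennreal_mult ennreal_plus)
  qed
  also have "... = ennreal (2 powr q) * ((Lpow M q f) + (Lpow M q g))"
    by (subst nn_integral_cmult) (auto simp: nn_integral_add)
  finally show ?thesis .
qed

lemma nn_integral_powr_add_le_real:
  fixes f g :: "'a => complex"
  assumes "f \<in> borel_measurable M" "g \<in> borel_measurable M" "q > 0"
    and "Lpow M q f <= ennreal a" "Lpow M q g <= ennreal b"
    and "a >= 0" "b >= 0"
  shows "Lpow M q (\<lambda>x. f x + g x) <= ennreal (2 powr q * (a + b))"
proof -
  have "Lpow M q (\<lambda>x. f x + g x) <= ennreal (2 powr q) * (ennreal a + ennreal b)"
    by (rule order_trans[OF nn_integral_powr_add_le[OF assms(1-3)] mult_left_mono[OF add_mono[OF assms(4,5)]]]) simp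
  then show ?thesis using assms(6,7) by (simp flip: ennreal_mult ennreal_plus)
qed

text \<open>Cutting off small values keeps a function in every power class it was in and makes it integrable.\<close>

lemma L1_Lp_approximation:
  fixes f :: "'a => complex"
  assumes p: "1 < p" and [measurable]: "f \<in> borel_measurable M"
    and fin: "Lpow M p f < \<infinity>"
  obtains h where "\<And>n::nat. integrable M (h n)" "\<And>n. (Lpow M p (\<lambda>x. h n x)) < \<infinity>"
    "(\<lambda>n. Lpow M p (\<lambda>x. h n x - f x)) \<longlonglongrightarrow> 0"
proof -
  define h where "h = (\<lambda>(n::nat) x. if norm (f x) >= 1 / real (Suc n) then f x else 0)"
  have hm [measurable]: "h n \<in> borel_measurable M" for n unfolding h_def by measurable
  have "integrable M (h n)" for n
  proof (rule integrableI_bounded)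
    have "(\<integral>\<^sup>+x. ennreal (norm (h n x)) \<partial>M) <= (\<integral>\<^sup>+x. ennreal (real (Suc n) powr (p - 1)) * ennreal (norm (f x) powr p) \<partial>M)"
    proof (rule nn_integral_mono)
      fix x
      have "norm (h n x) <= real (Suc n) powr (p - 1) * norm (f x) powr p"
      proof (cases "norm (f x) >= 1 / real (Suc n)")
        case True
        then have f0: "norm (f x) > 0" by (rule less_le_trans[rotated]) simp
        have "1 <= (real (Suc n) * norm (f x)) powr (p - 1)"
          using True p by (intro ge_one_powr_ge_zero) (auto simp: field_simps)
        then have "1 * norm (f x) <= (real (Suc n) * norm (f x)) powr (p - 1) * norm (f x)" by (rule mult_right_mono) simp
        also have "... = real (Suc n) powr (p - 1) * norm (f x) powr p"
          using f0 by (simp only: powr_mult mult.assoc) (simp add: powr_diff)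
        finally show ?thesis using True by (simp add: h_def)
      qed (simp add: h_def)
      then show "ennreal (norm (h n x)) <= ennreal (real (Suc n) powr (p - 1)) * ennreal (norm (f x) powr p)"
        by (simp add: ennreal_leI flip: ennreal_mult)
    qed
    also have "... = ennreal (real (Suc n) powr (p - 1)) * (Lpow M p f)"
      by (rule nn_integral_cmult) measurable
    also have "... < \<infinity>" using fin by (simp add: ennreal_mult_less_top)
    finally show "(\<integral>\<^sup>+x. ennreal (norm (h n x)) \<partial>M) < \<infinity>" .
  qed simp
  moreover have "Lpow M p (\<lambda>x. h n x) < \<infinity>" for n
    by (rule le_less_trans[OF nn_integral_mono fin]) (simp add: h_def)
  moreover have "(\<lambda>n. Lpow M p (\<lambda>x. h n x - f x)) \<longlonglongrightarrow> (\<integral>\<^sup>+x. 0 \<partial>M)"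
  proof (rule nn_integral_dominated_convergence[where w="\<lambda>x. ennreal (norm (f x) powr p)"])
    show "AE x in M. ennreal (norm (h n x - f x) powr p) <= ennreal (norm (f x) powr p)" for n
      by (intro AE_I2) (simp add: h_def)
    show "AE x in M. (\<lambda>n. ennreal (norm (h n x - f x) powr p)) \<longlonglongrightarrow> 0"
    proof (rule AE_I2)
      fix x
      show "(\<lambda>n. ennreal (norm (h n x - f x) powr p)) \<longlonglongrightarrow> 0"
      proof (cases "f x = 0")
        case True then show ?thesis by (simp add: h_def)
      next
        case False
        then obtain m :: nat where m: "1 / real (Suc m) < norm (f x)" using nat_approx_posE[of "norm (f x)"] by auto
        have "ennreal (norm (h n x - f x) powr p) = 0" if "n >= m" for n
        proof -
          have "1 / real (Suc n) <= 1 / real (Suc m)" using that by (simp add: frac_le)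
          then show ?thesis using m by (simp add: h_def)
        qed
        then show ?thesis by (intro tendsto_eventually) (auto simp: eventually_sequentially)
      qed
    qed
  qed (use fin in simp_all)
  ultimately show ?thesis by (intro that[of h]) auto
qed

section \<open>The extended transform as a limit\<close>

context jacobi begin

text \<open>Hausdorff-Young carries a sufficiently fast Cauchy sequence of integrable approximants
  to one on the spectral side, where completeness gives the limit. This provides the witness that
  makes the \<open>SOME\<close> in the definition of the transform meaningful.\<close>

lemma Ft_limit_exists:
  assumes p: "1 < p" "p <= 2" and fm [measurable]: "f \<in> borel_measurable borel"
    and fin: "Lpow J p f < \<infinity>"
  obtains h g where "\<And>n::nat. integrable J (h n)" "\<And>n. (Lpow J p (\<lambda>x. h n x)) < \<infinity>"
    "(\<lambda>n. Lpow J p (\<lambda>x. h n x - f x)) \<longlonglongrightarrow> 0"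
    "g \<in> borel_measurable borel"
    "(\<lambda>n. Lpow N (p / (p - 1)) (\<lambda>l. Ft (h n) l - g l)) \<longlonglongrightarrow> 0"
proof -
  let ?q = "p / (p - 1)"
  obtain h where h: "\<And>n::nat. integrable J (h n)" "\<And>n. (Lpow J p (\<lambda>x. h n x)) < \<infinity>"
    "(\<lambda>n. Lpow J p (\<lambda>x. h n x - f x)) \<longlonglongrightarrow> 0"
    by (rule L1_Lp_approximation[OF p(1) _ fin]) (use fm in auto)
  obtain C where C: "C > 0" "\<And>f K. integrable J f ==> K > 0 ==> Lpow J p f <= ennreal K
      ==> Lpow N ?q (Ft f) <= ennreal (C * K powr (1 / (p - 1)))"
    using hausdorff_young[OF p] by blast
  \<comment> \<open>With 4^(-np) on the p side, the exponent 1/(p-1) of Hausdorff-Young gives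
    exactly the rate 4^(-nq) that \<open>nn_integral_powr_complete\<close> expects.\<close>
  define \<delta> :: "nat => real" where "\<delta> n = (1/4) powr (real n * p)" for n
  have \<delta>: "\<delta> n > 0" for n by (simp add: \<delta>_def)
  have \<delta>_mono: "\<delta> m <= \<delta> n" if "n <= m" for m n
    unfolding \<delta>_def using that p by (intro powr_mono') (auto intro!: mult_right_mono)
  have "\<exists>m. \<forall>k\<ge>m. (Lpow J p (\<lambda>x. h k x - f x)) <= ennreal (\<delta> n)" for n
    by (rule ennreal_tendsto_0_le[OF h(3) \<delta>])
  then obtain r0 where r0: "\<And>n k. r0 n <= k ==> Lpow J p (\<lambda>x. h k x - f x) <= ennreal (\<delta> n)" by metis
  define r where "r n = max n (r0 n)" for n
  have r: "Lpow J p (\<lambda>x. h (r n) x - f x) <= ennreal (\<delta> n)" for n by (rule r0) (simp add: r_def)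
  have rt: "filterlim r sequentially sequentially"
    by (rule filterlim_at_top_mono[OF filterlim_ident]) (simp add: r_def)
  define u where "u n = Ft (h (r n))" for n
  have hm [measurable]: "h n \<in> borel_measurable borel" for n by (rule integrable_J_measurable[OF h(1)])
  let ?K = "C * (2 powr p * 2) powr (1 / (p - 1))"
  have "\<exists>g\<in>borel_measurable N. (\<lambda>n. Lpow N ?q (\<lambda>l. u n l - g l)) \<longlonglongrightarrow> 0"
  proof (rule nn_integral_powr_complete[where K="?K"])
    show "u n \<in> borel_measurable N" for n unfolding u_def using Ft_measurable[OF h(1)] by simp
    show "1 <= ?q" using p by (simp add: field_simps)
    show "0 <= ?K" using C(1) by simp
    fix n m :: nat assume nm: "n <= m"
    have "Lpow J p (\<lambda>x. (h (r n) x - f x) + (f x - h (r m) x)) <= ennreal (2 powr p * (\<delta> n + \<delta> m))"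
      using r[of n] r[of m] p less_imp_le[OF \<delta>[of n]] less_imp_le[OF \<delta>[of m]]
      by (intro nn_integral_powr_add_le_real) (auto simp: norm_minus_commute measurable_J)
    also have "... <= ennreal (2 powr p * 2 * \<delta> n)" unfolding mult.assoc
      using \<delta>_mono[OF nm] by (intro ennreal_leI mult_left_mono) auto
    finally have "Lpow J p (\<lambda>x. h (r n) x - h (r m) x) <= ennreal (2 powr p * 2 * \<delta> n)" by simp
    then have "Lpow N ?q (\<lambda>l. Ft (\<lambda>x. h (r n) x - h (r m) x) l) <= ennreal (C * (2 powr p * 2 * \<delta> n) powr (1 / (p - 1)))"
      using \<delta>[of n] by (intro C(2) Bochner_Integration.integrable_diff h(1)) auto
    moreover have "(2 powr p * 2 * \<delta> n) powr (1 / (p - 1)) = (2 powr p * 2) powr (1 / (p - 1)) * (1/4) powr (real n * ?q)"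
    proof -
      have "\<delta> n powr (1 / (p - 1)) = (1/4) powr (real n * ?q)" unfolding \<delta>_def powr_powr by simp
      then show ?thesis by (simp only: powr_mult[of "2 powr p * 2"])
    qed
    ultimately show "Lpow N ?q (\<lambda>l. u n l - u m l) <= ennreal (?K * (1/4) powr (real n * ?q))"
      by (simp only: Ft_diff[OF h(1) h(1)] u_def mult.assoc)
  qed
  then obtain g where g: "g \<in> borel_measurable borel" "(\<lambda>n. Lpow N ?q (\<lambda>l. Ft (h (r n)) l - g l)) \<longlonglongrightarrow> 0"
    unfolding u_def by (auto simp: measurable_N)
  show ?thesis
  proof (rule that[of "\<lambda>n. h (r n)" g])
    show "(\<lambda>n. Lpow J p (\<lambda>x. h (r n) x - f x)) \<longlonglongrightarrow> 0"
      by (rule filterlim_compose[OF h(3) rt])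
  qed (use h g in auto)
qed

lemma Ft_limit_Lp:
  assumes p: "1 < p" "p <= 2" and h: "\<And>n. integrable J (h n)" "\<And>n. (Lpow J p (\<lambda>x. h n x)) < \<infinity>"
    and g [measurable]: "g \<in> borel_measurable borel"
    and lim: "(\<lambda>n. Lpow N (p / (p - 1)) (\<lambda>l. Ft (h n) l - g l)) \<longlonglongrightarrow> 0"
  shows "Lpow N (p / (p - 1)) g < \<infinity>"
proof -
  let ?q = "p / (p - 1)"
  have q: "?q > 0" using p by simp
  obtain n where n: "Lpow N ?q (\<lambda>l. Ft (h n) l - g l) <= ennreal 1"
    using ennreal_tendsto_0_le[OF lim, of 1] by auto
  obtain K where K: "K >= 0" "Lpow J p (\<lambda>x. h n x) = ennreal K"
    using h(2)[of n] by (cases "Lpow J p (\<lambda>x. h n x)") auto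
  obtain C where "C > 0" "Lpow N ?q (Ft (h n)) <= ennreal (C * (K + 1) powr (1 / (p - 1)))"
    using hausdorff_young[OF p] h(1)[of n] K by (metis add_nonneg_pos ennreal_leI le_add_same_cancel1 zero_le_one zero_less_one)
  moreover have [measurable]: "Ft (h n) \<in> borel_measurable borel" by (rule Ft_measurable[OF h(1)])
  ultimately have "Lpow N ?q (\<lambda>l. Ft (h n) l + (g l - Ft (h n) l)) <= ennreal (2 powr ?q * (C * (K + 1) powr (1 / (p - 1)) + 1))"
    using n q by (intro nn_integral_powr_add_le_real) (auto simp: norm_minus_commute measurable_N)
  then show ?thesis by (simp add: order_le_less_trans)
qed

text \<open>The approximants carry no modulus bound of their own. For fixed x one index n is chosen
  so late that both approximation errors are below the size of the claim; then the difference for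
  h_n is split into the translate of h_n - f, f - h_n, and the modulus of f. The index depends on x,
  the constants do not.\<close>

lemma Ft_limit_modulus:
  assumes p: "1 < p" "p <= 2" and fm [measurable]: "f \<in> borel_measurable borel"
    and fin: "Lpow J p f < \<infinity>"
    and h: "\<And>n. integrable J (h n)" and hf: "(\<lambda>n. Lpow J p (\<lambda>x. h n x - f x)) \<longlonglongrightarrow> 0"
    and g [measurable]: "g \<in> borel_measurable borel"
    and lim: "(\<lambda>n. Lpow N (p / (p - 1)) (\<lambda>l. Ft (h n) l - g l)) \<longlonglongrightarrow> 0"
    and mod: "\<And>x. x > 0 ==> Lpow J p (\<lambda>y. transl x f y - f y) <= ennreal ((C * x powr \<gamma>) powr p)"
    and C: "C >= 0"
  shows "\<exists>K\<ge>0. \<forall>x>0. (Lpow N (p / (p - 1)) (\<lambda>l. of_real (1 - rphi l x) * g l))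
     <= ennreal (K * x powr (\<gamma> * (p / (p - 1))))"
proof -
  let ?q = "p / (p - 1)"
  have q: "?q > 0" using p by simp
  have hm [measurable]: "h n \<in> borel_measurable borel" for n by (rule integrable_J_measurable[OF h])
  \<comment> \<open>Strict positivity is needed: \<open>C\<close> may be 0, and an error tolerance
    of 0 could not be reached by any approximant.\<close>
  define D where "D = C + 1"
  have D: "D > 0" "C <= D" using C by (auto simp: D_def)
  obtain H where H: "H > 0" "\<And>f K. integrable J f ==> K > 0 ==> Lpow J p f <= ennreal K
      ==> Lpow N ?q (Ft f) <= ennreal (H * K powr (1 / (p - 1)))"
    using hausdorff_young[OF p] by blast
  \<comment> \<open>Two uses of the inequality (a+b)^q at most 2^q (a^q + b^q), with q = p, for the
    three summands.\<close>
  define B where "B = 2 powr p * (2 powr p * (1 + 1) + 1)"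
  have B: "B > 0" by (simp add: B_def add_pos_pos)
  let ?K = "2 powr ?q * (H * (B * D powr p) powr (1 / (p - 1)) + 2 powr ?q * 1)"
  have main: "Lpow N ?q (\<lambda>l. of_real (1 - rphi l x) * g l) <= ennreal (?K * x powr (\<gamma> * ?q))" if x: "x > 0" for x
  proof -
    define e where "e = (D * x powr \<gamma>) powr p"
    have e: "e > 0" using D x by (simp add: e_def)
    have modx: "Lpow J p (\<lambda>y. transl x f y - f y) <= ennreal e"
      unfolding e_def using C D p
      by (intro order_trans[OF mod[OF x]] ennreal_leI powr_mono2 mult_right_mono) auto
    define w where "w = x powr (\<gamma> * ?q)"
    have w: "w > 0" using x by (simp add: w_def)
    obtain m1 where m1: "\<And>n. n >= m1 ==> Lpow J p (\<lambda>y. h n y - f y) <= ennreal e"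
      using ennreal_tendsto_0_le[OF hf e] by blast
    obtain m2 where m2: "\<And>n. n >= m2 ==> Lpow N ?q (\<lambda>l. Ft (h n) l - g l) <= ennreal w"
      using ennreal_tendsto_0_le[OF lim w] by blast
    define n where "n = max m1 m2"
    have n1: "Lpow J p (\<lambda>y. h n y - f y) <= ennreal e" by (rule m1) (simp add: n_def)
    have n2: "Lpow N ?q (\<lambda>l. Ft (h n) l - g l) <= ennreal w" by (rule m2) (simp add: n_def)
    have p0: "p > 0" "1 <= p" using p by auto
    have hi: "Lpow J 1 (\<lambda>y. h n y) < \<infinity>"
      using h[of n] unfolding integrable_iff_bounded by simp
    have trd: "AE y in J. transl x (h n) y - transl x f y = transl x (\<lambda>t. h n t - f t) y"
      using AE_transl_integrable[OF order_refl x hm hi] AE_transl_integrable[OF p0(2) x fm fin]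
      by eventually_elim (simp add: transl_def)
    have t1: "Lpow J p (\<lambda>y. transl x (\<lambda>t. h n t - f t) y) <= ennreal e"
      by (rule order_trans[OF transl_contraction[OF p0(2) x] n1]) measurable
    have "Lpow J p (\<lambda>y. transl x (\<lambda>t. h n t - f t) y + (f y - h n y)) <= ennreal (2 powr p * (e + e))"
      using t1 n1 p0 e by (intro nn_integral_powr_add_le_real) (auto simp: norm_minus_commute measurable_J)
    then have "Lpow J p (\<lambda>y. (transl x (\<lambda>t. h n t - f t) y + (f y - h n y)) + (transl x f y - f y)) <= ennreal (2 powr p * (2 powr p * (e + e) + e))"
      using modx p0 e by (elim nn_integral_powr_add_le_real[rotated 3]) (auto simp: measurable_J)
    also have "2 powr p * (2 powr p * (e + e) + e) = B * e" by (simp add: B_def algebra_simps)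
    also have "(Lpow J p (\<lambda>y. (transl x (\<lambda>t. h n t - f t) y + (f y - h n y)) + (transl x f y - f y)))
        = Lpow J p (\<lambda>y. transl x (h n) y - h n y)"
    proof (rule nn_integral_cong_AE)
      show "AE y in J. ennreal (norm ((transl x (\<lambda>t. h n t - f t) y + (f y - h n y)) + (transl x f y - f y)) powr p)
          = ennreal (norm (transl x (h n) y - h n y) powr p)"
        using trd
      proof eventually_elim
        case (elim y)
        have "(transl x (\<lambda>t. h n t - f t) y + (f y - h n y)) + (transl x f y - f y) = transl x (h n) y - h n y"
          unfolding elim[symmetric] by simp
        then show ?case by (simp only:)
      qed
    qed
    finally have dn: "Lpow J p (\<lambda>y. transl x (h n) y - h n y) <= ennreal (B * e)" .
    note ti = transl_integrable_Ft[OF x h[of n]]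
    have "Lpow N ?q (\<lambda>l. Ft (\<lambda>y. transl x (h n) y - h n y) l) <= ennreal (H * (B * e) powr (1 / (p - 1)))"
      by (rule H(2)[OF _ _ dn]) (use ti(1) h B e in auto)
    moreover have "Ft (\<lambda>y. transl x (h n) y - h n y) l = - (of_real (1 - rphi l x) * Ft (h n) l)" for l
      using Ft_diff[OF ti(1) h] ti(2)[of l] by (simp add: algebra_simps)
    moreover have "(B * e) powr (1 / (p - 1)) = (B * D powr p) powr (1 / (p - 1)) * w"
    proof -
      have "B * e = (B * D powr p) * x powr (\<gamma> * p)" by (simp only: e_def powr_mult powr_powr mult.assoc)
      then show ?thesis by (simp only: powr_mult[of "B * D powr p"] powr_powr w_def) simp
    qed
    ultimately have u1: "Lpow N ?q (\<lambda>l. of_real (1 - rphi l x) * Ft (h n) l) <= ennreal (H * ((B * D powr p) powr (1 / (p - 1)) * w))"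
      by simp
    have rm [measurable]: "(\<lambda>l. rphi l x) \<in> borel_measurable borel"
      by (intro borel_measurable_continuous_onI continuous_at_imp_continuous_on ballI rphi_param_cont x)
    have Fm [measurable]: "Ft (h n) \<in> borel_measurable borel" by (rule Ft_measurable[OF h])
    have u2: "Lpow N ?q (\<lambda>l. of_real (1 - rphi l x) * (g l - Ft (h n) l)) <= ennreal (2 powr ?q * w)"
    proof -
      have "(Lpow N ?q (\<lambda>l. of_real (1 - rphi l x) * (g l - Ft (h n) l)))
          <= (\<integral>\<^sup>+l. ennreal (2 powr ?q) * ennreal (norm (Ft (h n) l - g l) powr ?q) \<partial>N)"
      proof (rule nn_integral_mono)
        fix l
        have "\<bar>1 - rphi l x\<bar> <= 2" using rphi_le_1[of x l] x by auto
        then have "norm (of_real (1 - rphi l x) * (g l - Ft (h n) l)) <= 2 * norm (Ft (h n) l - g l)"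
          unfolding norm_mult norm_of_real norm_minus_commute[of "g l"] by (rule mult_right_mono) simp
        then have "norm (of_real (1 - rphi l x) * (g l - Ft (h n) l)) powr ?q <= (2 * norm (Ft (h n) l - g l)) powr ?q"
          using q by (intro powr_mono2) auto
        then show "ennreal (norm (of_real (1 - rphi l x) * (g l - Ft (h n) l)) powr ?q) <= ennreal (2 powr ?q) * ennreal (norm (Ft (h n) l - g l) powr ?q)"
          unfolding powr_mult by (simp add: ennreal_leI flip: ennreal_mult)
      qed
      also have "... = ennreal (2 powr ?q) * (Lpow N ?q (\<lambda>l. Ft (h n) l - g l))"
        by (rule nn_integral_cmult) measurable
      also have "... <= ennreal (2 powr ?q) * ennreal w" by (intro mult_left_mono n2) simp
      finally show ?thesis using w by (simp add: ennreal_mult)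
    qed
    have "(Lpow N ?q (\<lambda>l. of_real (1 - rphi l x) * Ft (h n) l + of_real (1 - rphi l x) * (g l - Ft (h n) l)))
        <= ennreal (2 powr ?q * (H * ((B * D powr p) powr (1 / (p - 1)) * w) + 2 powr ?q * w))"
      using u1 u2 q H(1) w by (intro nn_integral_powr_add_le_real) (auto simp: measurable_N)
    also have "2 powr ?q * (H * ((B * D powr p) powr (1 / (p - 1)) * w) + 2 powr ?q * w) = ?K * w" by (simp add: algebra_simps)
    finally have "Lpow N ?q (\<lambda>l. of_real (1 - rphi l x) * Ft (h n) l + of_real (1 - rphi l x) * (g l - Ft (h n) l)) <= ennreal (?K * w)" .
    moreover have "of_real (1 - rphi l x) * Ft (h n) l + of_real (1 - rphi l x) * (g l - Ft (h n) l) = of_real (1 - rphi l x) * g l" for l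
      by (simp add: algebra_simps)
    ultimately show ?thesis by (simp only: w_def)
  qed
  have "?K >= 0" using H(1) by simp
  with main show ?thesis by blast
qed

lemma Ft_eq_0_of_modulus:
  assumes f: "integrable J f" and \<gamma>: "\<gamma> > 2"
    and mod: "\<And>x. x > 0 ==> (\<integral>\<^sup>+y. ennreal (norm (transl x f y - f y)) \<partial>J) <= ennreal (C * x powr \<gamma>)"
    and C: "C >= 0"
  shows "Ft f l = 0"
proof -
  define c where "c = \<kappa> l / (4 * (1 + 2 * Hc))"
  have c: "c > 0" using \<kappa>_pos[of l] Hc_nonneg by (simp add: c_def)
  define d where "d = min 1 (1 / sqrt (\<kappa> l))"
  have d: "d > 0" using \<kappa>_pos[of l] by (simp add: d_def)
  have le: "norm (Ft f l) <= C / c * x powr (\<gamma> - 2)" if x: "0 < x" "x <= d" for x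
  proof -
    have "x\<^sup>2 <= (1 / sqrt (\<kappa> l))\<^sup>2" using x by (intro power_mono) (auto simp: d_def)
    then have "\<kappa> l * x\<^sup>2 <= 1" using \<kappa>_pos[of l] by (simp add: power_divide field_simps)
    then have "c * x\<^sup>2 <= 1 - rphi l x" using one_minus_rphi_ge[of x l] x by (simp add: c_def d_def)
    then have "c * x\<^sup>2 * norm (Ft f l) <= norm (of_real (1 - rphi l x) * Ft f l)"
      unfolding norm_mult norm_of_real by (intro mult_right_mono) auto
    also have "of_real (1 - rphi l x) * Ft f l = - Ft (\<lambda>y. transl x f y - f y) l"
      unfolding Ft_diff[OF transl_integrable_Ft(1)[OF x(1) f] f] transl_integrable_Ft(2)[OF x(1) f]
      by (simp add: algebra_simps)
    also have "norm ... = norm (Ft (\<lambda>y. transl x f y - f y) l)" by (rule norm_minus_cancel)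
    also have "... <= (\<integral>y. norm (transl x f y - f y) \<partial>J)"
      by (intro Ft_le Bochner_Integration.integrable_diff transl_integrable_Ft x f)
    also have "... <= C * x powr \<gamma>"
    proof -
      have "ennreal (\<integral>y. norm (transl x f y - f y) \<partial>J) = (\<integral>\<^sup>+y. ennreal (norm (transl x f y - f y)) \<partial>J)"
        by (intro nn_integral_eq_integral[symmetric] integrable_norm Bochner_Integration.integrable_diff transl_integrable_Ft x f) auto
      then have "ennreal (\<integral>y. norm (transl x f y - f y) \<partial>J) <= ennreal (C * x powr \<gamma>)" using mod[OF x(1)] by simp
      then show ?thesis using C by (subst (asm) ennreal_le_iff) auto
    qed
    also have "x powr \<gamma> = x powr (\<gamma> - 2) * x\<^sup>2" using x by (simp add: powr_diff powr_numeral)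
    finally have "(c * norm (Ft f l)) * x\<^sup>2 <= (C * x powr (\<gamma> - 2)) * x\<^sup>2" by (simp add: ac_simps)
    then have "c * norm (Ft f l) <= C * x powr (\<gamma> - 2)" using x by (simp add: mult_le_cancel_right)
    then show ?thesis using c by (simp add: field_simps)
  qed
  show ?thesis
  proof (rule ccontr)
    assume "Ft f l \<noteq> 0"
    then have a: "norm (Ft f l) > 0" by simp
    \<comment> \<open>Taking x with x^(\<gamma>-2) at most b makes the right-hand side of
      \<open>le\<close> less than half of the norm on the left; dividing by C + 1 also covers C =
      0.\<close>
    define b where "b = norm (Ft f l) * c / (2 * (C + 1))"
    have b: "b > 0" using a c C by (simp add: b_def)
    define x where "x = min d (b powr (1 / (\<gamma> - 2)))"
    have x: "0 < x" "x <= d" using d b by (auto simp: x_def)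
    have "x powr (\<gamma> - 2) <= (b powr (1 / (\<gamma> - 2))) powr (\<gamma> - 2)"
      using x \<gamma> by (intro powr_mono2) (auto simp: x_def)
    also have "... = b" using \<gamma> b unfolding powr_powr by simp
    finally have "C / c * x powr (\<gamma> - 2) <= C / c * b" using C c by (intro mult_left_mono) auto
    with le[OF x] have "norm (Ft f l) <= C / c * b" by simp
    also have "... = norm (Ft f l) * (C / (2 * (C + 1)))" using c by (simp add: b_def)
    also have "... < norm (Ft f l) * 1" using a C by (intro mult_strict_left_mono) (auto simp: field_simps)
    finally show False by simp
  qed
qed

end

section \<open>Besov functions\<close>

text \<open>Membership in a power class says nothing about a function off the positive half-line;
  extension by 0 gives a Borel function on the line on which \<open>J\<close> and \<open>N\<close>
  can act.\<close>

definition zext :: "(real => complex) => real => complex" where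
  "zext f x = indicator {0<..} x *\<^sub>R f x"

lemma zext_pos [simp]: "x > 0 ==> zext f x = f x" by (simp add: zext_def)

lemma zext_measurable_iff:
  assumes "sets M = sets (restrict_space borel {0<..})"
  shows "f \<in> borel_measurable M \<longleftrightarrow> zext f \<in> borel_measurable borel"
  unfolding measurable_cong_sets[OF assms refl] zext_def[abs_def]
  by (rule borel_measurable_restrict_space_iff) simp

section \<open>From the whole-line measures back to the half-line definitions\<close>

context jacobi begin

lemma sets_jac: "sets (jac_measure \<alpha> \<beta>) = sets (restrict_space borel {0<..})"
  unfolding jac_measure_def by (simp add: sets_restrict_space)

lemma space_jac: "space (jac_measure \<alpha> \<beta>) = {0<..}"
  unfolding jac_measure_def by (simp add: space_restrict_space)

lemma sets_planch: "sets (plancherel_measure \<alpha> \<beta>) = sets (restrict_space borel {0<..})"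
  unfolding plancherel_measure_def by (simp add: sets_restrict_space)

lemma space_planch: "space (plancherel_measure \<alpha> \<beta>) = {0<..}"
  unfolding plancherel_measure_def by (simp add: space_restrict_space)

lemma nn_integral_jac_cong:
  assumes "h \<in> borel_measurable borel" "\<And>x. x > 0 ==> u x = h x"
  shows "(\<integral>\<^sup>+x. u x \<partial>jac_measure \<alpha> \<beta>) = (\<integral>\<^sup>+x. h x \<partial>J)"
  unfolding nn_integral_jac[OF assms(1), symmetric]
  by (rule nn_integral_cong) (simp add: space_jac assms(2))

lemma nn_integral_planch_cong:
  assumes "h \<in> borel_measurable borel" "\<And>x. x > 0 ==> u x = h x"
  shows "(\<integral>\<^sup>+x. u x \<partial>plancherel_measure \<alpha> \<beta>) = (\<integral>\<^sup>+x. h x \<partial>N)"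
  unfolding nn_integral_plancherel[OF assms(1), symmetric]
  by (rule nn_integral_cong) (simp add: space_planch assms(2))

lemma in_Lp_jac:
  "in_Lp (jac_measure \<alpha> \<beta>) p f \<longleftrightarrow> zext f \<in> borel_measurable borel \<and> Lpow J p (zext f) < \<infinity>"
proof -
  have "Lpow (jac_measure \<alpha> \<beta>) p f = Lpow J p (zext f)"
    if [measurable]: "zext f \<in> borel_measurable borel" by (rule nn_integral_jac_cong) auto
  then show ?thesis unfolding in_Lp_def zext_measurable_iff[OF sets_jac] by auto
qed

lemma in_Lp_planch:
  "in_Lp (plancherel_measure \<alpha> \<beta>) p f \<longleftrightarrow> zext f \<in> borel_measurable borel \<and> Lpow N p (zext f) < \<infinity>"
proof -
  have "Lpow (plancherel_measure \<alpha> \<beta>) p f = Lpow N p (zext f)"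
    if [measurable]: "zext f \<in> borel_measurable borel" by (rule nn_integral_planch_cong) auto
  then show ?thesis unfolding in_Lp_def zext_measurable_iff[OF sets_planch] by auto
qed

lemma integrable_zext:
  assumes "in_Lp (jac_measure \<alpha> \<beta>) 1 f" shows "integrable J (zext f)"
  using assms unfolding in_Lp_jac by (intro integrableI_bounded) (auto simp: measurable_J)

lemma jacobi_FT1_eq:
  assumes [measurable]: "zext f \<in> borel_measurable borel"
  shows "jacobi_FT1 \<alpha> \<beta> f l = Ft (zext f) l"
proof -
  have "jacobi_FT1 \<alpha> \<beta> f l = (\<integral>x. zext f x * of_real (rphi l x) \<partial>jac_measure \<alpha> \<beta>)"
    unfolding jacobi_FT1_def by (rule Bochner_Integration.integral_cong) (auto simp: space_jac phi_real)
  also have "... = Ft (zext f) l" unfolding Ft_def by (rule integral_jac) measurable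
  finally show ?thesis .
qed

lemma AE_J_neq: "AE y in J. y \<noteq> x"
  unfolding J_def by (subst AE_density) (simp, use AE_lborel_singleton[of x] in eventually_elim, simp)

text \<open>The translation integrates \<open>f\<close> itself, which is only assumed measurable on the positive half-line. If
  \<open>f\<close> is not Borel on the whole line, every translate is the junk value 0 and the modulus condition forces
  \<open>f\<close> to vanish almost everywhere.\<close>

lemma besov_modulus:
  assumes p: "1 <= p" and \<gamma>: "\<gamma> > 0" and fm: "zext f \<in> borel_measurable borel" and C: "C >= 0"
    and mod: "\<And>x. x > 0 ==> mod_cont_pow \<alpha> \<beta> p f x <= ennreal ((C * x powr \<gamma>) powr p)" and x: "x > 0"
  shows "Lpow J p (\<lambda>y. transl x (zext f) y - zext f y) <= ennreal ((C * x powr \<gamma>) powr p)"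
proof (cases "f \<in> borel_measurable borel")
  case True
  note [measurable] = True fm
  have "mod_cont_pow \<alpha> \<beta> p f x = Lpow J p (\<lambda>y. transl x f y - f y)"
    unfolding mod_cont_pow_def
  proof (rule nn_integral_jac_cong)
    show "(\<lambda>y. ennreal (norm (transl x f y - f y) powr p)) \<in> borel_measurable borel" by measurable
  qed (use x True in \<open>simp add: gen_transl_eq transl_def\<close>)
  also have "... = Lpow J p (\<lambda>y. transl x (zext f) y - zext f y)"
  proof (rule nn_integral_cong_AE)
    show "AE y in J. ennreal (norm (transl x f y - f y) powr p) = ennreal (norm (transl x (zext f) y - zext f y) powr p)"
      using AE_J AE_J_neq[of x]
    proof eventually_elim
      case (elim y)
      \<comment> \<open>For y different from x the third side is at least |x - y| > 0, so the
        translation never evaluates f at or below 0, where f and its zero extension may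
        differ.\<close>
      have "tt x y w > 0" for w using tt_bounds(1)[of x y w] x elim by simp
      then have "transl x f y = transl x (zext f) y" unfolding transl_def by simp
      then show ?case using elim by simp
    qed
  qed
  finally show ?thesis using mod[OF x] by simp
next
  case False
  note [measurable] = fm
  let ?I = "Lpow J p (zext f)"
  have I: "?I <= ennreal ((C * x powr \<gamma>) powr p)" if x: "x > 0" for x
  proof -
    have "gen_transl \<alpha> \<beta> x f y = 0" if "y > 0" for y
      unfolding gen_transl_def using x that False
      by (subst hyp_conv_eq) (auto intro!: not_integrable_integral_eq dest!: borel_measurable_integrable)
    then have "mod_cont_pow \<alpha> \<beta> p f x = ?I"
      unfolding mod_cont_pow_def by (intro nn_integral_jac_cong) auto
    then show ?thesis using mod[OF x] by simp
  qed
  have "?I <= ennreal e" if e: "e > 0" for e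
  proof -
    \<comment> \<open>The solution of (C + 1) x^\<gamma> = e^(1/p), a step small enough for the
      modulus bound to fall below e.\<close>
    define x where "x = (e powr (1 / p) / (C + 1)) powr (1 / \<gamma>)"
    have b: "e powr (1 / p) / (C + 1) > 0" using e C by simp
    have x: "x > 0" unfolding x_def powr_gt_zero using b by linarith
    have "x powr \<gamma> = e powr (1 / p) / (C + 1)" unfolding x_def powr_powr using \<gamma> powr_one[of "e powr (1 / p) / (C + 1)"] b by (simp del: powr_one)
    then have "x powr \<gamma> + C * x powr \<gamma> = e powr (1 / p)" using C by (simp add: field_simps)
    then have "C * x powr \<gamma> <= e powr (1 / p)" using powr_ge_zero[of x \<gamma>] by linarith
    then have "(C * x powr \<gamma>) powr p <= (e powr (1 / p)) powr p" using C p by (intro powr_mono2) auto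
    also have "... = e" unfolding powr_powr using p e by simp
    finally show ?thesis using I[OF x] by (meson ennreal_leI order_trans)
  qed
  then have I0: "?I = 0" by (metis ennreal_le_epsilon add_0 le_zero_eq)
  then have "AE y in J. zext f y = 0" by (subst (asm) nn_integral_0_iff_AE) (auto simp: measurable_J)
  moreover have "Lpow J p (transl x (zext f)) = 0"
    using transl_contraction[OF p x fm] I0 by simp
  then have "AE y in J. transl x (zext f) y = 0" by (subst (asm) nn_integral_0_iff_AE) (auto simp: measurable_J)
  ultimately have "AE y in J. ennreal (norm (transl x (zext f) y - zext f y) powr p) = 0" by eventually_elim simp
  then have "Lpow J p (\<lambda>y. transl x (zext f) y - zext f y) = (\<integral>\<^sup>+y. 0 \<partial>J)" by (rule nn_integral_cong_AE)
  then show ?thesis by simp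
qed

text \<open>Nothing is known about the function chosen by \<open>SOME\<close> beyond its defining
  property. \<open>Ft_limit_exists\<close> shows that the property is satisfiable, so it holds for
  the chosen function, and the sequence handed out is the one belonging to that function.\<close>

lemma jacobi_FT_limit:
  assumes p: "1 < p" "p <= 2" and f: "in_Lp (jac_measure \<alpha> \<beta>) p f"
  obtains h where "\<And>n::nat. integrable J (h n)" "\<And>n. (Lpow J p (\<lambda>x. h n x)) < \<infinity>"
    "(\<lambda>n. Lpow J p (\<lambda>x. h n x - zext f x)) \<longlonglongrightarrow> 0"
    "zext (jacobi_FT \<alpha> \<beta> p f) \<in> borel_measurable borel"
    "(\<lambda>n. Lpow N (p / (p - 1)) (\<lambda>l. Ft (h n) l - zext (jacobi_FT \<alpha> \<beta> p f) l)) \<longlonglongrightarrow> 0"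
proof -
  let ?j = "jac_measure \<alpha> \<beta>" and ?P = "plancherel_measure \<alpha> \<beta>" and ?q = "p / (p - 1)"
  let ?Q = "\<lambda>g. g \<in> borel_measurable ?P \<and>
              (\<exists>fn. (\<forall>n. in_Lp ?j 1 (fn n) \<and> in_Lp ?j p (fn n)) \<and>
                 (\<lambda>n. Lpow ?j p (\<lambda>x. fn n x - f x)) \<longlonglongrightarrow> 0 \<and>
                 (\<lambda>n. Lpow ?P ?q (\<lambda>l. jacobi_FT1 \<alpha> \<beta> (fn n) l - g l)) \<longlonglongrightarrow> 0)"
  have fm [measurable]: "zext f \<in> borel_measurable borel" and fin: "Lpow J p (zext f) < \<infinity>"
    using f by (auto simp: in_Lp_jac)
  have e1: "Lpow ?j p (\<lambda>x. k x - f x) = Lpow J p (\<lambda>x. zext k x - zext f x)"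
    if [measurable]: "zext k \<in> borel_measurable borel" for k by (rule nn_integral_jac_cong) auto
  have e2: "Lpow ?P ?q (\<lambda>l. jacobi_FT1 \<alpha> \<beta> k l - g l) = Lpow N ?q (\<lambda>l. Ft (zext k) l - zext g l)"
    if k: "integrable J (zext k)" and [measurable]: "zext g \<in> borel_measurable borel" for k g
  proof -
    have [measurable]: "Ft (zext k) \<in> borel_measurable borel" by (rule Ft_measurable[OF k])
    show ?thesis
      by (rule nn_integral_planch_cong) (auto simp: jacobi_FT1_eq[OF integrable_J_measurable[OF k]])
  qed
  obtain h g where h: "\<And>n::nat. integrable J (h n)" "\<And>n. (Lpow J p (\<lambda>x. h n x)) < \<infinity>"
    "(\<lambda>n. Lpow J p (\<lambda>x. h n x - zext f x)) \<longlonglongrightarrow> 0"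
    "g \<in> borel_measurable borel" "(\<lambda>n. Lpow N ?q (\<lambda>l. Ft (h n) l - g l)) \<longlonglongrightarrow> 0"
    by (rule Ft_limit_exists[OF p fm fin]) (rule that)
  have zm: "zext k \<in> borel_measurable borel" if [measurable]: "k \<in> borel_measurable borel" for k
    unfolding zext_def[abs_def] by measurable
  have hm [measurable]: "h n \<in> borel_measurable borel" for n by (rule integrable_J_measurable[OF h(1)])
  have zhm [measurable]: "zext (h n) \<in> borel_measurable borel" for n by (rule zm[OF hm])
  have zAE: "AE x in J. zext k x = k x" for k using AE_J by eventually_elim simp
  have zi: "integrable J (zext (h n))" for n
    by (subst integrable_cong_AE[OF _ _ zAE]) (use h(1) in \<open>auto simp: measurable_J\<close>)
  have zFt: "Ft (zext (h n)) l = Ft (h n) l" for n l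
    unfolding Ft_def
  proof (rule integral_cong_AE)
    show "AE x in J. zext (h n) x * of_real (rphi l x) = h n x * of_real (rphi l x)"
      using zAE[of "h n"] by eventually_elim simp
  qed (auto simp: measurable_J)
  have zp: "Lpow J p' (\<lambda>x. zext (h n) x - k x) = Lpow J p' (\<lambda>x. h n x - k x)" for n k p'
    by (rule nn_integral_cong_AE) (use zAE[of "h n"] in \<open>eventually_elim, simp\<close>)
  have gN: "Lpow N ?q (\<lambda>l. Ft (h n) l - zext g l) = Lpow N ?q (\<lambda>l. Ft (h n) l - g l)" for n
    by (rule nn_integral_cong_AE) (use AE_N in \<open>eventually_elim, simp\<close>)
  have zh: "in_Lp ?j 1 (h n)" "in_Lp ?j p (h n)" for n
  proof -
    have "Lpow J 1 (\<lambda>x. h n x) < \<infinity>" using h(1)[of n] unfolding integrable_iff_bounded by simp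
    then show "in_Lp ?j 1 (h n)" "in_Lp ?j p (h n)"
      unfolding in_Lp_jac using zhm zp[of n "\<lambda>_. 0"] h(2)[of n] by (simp_all only: diff_0_right simp_thms)
  qed
  have "?Q g"
  proof (intro conjI exI[of _ h] allI zh)
    show "g \<in> borel_measurable ?P" unfolding zext_measurable_iff[OF sets_planch] by (rule zm[OF h(4)])
    show "(\<lambda>n. Lpow ?j p (\<lambda>x. h n x - f x)) \<longlonglongrightarrow> 0"
      using h(3) by (simp only: e1[OF zhm] zp)
    show "(\<lambda>n. Lpow ?P ?q (\<lambda>l. jacobi_FT1 \<alpha> \<beta> (h n) l - g l)) \<longlonglongrightarrow> 0"
      using h(5) by (simp only: e2[OF zi zm[OF h(4)]] zFt gN)
  qed
  then have "?Q (SOME g. ?Q g)" by (rule someI[where P="?Q"])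
  moreover have "jacobi_FT \<alpha> \<beta> p f = (SOME g. ?Q g)" unfolding jacobi_FT_def by (rule if_not_P) (use p in simp)
  ultimately have Q: "?Q (jacobi_FT \<alpha> \<beta> p f)" by (simp only:)
  then obtain k where k: "\<And>n. in_Lp ?j 1 (k n)" "\<And>n. in_Lp ?j p (k n)"
    "(\<lambda>n. Lpow ?j p (\<lambda>x. k n x - f x)) \<longlonglongrightarrow> 0"
    "(\<lambda>n. Lpow ?P ?q (\<lambda>l. jacobi_FT1 \<alpha> \<beta> (k n) l - jacobi_FT \<alpha> \<beta> p f l)) \<longlonglongrightarrow> 0" by blast
  have gm: "zext (jacobi_FT \<alpha> \<beta> p f) \<in> borel_measurable borel" using Q unfolding zext_measurable_iff[OF sets_planch] by blast
  have km: "zext (k n) \<in> borel_measurable borel" for n using k(2)[of n] unfolding in_Lp_jac by blast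
  show ?thesis
  proof (rule that[of "\<lambda>n. zext (k n)"])
    show "Lpow J p (zext (k n)) < \<infinity>" for n using k(2)[of n] unfolding in_Lp_jac by blast
    show "(\<lambda>n. Lpow J p (\<lambda>x. zext (k n) x - zext f x)) \<longlonglongrightarrow> 0" using k(3) by (simp only: e1[OF km])
    show "(\<lambda>n. Lpow N ?q (\<lambda>l. Ft (zext (k n)) l - zext (jacobi_FT \<alpha> \<beta> p f) l)) \<longlonglongrightarrow> 0"
      using k(4) by (simp only: e2[OF integrable_zext[OF k(1)] gm])
  qed (use integrable_zext[OF k(1)] gm in auto)
qed

lemma besov_FT_in_Lp:
  assumes p: "1 < p" "p <= 2" and \<gamma>: "\<gamma> > 0" and f: "f \<in> besov_inf \<alpha> \<beta> p \<gamma>"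
    and s: "2 * (\<alpha> + 1) * p / (\<gamma> * p + 2 * (\<alpha> + 1) * (p - 1)) < s" "s <= p / (p - 1)"
  shows "in_Lp (plancherel_measure \<alpha> \<beta>) s (jacobi_FT \<alpha> \<beta> p f)"
proof -
  let ?q = "p / (p - 1)" and ?d = "2 * (\<alpha> + 1)" and ?g = "zext (jacobi_FT \<alpha> \<beta> p f)"
  obtain C where fL: "in_Lp (jac_measure \<alpha> \<beta>) p f" and C: "C >= 0"
    "\<And>x. x > 0 ==> mod_cont_pow \<alpha> \<beta> p f x <= ennreal ((C * x powr \<gamma>) powr p)"
    using f unfolding besov_inf_def by blast
  have fm: "zext f \<in> borel_measurable borel" and fin: "Lpow J p (zext f) < \<infinity>"
    using fL by (auto simp: in_Lp_jac)
  obtain h where h: "\<And>n::nat. integrable J (h n)" "\<And>n. (Lpow J p (\<lambda>x. h n x)) < \<infinity>"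
    "(\<lambda>n. Lpow J p (\<lambda>x. h n x - zext f x)) \<longlonglongrightarrow> 0" "?g \<in> borel_measurable borel"
    "(\<lambda>n. Lpow N ?q (\<lambda>l. Ft (h n) l - ?g l)) \<longlonglongrightarrow> 0"
    by (rule jacobi_FT_limit[OF p fL]) (rule that)
  have p1: "1 <= p" using p by simp
  obtain K where K: "K >= 0" "\<And>x. x > 0 ==> (Lpow N ?q (\<lambda>l. of_real (1 - rphi l x) * ?g l))
     <= ennreal (K * x powr (\<gamma> * ?q))"
    using Ft_limit_modulus[OF p fm fin h(1,3,4,5) besov_modulus[OF p1 \<gamma> fm C] C(1)] by blast
  have q: "?q > 0" using p by simp
  have d: "?d > 0" using \<alpha>_gt by simp
  have den: "\<gamma> * p + ?d * (p - 1) > 0" by (rule add_pos_pos[OF mult_pos_pos mult_pos_pos[OF d]]) (use p \<gamma> in auto)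
  have "0 < ?d * p / (\<gamma> * p + ?d * (p - 1))" by (rule divide_pos_pos[OF mult_pos_pos[OF d] den]) (use p in simp)
  then have s0: "0 < s" using s(1) by linarith
  \<comment> \<open>Dividing by p - 1 rewrites the lower bound for s in terms of q = p/(p-1); the
    outcome is the balance condition of \<open>modulus_imp_Lp\<close>.\<close>
  have "?d * p < s * (\<gamma> * p + ?d * (p - 1))" using s(1) den by (simp add: pos_divide_less_eq)
  then have "?d * p / (p - 1) < s * (\<gamma> * p + ?d * (p - 1)) / (p - 1)" using p by (intro divide_strict_right_mono) auto
  also have "... = s * (\<gamma> * ?q + ?d)" using p by (simp add: add_divide_distrib distrib_left)
  finally have "?d * ?q < s * (\<gamma> * ?q + ?d)" by simp
  then have "Lpow N s ?g < \<infinity>"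
    using modulus_imp_Lp[OF h(4) s0 s(2) q K(1) Ft_limit_Lp[OF p h(1,2,4,5)], of \<gamma>] K(2) by blast
  then show ?thesis unfolding in_Lp_planch using h(4) by blast
qed

lemma besov_FT1_eq_0:
  assumes \<gamma>: "\<gamma> > 2" and f: "f \<in> besov_inf \<alpha> \<beta> 1 \<gamma>"
  shows "jacobi_FT \<alpha> \<beta> 1 f l = 0"
proof -
  obtain C where fL: "in_Lp (jac_measure \<alpha> \<beta>) 1 f" and C: "C >= 0"
    "\<And>x. x > 0 ==> mod_cont_pow \<alpha> \<beta> 1 f x <= ennreal ((C * x powr \<gamma>) powr 1)"
    using f unfolding besov_inf_def by blast
  have fm: "zext f \<in> borel_measurable borel" using fL by (simp add: in_Lp_jac)
  have "Ft (zext f) l = 0"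
  proof (rule Ft_eq_0_of_modulus[OF integrable_zext[OF fL] \<gamma> _ C(1)])
    fix x :: real assume x: "x > 0"
    have "Lpow J 1 (\<lambda>y. transl x (zext f) y - zext f y) <= ennreal ((C * x powr \<gamma>) powr 1)"
      by (rule besov_modulus[OF _ _ fm C x]) (use \<gamma> in auto)
    then show "(\<integral>\<^sup>+y. ennreal (norm (transl x (zext f) y - zext f y)) \<partial>J) <= ennreal (C * x powr \<gamma>)"
      using C(1) by simp
  qed
  then show ?thesis by (simp add: jacobi_FT_def jacobi_FT1_eq[OF fm])
qed

end

theorem theorem2:
  fixes \<alpha> \<beta> \<gamma> p :: real and f :: "real \<Rightarrow> complex"
  assumes "\<alpha> \<ge> \<beta>" and "\<beta> \<ge> -1/2" and "\<alpha> \<noteq> -1/2"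
    and "\<gamma> > 0" and "1 \<le> p" and "p \<le> 2"
    and "f \<in> besov_inf \<alpha> \<beta> p \<gamma>"
  shows "(1 < p \<and> \<gamma> \<le> 2*(\<alpha>+1)/p \<longrightarrow>
            (\<forall>s. 2*(\<alpha>+1)*p / (\<gamma>*p + 2*(\<alpha>+1)*(p-1)) < s \<and> s \<le> p/(p-1) \<longrightarrow>
                 in_Lp (plancherel_measure \<alpha> \<beta>) s (jacobi_FT \<alpha> \<beta> p f)))
       \<and> (1 < p \<and> \<gamma> > 2*(\<alpha>+1)/p \<longrightarrow> in_Lp (plancherel_measure \<alpha> \<beta>) 1 (jacobi_FT \<alpha> \<beta> p f))
       \<and> (p = 1 \<and> \<gamma> > max 3 (2*(\<alpha>+1)) \<longrightarrow> in_Lp (plancherel_measure \<alpha> \<beta>) 1 (jacobi_FT \<alpha> \<beta> p f))"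
proof -
  interpret jacobi \<alpha> \<beta> by unfold_locales (use assms in auto)
  show ?thesis
  proof (intro conjI impI allI)
    fix s assume "1 < p \<and> \<gamma> <= 2*(\<alpha>+1)/p" "2*(\<alpha>+1)*p / (\<gamma>*p + 2*(\<alpha>+1)*(p-1)) < s \<and> s <= p/(p-1)"
    then show "in_Lp (plancherel_measure \<alpha> \<beta>) s (jacobi_FT \<alpha> \<beta> p f)"
      using besov_FT_in_Lp[of p \<gamma> f s] assms by blast
  next
    assume a: "1 < p \<and> \<gamma> > 2*(\<alpha>+1)/p"
    have d: "2 * (\<alpha> + 1) > 0" using \<alpha>_gt by simp
    have den: "\<gamma>*p + 2*(\<alpha>+1)*(p-1) > 0" by (rule add_pos_pos[OF mult_pos_pos mult_pos_pos[OF d]]) (use a assms(4) in auto)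
    \<comment> \<open>The condition \<gamma> > 2(\<alpha>+1)/p is equivalent to the lower bound for
      s in (i) being less than 1, so the exponent s = 1 is admissible.\<close>
    have "2*(\<alpha>+1) < \<gamma> * p" using a pos_divide_less_eq[of p "2*(\<alpha>+1)" \<gamma>] by linarith
    then have "2*(\<alpha>+1)*p < \<gamma>*p + 2*(\<alpha>+1)*(p-1)" by (simp add: algebra_simps)
    then have "2*(\<alpha>+1)*p / (\<gamma>*p + 2*(\<alpha>+1)*(p-1)) < 1" using den by (simp add: pos_divide_less_eq)
    moreover have "1 <= p/(p-1)" using a by (simp add: field_simps)
    ultimately show "in_Lp (plancherel_measure \<alpha> \<beta>) 1 (jacobi_FT \<alpha> \<beta> p f)"
      using besov_FT_in_Lp[of p \<gamma> f 1] a assms by blast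
  next
    assume a: "p = 1 \<and> \<gamma> > max 3 (2*(\<alpha>+1))"
    then have "jacobi_FT \<alpha> \<beta> p f = (\<lambda>_. 0)" using besov_FT1_eq_0[of \<gamma> f] assms(7) by auto
    then show "in_Lp (plancherel_measure \<alpha> \<beta>) 1 (jacobi_FT \<alpha> \<beta> p f)" by (simp add: in_Lp_def)
  qed
qed

end
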